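(* Let $n$ be a positive integer, $0< p < \infty$, and $A \in W^{n-1,\infty}(D)$. Then every $f \in H^{n,p}_A(D)$ has a nontangential boundary value $f_+ \in L^p(\partial D)$ almost everywhere on $\partial D$, and \[ \lim_{r\nearrow 1} \int_0^{2\pi} \left| f_+(e^{i\theta}) - f(re^{i\theta}) \right|^p \,d\theta = 0. \]
   Context: $D$ is the open unit disk in $\mathbb{C}$ and $\partial D$ its boundary circle. $W^{k,q}(D)$ is the Sobolev space of (complex-valued) $L^q(D)$ functions with $k$ weak derivatives which are all in $L^q(D)$ (so $W^{0,q}(D)=L^q(D)$). The meta-Hardy space $H^{n,p}_A(D)$ is the set of functions $f: D \to \mathbb{C}$ that satisfy $\left(\frac{\partial}{\partial\bar z}- A\right)^n f= 0$ (the $n$-fold composition of the operator $f \mapsto \frac{\partial f}{\partial\bar z} - Af$) and \[ \|f\|_{n,p} := \sum_{k=0}^{n-1} \left( \sup_{0 < r < 1} \int_0^{2\pi} \left| \frac{\partial^k f}{\partial\bar z^k}(re^{i\theta}) \right|^p d\theta \right)^{1/p} < \infty. \] *)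

theory Defs
  imports "HOL-Analysis.Analysis"
begin

abbreviation unit_disk :: "complex set" where
  "unit_disk \<equiv> ball 0 1"

definition partial_deriv :: "complex \<Rightarrow> (complex \<Rightarrow> complex) \<Rightarrow> complex \<Rightarrow> complex" where
  "partial_deriv v \<phi> z = frechet_derivative \<phi> (at z) v"

text \<open>The Wirtinger operator, half of d/dx + i d/dy.\<close>

definition dbar :: "(complex \<Rightarrow> complex) \<Rightarrow> complex \<Rightarrow> complex" where
  "dbar \<phi> z = (partial_deriv 1 \<phi> z + \<i> * partial_deriv \<i> \<phi> z) / 2"

text \<open>Smoothness is in the real sense: every iterated directional derivative is
  (real) differentiable.\<close>

definition test_function :: "(complex \<Rightarrow> complex) \<Rightarrow> bool" where
  "test_function \<phi> \<longleftrightarrow>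
     (\<forall>vs. foldr partial_deriv vs \<phi> differentiable_on UNIV) \<and>
     (\<exists>K. compact K \<and> K \<subseteq> unit_disk \<and> (\<forall>z. z \<notin> K \<longrightarrow> \<phi> z = 0))"

definition locally_integrable :: "(complex \<Rightarrow> complex) \<Rightarrow> bool" where
  "locally_integrable f \<longleftrightarrow>
     (\<forall>K. compact K \<and> K \<subseteq> unit_disk \<longrightarrow> integrable (lebesgue_on K) f)"

text \<open>For a first-order constant-coefficient operator \<open>L\<close> (a partial derivative or
  \<open>dbar\<close>), \<open>weak_deriv L f g\<close> says that \<open>L f = g\<close> holds weakly in the disk.
  This determines \<open>g\<close> up to null sets, hence the use of a relation; iterated weak
  derivatives are relational powers.\<close>

definition weak_deriv ::
  "((complex \<Rightarrow> complex) \<Rightarrow> complex \<Rightarrow> complex) \<Rightarrow> (complex \<Rightarrow> complex) \<Rightarrow> (complex \<Rightarrow> complex) \<Rightarrow> bool" where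
  "weak_deriv L f g \<longleftrightarrow> locally_integrable f \<and> locally_integrable g \<and>
     (\<forall>\<phi>. test_function \<phi> \<longrightarrow>
        (\<integral>z. f z * L \<phi> z \<partial>lebesgue_on unit_disk) = - (\<integral>z. g z * \<phi> z \<partial>lebesgue_on unit_disk))"

definition L_inf :: "(complex \<Rightarrow> complex) set" where
  "L_inf = {f. f \<in> borel_measurable (lebesgue_on unit_disk) \<and>
     (\<exists>C. AE z in lebesgue_on unit_disk. cmod (f z) \<le> C)}"

primrec W_inf :: "nat \<Rightarrow> (complex \<Rightarrow> complex) set" where
  "W_inf 0 = L_inf"
| "W_inf (Suc k) =
     {f \<in> L_inf. \<forall>v\<in>{1, \<i>}. \<exists>g\<in>W_inf k. weak_deriv (partial_deriv v) f g}"

text \<open>\<open>meta_op A f g\<close>: the function \<open>g\<close> is (a version of) \<open>dbar f - A f\<close>, weakly in the disk.\<close>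

definition meta_op ::
  "(complex \<Rightarrow> complex) \<Rightarrow> (complex \<Rightarrow> complex) \<Rightarrow> (complex \<Rightarrow> complex) \<Rightarrow> bool" where
  "meta_op A f g \<longleftrightarrow>
     (\<exists>h. weak_deriv dbar f h \<and> (AE z in lebesgue_on unit_disk. g z = h z - A z * f z))"

text \<open>The \<open>k\<close>-th weak \<open>dbar\<close>-derivative, evaluated pointwise. Values on circles, which are null
  sets, are those of the continuous version. That version is unique on the disk, and for
  \<open>k < n\<close> it exists whenever \<open>f\<close> is a continuous solution of the meta-analytic equation of
  order \<open>n\<close> with coefficient in \<open>W_inf (n - 1)\<close>.\<close>

definition dbar_power :: "nat \<Rightarrow> (complex \<Rightarrow> complex) \<Rightarrow> complex \<Rightarrow> complex" where
  "dbar_power k f = (SOME h. continuous_on unit_disk h \<and> (weak_deriv dbar ^^ k) f h)"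

definition ennreal_powr :: "ennreal \<Rightarrow> real \<Rightarrow> ennreal" where
  "ennreal_powr x a = (if x = \<infinity> then \<infinity> else ennreal (enn2real x powr a))"

definition circle_integral :: "real \<Rightarrow> (complex \<Rightarrow> complex) \<Rightarrow> ennreal" where
  "circle_integral p g = (\<integral>\<^sup>+\<theta>. ennreal (cmod (g (cis \<theta>)) powr p) \<partial>lebesgue_on {0..2*pi})"

definition meta_hardy_norm :: "nat \<Rightarrow> real \<Rightarrow> (complex \<Rightarrow> complex) \<Rightarrow> ennreal" where
  "meta_hardy_norm n p f =
     (\<Sum>k<n. ennreal_powr
        (SUP r\<in>{0<..<1::real}. circle_integral p (\<lambda>\<zeta>. dbar_power k f (of_real r * \<zeta>))) (1 / p))"

text \<open>Weak solutions are only determined almost everywhere, whereas circle means and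
  nontangential limits need pointwise values; members are therefore the continuous versions,
  which always exist. No regularity of the derivatives is required.\<close>

definition meta_hardy :: "nat \<Rightarrow> real \<Rightarrow> (complex \<Rightarrow> complex) \<Rightarrow> (complex \<Rightarrow> complex) set" where
  "meta_hardy n p A =
     {f. continuous_on unit_disk f \<and> (meta_op A ^^ n) f (\<lambda>_. 0) \<and> meta_hardy_norm n p f < \<infinity>}"

definition Lp_circle :: "real \<Rightarrow> (complex \<Rightarrow> complex) set" where
  "Lp_circle p = {g. (\<lambda>\<theta>. g (cis \<theta>)) \<in> borel_measurable (lebesgue_on {0..2*pi}) \<and>
     circle_integral p g < \<infinity>}"

definition stolz_region :: "real \<Rightarrow> complex \<Rightarrow> complex set" where
  "stolz_region \<alpha> \<zeta> = {z \<in> unit_disk. cmod (z - \<zeta>) < \<alpha> * (1 - cmod z)}"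

definition nontangential_limit :: "(complex \<Rightarrow> complex) \<Rightarrow> complex \<Rightarrow> complex \<Rightarrow> bool" where
  "nontangential_limit f \<zeta> l \<longleftrightarrow> (\<forall>\<alpha>>1. (f \<longlongrightarrow> l) (at \<zeta> within stolz_region \<alpha> \<zeta>))"

end

theory Submission
  imports Defs "HOL-Complex_Analysis.Complex_Analysis"
begin

text \<open>Let \<open>s\<close> be the Cauchy transform of \<open>A\<close> over the disk, so that \<open>dbar s = A\<close> weakly and \<open>s\<close> is continuous
  on the whole plane. Conjugation with \<open>exp s\<close> turns \<open>dbar - A\<close> into \<open>dbar\<close>, so by Weyl's lemma
  \<open>f = exp s * (\<Sum>j<n. cnj z ^ j * \<psi> j / fact j)\<close> with holomorphic \<open>\<psi> j\<close>. The derivatives of \<open>f\<close> depend on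
  those of the polyanalytic factor through a triangular system with bounded coefficients and
  diagonal \<open>exp s\<close>, so finiteness of the norm puts every \<open>\<psi> j\<close> in the classical Hardy space, and the
  boundary values of the \<open>\<psi> j\<close> recombine to those of \<open>f\<close>.

  For the Hardy space with exponent 2, nontangential convergence follows from a maximal inequality over
  Stolz regions (Poisson kernel and Vitali covering) and convergence in mean from Parseval. For general \<open>p\<close>
  one factors \<open>\<psi> = B * G ^ m\<close> with \<open>B\<close> bounded and \<open>G\<close>, \<open>F\<close> of exponent 2, where \<open>\<bar>G\<bar> powr (m p) = \<bar>F\<bar>\<^sup>2\<close>. No
  Blaschke products are needed: on each smaller circle \<open>\<bar>\<psi>\<bar>\<close> has a zero-free majorant \<open>\<bar>exp P\<bar>\<close> with \<open>P\<close> a polynomial,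
  and Montel's theorem provides the limit of these factorizations.\<close>

section \<open>Hardy spaces of holomorphic functions\<close>

text \<open>The norm reads derivatives on circles, which are null sets, so every coefficient in
  front of a holomorphic component must have a continuous bounded version. The margin is exact: a
  function in \<open>W_inf m\<close> is only guaranteed continuous \<open>dbar\<close>-derivatives
  up to order \<open>m - 1\<close>, but \<open>dbar (exp s) = A * exp s\<close> gains one order for
  \<open>exp s\<close>, and the derivatives of order up to \<open>m = n - 1\<close> consume it.
  Products with such coefficients obey Leibniz's rule because a bounded function with bounded
  \<open>dbar\<close> is locally the Cauchy transform of a bounded function, hence a bounded limit
  of smooth functions.

  For small \<open>p\<close> the triangle inequality is not at hand, so convergence in mean has to
  come from domination. This is why the factorization carries two functions of exponent 2:
  \<open>G\<close> yields the nontangential limits of \<open>\<psi>\<close>, and \<open>F\<close>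
  yields the majorant of \<open>cmod \<psi> powr p\<close> that itself converges in mean. A majorant
  without zeros is what permits the fractional powers \<open>exp (P / m)\<close> and
  \<open>exp (p * P / 2)\<close>.\<close>

lemma poisson_representation_sq:
  assumes "open S" "cball 0 1 \<subseteq> S" "H holomorphic_on S" "cmod z < 1"
  shows "(cmod (H z))\<^sup>2 \<le> integral {a..a+2*pi}
           (\<lambda>t. (cmod (H (cis t)))\<^sup>2 * ((1 - (cmod z)\<^sup>2) / (cmod (cis t - z))\<^sup>2)) / (2*pi)"
proof -
  \<comment> \<open>Rotating by \<open>a\<close> lets Cauchy's formula be used on
    \<open>{0..2*pi}\<close>; a translation of the variable then puts the Poisson integral on
    \<open>{a..a+2*pi}\<close>.\<close>
  define z' where "z' = z * cis (-a)"
  have nz': "cmod z' < 1" "cmod z' = cmod z" using assms by (auto simp: z'_def norm_mult)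
  \<comment> \<open>Cauchy's formula is applied to this function at \<open>z'\<close>. There the
    extra factor equals 1, since \<open>cnj z' * z' = (cmod z)\<^sup>2\<close>; on the circle
    \<open>cmod (1 - cnj z' * w) = cmod (w - z')\<close>, so the modulus of the Cauchy integrand is
    the squared modulus of \<open>H\<close> times the Poisson kernel.\<close>
  define F where "F w = (H (cis a * w))\<^sup>2 * (1 - (cmod z)\<^sup>2) / (1 - cnj z' * w)" for w
  have ne: "1 - cnj z' * w \<noteq> 0" if "w \<in> cball 0 1" for w
  proof
    assume "1 - cnj z' * w = 0"
    then have "cmod (cnj z' * w) = 1" by (metis eq_iff_diff_eq_0 norm_one)
    moreover have "cmod (cnj z' * w) \<le> cmod z' * 1" using that
      unfolding norm_mult by (intro mult_mono) auto
    ultimately show False using nz' by simp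
  qed
  have "(\<lambda>w. H (cis a * w)) holomorphic_on cball 0 1"
  proof -
    have "(H \<circ> (\<lambda>w. cis a * w)) holomorphic_on cball 0 1"
      by (rule holomorphic_on_compose_gen[OF _ assms(3)])
         (use assms(2) in \<open>auto intro!: holomorphic_intros simp: norm_mult subset_iff\<close>)
    then show ?thesis by (simp add: o_def)
  qed
  then have holF: "F holomorphic_on cball 0 1"
    unfolding F_def by (intro holomorphic_intros) (use ne in auto)
  have "((\<lambda>u. F u / (u - z')) has_contour_integral (2 * pi * \<i> * F z')) (circlepath 0 1)"
    using Cauchy_integral_circlepath_simple[OF holF, of z'] nz' assms by simp
  then have I: "((\<lambda>t. F (cis t) / (cis t - z') * \<i> * cis t) has_integral (2 * pi * \<i> * F z')) {0..2*pi}"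
    unfolding circlepath_def by (subst (asm) has_contour_integral_part_circlepath_iff) (auto simp: mult_ac)
  have Fz: "F z' = (H z)\<^sup>2"
  proof -
    have "cnj z' * z' = complex_of_real ((cmod z)\<^sup>2)" using nz'(2) complex_norm_square[of z'] by (simp add: mult.commute)
    moreover have "complex_of_real ((cmod z)\<^sup>2) \<noteq> 1"
    proof -
      have "(cmod z)\<^sup>2 < 1" using assms(4) by (simp add: abs_square_less_1)
      then show ?thesis by (metis less_irrefl of_real_eq_1_iff)
    qed
    moreover have "cis a * z' = z" by (simp add: z'_def cis_mult mult.left_commute)
    ultimately show ?thesis unfolding F_def by (simp del: of_real_power)
  qed
  define P where "P t = (cmod (H (cis t)))\<^sup>2 * ((1 - (cmod z)\<^sup>2) / (cmod (cis t - z))\<^sup>2)" for t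
  have nzz: "cis t \<noteq> z" for t using assms(4) by auto
  have contP: "continuous_on T P" for T
  proof -
    have cH: "continuous_on T (\<lambda>t. H (cis t))"
      by (rule continuous_on_compose2[OF holomorphic_on_imp_continuous_on[OF assms(3)]])
         (use assms(2) in \<open>auto intro!: continuous_intros simp: subset_iff\<close>)
    show ?thesis unfolding P_def using nzz by (intro continuous_intros cH) auto
  qed
  have nrm: "norm (F (cis t) / (cis t - z') * \<i> * cis t) = P (t + a)" for t
  proof -
    have "1 - cnj z' * cis t = cis t * cnj (cis t - z')"
      by (simp add: algebra_simps cis_cnj cis_mult)
    then have "cmod (1 - cnj z' * cis t) = cmod (cis t - z')" by (simp add: norm_mult complex_mod_cnj del: complex_cnj_diff)
    moreover have "cis (t+a) - z = cis a * (cis t - z')" by (simp add: z'_def algebra_simps cis_mult mult.left_commute)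
    then have "cmod (cis (t+a) - z) = cmod (cis t - z')" by (simp add: norm_mult)
    moreover have "cis a * cis t = cis (t+a)" by (simp add: cis_mult add.commute)
    moreover have "cmod (1 - (complex_of_real (cmod z))\<^sup>2) = 1 - (cmod z)\<^sup>2"
    proof -
      have "1 - (complex_of_real (cmod z))\<^sup>2 = of_real (1 - (cmod z)\<^sup>2)" by simp
      moreover have "(cmod z)\<^sup>2 \<le> 1" using assms(4) by (simp add: power_le_one)
      ultimately show ?thesis by (metis abs_of_nonneg diff_ge_0_iff_ge norm_of_real)
    qed
    ultimately show ?thesis unfolding P_def F_def
      by (simp add: norm_mult norm_divide norm_power power2_eq_square)
  qed
  have P': "((\<lambda>t. P (t + a)) has_integral integral {a..a+2*pi} P) {0..2*pi}"
  proof -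
    have "(P has_integral integral {a..a+2*pi} P) (cbox a (a+2*pi))"
      using integrable_continuous_real[OF contP[of "{a..a+2*pi}"]] by (simp add: integrable_integral)
    from has_integral_affinity[OF this, of 1 a] show ?thesis by simp
  qed
  have "norm (integral {0..2*pi} (\<lambda>t. F (cis t) / (cis t - z') * \<i> * cis t)) \<le> integral {0..2*pi} (\<lambda>t. P (t + a))"
    by (rule integral_norm_bound_integral) (use I P' nrm in \<open>auto simp: integrable_on_def\<close>)
  then have "norm (2 * pi * \<i> * (H z)\<^sup>2) \<le> integral {a..a+2*pi} P"
    using integral_unique[OF I] integral_unique[OF P'] Fz by simp
  then have "(2*pi) * (cmod (H z))\<^sup>2 \<le> integral {a..a+2*pi} P"
    by (simp add: norm_mult norm_power)
  then show ?thesis unfolding P_def by (simp add: field_simps)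
qed

text \<open>A crude form of Jordan's inequality: up to \<open>pi/3\<close> the mean value theorem
  applies with derivative at least 1/2, and beyond that the sine is at least 1/2 while
  \<open>x \<le> 2\<close>.\<close>

lemma sin_ge_quarter:
  assumes "0 \<le> x" "x \<le> pi/2" shows "sin x \<ge> x/4"
proof (cases "x \<le> pi/3")
  case True
  show ?thesis
  proof (cases "x = 0")
    case False
    then have "0 < x" using assms by simp
    then obtain \<xi> where \<xi>: "0 < \<xi>" "\<xi> < x" "sin x - sin 0 = (x - 0) * cos \<xi>"
      using MVT2[of 0 x sin cos] by auto
    have "cos \<xi> \<ge> cos (pi/3)" using \<xi> True by (intro cos_monotone_0_pi_le) auto
    then have "x * cos \<xi> \<ge> x * (1/4)" using \<open>0 < x\<close> by (intro mult_left_mono) (auto simp: cos_60)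
    then show ?thesis using \<xi> by simp
  qed simp
next
  case False
  then have "sin (pi/6) \<le> sin x" using assms by (intro sin_monotone_2pi_le) auto
  moreover have "x \<le> 2" using assms pi_less_4 by simp
  ultimately show ?thesis by (simp add: sin_30)
qed

text \<open>The chord has length \<open>2 * \<bar>sin ((t - \<theta>)/2)\<bar>\<close>, and the
  restriction to half a period keeps the half angle in the range of the sine bound.\<close>

lemma cmod_cis_diff_ge:
  assumes "\<bar>t - \<theta>\<bar> \<le> pi" shows "cmod (cis t - cis \<theta>) \<ge> \<bar>t - \<theta>\<bar> / 4"
proof -
  have "cis t - cis \<theta> = cis \<theta> * (exp (\<i> * of_real (t - \<theta>)) - 1)"
    by (simp add: cis_conv_exp algebra_simps flip: exp_add)
  then have "cmod (cis t - cis \<theta>) = 2 * \<bar>sin ((t - \<theta>)/2)\<bar>"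
    using dist_exp_i_1[of "t - \<theta>"] by (simp add: norm_mult)
  also have "\<bar>sin ((t - \<theta>)/2)\<bar> = sin \<bar>(t - \<theta>)/2\<bar>"
  proof (cases "t \<ge> \<theta>")
    case False
    then have "sin ((t - \<theta>)/2) = - sin ((\<theta> - t)/2)" by (simp flip: sin_minus add: minus_divide_left)
    then show ?thesis using False sin_ge_zero[of "(\<theta> - t)/2"] assms by (simp add: abs_if)
  qed (use sin_ge_zero[of "(t - \<theta>)/2"] assms in simp)
  also have "2 * \<dots> \<ge> 2 * (\<bar>(t - \<theta>)/2\<bar> / 4)"
    using sin_ge_quarter[of "\<bar>(t - \<theta>)/2\<bar>"] assms by (intro mult_left_mono) auto
  finally show ?thesis by simp
qed

text \<open>For \<open>z\<close> in the Stolz region the Poisson kernel is at most a sum of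
  multiples \<open>c k\<close> of indicators of intervals of radius \<open>v k\<close> about
  \<open>\<theta>\<close>. The heights fall like \<open>4 ^ k\<close> while the radii grow at most
  like \<open>2 ^ k\<close>, so the masses form a geometric series and the centred averages control
  the Poisson integral.\<close>

lemma stolz_sq_le_averages:
  assumes H: "open S" "cball 0 1 \<subseteq> S" "H holomorphic_on S"
    and \<alpha>: "\<alpha> \<ge> 1" and z: "z \<in> stolz_region \<alpha> (cis \<theta>)" and M: "M \<ge> 0"
    and avg: "\<And>u. 0 < u \<Longrightarrow> u \<le> pi \<Longrightarrow> integral {\<theta>-u..\<theta>+u} (\<lambda>t. (cmod (H (cis t)))\<^sup>2) \<le> 2 * u * M"
  shows "(cmod (H z))\<^sup>2 \<le> 64 * \<alpha> * M"
proof -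
  define \<delta> where "\<delta> = 1 - cmod z"
  have \<delta>: "\<delta> > 0" "\<delta> \<le> 1" and zz: "cmod z < 1" "cmod (z - cis \<theta>) < \<alpha> * \<delta>"
    using z by (auto simp: stolz_region_def \<delta>_def)
  define h where "h t = (cmod (H (cis t)))\<^sup>2" for t
  define P where "P t = (1 - (cmod z)\<^sup>2) / (cmod (cis t - z))\<^sup>2" for t
  have conth: "continuous_on T h" for T
  proof -
    have "continuous_on T (\<lambda>t. H (cis t))"
      by (rule continuous_on_compose2[OF holomorphic_on_imp_continuous_on[OF H(3)]])
         (use H(2) in \<open>auto intro!: continuous_intros simp: subset_iff\<close>)
    then show ?thesis unfolding h_def by (intro continuous_intros)
  qed
  have contP: "continuous_on T P" for T
    unfolding P_def using zz by (intro continuous_intros) auto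
  have h0: "h t \<ge> 0" for t by (simp add: h_def)
  \<comment> \<open>This scale makes \<open>cis \<theta>\<close> as good a centre as
    \<open>z\<close>: for \<open>s \<ge> 8 * \<alpha> * \<delta>\<close> the chord is at least
    \<open>s/4\<close> and \<open>z\<close> is within \<open>\<alpha> * \<delta> \<le> s/8\<close>
    of \<open>cis \<theta>\<close>, which leaves \<open>s/8\<close> for
    \<open>cmod (cis t - z)\<close>.\<close>
  define u where "u k = 8 * \<alpha> * \<delta> * 2 ^ k" for k :: nat
  have u0: "u k > 0" for k using \<alpha> \<delta> by (simp add: u_def)
  obtain N where N: "pi \<le> u N"
  proof -
    obtain N where "pi / (8 * \<alpha> * \<delta>) < 2 ^ N" using real_arch_pow[of 2] by auto
    then have "pi \<le> u N" using u0[of 0] by (simp add: u_def field_simps)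
    then show thesis by (rule that)
  qed
  \<comment> \<open>The averages are assumed only for radii up to \<open>pi\<close>; capping there
    loses no \<open>t\<close>, as \<open>t\<close> stays within \<open>pi\<close> of
    \<open>\<theta>\<close>.\<close>
  define v where "v k = min (u k) pi" for k
  have v: "0 < v k" "v k \<le> pi" "v k \<le> u k" for k using u0 by (auto simp: v_def)
  \<comment> \<open>That is \<open>8 / (\<delta> * 4 ^ k)\<close>. The kernel is at most
    \<open>2 / \<delta>\<close> everywhere and at most \<open>2 / (\<delta> * 4 ^ j)\<close> beyond
    \<open>u j\<close>; the shift from \<open>j\<close> to \<open>k = Suc j\<close> costs the factor
    4.\<close>
  define c where "c k = 64 * \<alpha> / (4 ^ k * u 0)" for k :: nat
  have c0: "c k \<ge> 0" for k using \<alpha> u0[of 0] by (simp add: c_def)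
  have P2: "P t \<le> 2 * \<delta> / (cmod (cis t - z))\<^sup>2" for t
  proof -
    have "1 - (cmod z)\<^sup>2 = \<delta> * (1 + cmod z)" by (simp add: \<delta>_def algebra_simps power2_eq_square)
    also have "\<dots> \<le> \<delta> * 2" using zz \<delta> by (intro mult_left_mono) auto
    finally show ?thesis unfolding P_def by (intro divide_right_mono) auto
  qed
  have key: "P t \<le> (\<Sum>k\<le>N. c k * (if t \<in> {\<theta> - v k..\<theta> + v k} then 1 else 0))"
    if t: "t \<in> {\<theta>-pi..\<theta>+pi}" for t
  proof -
    define s where "s = \<bar>t - \<theta>\<bar>"
    have s: "s \<le> pi" "s \<ge> 0" using t by (auto simp: s_def)
    have "s \<le> u N" using s N by simp
    define k where "k = (LEAST k. s \<le> u k)"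
    have k: "s \<le> u k" "k \<le> N" unfolding k_def using \<open>s \<le> u N\<close> by (auto intro: LeastI Least_le)
    have "P t \<le> c k"
    proof (cases k)
      case 0
      have "cmod (cis t - z) \<ge> \<delta>" using norm_triangle_ineq2[of "cis t" z] by (simp add: \<delta>_def)
      moreover from this have "cmod (cis t - z) > 0" using \<delta> by linarith
      ultimately have "2 * \<delta> / (cmod (cis t - z))\<^sup>2 \<le> 2 * \<delta> / \<delta>\<^sup>2"
        using \<delta> by (intro divide_left_mono power_mono mult_pos_pos zero_less_power) auto
      also have "\<dots> = 2 / \<delta>" by (simp add: power2_eq_square)
      also have "\<dots> \<le> c 0" using \<delta> \<alpha> by (simp add: c_def u_def field_simps)
      finally show ?thesis using P2[of t] 0 by simp
    next
      case (Suc j)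
      then have "\<not> s \<le> u j" using not_less_Least[of j "\<lambda>k. s \<le> u k"] unfolding k_def by simp
      then have sj: "u j < s" by simp
      have s8: "s \<ge> 8 * \<alpha> * \<delta>"
      proof -
        have "8 * \<alpha> * \<delta> * 1 \<le> u j" unfolding u_def using \<alpha> \<delta> by (intro mult_left_mono) auto
        then show ?thesis using sj by simp
      qed
      have "cmod (cis t - cis \<theta>) \<le> cmod (cis t - z) + cmod (z - cis \<theta>)"
        using norm_triangle_ineq[of "cis t - z" "z - cis \<theta>"] by simp
      then have "cmod (cis t - z) \<ge> s/4 - \<alpha> * \<delta>" using cmod_cis_diff_ge[of t \<theta>] s zz by (simp add: s_def)
      then have g: "cmod (cis t - z) \<ge> s/8" using s8 by simp
      have sp: "s > 0" using sj u0[of j] by simp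
      have "2 * \<delta> / (cmod (cis t - z))\<^sup>2 \<le> 2 * \<delta> / (s/8)\<^sup>2"
        using \<delta> g sp by (intro divide_left_mono power_mono mult_pos_pos) (auto intro: less_le_trans)
      also have "\<dots> \<le> 2 * \<delta> / (u j/8)\<^sup>2"
        using \<delta> sj u0[of j] sp by (intro divide_left_mono power_mono mult_pos_pos) auto
      also have "\<dots> = 2 / (\<alpha>\<^sup>2 * \<delta> * 4 ^ j)"
      proof -
        have "(2::real) ^ (j * 2) = 4 ^ j" by (simp add: power_mult mult.commute[of j])
        then show ?thesis using \<alpha> \<delta> by (simp add: u_def power_mult_distrib field_simps power2_eq_square flip: power_add mult_2_right)
      qed
      also have "\<dots> \<le> 2 / (\<delta> * 4 ^ j)"
        using \<alpha> \<delta> by (intro divide_left_mono) (auto simp: one_le_power)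
      also have "\<dots> = c k" unfolding c_def u_def Suc using \<alpha> \<delta> by (simp add: field_simps)
      finally show ?thesis using P2[of t] by simp
    qed
    also have "c k = c k * (if t \<in> {\<theta> - v k..\<theta> + v k} then 1 else 0)"
      using k s by (auto simp: v_def s_def abs_if split: if_splits)
    also have "\<dots> \<le> (\<Sum>k\<le>N. c k * (if t \<in> {\<theta> - v k..\<theta> + v k} then 1 else 0))"
      by (rule member_le_sum) (use k c0 in auto)
    finally show ?thesis .
  qed
  have i1: "((\<lambda>t. if t \<in> {\<theta> - v k..\<theta> + v k} then h t else 0) has_integral integral {\<theta> - v k..\<theta> + v k} h) {\<theta>-pi..\<theta>+pi}" for k
  proof (subst has_integral_restrict)
    show "{\<theta> - v k..\<theta> + v k} \<subseteq> {\<theta> - pi..\<theta> + pi}" using v[of k] by auto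
    show "(h has_integral integral {\<theta> - v k..\<theta> + v k} h) {\<theta> - v k..\<theta> + v k}"
      by (intro integrable_integral integrable_continuous_real conth)
  qed
  have i2: "((\<lambda>t. \<Sum>k\<le>N. c k * (if t \<in> {\<theta> - v k..\<theta> + v k} then h t else 0)) has_integral
         (\<Sum>k\<le>N. c k * integral {\<theta> - v k..\<theta> + v k} h)) {\<theta>-pi..\<theta>+pi}"
    by (intro has_integral_sum has_integral_mult_right i1) auto
  have i3: "((\<lambda>t. h t * P t) has_integral integral {\<theta>-pi..\<theta>+pi} (\<lambda>t. h t * P t)) {\<theta>-pi..\<theta>+pi}"
    by (intro integrable_integral integrable_continuous_real continuous_intros conth contP)
  have "integral {\<theta>-pi..\<theta>+pi} (\<lambda>t. h t * P t) \<le> (\<Sum>k\<le>N. c k * integral {\<theta> - v k..\<theta> + v k} h)"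
  proof (rule has_integral_le[OF i3 i2])
    fix t assume t: "t \<in> {\<theta>-pi..\<theta>+pi}"
    have "h t * P t \<le> h t * (\<Sum>k\<le>N. c k * (if t \<in> {\<theta> - v k..\<theta> + v k} then 1 else 0))"
      by (rule mult_left_mono[OF key[OF t] h0])
    also have "\<dots> = (\<Sum>k\<le>N. c k * (if t \<in> {\<theta> - v k..\<theta> + v k} then h t else 0))"
      unfolding sum_distrib_left by (rule sum.cong) auto
    finally show "h t * P t \<le> \<dots>" .
  qed
  \<comment> \<open>Each term is at most
    \<open>c k * (2 * u k * M) = 128 * \<alpha> * M / 2 ^ k\<close>. The geometric series doubles
    this to 256, and division by \<open>2 * pi \<ge> 4\<close> leaves the constant 64 of the
    statement.\<close>
  also have "\<dots> \<le> (\<Sum>k\<le>N. 128 * \<alpha> * M * (1/2) ^ k)"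
  proof (rule sum_mono)
    fix k
    have "c k * integral {\<theta> - v k..\<theta> + v k} h \<le> c k * (2 * u k * M)"
    proof (rule mult_left_mono[OF _ c0])
      have "integral {\<theta> - v k..\<theta> + v k} h \<le> 2 * v k * M"
        unfolding h_def by (rule avg) (use v in auto)
      also have "\<dots> \<le> 2 * u k * M" using v[of k] M by (intro mult_right_mono) auto
      finally show "integral {\<theta> - v k..\<theta> + v k} h \<le> 2 * u k * M" .
    qed
    also have "\<dots> = 128 * \<alpha> * M * (1/2) ^ k"
    proof -
      have "(4::real) ^ k = 2 ^ k * 2 ^ k" by (simp flip: power_mult_distrib)
      then show ?thesis using \<alpha> \<delta> by (simp add: c_def u_def field_simps)
    qed
    finally show "c k * integral {\<theta> - v k..\<theta> + v k} h \<le> 128 * \<alpha> * M * (1/2) ^ k" .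
  qed
  also have "\<dots> = 128 * \<alpha> * M * (\<Sum>k\<le>N. (1/2) ^ k)" by (simp add: sum_distrib_left)
  also have "\<dots> \<le> 128 * \<alpha> * M * 2"
    using \<alpha> M sum_le_suminf[of "\<lambda>k. (1/2::real)^k" "{..N}"] suminf_geometric[of "1/2::real"] summable_geometric[of "1/2::real"]
    by (intro mult_left_mono) auto
  finally have a: "integral {\<theta>-pi..\<theta>+pi} (\<lambda>t. h t * P t) \<le> 256 * \<alpha> * M" by simp
  have "(cmod (H z))\<^sup>2 \<le> integral {\<theta>-pi..\<theta>+pi} (\<lambda>t. h t * P t) / (2*pi)"
    using poisson_representation_sq[OF H zz(1), of "\<theta> - pi"] unfolding h_def P_def
    by (simp add: algebra_simps)
  also have "\<dots> \<le> 256 * \<alpha> * M / (2*pi)" using a by (intro divide_right_mono) auto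
  also have "\<dots> \<le> 256 * \<alpha> * M / (2*2)" using pi_ge_two \<alpha> M by (intro divide_left_mono) auto
  finally show ?thesis by (simp add: mult.commute mult.left_commute)
qed

lemma continuous_on_cis_compose:
  assumes "continuous_on S H" "sphere 0 1 \<subseteq> S"
  shows "continuous_on T (\<lambda>t. H (cis t))"
  by (rule continuous_on_compose2[OF assms(1)])
     (use assms(2) in \<open>auto intro!: continuous_intros simp: subset_iff\<close>)

lemma emeasure_density_interval:
  fixes h :: "real \<Rightarrow> real"
  assumes "continuous_on UNIV h" "\<And>t. 0 \<le> h t"
  shows "emeasure (density lborel (\<lambda>t. ennreal (h t))) {a..b} = ennreal (integral {a..b} h)"
proof -
  have m: "(\<lambda>t. ennreal (h t)) \<in> borel_measurable lborel"
    using borel_measurable_continuous_onI[OF assms(1)] by simp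
  have "emeasure (density lborel (\<lambda>t. ennreal (h t))) {a..b} = (\<integral>\<^sup>+t. ennreal (h t) * indicator {a..b} t \<partial>lborel)"
    by (rule emeasure_density[OF m]) simp
  also have "\<dots> = ennreal (integral {a..b} h)"
  proof -
    have "(h has_integral integral {a..b} h) {a..b}"
      by (intro integrable_integral integrable_continuous_real continuous_on_subset[OF assms(1)]) auto
    from nn_integral_has_integral_lebesgue[OF assms(2) this]
    have "(\<integral>\<^sup>+t. ennreal (indicator {a..b} t * h t) \<partial>lborel) = ennreal (integral {a..b} h)" by simp
    moreover have "ennreal (indicator {a..b} t * h t) = ennreal (h t) * indicator {a..b} t" for t
      by (simp split: split_indicator)
    ultimately show ?thesis by simp
  qed
  finally show ?thesis .
qed

text \<open>For fixed \<open>z\<close> the angles whose Stolz region contains \<open>z\<close> form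
  an open set. The set in question is a union of such sets, so nothing is asked of
  \<open>P\<close>.\<close>

lemma measurable_stolz_exceed:
  "{\<theta>\<in>{0..2*pi}. \<exists>z\<in>stolz_region \<alpha> (cis \<theta>). P z} \<in> sets lborel"
proof -
  have "open {\<theta>::real. cmod (z - cis \<theta>) < \<alpha> * (1 - cmod z)}" for z
    by (intro open_Collect_less continuous_intros)
  then have "open (\<Union>z\<in>{z\<in>unit_disk. P z}. {\<theta>::real. cmod (z - cis \<theta>) < \<alpha> * (1 - cmod z)})"
    by blast
  moreover have "{\<theta>\<in>{0..2*pi}. \<exists>z\<in>stolz_region \<alpha> (cis \<theta>). P z} = {0..2*pi} \<inter>
      (\<Union>z\<in>{z\<in>unit_disk. P z}. {\<theta>::real. cmod (z - cis \<theta>) < \<alpha> * (1 - cmod z)})"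
    by (auto simp: stolz_region_def)
  ultimately show ?thesis by simp
qed

text \<open>By the contrapositive of \<open>stolz_sq_le_averages\<close>, each exceptional angle is
  the centre of an interval on which the average of the squared modulus exceeds \<open>M\<close>.
  Vitali's covering lemma extracts disjoint intervals whose fivefold enlargements cover, and
  disjointness bounds their total mass by the integral.\<close>

theorem stolz_maximal_inequality:
  assumes H: "open S" "cball 0 1 \<subseteq> S" "H holomorphic_on S"
    and \<alpha>: "\<alpha> \<ge> 1" and l: "l > 0"
  shows "emeasure lborel {\<theta>\<in>{0..2*pi}. \<exists>z\<in>stolz_region \<alpha> (cis \<theta>). l < cmod (H z)}
     \<le> ennreal (640 * \<alpha> * integral {0..2*pi} (\<lambda>t. (cmod (H (cis t)))\<^sup>2) / l\<^sup>2)"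
proof -
  define h where "h t = (cmod (H (cis t)))\<^sup>2" for t
  \<comment> \<open>Chosen so that \<open>64 * \<alpha> * M = l\<^sup>2\<close>. The constant 640 is
    this 64 times 5 from the covering and 2 from the two periods met below.\<close>
  define M where "M = l\<^sup>2 / (64 * \<alpha>)"
  have M: "M > 0" using \<alpha> l by (simp add: M_def)
  have conth: "continuous_on T h" for T
    unfolding h_def by (intro continuous_intros continuous_on_cis_compose[OF holomorphic_on_imp_continuous_on[OF H(3)]])
       (use H(2) in auto)
  have h0: "h t \<ge> 0" for t by (simp add: h_def)
  define \<mu> where "\<mu> = density lborel (\<lambda>t. ennreal (h t))"
  have sets\<mu>: "sets \<mu> = sets borel" by (simp add: \<mu>_def)
  have \<mu>: "emeasure \<mu> {a..b} = ennreal (integral {a..b} h)" for a b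
    unfolding \<mu>_def by (rule emeasure_density_interval[OF conth h0])
  define U where "U = {\<theta>\<in>{0..2*pi}. \<exists>z\<in>stolz_region \<alpha> (cis \<theta>). l < cmod (H z)}"
  have "\<exists>u. 0 < u \<and> u \<le> pi \<and> 2 * u * M < integral {\<theta>-u..\<theta>+u} h" if \<theta>: "\<theta> \<in> U" for \<theta>
  proof (rule ccontr)
    assume n: "\<not> ?thesis"
    obtain z where z: "z \<in> stolz_region \<alpha> (cis \<theta>)" "l < cmod (H z)" using \<theta> by (auto simp: U_def)
    have "(cmod (H z))\<^sup>2 \<le> 64 * \<alpha> * M"
      by (rule stolz_sq_le_averages[OF H \<alpha> z(1)]) (use M n in \<open>auto simp: h_def[abs_def] not_less\<close>)
    also have "\<dots> = l\<^sup>2" using \<alpha> by (simp add: M_def)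
    finally have "cmod (H z) \<le> l" using l power2_le_imp_le by fastforce
    then show False using z by simp
  qed
  then obtain u where u: "\<And>\<theta>. \<theta> \<in> U \<Longrightarrow> 0 < u \<theta> \<and> u \<theta> \<le> pi \<and> 2 * u \<theta> * M < integral {\<theta>-u \<theta>..\<theta>+u \<theta>} h"
    by metis
  have "U \<subseteq> (\<Union>i\<in>U. cball i (u i))" using u by force
  then obtain C where C: "countable C" "C \<subseteq> U"
     "pairwise (\<lambda>i j. disjnt (cball i (u i)) (cball j (u j))) C"
     "U \<subseteq> (\<Union>i\<in>C. cball i (5 * u i))"
    by (rule Vitali_covering_lemma_cballs[where a="\<lambda>x. x" and r=u and K=U and B=pi]) (use u in auto)
  define N where "N = to_nat_on C ` C"
  define e where "e = from_nat_into C"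
  have e: "e n \<in> C" if "n \<in> N" for n using that C(1) by (auto simp: N_def e_def)
  have einj: "e m \<noteq> e n" if "m \<in> N" "n \<in> N" "m \<noteq> n" for m n using that C(1) by (auto simp: N_def e_def)
  have esurj: "\<exists>n\<in>N. e n = i" if "i \<in> C" for i using that C(1) by (auto simp: N_def e_def)
  define A where "A n = (if n \<in> N then {e n - u (e n)..e n + u (e n)} else {})" for n
  define B where "B n = (if n \<in> N then {e n - 5 * u (e n)..e n + 5 * u (e n)} else {})" for n
  have disj: "disjoint_family A"
    unfolding disjoint_family_on_def
  proof (intro ballI impI)
    fix m n :: nat assume "m \<noteq> n"
    show "A m \<inter> A n = {}"
    proof (cases "m \<in> N \<and> n \<in> N")
      case True
      then have "disjnt (cball (e m) (u (e m))) (cball (e n) (u (e n)))"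
        using C(3) e einj[of m n] \<open>m \<noteq> n\<close> by (auto simp: pairwise_def)
      then show ?thesis using True by (simp add: A_def disjnt_def cball_eq_atLeastAtMost)
    qed (auto simp: A_def)
  qed
  have AB: "emeasure lborel (B n) \<le> ennreal (5 / M) * emeasure \<mu> (A n)" for n
  proof (cases "n \<in> N")
    case True
    then have U: "e n \<in> U" using e C(2) by auto
    have "emeasure lborel (B n) = ennreal (10 * u (e n))"
      using True u[OF U] by (simp add: B_def)
    also have "\<dots> \<le> ennreal (5 / M * integral {e n - u (e n)..e n + u (e n)} h)"
      using u[OF U] M by (intro ennreal_leI) (simp add: field_simps)
    also have "\<dots> = ennreal (5 / M) * emeasure \<mu> (A n)"
      using True M by (simp add: A_def \<mu> ennreal_mult' h0 flip: ennreal_mult' )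
    finally show ?thesis .
  qed (simp add: B_def)
  have "emeasure lborel U \<le> emeasure lborel (\<Union>n. B n)"
  proof (rule emeasure_mono)
    show "U \<subseteq> (\<Union>n. B n)"
    proof
      fix x assume "x \<in> U"
      then obtain i where "i \<in> C" "x \<in> cball i (5 * u i)" using C(4) by auto
      moreover obtain n where "n \<in> N" "e n = i" using esurj \<open>i \<in> C\<close> by auto
      ultimately have "x \<in> B n" by (auto simp: B_def cball_eq_atLeastAtMost)
      then show "x \<in> (\<Union>n. B n)" by blast
    qed
  qed (auto simp: B_def)
  also have "\<dots> \<le> (\<Sum>n. emeasure lborel (B n))"
    by (rule emeasure_subadditive_countably) (auto simp: B_def)
  also have "\<dots> \<le> (\<Sum>n. ennreal (5 / M) * emeasure \<mu> (A n))"
    by (intro suminf_le AB) auto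
  also have "\<dots> = ennreal (5 / M) * (\<Sum>n. emeasure \<mu> (A n))" by simp
  also have "(\<Sum>n. emeasure \<mu> (A n)) = emeasure \<mu> (\<Union>n. A n)"
    by (rule suminf_emeasure[OF _ disj]) (auto simp: A_def sets\<mu>)
  \<comment> \<open>Intervals of radius at most \<open>pi\<close> with centres in
    \<open>{0..2*pi}\<close> reach out to \<open>{-pi..3*pi}\<close>, which is two periods.\<close>
  also have "ennreal (5 / M) * \<dots> \<le> ennreal (5 / M) * emeasure \<mu> {-pi..3*pi}"
  proof (intro mult_left_mono emeasure_mono)
    show "(\<Union>n. A n) \<subseteq> {-pi..3*pi}"
    proof
      fix x assume "x \<in> (\<Union>n. A n)"
      then obtain n where n: "n \<in> N" "x \<in> {e n - u (e n)..e n + u (e n)}" by (auto simp: A_def split: if_splits)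
      then have "e n \<in> U" using e C(2) by auto
      then have "0 \<le> e n" "e n \<le> 2*pi" "u (e n) \<le> pi" using u by (auto simp: U_def)
      then show "x \<in> {-pi..3*pi}" using n by auto
    qed
  qed (auto simp: sets\<mu>)
  also have "emeasure \<mu> {-pi..3*pi} = ennreal (2 * integral {0..2*pi} h)"
  proof -
    have int: "h integrable_on {a..b}" for a b by (intro integrable_continuous_real conth)
    have "cis (t + 2 * pi) = cis t" for t by (simp add: complex_eq_iff)
    then have per: "h (t + 2 * pi) = h t" for t by (simp add: h_def)
    have "integral {-pi..3*pi} h = integral {-pi..0} h + integral {0..2*pi} h + integral {2*pi..3*pi} h"
      using Henstock_Kurzweil_Integration.integral_combine[of "-pi" 0 "3*pi" h]
            Henstock_Kurzweil_Integration.integral_combine[of 0 "2*pi" "3*pi" h] int by simp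
    moreover have shift: "integral {a..b} h = integral {a+2*pi..b+2*pi} h" for a b
    proof -
      have "(h has_integral integral {a+2*pi..b+2*pi} h) (cbox (a+2*pi) (b+2*pi))"
        using int by (simp add: integrable_integral)
      from has_integral_affinity[OF this, of 1 "2*pi"]
      have "((\<lambda>x. h (x + 2*pi)) has_integral integral {a+2*pi..b+2*pi} h) {a..b}" by simp
      then show ?thesis by (simp add: per integral_unique)
    qed
    moreover have "integral {0..2*pi} h = integral {0..pi} h + integral {pi..2*pi} h"
      using Henstock_Kurzweil_Integration.integral_combine[of 0 pi "2*pi" h] int by simp
    ultimately have "integral {-pi..3*pi} h = 2 * integral {0..2*pi} h"
      using shift[of "-pi" 0] shift[of 0 pi] by simp
    then show ?thesis by (simp add: \<mu>)
  qed
  also have "ennreal (5 / M) * ennreal (2 * integral {0..2*pi} h) = ennreal (640 * \<alpha> * integral {0..2*pi} h / l\<^sup>2)"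
    using M \<alpha> l by (subst ennreal_mult'[symmetric]) (auto simp: M_def field_simps)
  finally show ?thesis unfolding U_def h_def .
qed

section \<open>Parseval's identity and square means over circles\<close>

lemma sums_integral_cmult:
  fixes c :: "nat \<Rightarrow> complex" and g :: "nat \<Rightarrow> real \<Rightarrow> complex"
  assumes "summable (\<lambda>n. norm (c n))" "\<And>n. continuous_on {a..b} (g n)" "\<And>n t. t \<in> {a..b} \<Longrightarrow> norm (g n t) \<le> B"
  shows "(\<lambda>n. c n * integral {a..b} (g n)) sums integral {a..b} (\<lambda>t. \<Sum>n. c n * g n t)"
proof -
  have "uniform_limit {a..b} (\<lambda>n t. \<Sum>i<n. c i * g i t) (\<lambda>t. \<Sum>i. c i * g i t) sequentially"
  proof (rule Weierstrass_m_test)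
    show "summable (\<lambda>n. norm (c n) * B)" using assms(1) by (rule summable_mult2)
    show "norm (c n * g n t) \<le> norm (c n) * B" if "t \<in> {a..b}" for n t
      unfolding norm_mult using that by (intro mult_left_mono assms(3)) auto
  qed
  moreover have "continuous_on {a..b} (\<lambda>t. \<Sum>i<n. c i * g i t)" for n
    by (intro continuous_intros assms(2))
  ultimately obtain I J where IJ: "\<And>n. ((\<lambda>t. \<Sum>i<n. c i * g i t) has_integral I n) {a..b}"
    "((\<lambda>t. \<Sum>i. c i * g i t) has_integral J) {a..b}" "I \<longlonglongrightarrow> J"
    by (rule uniform_limit_integral) auto
  have "I n = (\<Sum>i<n. c i * integral {a..b} (g i))" for n
  proof -
    have "((\<lambda>t. \<Sum>i<n. c i * g i t) has_integral (\<Sum>i<n. c i * integral {a..b} (g i))) {a..b}"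
      by (intro has_integral_sum has_integral_mult_right integrable_integral integrable_continuous_real assms(2)) auto
    then show ?thesis using IJ(1) has_integral_unique by blast
  qed
  then have "I = (\<lambda>n. \<Sum>i<n. c i * integral {a..b} (g i))" by blast
  then show ?thesis using IJ(3) integral_unique[OF IJ(2)] unfolding sums_def by simp
qed

lemma integral_cis_multiple:
  "integral {0..2*pi} (\<lambda>t. cis (of_int k * t)) = (if k = 0 then 2 * pi else 0)"
proof (cases "k = 0")
  case False
  have "((\<lambda>t. cis (of_int k * t)) has_integral
      (cis (of_int k * (2*pi)) / (\<i> * of_int k) - cis (of_int k * 0) / (\<i> * of_int k))) {0..2*pi}"
  proof (rule fundamental_theorem_of_calculus)
    fix t assume "t \<in> {0..2*pi}"
    have "((\<lambda>z. exp (\<i> * of_int k * z) / (\<i> * of_int k)) has_field_derivative exp (\<i> * of_int k * of_real t)) (at (of_real t))"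
      using False by (auto intro!: derivative_eq_intros)
    from has_vector_derivative_real_field[OF this]
    show "((\<lambda>t. cis (of_int k * t) / (\<i> * of_int k)) has_vector_derivative cis (of_int k * t)) (at t within {0..2*pi})"
      by (auto simp: cis_conv_exp mult_ac intro: has_vector_derivative_at_within)
  qed simp
  moreover have "cis (of_int k * (2*pi)) = 1"
    by (metis cis_multiple_2pi Ints_of_int mult.commute mult.left_commute)
  ultimately show ?thesis using False by (simp add: integral_unique)
qed (simp add: scaleR_conv_of_real)

text \<open>Absolute convergence makes the series uniform, so integration is termwise: against
  \<open>cis (- (m * t))\<close> orthogonality isolates \<open>c m\<close>, and then the conjugate
  series of \<open>F\<close> pairs every \<open>cnj (c m)\<close> with that coefficient.\<close>

lemma parseval_sums:
  fixes c :: "nat \<Rightarrow> complex"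
  assumes "summable (\<lambda>n. norm (c n))"
  shows "(\<lambda>n. 2 * pi * (cmod (c n))\<^sup>2) sums integral {0..2*pi} (\<lambda>t. (cmod (\<Sum>n. c n * cis (n * t)))\<^sup>2)"
proof -
  define F where "F t = (\<Sum>n. c n * cis (real n * t))" for t
  have contF: "continuous_on {0..2*pi} F"
  proof -
    have "uniform_limit {0..2*pi} (\<lambda>n t. \<Sum>i<n. c i * cis (real i * t)) F sequentially"
      unfolding F_def by (rule Weierstrass_m_test[OF _ assms]) (simp add: norm_mult)
    then show ?thesis
      by (rule uniform_limit_theorem[rotated]) (auto intro!: continuous_intros always_eventually)
  qed
  have coeff: "integral {0..2*pi} (\<lambda>t. F t * cis (- (real m * t))) = 2 * pi * c m" for m
  proof -
    have "(\<lambda>n. c n * integral {0..2*pi} (\<lambda>t. cis (real n * t) * cis (- (real m * t)))) sums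
        integral {0..2*pi} (\<lambda>t. \<Sum>n. c n * (cis (real n * t) * cis (- (real m * t))))"
      by (rule sums_integral_cmult[OF assms, where B=1]) (auto intro!: continuous_intros simp: norm_mult)
    moreover have "(\<Sum>n. c n * (cis (real n * t) * cis (- (real m * t)))) = F t * cis (- (real m * t))" for t
    proof -
      have "summable (\<lambda>n. c n * cis (real n * t))"
        by (rule summable_norm_cancel) (use assms in \<open>simp add: norm_mult\<close>)
      then show ?thesis unfolding F_def by (simp add: suminf_mult2 mult.assoc)
    qed
    moreover have "integral {0..2*pi} (\<lambda>t. cis (real n * t) * cis (- (real m * t))) = (if n = m then 2 * pi else 0)" for n
      using integral_cis_multiple[of "int n - int m"] by (simp add: cis_mult algebra_simps)
    ultimately have "(\<lambda>n. c n * (if n = m then 2 * pi else 0)) sums integral {0..2*pi} (\<lambda>t. F t * cis (- (real m * t)))"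
      by simp
    moreover have "(\<lambda>n. c n * (if n = m then 2 * pi else 0)) sums (c m * (2 * pi))"
      using sums_single[of m "\<lambda>n. c n * (2 * pi)"] by (simp add: if_distrib cong: if_cong)
    ultimately show ?thesis using sums_unique2 by fastforce
  qed
  have "\<exists>B. \<forall>t\<in>{0..2*pi}. norm (F t) \<le> B"
    using compact_continuous_image[OF contF] by (metis compact_Icc compact_imp_bounded bounded_iff imageI)
  then obtain B where B: "\<And>t. t \<in> {0..2*pi} \<Longrightarrow> norm (F t) \<le> B" by blast
  have "(\<lambda>m. cnj (c m) * integral {0..2*pi} (\<lambda>t. F t * cis (- (real m * t)))) sums
        integral {0..2*pi} (\<lambda>t. \<Sum>m. cnj (c m) * (F t * cis (- (real m * t))))"
    by (rule sums_integral_cmult[where B=B]) (use assms B in \<open>auto intro!: continuous_intros contF simp: norm_mult\<close>)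
  moreover have "(\<Sum>m. cnj (c m) * (F t * cis (- (real m * t)))) = of_real ((cmod (F t))\<^sup>2)" for t
  proof -
    have s: "summable (\<lambda>n. c n * cis (real n * t))"
      by (rule summable_norm_cancel) (use assms in \<open>simp add: norm_mult\<close>)
    then have "(\<lambda>n. c n * cis (real n * t)) sums F t" by (simp add: F_def summable_sums)
    then have "(\<lambda>n. cnj (c n * cis (real n * t))) sums cnj (F t)" by (simp only: sums_cnj)
    then have "(\<lambda>n. F t * cnj (c n * cis (real n * t))) sums (F t * cnj (F t))" by (rule sums_mult)
    then show ?thesis by (simp add: sums_iff cis_cnj mult_ac complex_norm_square del: of_real_power)
  qed
  ultimately have "(\<lambda>m. cnj (c m) * (2 * pi * c m)) sums integral {0..2*pi} (\<lambda>t. complex_of_real ((cmod (F t))\<^sup>2))"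
    by (simp add: coeff)
  moreover have "integral {0..2*pi} (\<lambda>t. complex_of_real ((cmod (F t))\<^sup>2)) = of_real (integral {0..2*pi} (\<lambda>t. (cmod (F t))\<^sup>2))"
    by (intro integral_unique has_integral_of_real integrable_integral integrable_continuous_real continuous_intros contF)
  moreover have "(\<lambda>m. cnj (c m) * (2 * pi * c m)) = (\<lambda>m. of_real (2 * pi * (cmod (c m))\<^sup>2))"
  proof
    fix m
    show "cnj (c m) * (2 * pi * c m) = of_real (2 * pi * (cmod (c m))\<^sup>2)"
      using complex_norm_square[of "c m"] by (simp add: mult_ac)
  qed
  ultimately have "(\<lambda>m. complex_of_real (2 * pi * (cmod (c m))\<^sup>2)) sums of_real (integral {0..2*pi} (\<lambda>t. (cmod (F t))\<^sup>2))"
    by (simp only:)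
  then show ?thesis unfolding F_def by (simp only: sums_of_real_iff)
qed

lemma holomorphic_circle_mean_sums:
  assumes G: "G holomorphic_on ball 0 R"
  obtains a where "\<And>z. cmod z < R \<Longrightarrow> (\<lambda>n. a n * z ^ n) sums G z"
    and "\<And>z. cmod z < R \<Longrightarrow> summable (\<lambda>n. norm (a n * z ^ n))"
proof -
  define a where "a n = (deriv ^^ n) G 0 / fact n" for n
  have s: "(\<lambda>n. a n * z ^ n) sums G z" if "cmod z < R" for z
    using holomorphic_power_series[OF G, of z] that by (simp add: a_def)
  have "summable (\<lambda>n. norm (a n * z ^ n))" if z: "cmod z < R" for z
  proof -
    obtain \<rho> where \<rho>: "cmod z < \<rho>" "\<rho> < R" using dense[OF z] by blast
    then have "summable (\<lambda>n. a n * of_real \<rho> ^ n)"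
      using s[of "of_real \<rho>"] norm_ge_zero[of z] by (simp add: sums_iff del: norm_ge_zero)
    then show ?thesis by (rule powser_insidea) (use \<rho> norm_ge_zero[of z] in \<open>simp del: norm_ge_zero\<close>)
  qed
  with s show thesis by (rule that)
qed

text \<open>Parseval with the coefficients \<open>a n * r ^ n\<close>. The terms increase with
  \<open>r\<close>, which later compares means over different circles.\<close>

lemma power_series_circle_mean:
  fixes a :: "nat \<Rightarrow> complex"
  assumes "\<And>z. cmod z < R \<Longrightarrow> (\<lambda>n. a n * z ^ n) sums G z" "\<And>z. cmod z < R \<Longrightarrow> summable (\<lambda>n. norm (a n * z ^ n))"
    and r: "0 \<le> r" "r < R"
  shows "(\<lambda>n. 2 * pi * ((cmod (a n))\<^sup>2 * (r ^ n)\<^sup>2)) sums integral {0..2*pi} (\<lambda>t. (cmod (G (of_real r * cis t)))\<^sup>2)"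
proof -
  have "summable (\<lambda>n. norm (a n * of_real r ^ n))" using assms(2)[of "of_real r"] r by simp
  from parseval_sums[OF this]
  have "(\<lambda>n. 2 * pi * (cmod (a n * of_real r ^ n))\<^sup>2) sums integral {0..2*pi} (\<lambda>t. (cmod (\<Sum>n. a n * of_real r ^ n * cis (n * t)))\<^sup>2)" .
  moreover have "(\<Sum>n. a n * of_real r ^ n * cis (n * t)) = G (of_real r * cis t)" for t :: real
    unfolding Complex.DeMoivre[symmetric] using assms(1)[of "of_real r * cis t"] r by (simp add: sums_iff norm_mult power_mult_distrib mult.assoc)
  ultimately show ?thesis using r by (simp add: norm_mult norm_power power_mult_distrib)
qed

lemma nn_integral_circle_continuous:
  fixes h :: "real \<Rightarrow> real"
  assumes "continuous_on UNIV h" "\<And>t. 0 \<le> h t"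
  shows "(\<integral>\<^sup>+t. ennreal (h t) \<partial>lebesgue_on {0..2*pi}) = ennreal (integral {0..2*pi} h)"
proof -
  have m: "h \<in> borel_measurable borel" by (rule borel_measurable_continuous_onI[OF assms(1)])
  have "(\<integral>\<^sup>+t. ennreal (h t) \<partial>lebesgue_on {0..2*pi}) = (\<integral>\<^sup>+t. ennreal (h t) * indicator {0..2*pi} t \<partial>lebesgue)"
    by (rule nn_integral_restrict_space) simp
  also have "\<dots> = (\<integral>\<^sup>+t. ennreal (h t) * indicator {0..2*pi} t \<partial>lborel)"
    by (rule nn_integral_completion) (use m in measurable)
  also have "\<dots> = emeasure (density lborel (\<lambda>t. ennreal (h t))) {0..2*pi}"
    by (rule emeasure_density[symmetric]) (use m in measurable)
  finally show ?thesis by (simp add: emeasure_density_interval[OF assms])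
qed

lemma eventually_at_left_1I:
  assumes "\<And>r::real. 0 < r \<Longrightarrow> r < 1 \<Longrightarrow> P r"
  shows "eventually P (at_left 1)"
  unfolding eventually_at_left_field using assms zero_less_one by blast

lemma AE_circle_lborel:
  assumes "AE t in lborel. t \<in> {0..2*pi} \<longrightarrow> P t"
  shows "AE t in lebesgue_on {0..2*pi}. P t"
  using AE_completion[OF assms] by (subst AE_restrict_space_iff) auto

text \<open>By Parseval a dilation contributes the weights
  \<open>(1 - r ^ n)\<^sup>2 * (\<rho> ^ n)\<^sup>2\<close> and a pair of circles the weights
  \<open>(\<rho> ^ n - r ^ n)\<^sup>2\<close>, both at most \<open>(1 - r ^ n)\<^sup>2\<close>. One
  modulus \<open>D\<close> thus serves the maximal estimate for \<open>G z - G (r * z)\<close> as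
  well as convergence in mean.\<close>

lemma hardy2_dilation_bounds:
  assumes G: "G holomorphic_on unit_disk"
    and I: "\<And>r. 0 < r \<Longrightarrow> r < 1 \<Longrightarrow> integral {0..2*pi} (\<lambda>t. (cmod (G (of_real r * cis t)))\<^sup>2) \<le> I"
  obtains D where "(D \<longlongrightarrow> 0) (at_left 1)"
    and "\<And>r \<rho>. 0 < r \<Longrightarrow> r < 1 \<Longrightarrow> 0 < \<rho> \<Longrightarrow> \<rho> < 1 \<Longrightarrow>
       integral {0..2*pi} (\<lambda>t. (cmod (G (of_real \<rho> * cis t) - G (of_real r * (of_real \<rho> * cis t))))\<^sup>2) \<le> D r"
    and "\<And>r \<rho>. 0 < r \<Longrightarrow> r \<le> \<rho> \<Longrightarrow> \<rho> < 1 \<Longrightarrow>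
       integral {0..2*pi} (\<lambda>t. (cmod (G (of_real \<rho> * cis t) - G (of_real r * cis t)))\<^sup>2) \<le> D r"
proof -
  obtain a where a: "\<And>z. cmod z < 1 \<Longrightarrow> (\<lambda>n. a n * z ^ n) sums G z"
     "\<And>z. cmod z < 1 \<Longrightarrow> summable (\<lambda>n. norm (a n * z ^ n))"
    using holomorphic_circle_mean_sums[OF G] by metis
  define b where "b n = 2 * pi * (cmod (a n))\<^sup>2" for n
  have b0: "b n \<ge> 0" for n by (simp add: b_def)
  \<comment> \<open>Each finite part of the Parseval sum keeps its bound as \<open>r\<close> tends
    to 1. This makes \<open>b\<close> summable, and \<open>b\<close> is the majorant for the series
    \<open>D\<close>.\<close>
  have part: "(\<Sum>n<N. b n) \<le> I" for N
  proof (rule tendsto_upperbound)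
    show "((\<lambda>r. \<Sum>n<N. b n * (r ^ n)\<^sup>2) \<longlongrightarrow> (\<Sum>n<N. b n)) (at_left 1)"
    proof -
      have "((\<lambda>r. \<Sum>n<N. b n * (r ^ n)\<^sup>2) \<longlongrightarrow> (\<Sum>n<N. b n * (1 ^ n)\<^sup>2)) (at_left 1)"
        by (intro tendsto_intros)
      then show ?thesis by simp
    qed
    have "(\<Sum>n<N. b n * (r ^ n)\<^sup>2) \<le> I" if r: "0 < r" "r < 1" for r :: real
    proof -
      have s: "(\<lambda>n. b n * (r ^ n)\<^sup>2) sums integral {0..2*pi} (\<lambda>t. (cmod (G (of_real r * cis t)))\<^sup>2)"
        using power_series_circle_mean[OF a, where r=r] r by (simp add: b_def mult.assoc)
      have "(\<Sum>n<N. b n * (r ^ n)\<^sup>2) \<le> integral {0..2*pi} (\<lambda>t. (cmod (G (of_real r * cis t)))\<^sup>2)"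
        using s b0 sum_le_suminf[of "\<lambda>n. b n * (r ^ n)\<^sup>2" "{..<N}"] by (auto simp: sums_iff)
      then show ?thesis using I[OF r] by simp
    qed
    then show "\<forall>\<^sub>F r in at_left 1. (\<Sum>n<N. b n * (r ^ n)\<^sup>2) \<le> I"
      by (rule eventually_at_left_1I)
  qed auto
  have sb: "summable b" by (rule summableI_nonneg_bounded[OF b0 part])
  define D where "D r = (\<Sum>n. b n * (1 - r ^ n)\<^sup>2)" for r :: real
  have le1: "0 \<le> (1 - r ^ n)\<^sup>2" "(1 - r ^ n)\<^sup>2 \<le> 1" if "0 < r" "r < 1" for r :: real and n
  proof -
    have "0 \<le> r ^ n" "r ^ n \<le> 1" using that by (auto intro: power_le_one)
    then show "(1 - r ^ n)\<^sup>2 \<le> 1" by (intro power_le_one) auto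
  qed simp
  have sD: "summable (\<lambda>n. b n * (1 - r ^ n)\<^sup>2)" if "0 < r" "r < 1" for r :: real
    by (rule summable_comparison_test'[OF sb, of 0]) (use le1[OF that] b0 in \<open>auto simp: abs_mult intro: mult_left_le\<close>)
  show thesis
  proof
    have ev: "\<forall>\<^sub>F r in at_left 1. 0 < r \<and> r < (1::real)"
      by (rule eventually_at_left_1I) simp
    \<comment> \<open>Tannery's theorem with majorant \<open>b\<close>; at \<open>r = 1\<close>
      every term vanishes.\<close>
    have "((\<lambda>r. \<Sum>n. b n * (1 - r ^ n)\<^sup>2) \<longlongrightarrow> (\<Sum>n. b n * (1 - 1 ^ n)\<^sup>2)) (at_left 1)"
    proof (rule tannerys_theorem[THEN conjunct2, THEN conjunct2])
      show "((\<lambda>r. b k * (1 - r ^ k)\<^sup>2) \<longlongrightarrow> b k * (1 - 1 ^ k)\<^sup>2) (at_left 1)" for k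
        by (intro tendsto_intros)
      have "\<forall>\<^sub>F x in at_top \<times>\<^sub>F at_left 1. snd x > 0 \<and> snd x < (1::real)"
        using ev by (rule eventually_compose_filterlim[OF _ filterlim_snd])
      then show "\<forall>\<^sub>F (k, r) in at_top \<times>\<^sub>F at_left 1. norm (b k * (1 - r ^ k)\<^sup>2) \<le> b k"
        by eventually_elim (use le1 b0 in \<open>auto simp: abs_mult intro: mult_left_le\<close>)
    qed (use sb in auto)
    then show "(D \<longlongrightarrow> 0) (at_left 1)" by (simp add: D_def[abs_def])
  next
    fix r \<rho> :: real assume r: "0 < r" "r < 1" "0 < \<rho>" "\<rho> < 1"
    have s: "(\<lambda>n. 2 * pi * ((cmod (a n * (1 - of_real r ^ n)))\<^sup>2 * (\<rho> ^ n)\<^sup>2)) sums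
        integral {0..2*pi} (\<lambda>t. (cmod (G (of_real \<rho> * cis t) - G (of_real r * (of_real \<rho> * cis t))))\<^sup>2)"
    proof (rule power_series_circle_mean[where R=1 and G = "\<lambda>z. G z - G (of_real r * z)"])
      fix z :: complex assume z: "cmod z < 1"
      then have rz: "cmod (of_real r * z) < 1" using r mult_right_mono[of r 1 "cmod z"] by (simp add: norm_mult)
      show "(\<lambda>n. a n * (1 - of_real r ^ n) * z ^ n) sums (G z - G (of_real r * z))"
        using sums_diff[OF a(1)[OF z] a(1)[OF rz]] by (simp add: algebra_simps power_mult_distrib)
      show "summable (\<lambda>n. norm (a n * (1 - of_real r ^ n) * z ^ n))"
      proof (rule summable_comparison_test'[of _ 0])
        show "summable (\<lambda>n. norm (a n * z ^ n) + norm (a n * (of_real r * z) ^ n))"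
          using a(2)[OF z] a(2)[OF rz] by (rule summable_add)
        show "norm (norm (a n * (1 - of_real r ^ n) * z ^ n)) \<le> norm (a n * z ^ n) + norm (a n * (of_real r * z) ^ n)" for n
          using norm_triangle_ineq4[of "a n * z ^ n" "a n * (of_real r * z) ^ n"] by (simp add: algebra_simps power_mult_distrib)
      qed
    qed (use r in auto)
    have "2 * pi * ((cmod (a n * (1 - of_real r ^ n)))\<^sup>2 * (\<rho> ^ n)\<^sup>2) \<le> b n * (1 - r ^ n)\<^sup>2" for n
    proof -
      have "cmod (1 - of_real r ^ n) = \<bar>1 - r ^ n\<bar>" by (metis norm_of_real of_real_1 of_real_diff of_real_power)
      then have "2 * pi * ((cmod (a n * (1 - of_real r ^ n)))\<^sup>2 * (\<rho> ^ n)\<^sup>2) = b n * (1 - r ^ n)\<^sup>2 * (\<rho> ^ n)\<^sup>2"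
        by (simp add: b_def norm_mult power_mult_distrib)
      also have "\<dots> \<le> b n * (1 - r ^ n)\<^sup>2"
        using b0[of n] r by (intro mult_left_le) (auto intro!: power_le_one)
      finally show ?thesis .
    qed
    then show "integral {0..2*pi} (\<lambda>t. (cmod (G (of_real \<rho> * cis t) - G (of_real r * (of_real \<rho> * cis t))))\<^sup>2) \<le> D r"
      using s summable_sums[OF sD[OF r(1,2)]] unfolding D_def by (rule sums_le)
  next
    fix r \<rho> :: real assume r: "0 < r" "r \<le> \<rho>" "\<rho> < 1"
    have s: "(\<lambda>n. 2 * pi * ((cmod (a n * (of_real \<rho> ^ n - of_real r ^ n)))\<^sup>2 * (1 ^ n)\<^sup>2)) sums
        integral {0..2*pi} (\<lambda>t. (cmod (G (of_real \<rho> * (of_real 1 * cis t)) - G (of_real r * (of_real 1 * cis t))))\<^sup>2)"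
    \<comment> \<open>The two circles are absorbed into one function on the disk of radius
      \<open>1 / \<rho> > 1\<close>, whose mean is then read off at radius 1.\<close>
    proof (rule power_series_circle_mean[where R="1/\<rho>" and G = "\<lambda>z. G (of_real \<rho> * z) - G (of_real r * z)"])
      fix z :: complex assume z: "cmod z < 1/\<rho>"
      then have rz: "cmod (of_real \<rho> * z) < 1" using r by (simp add: norm_mult field_simps)
      have "r * cmod z \<le> \<rho> * cmod z" using r by (intro mult_right_mono) auto
      then have rz': "cmod (of_real r * z) < 1" using rz r by (simp add: norm_mult)
      show "(\<lambda>n. a n * (of_real \<rho> ^ n - of_real r ^ n) * z ^ n) sums (G (of_real \<rho> * z) - G (of_real r * z))"
        using sums_diff[OF a(1)[OF rz] a(1)[OF rz']] by (simp add: algebra_simps power_mult_distrib)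
      show "summable (\<lambda>n. norm (a n * (of_real \<rho> ^ n - of_real r ^ n) * z ^ n))"
      proof (rule summable_comparison_test'[of _ 0])
        show "summable (\<lambda>n. norm (a n * (of_real \<rho> * z) ^ n) + norm (a n * (of_real r * z) ^ n))"
          using a(2)[OF rz] a(2)[OF rz'] by (rule summable_add)
        show "norm (norm (a n * (of_real \<rho> ^ n - of_real r ^ n) * z ^ n)) \<le> norm (a n * (of_real \<rho> * z) ^ n) + norm (a n * (of_real r * z) ^ n)" for n
          using norm_triangle_ineq4[of "a n * (of_real \<rho> * z) ^ n" "a n * (of_real r * z) ^ n"] by (simp add: algebra_simps power_mult_distrib)
      qed
    qed (use r in auto)
    have le: "2 * pi * ((cmod (a n * (of_real \<rho> ^ n - of_real r ^ n)))\<^sup>2 * (1 ^ n)\<^sup>2) \<le> b n * (1 - r ^ n)\<^sup>2" for n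
    proof -
      have "cmod (of_real \<rho> ^ n - of_real r ^ n) = \<bar>\<rho> ^ n - r ^ n\<bar>" by (metis norm_of_real of_real_diff of_real_power)
      then have "2 * pi * ((cmod (a n * (of_real \<rho> ^ n - of_real r ^ n)))\<^sup>2 * (1 ^ n)\<^sup>2) = b n * (\<rho> ^ n - r ^ n)\<^sup>2"
        by (simp add: b_def norm_mult power_mult_distrib)
      also have "\<dots> \<le> b n * (1 - r ^ n)\<^sup>2"
        using b0[of n] r by (intro mult_left_mono power_mono) (auto intro: power_mono power_le_one)
      finally show ?thesis .
    qed
    have Ds: "(\<lambda>n. b n * (1 - r ^ n)\<^sup>2) sums D r"
      unfolding D_def by (rule summable_sums[OF sD]) (use r in auto)
    have "integral {0..2*pi} (\<lambda>t. (cmod (G (of_real \<rho> * (of_real 1 * cis t)) - G (of_real r * (of_real 1 * cis t))))\<^sup>2) \<le> D r"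
      by (rule sums_le[OF le s Ds])
    then show "integral {0..2*pi} (\<lambda>t. (cmod (G (of_real \<rho> * cis t) - G (of_real r * cis t)))\<^sup>2) \<le> D r"
      by simp
  qed
qed

section \<open>Nontangential boundary values for exponent 2\<close>

text \<open>Taking \<open>lim\<close> along one fixed sequence of radii gives a value at every point
  and a Borel function of the angle before convergence is known. Where the nontangential limit
  exists it is this value; elsewhere the value is arbitrary. The shift by 2 keeps the radii inside
  \<open>{0<..<1}\<close>.\<close>

definition radial_limit :: "(complex \<Rightarrow> complex) \<Rightarrow> complex \<Rightarrow> complex" where
  "radial_limit G \<zeta> = lim (\<lambda>n. G (of_real (1 - 1 / (real n + 2)) * \<zeta>))"

lemma radial_seq:
  "0 < 1 - 1 / (real n + 2)" "1 - 1 / (real n + 2) < (1::real)"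
  "(\<lambda>n. 1 - 1 / (real n + 2)) \<longlonglongrightarrow> (1::real)"
proof -
  have "(\<lambda>n. inverse (real (Suc (Suc n)))) \<longlonglongrightarrow> 0"
    using LIMSEQ_Suc[OF LIMSEQ_inverse_real_of_nat] by simp
  then have "(\<lambda>n. 1 / (real n + 2)) \<longlonglongrightarrow> 0" by (simp add: field_simps inverse_eq_divide)
  from tendsto_diff[OF tendsto_const this, of 1]
  show "(\<lambda>n. 1 - 1 / (real n + 2)) \<longlonglongrightarrow> (1::real)" by simp
qed (auto simp: field_simps)

lemma radial_seq_tendsto:
  "(\<lambda>n. of_real (1 - 1 / (real n + 2)) * \<zeta>) \<longlonglongrightarrow> (\<zeta>::complex)"
proof -
  have "(\<lambda>n. complex_of_real (1 - 1 / (real n + 2)) * \<zeta>) \<longlonglongrightarrow> of_real 1 * \<zeta>"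
    by (intro tendsto_intros radial_seq)
  then show ?thesis by simp
qed

lemma dilate_in_stolz:
  assumes "cmod \<zeta> = 1" "\<alpha> > 1" "0 < r" "r < 1"
  shows "of_real r * \<zeta> \<in> stolz_region \<alpha> \<zeta>"
proof -
  have "of_real r * \<zeta> - \<zeta> = - (of_real (1 - r) * \<zeta>)" by (simp add: algebra_simps)
  then have "cmod (of_real r * \<zeta> - \<zeta>) = cmod (of_real (1 - r) * \<zeta>)" by (simp only: norm_minus_cancel)
  also have "\<dots> = 1 - r" using assms by (simp add: norm_mult del: of_real_diff)
  finally have "cmod (of_real r * \<zeta> - \<zeta>) = 1 - r" .
  moreover have "cmod (of_real r * \<zeta>) = r" using assms by (simp add: norm_mult)
  moreover have "1 * (1 - r) < \<alpha> * (1 - r)" using assms by (intro mult_strict_right_mono) auto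
  ultimately show ?thesis unfolding stolz_region_def using assms by simp
qed

lemma filterlim_radial_stolz:
  assumes "cmod \<zeta> = 1" "\<alpha> > 1" "\<And>n. 0 < S n" "\<And>n. S n < 1" "S \<longlonglongrightarrow> (1::real)"
  shows "filterlim (\<lambda>n. of_real (S n) * \<zeta>) (at \<zeta> within stolz_region \<alpha> \<zeta>) sequentially"
  unfolding filterlim_at
proof (intro conjI always_eventually allI)
  have "(\<lambda>n. of_real (S n) * \<zeta>) \<longlonglongrightarrow> of_real 1 * \<zeta>" by (intro tendsto_intros assms)
  then show "(\<lambda>n. of_real (S n) * \<zeta>) \<longlonglongrightarrow> \<zeta>" by simp
  fix n
  show *: "of_real (S n) * \<zeta> \<in> stolz_region \<alpha> \<zeta>" by (rule dilate_in_stolz[OF assms(1-4)])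
  have "\<zeta> \<notin> stolz_region \<alpha> \<zeta>" using assms(1) by (simp add: stolz_region_def)
  with * show "of_real (S n) * \<zeta> \<noteq> \<zeta>" by force
qed

lemma nontangential_limit_radial:
  assumes "nontangential_limit G \<zeta> l" "cmod \<zeta> = 1" "\<And>n. 0 < S n" "\<And>n. S n < 1" "S \<longlonglongrightarrow> (1::real)"
  shows "(\<lambda>n. G (of_real (S n) * \<zeta>)) \<longlonglongrightarrow> l"
proof -
  have "(G \<longlongrightarrow> l) (at \<zeta> within stolz_region 2 \<zeta>)" using assms(1) by (simp add: nontangential_limit_def)
  from filterlim_compose[OF this filterlim_radial_stolz[OF assms(2) _ assms(3-5)]] show ?thesis by simp
qed

lemma radial_limit_eq:
  assumes "nontangential_limit G \<zeta> l" "cmod \<zeta> = 1"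
  shows "(\<lambda>n. G (of_real (1 - 1 / (real n + 2)) * \<zeta>)) \<longlonglongrightarrow> l" "radial_limit G \<zeta> = l"
proof -
  show *: "(\<lambda>n. G (of_real (1 - 1 / (real n + 2)) * \<zeta>)) \<longlonglongrightarrow> l"
    by (rule nontangential_limit_radial[OF assms radial_seq])
  then show "radial_limit G \<zeta> = l" unfolding radial_limit_def by (rule limI)
qed

lemma continuous_dilate_cis:
  assumes "continuous_on unit_disk G" "0 \<le> r" "r < 1"
  shows "continuous_on T (\<lambda>t. G (of_real r * cis t))"
  by (rule continuous_on_compose2[OF assms(1)]) (use assms in \<open>auto intro!: continuous_intros simp: norm_mult\<close>)

lemma radial_limit_measurable:
  assumes "continuous_on unit_disk G"
  shows "(\<lambda>t. radial_limit G (cis t)) \<in> borel_measurable borel"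
proof -
  have "(\<lambda>t. G (of_real (1 - 1 / (real n + 2)) * cis t)) \<in> borel_measurable borel" for n
    by (rule borel_measurable_continuous_onI, rule continuous_dilate_cis[OF assms])
       (use radial_seq(1,2)[of n] in linarith)+
  then show ?thesis unfolding radial_limit_def by (rule borel_measurable_lim_metric)
qed

text \<open>If dilates \<open>G (r * z)\<close> approximate \<open>G\<close> uniformly on a Stolz
  region, then \<open>G\<close> has a limit at its vertex, because each dilate is continuous there.
  The angles where a given threshold is exceeded for every \<open>r\<close> form a set of measure at
  most a multiple of \<open>D r\<close> for every \<open>r\<close>, hence a null set.\<close>

lemma nontangential_limit_AE_of_small_oscillation:
  assumes G: "continuous_on unit_disk G"
    and D: "(D \<longlongrightarrow> 0) (at_left 1)"
    and osc: "\<And>r \<alpha> l. 0 < r \<Longrightarrow> r < 1 \<Longrightarrow> \<alpha> \<ge> 1 \<Longrightarrow> l > 0 \<Longrightarrow>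
        emeasure lborel {\<theta>\<in>{0..2*pi}. \<exists>z\<in>stolz_region \<alpha> (cis \<theta>). l < cmod (G z - G (of_real r * z))}
        \<le> ennreal (640 * \<alpha> * D r / l\<^sup>2)"
  shows "AE \<theta> in lebesgue_on {0..2*pi}. nontangential_limit G (cis \<theta>) (radial_limit G (cis \<theta>))"
proof (rule AE_circle_lborel)
  define E where "E \<alpha> l r = {\<theta>\<in>{0..2*pi}. \<exists>z\<in>stolz_region \<alpha> (cis \<theta>). l < cmod (G z - G (of_real r * z))}" for \<alpha> l r
  define rr where "rr i = 1 - 1 / (real i + 2)" for i
  have rr: "0 < rr i" "rr i < 1" "rr \<longlonglongrightarrow> 1" for i unfolding rr_def[abs_def] by (rule radial_seq)+
  have "filterlim rr (at_left 1) sequentially"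
    unfolding filterlim_at using rr(3)
    by (intro conjI always_eventually allI) (auto simp: rr(2) less_imp_neq[OF rr(2)])
  from filterlim_compose[OF D this] have Drr: "(\<lambda>i. D (rr i)) \<longlonglongrightarrow> 0" .
  have measE: "E \<alpha> l r \<in> sets lborel" for \<alpha> l r unfolding E_def by (rule measurable_stolz_exceed)
  \<comment> \<open>Stolz regions grow with the aperture, so countably many apertures and thresholds
    cover all cases. Only failure along all radii \<open>rr i\<close> counts, hence the inner
    intersection.\<close>
  define N where "N = (\<Union>k::nat. \<Union>j::nat. \<Inter>i. E (real k + 2) (1 / (real j + 1)) (rr i))"
  have "(\<Inter>i. E \<alpha> l (rr i)) \<in> null_sets lborel" if "\<alpha> \<ge> 1" "l > 0" for \<alpha> l
  proof -
    have "emeasure lborel (\<Inter>i. E \<alpha> l (rr i)) \<le> ennreal (640 * \<alpha> * D (rr i) / l\<^sup>2)" for i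
    proof -
      have "emeasure lborel (\<Inter>i. E \<alpha> l (rr i)) \<le> emeasure lborel (E \<alpha> l (rr i))"
        by (rule emeasure_mono) (use measE in auto)
      also have "\<dots> \<le> ennreal (640 * \<alpha> * D (rr i) / l\<^sup>2)"
        unfolding E_def by (rule osc) (use rr that in auto)
      finally show ?thesis .
    qed
    moreover have "(\<lambda>i. ennreal (640 * \<alpha> * D (rr i) / l\<^sup>2)) \<longlonglongrightarrow> ennreal (640 * \<alpha> * 0 / l\<^sup>2)"
      by (intro tendsto_ennrealI tendsto_intros Drr) (use that in auto)
    ultimately have "emeasure lborel (\<Inter>i. E \<alpha> l (rr i)) \<le> 0"
      by (intro tendsto_lowerbound[where F=sequentially]) auto
    moreover have "(\<Inter>i. E \<alpha> l (rr i)) \<in> sets lborel" using measE by (intro sets.countable_INT) auto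
    ultimately show ?thesis by (simp add: null_sets_def)
  qed
  then have N: "N \<in> null_sets lborel"
    unfolding N_def by (intro null_sets_UN) auto
  show "AE \<theta> in lborel. \<theta> \<in> {0..2*pi} \<longrightarrow> nontangential_limit G (cis \<theta>) (radial_limit G (cis \<theta>))"
  proof (rule AE_I'[OF N], rule subsetI)
    fix \<theta> assume "\<theta> \<in> {\<theta> \<in> space lborel. \<not> (\<theta> \<in> {0..2*pi} \<longrightarrow> nontangential_limit G (cis \<theta>) (radial_limit G (cis \<theta>)))}"
    then have \<theta>: "\<theta> \<in> {0..2*pi}" and no: "\<not> nontangential_limit G (cis \<theta>) (radial_limit G (cis \<theta>))" by auto
    show "\<theta> \<in> N"
    proof (rule ccontr)
      assume nN: "\<theta> \<notin> N"
      define \<zeta> where "\<zeta> = cis \<theta>"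
      have \<zeta>: "cmod \<zeta> = 1" by (simp add: \<zeta>_def)
      have cauchy: "\<exists>\<delta>>0. \<forall>z\<in>stolz_region (real k + 2) \<zeta>. \<forall>w\<in>stolz_region (real k + 2) \<zeta>.
          cmod (z - \<zeta>) < \<delta> \<longrightarrow> cmod (w - \<zeta>) < \<delta> \<longrightarrow> cmod (G z - G w) < e" if e: "e > 0" for e and k :: nat
      proof -
        obtain j where j: "1 / (real j + 1) < e / 4"
        proof -
          obtain j where "inverse (real (Suc j)) < e/4" using reals_Archimedean[of "e/4"] e by auto
          then show thesis by (intro that[of j]) (simp add: inverse_eq_divide add.commute)
        qed
        obtain i where "\<theta> \<notin> E (real k + 2) (1 / (real j + 1)) (rr i)" using nN by (auto simp: N_def)
        then have le: "cmod (G z - G (of_real (rr i) * z)) \<le> 1 / (real j + 1)" if "z \<in> stolz_region (real k + 2) \<zeta>" for z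
          using that \<theta> by (auto simp: E_def \<zeta>_def not_less)
        \<comment> \<open>The dilate lives on a disk of radius \<open>1 / rr i > 1\<close>, in which
          \<open>\<zeta>\<close> is an interior point.\<close>
        have "continuous_on (ball 0 (1 / rr i)) (\<lambda>z. G (of_real (rr i) * z))"
          by (rule continuous_on_compose2[OF G])
             (use rr(1)[of i] in \<open>auto intro!: continuous_intros simp: norm_mult field_simps\<close>)
        moreover have "\<zeta> \<in> ball 0 (1 / rr i)" using rr(1,2)[of i] \<zeta> by (simp add: field_simps)
        ultimately have "isCont (\<lambda>z. G (of_real (rr i) * z)) \<zeta>"
          using continuous_on_eq_continuous_at[OF open_ball] by blast
        then obtain \<delta> where \<delta>: "\<delta> > 0" "\<And>z. cmod (z - \<zeta>) < \<delta> \<Longrightarrow> cmod (G (of_real (rr i) * z) - G (of_real (rr i) * \<zeta>)) < e/4"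
        proof -
          have "e/4 > 0" using e by simp
          then show thesis using that \<open>isCont (\<lambda>z. G (of_real (rr i) * z)) \<zeta>\<close>
            unfolding continuous_at_eps_delta dist_norm by blast
        qed
        show ?thesis
        proof (intro exI[of _ \<delta>] conjI ballI impI)
          fix z w assume zw: "z \<in> stolz_region (real k + 2) \<zeta>" "w \<in> stolz_region (real k + 2) \<zeta>"
             "cmod (z - \<zeta>) < \<delta>" "cmod (w - \<zeta>) < \<delta>"
          let ?c = "G (of_real (rr i) * \<zeta>)"
          let ?z = "G (of_real (rr i) * z)" let ?w = "G (of_real (rr i) * w)"
          have "G z - G w = (G z - ?z) + (?z - ?c) - (?w - ?c) - (G w - ?w)" by simp
          also have "cmod \<dots> \<le> cmod (G z - ?z) + cmod (?z - ?c) + cmod (?w - ?c) + cmod (G w - ?w)"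
            using norm_triangle_ineq[of "G z - ?z" "?z - ?c"] norm_triangle_ineq4[of "(G z - ?z) + (?z - ?c)" "?w - ?c"]
              norm_triangle_ineq4[of "(G z - ?z) + (?z - ?c) - (?w - ?c)" "G w - ?w"] by linarith
          also have "\<dots> < e" using le[OF zw(1)] le[OF zw(2)] \<delta>(2)[OF zw(3)] \<delta>(2)[OF zw(4)] j by linarith
          finally show "cmod (G z - G w) < e" .
        qed (use \<delta> in auto)
      qed
      \<comment> \<open>The radial points lie in all these Stolz regions at once, so the limits for
        the different apertures coincide with the one along this sequence.\<close>
      define x where "x n = of_real (1 - 1 / (real n + 2)) * \<zeta>" for n
      have xs: "x n \<in> stolz_region (real k + 2) \<zeta>" for n and k :: nat
        unfolding x_def by (rule dilate_in_stolz[OF _ _ radial_seq(1,2)]) (use \<zeta> in auto)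
      have xl: "x \<longlonglongrightarrow> \<zeta>" unfolding x_def by (rule radial_seq_tendsto)
      have "Cauchy (\<lambda>n. G (x n))"
      proof (rule metric_CauchyI)
        fix e :: real assume "e > 0"
        from cauchy[OF this, of 0] obtain \<delta> where \<delta>: "\<delta> > 0" "\<forall>z\<in>stolz_region 2 \<zeta>. \<forall>w\<in>stolz_region 2 \<zeta>.
          cmod (z - \<zeta>) < \<delta> \<longrightarrow> cmod (w - \<zeta>) < \<delta> \<longrightarrow> cmod (G z - G w) < e" by auto
        obtain M where "\<forall>n\<ge>M. cmod (x n - \<zeta>) < \<delta>"
          using metric_LIMSEQ_D[OF xl \<delta>(1)] by (auto simp: dist_norm)
        then show "\<exists>M. \<forall>m\<ge>M. \<forall>n\<ge>M. dist (G (x m)) (G (x n)) < e"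
        proof (intro exI[of _ M] allI impI)
          fix m n assume "m \<ge> M" "n \<ge> M"
          then show "dist (G (x m)) (G (x n)) < e"
            using \<open>\<forall>n\<ge>M. cmod (x n - \<zeta>) < \<delta>\<close> \<delta>(2) xs[where k=0] unfolding dist_norm by simp
        qed
      qed
      then have lim: "(\<lambda>n. G (x n)) \<longlonglongrightarrow> radial_limit G \<zeta>"
        unfolding radial_limit_def x_def by (simp add: Cauchy_convergent_iff convergent_LIMSEQ_iff)
      have "nontangential_limit G \<zeta> (radial_limit G \<zeta>)"
        unfolding nontangential_limit_def
      proof (intro allI impI)
        fix \<alpha> :: real assume "\<alpha> > 1"
        obtain k :: nat where k: "\<alpha> \<le> real k + 2"
        proof -
          obtain k :: nat where "\<alpha> \<le> real k" using real_arch_simple by blast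
          then show thesis by (intro that[of k]) simp
        qed
        have sub: "stolz_region \<alpha> \<zeta> \<subseteq> stolz_region (real k + 2) \<zeta>"
        proof
          fix z assume z: "z \<in> stolz_region \<alpha> \<zeta>"
          then have "\<alpha> * (1 - cmod z) \<le> (real k + 2) * (1 - cmod z)"
            using k by (intro mult_right_mono) (auto simp: stolz_region_def)
          then have "cmod (z - \<zeta>) < (real k + 2) * (1 - cmod z)"
            using z unfolding stolz_region_def mem_Collect_eq by linarith
          then show "z \<in> stolz_region (real k + 2) \<zeta>" using z by (simp add: stolz_region_def)
        qed
        have "(G \<longlongrightarrow> radial_limit G \<zeta>) (at \<zeta> within stolz_region (real k + 2) \<zeta>)"
        proof (rule tendstoI)
          fix e :: real assume e: "e > 0"
          then have "e/2 > 0" by simp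
          from cauchy[OF this, of k] obtain \<delta> where \<delta>: "\<delta> > 0" "\<forall>z\<in>stolz_region (real k + 2) \<zeta>. \<forall>w\<in>stolz_region (real k + 2) \<zeta>.
            cmod (z - \<zeta>) < \<delta> \<longrightarrow> cmod (w - \<zeta>) < \<delta> \<longrightarrow> cmod (G z - G w) < e/2" by auto
          have "dist (G z) (radial_limit G \<zeta>) < e" if z: "z \<in> stolz_region (real k + 2) \<zeta>" "dist z \<zeta> < \<delta>" for z
          proof -
            have "\<forall>\<^sub>F n in sequentially. cmod (G z - G (x n)) \<le> e/2"
            proof -
              have "\<forall>\<^sub>F n in sequentially. cmod (x n - \<zeta>) < \<delta>"
                using tendstoD[OF xl \<delta>(1)] by (simp add: dist_norm)
              then show ?thesis
              proof eventually_elim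
                case (elim n)
                then show ?case using \<delta>(2) z xs[where k=k and n=n] unfolding dist_norm by (meson less_imp_le)
              qed
            qed
            moreover have "(\<lambda>n. cmod (G z - G (x n))) \<longlonglongrightarrow> cmod (G z - radial_limit G \<zeta>)"
              by (intro tendsto_intros lim)
            ultimately have "cmod (G z - radial_limit G \<zeta>) \<le> e/2"
              by (intro tendsto_upperbound[where F=sequentially]) auto
            then show ?thesis using e by (simp add: dist_norm)
          qed
          then show "\<forall>\<^sub>F z in at \<zeta> within stolz_region (real k + 2) \<zeta>. dist (G z) (radial_limit G \<zeta>) < e"
            unfolding eventually_at using \<delta>(1) by blast
        qed
        then show "(G \<longlongrightarrow> radial_limit G \<zeta>) (at \<zeta> within stolz_region \<alpha> \<zeta>)"
          using sub by (rule tendsto_within_subset)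
      qed
      then show False using no by (simp add: \<zeta>_def)
    qed
  qed
qed

text \<open>A strict inequality between continuous quantities is stable. This lets estimates for
  functions that are holomorphic beyond the closed disk reach \<open>G\<close> itself.\<close>

lemma eventually_dilate_exceeds:
  assumes "continuous_on unit_disk G" "cmod z < 1" "l < cmod (G z - G (of_real r * z))" "0 < r" "r < 1" "\<rho> \<longlonglongrightarrow> (1::real)"
  shows "\<forall>\<^sub>F n in sequentially. l < cmod (G (of_real (\<rho> n) * z) - G (of_real r * (of_real (\<rho> n) * z)))"
proof -
  have c: "isCont G w" if "cmod w < 1" for w
    using assms(1) that by (simp add: continuous_on_eq_continuous_at)
  have rz: "cmod (of_real r * z) < 1" using assms mult_right_mono[of r 1 "cmod z"] by (simp add: norm_mult)
  have l1: "(\<lambda>n. of_real (\<rho> n) * z) \<longlonglongrightarrow> of_real 1 * z" by (intro tendsto_intros assms)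
  have l2: "(\<lambda>n. of_real r * (of_real (\<rho> n) * z)) \<longlonglongrightarrow> of_real r * (of_real 1 * z)" by (intro tendsto_intros assms)
  have "(\<lambda>n. cmod (G (of_real (\<rho> n) * z) - G (of_real r * (of_real (\<rho> n) * z)))) \<longlonglongrightarrow> cmod (G z - G (of_real r * z))"
    using isCont_tendsto_compose[OF c l1] isCont_tendsto_compose[OF c l2] assms(2) rz by (intro tendsto_intros) simp_all
  then show ?thesis using assms(3) by (rule order_tendstoD(1))
qed

text \<open>The maximal inequality asks for holomorphy across the circle, so it is applied to
  \<open>G\<close> dilated by \<open>\<rho> n\<close>, with a bound independent of
  \<open>n\<close>.\<close>

lemma hardy2_oscillation:
  assumes G: "G holomorphic_on unit_disk" and r: "0 < r" "r < 1" and \<alpha>: "\<alpha> \<ge> 1" and l: "l > 0"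
    and D: "\<And>\<rho>. 0 < \<rho> \<Longrightarrow> \<rho> < 1 \<Longrightarrow>
       integral {0..2*pi} (\<lambda>t. (cmod (G (of_real \<rho> * cis t) - G (of_real r * (of_real \<rho> * cis t))))\<^sup>2) \<le> d"
  shows "emeasure lborel {\<theta>\<in>{0..2*pi}. \<exists>z\<in>stolz_region \<alpha> (cis \<theta>). l < cmod (G z - G (of_real r * z))}
        \<le> ennreal (640 * \<alpha> * d / l\<^sup>2)"
proof -
  define \<rho> where "\<rho> n = 1 - 1 / (real n + 2)" for n
  have \<rho>: "0 < \<rho> n" "\<rho> n < 1" "\<rho> \<longlonglongrightarrow> 1" for n unfolding \<rho>_def[abs_def] by (rule radial_seq)+
  define H where "H n z = G (of_real (\<rho> n) * z) - G (of_real r * (of_real (\<rho> n) * z))" for n z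
  define B where "B n = {\<theta>\<in>{0..2*pi}. \<exists>z\<in>stolz_region \<alpha> (cis \<theta>). l < cmod (H n z)}" for n
  have Bm: "B n \<in> sets lborel" for n unfolding B_def by (rule measurable_stolz_exceed)
  have Bb: "emeasure lborel (B n) \<le> ennreal (640 * \<alpha> * d / l\<^sup>2)" for n
  proof -
    have "emeasure lborel (B n) \<le> ennreal (640 * \<alpha> * integral {0..2*pi} (\<lambda>t. (cmod (H n (cis t)))\<^sup>2) / l\<^sup>2)"
      unfolding B_def
    proof (rule stolz_maximal_inequality[OF _ _ _ \<alpha> l])
      show "cball (0::complex) 1 \<subseteq> ball 0 (1 / \<rho> n)" using \<rho>(1,2)[of n] by (simp add: cball_subset_ball_iff field_simps)
      have "(G \<circ> (\<lambda>z. of_real (\<rho> n) * z)) holomorphic_on ball 0 (1 / \<rho> n)"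
        by (rule holomorphic_on_compose_gen[OF _ G])
           (use \<rho>(1,2)[of n] in \<open>auto intro!: holomorphic_intros simp: norm_mult field_simps\<close>)
      moreover have "(G \<circ> (\<lambda>z. of_real r * (of_real (\<rho> n) * z))) holomorphic_on ball 0 (1 / \<rho> n)"
      proof (rule holomorphic_on_compose_gen[OF _ G])
        show "(\<lambda>z. of_real r * (of_real (\<rho> n) * z)) ` ball 0 (1 / \<rho> n) \<subseteq> unit_disk"
        proof clarify
          fix z :: complex assume "z \<in> ball 0 (1 / \<rho> n)"
          then have "\<rho> n * cmod z < 1" using \<rho>(1,2)[of n] by (simp add: field_simps)
          moreover have "r * (\<rho> n * cmod z) \<le> 1 * (\<rho> n * cmod z)"
            using r \<rho>(1,2)[of n] by (intro mult_right_mono) auto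
          ultimately have "r * (\<rho> n * cmod z) < 1" by linarith
          then show "of_real r * (of_real (\<rho> n) * z) \<in> unit_disk"
            using r \<rho>(1,2)[of n] by (simp add: norm_mult)
        qed
      qed (auto intro!: holomorphic_intros)
      ultimately show "H n holomorphic_on ball 0 (1 / \<rho> n)"
        unfolding H_def[abs_def] o_def by (rule holomorphic_on_diff)
    qed simp
    also have "\<dots> \<le> ennreal (640 * \<alpha> * d / l\<^sup>2)"
      unfolding H_def using D[OF \<rho>(1,2)] \<alpha> by (intro ennreal_leI divide_right_mono mult_left_mono) auto
    finally show ?thesis .
  qed
  \<comment> \<open>By \<open>eventually_dilate_exceeds\<close> the exceptional set of
    \<open>G\<close> lies in the lower limit of the sets \<open>B n\<close>. Its measure is the
    supremum over the increasing \<open>C N\<close>, and each \<open>C N\<close> is contained in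
    \<open>B N\<close>.\<close>
  define C where "C N = (\<Inter>n\<in>{N..}. B n)" for N
  have Cm: "C N \<in> sets lborel" for N unfolding C_def using Bm by (intro sets.countable_INT'') auto
  have "incseq C" unfolding C_def incseq_def by (auto intro!: INT_anti_mono)
  have "{\<theta>\<in>{0..2*pi}. \<exists>z\<in>stolz_region \<alpha> (cis \<theta>). l < cmod (G z - G (of_real r * z))} \<subseteq> (\<Union>N. C N)"
  proof clarify
    fix \<theta> z assume \<theta>: "\<theta> \<in> {0..2*pi}" and z: "z \<in> stolz_region \<alpha> (cis \<theta>)" "l < cmod (G z - G (of_real r * z))"
    then have "cmod z < 1" by (simp add: stolz_region_def)
    from eventually_dilate_exceeds[OF holomorphic_on_imp_continuous_on[OF G] this z(2) r \<rho>(3)]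
    obtain N where "\<forall>n\<ge>N. l < cmod (H n z)" unfolding H_def eventually_sequentially by auto
    then have "\<theta> \<in> C N" using \<theta> z unfolding C_def B_def by blast
    then show "\<theta> \<in> (\<Union>N. C N)" by blast
  qed
  then have "emeasure lborel {\<theta>\<in>{0..2*pi}. \<exists>z\<in>stolz_region \<alpha> (cis \<theta>). l < cmod (G z - G (of_real r * z))}
      \<le> emeasure lborel (\<Union>N. C N)"
    by (rule emeasure_mono) (use Cm in auto)
  also have "\<dots> = (SUP N. emeasure lborel (C N))"
    by (rule SUP_emeasure_incseq[symmetric]) (use Cm \<open>incseq C\<close> in auto)
  also have "\<dots> \<le> ennreal (640 * \<alpha> * d / l\<^sup>2)"
  proof (rule SUP_least)
    fix N
    have "emeasure lborel (C N) \<le> emeasure lborel (B N)"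
      by (rule emeasure_mono[OF _ Bm]) (auto simp: C_def)
    then show "emeasure lborel (C N) \<le> ennreal (640 * \<alpha> * d / l\<^sup>2)" using Bb[of N] by (rule order_trans)
  qed
  finally show ?thesis .
qed

lemma continuous_on_circle_measurable:
  assumes "continuous_on UNIV (h :: real \<Rightarrow> 'a::topological_space)"
  shows "h \<in> borel_measurable (lebesgue_on S)"
  using borel_measurable_continuous_onI[OF assms] by (intro measurable_restrict_space1 measurable_completion) simp

lemma radial_limit_measurable_circle:
  assumes "continuous_on unit_disk G"
  shows "(\<lambda>t. radial_limit G (cis t)) \<in> borel_measurable (lebesgue_on S)"
  using radial_limit_measurable[OF assms] by (intro measurable_restrict_space1 measurable_completion) simp

text \<open>\<open>D\<close> controls both the oscillation between \<open>G\<close> and its dilates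
  and the distance between two circles. Fatou's lemma along the radial sequence lets the outer
  circle become the boundary.\<close>

theorem hardy2_boundary:
  assumes G: "G holomorphic_on unit_disk"
    and I: "\<And>r. 0 < r \<Longrightarrow> r < 1 \<Longrightarrow> integral {0..2*pi} (\<lambda>t. (cmod (G (of_real r * cis t)))\<^sup>2) \<le> I"
  shows "AE \<theta> in lebesgue_on {0..2*pi}. nontangential_limit G (cis \<theta>) (radial_limit G (cis \<theta>))"
    and "((\<lambda>r. \<integral>\<^sup>+t. ennreal ((cmod (radial_limit G (cis t) - G (of_real r * cis t)))\<^sup>2) \<partial>lebesgue_on {0..2*pi}) \<longlongrightarrow> 0) (at_left 1)"
    and "(\<integral>\<^sup>+t. ennreal ((cmod (radial_limit G (cis t)))\<^sup>2) \<partial>lebesgue_on {0..2*pi}) < \<infinity>"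
proof -
  have contG: "continuous_on unit_disk G" by (rule holomorphic_on_imp_continuous_on[OF G])
  obtain D where D: "(D \<longlongrightarrow> 0) (at_left 1)"
    "\<And>r \<rho>. 0 < r \<Longrightarrow> r < 1 \<Longrightarrow> 0 < \<rho> \<Longrightarrow> \<rho> < 1 \<Longrightarrow>
       integral {0..2*pi} (\<lambda>t. (cmod (G (of_real \<rho> * cis t) - G (of_real r * (of_real \<rho> * cis t))))\<^sup>2) \<le> D r"
    "\<And>r \<rho>. 0 < r \<Longrightarrow> r \<le> \<rho> \<Longrightarrow> \<rho> < 1 \<Longrightarrow>
       integral {0..2*pi} (\<lambda>t. (cmod (G (of_real \<rho> * cis t) - G (of_real r * cis t)))\<^sup>2) \<le> D r"
    by (rule hardy2_dilation_bounds[OF G]) (use I that in blast)+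
  show nt: "AE \<theta> in lebesgue_on {0..2*pi}. nontangential_limit G (cis \<theta>) (radial_limit G (cis \<theta>))"
    by (rule nontangential_limit_AE_of_small_oscillation[OF contG D(1)]) (rule hardy2_oscillation[OF G _ _ _ _ D(2)])
  define \<rho> where "\<rho> n = 1 - 1 / (real n + 2)" for n
  have \<rho>: "0 < \<rho> n" "\<rho> n < 1" "\<rho> \<longlonglongrightarrow> 1" for n unfolding \<rho>_def[abs_def] by (rule radial_seq)+
  have conv: "AE t in lebesgue_on {0..2*pi}. (\<lambda>n. G (of_real (\<rho> n) * cis t)) \<longlonglongrightarrow> radial_limit G (cis t)"
    using nt by eventually_elim (use radial_limit_eq(1) in \<open>simp add: \<rho>_def\<close>)
  \<comment> \<open>Used with \<open>k = 0\<close> for the norm of the boundary function, and with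
    \<open>k\<close> the values on a circle of radius \<open>r\<close> for convergence in
    mean.\<close>
  have fatou: "(\<integral>\<^sup>+t. ennreal ((cmod (radial_limit G (cis t) - k t))\<^sup>2) \<partial>lebesgue_on {0..2*pi}) \<le> ennreal d"
    if k: "continuous_on UNIV k" and ev: "\<forall>\<^sub>F n in sequentially. integral {0..2*pi} (\<lambda>t. (cmod (G (of_real (\<rho> n) * cis t) - k t))\<^sup>2) \<le> d" for k d
  proof -
    define u where "u n t = ennreal ((cmod (G (of_real (\<rho> n) * cis t) - k t))\<^sup>2)" for n t
    have c: "continuous_on UNIV (\<lambda>t. (cmod (G (of_real (\<rho> n) * cis t) - k t))\<^sup>2)" for n
      using \<rho>(1,2)[of n] by (intro continuous_intros k continuous_dilate_cis[OF contG]) auto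
    have um: "u n \<in> borel_measurable (lebesgue_on {0..2*pi})" for n
      unfolding u_def[abs_def] using continuous_on_circle_measurable[OF c[of n]] by measurable
    have "(\<integral>\<^sup>+t. ennreal ((cmod (radial_limit G (cis t) - k t))\<^sup>2) \<partial>lebesgue_on {0..2*pi})
        = (\<integral>\<^sup>+t. liminf (\<lambda>n. u n t) \<partial>lebesgue_on {0..2*pi})"
    proof (rule nn_integral_cong_AE, use conv in eventually_elim)
      case (elim t)
      have "(\<lambda>n. u n t) \<longlonglongrightarrow> ennreal ((cmod (radial_limit G (cis t) - k t))\<^sup>2)"
        unfolding u_def by (intro tendsto_ennrealI tendsto_intros elim)
      from lim_imp_Liminf[OF _ this] show ?case by simp
    qed
    also have "\<dots> \<le> liminf (\<lambda>n. \<integral>\<^sup>+t. u n t \<partial>lebesgue_on {0..2*pi})" by (rule nn_integral_liminf[OF um])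
    also have "\<dots> \<le> ennreal d"
    proof (rule Liminf_le)
      show "\<forall>\<^sub>F n in sequentially. (\<integral>\<^sup>+t. u n t \<partial>lebesgue_on {0..2*pi}) \<le> ennreal d"
        using ev by eventually_elim (simp add: u_def nn_integral_circle_continuous[OF c] ennreal_leI)
    qed simp
    finally show ?thesis .
  qed
  have "(\<integral>\<^sup>+t. ennreal ((cmod (radial_limit G (cis t) - 0))\<^sup>2) \<partial>lebesgue_on {0..2*pi}) \<le> ennreal I"
    by (rule fatou) (use I \<rho> in auto)
  then show "(\<integral>\<^sup>+t. ennreal ((cmod (radial_limit G (cis t)))\<^sup>2) \<partial>lebesgue_on {0..2*pi}) < \<infinity>"
    by (simp add: le_less_trans)
  have le: "(\<integral>\<^sup>+t. ennreal ((cmod (radial_limit G (cis t) - G (of_real r * cis t)))\<^sup>2) \<partial>lebesgue_on {0..2*pi}) \<le> ennreal (D r)"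
    if r: "0 < r" "r < 1" for r
  proof (rule fatou)
    show "continuous_on UNIV (\<lambda>t. G (of_real r * cis t))" by (rule continuous_dilate_cis[OF contG]) (use r in auto)
    have "\<forall>\<^sub>F n in sequentially. r < \<rho> n" using \<rho>(3) r(2) by (rule order_tendstoD(1))
    then show "\<forall>\<^sub>F n in sequentially. integral {0..2*pi} (\<lambda>t. (cmod (G (of_real (\<rho> n) * cis t) - G (of_real r * cis t)))\<^sup>2) \<le> D r"
      by eventually_elim (rule D(3), use r \<rho> in auto)
  qed
  show "((\<lambda>r. \<integral>\<^sup>+t. ennreal ((cmod (radial_limit G (cis t) - G (of_real r * cis t)))\<^sup>2) \<partial>lebesgue_on {0..2*pi}) \<longlongrightarrow> 0) (at_left 1)"
  proof (rule tendsto_sandwich[where f="\<lambda>_. 0" and h="\<lambda>r. ennreal (D r)"])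
    show "((\<lambda>r. ennreal (D r)) \<longlongrightarrow> 0) (at_left 1)" using tendsto_ennrealI[OF D(1)] by simp
    show "\<forall>\<^sub>F r in at_left 1. (\<integral>\<^sup>+t. ennreal ((cmod (radial_limit G (cis t) - G (of_real r * cis t)))\<^sup>2) \<partial>lebesgue_on {0..2*pi}) \<le> ennreal (D r)"
      by (rule eventually_at_left_1I) (rule le)
  qed auto
qed

section \<open>Zero-free majorants on the unit circle\<close>

text \<open>These are the real parts of polynomials. The inductive form reduces closure under
  multiplication on the circle to monomials.\<close>

inductive circle_harmonic :: "(complex \<Rightarrow> real) \<Rightarrow> bool" where
  monom: "circle_harmonic (\<lambda>z. Re (a * z ^ n))"
| add: "circle_harmonic f \<Longrightarrow> circle_harmonic g \<Longrightarrow> circle_harmonic (\<lambda>z. f z + g z)"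

lemma circle_harmonic_entire:
  "circle_harmonic f \<Longrightarrow> \<exists>P. P holomorphic_on UNIV \<and> f = (\<lambda>z. Re (P z))"
proof (induction rule: circle_harmonic.induct)
  case (monom a n)
  show ?case by (rule exI[of _ "\<lambda>z. a * z ^ n"]) (auto intro!: holomorphic_intros)
next
  case (add f g)
  then obtain P Q where "P holomorphic_on UNIV" "f = (\<lambda>z. Re (P z))" "Q holomorphic_on UNIV" "g = (\<lambda>z. Re (Q z))" by blast
  then show ?case by (intro exI[of _ "\<lambda>z. P z + Q z"]) (auto intro!: holomorphic_intros)
qed

text \<open>\<open>Re x * Re y = (Re (x * y) + Re (cnj x * y)) / 2\<close>, and on the unit circle
  \<open>cnj (z ^ m) * z ^ n = z ^ (n - m)\<close> for \<open>m \<le> n\<close>, which is again a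
  power.\<close>

lemma circle_harmonic_mult_monom:
  "\<exists>h. circle_harmonic h \<and> (\<forall>z\<in>sphere 0 1. Re (a * z ^ m) * Re (b * z ^ n) = h z)"
proof (induction m n arbitrary: a b rule: linorder_wlog)
  case (le m n)
  have "Re (a * z ^ m) * Re (b * z ^ n) = Re (a * b / 2 * z ^ (m + n)) + Re (cnj a * b / 2 * z ^ (n - m))"
    if "z \<in> sphere 0 1" for z
  proof -
    have "cnj z * z = 1" using that complex_norm_square[of z] by (simp add: mult.commute)
    then have "cnj (z ^ m) * z ^ n = z ^ (n - m)"
      using le power_add[of z m "n - m"] by (simp add: mult.assoc[symmetric] flip: power_mult_distrib)
    then have *: "cnj (a * z ^ m) * (b * z ^ n) = cnj a * b * z ^ (n - m)"
      by (simp add: mult_ac)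
    have "Re x * Re y = Re (x * y) / 2 + Re (cnj x * y) / 2" for x y by (simp add: field_simps)
    from this[of "a * z ^ m" "b * z ^ n", unfolded *]
    have "Re (a * z ^ m) * Re (b * z ^ n) = Re ((a * z ^ m) * (b * z ^ n)) / 2 + Re (cnj a * b * z ^ (n - m)) / 2" .
    also have "(a * z ^ m) * (b * z ^ n) = a * b * z ^ (m + n)" by (simp add: power_add)
    finally show ?thesis by (metis Re_divide_numeral times_divide_eq_left)
  qed
  then show ?case
    by (intro exI[of _ "\<lambda>z. Re (a * b / 2 * z ^ (m + n)) + Re (cnj a * b / 2 * z ^ (n - m))"] conjI circle_harmonic.intros) auto
next
  case (sym m n)
  from sym[of b a] show ?case by (simp only: mult.commute[of "Re (a * _)"])
qed

lemma circle_harmonic_mult: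
  assumes "circle_harmonic f" "circle_harmonic g"
  shows "\<exists>h. circle_harmonic h \<and> (\<forall>z\<in>sphere 0 1. f z * g z = h z)"
  using assms(1)
proof (induction rule: circle_harmonic.induct)
  case (monom a n)
  show ?case using assms(2)
  proof (induction rule: circle_harmonic.induct)
    case (monom b m)
    show ?case by (rule circle_harmonic_mult_monom)
  next
    case (add f g)
    then obtain h k where "circle_harmonic h" "\<forall>z\<in>sphere 0 1. Re (a * z ^ n) * f z = h z"
        "circle_harmonic k" "\<forall>z\<in>sphere 0 1. Re (a * z ^ n) * g z = k z" by blast
    then show ?case by (intro exI[of _ "\<lambda>z. h z + k z"]) (auto intro: circle_harmonic.add simp: distrib_left)
  qed
next
  case (add f1 f2)
  then obtain h k where "circle_harmonic h" "\<forall>z\<in>sphere 0 1. f1 z * g z = h z"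
        "circle_harmonic k" "\<forall>z\<in>sphere 0 1. f2 z * g z = k z" by blast
  then show ?case by (intro exI[of _ "\<lambda>z. h z + k z"]) (auto intro: circle_harmonic.add simp: distrib_right)
qed

text \<open>Stone-Weierstrass stands in for the Dirichlet problem: up to the error \<open>e\<close>
  it produces the boundary data as the real part of an entire function, the harmonic conjugate
  included.\<close>

lemma circle_real_part_approximation:
  assumes "continuous_on (sphere 0 1) (\<phi> :: complex \<Rightarrow> real)" "e > 0"
  obtains P where "P holomorphic_on UNIV" "\<And>z. z \<in> sphere 0 1 \<Longrightarrow> \<bar>\<phi> z - Re (P z)\<bar> < e"
proof -
  \<comment> \<open>A product of two harmonic polynomials agrees with a harmonic polynomial only on
    the circle, so membership in \<open>T\<close> is decided by the values there.\<close>
  define T where "T f \<longleftrightarrow> (\<exists>h. circle_harmonic h \<and> (\<forall>z\<in>sphere 0 1. f z = h z))" for f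
  have "\<exists>g. T g \<and> (\<forall>z\<in>sphere 0 1. \<bar>\<phi> z - g z\<bar> < e)"
  proof (rule Stone_Weierstrass_HOL)
    fix c :: real
    show "T (\<lambda>_. c)" unfolding T_def
      using circle_harmonic.monom[of "of_real c" 0] by (auto intro!: exI[of _ "\<lambda>z. Re (of_real c * z ^ 0)"])
  next
    fix f assume "T f"
    then obtain h where h: "circle_harmonic h" "\<forall>z\<in>sphere 0 1. f z = h z" by (auto simp: T_def)
    then obtain P where "P holomorphic_on UNIV" "h = (\<lambda>z. Re (P z))" using circle_harmonic_entire by blast
    then have "continuous_on (sphere 0 1) h"
      by (auto intro!: continuous_intros continuous_on_subset[OF holomorphic_on_imp_continuous_on])
    then show "continuous_on (sphere 0 1) f" using h(2) continuous_on_cong[of "sphere 0 1" "sphere 0 1" f h] by simp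
  next
    fix f g assume "T f \<and> T g"
    then obtain h k where hk: "circle_harmonic h" "\<forall>z\<in>sphere 0 1. f z = h z" "circle_harmonic k" "\<forall>z\<in>sphere 0 1. g z = k z"
      unfolding T_def by blast
    show "T (\<lambda>x. f x + g x)" unfolding T_def
      using hk by (intro exI[of _ "\<lambda>z. h z + k z"]) (auto intro: circle_harmonic.add)
    show "T (\<lambda>x. f x * g x)" unfolding T_def
      using circle_harmonic_mult[OF hk(1,3)] hk(2,4) by auto
  next
    fix x y :: complex assume xy: "x \<in> sphere 0 1 \<and> y \<in> sphere 0 1 \<and> x \<noteq> y"
    have 1: "T (\<lambda>z. Re (a * z ^ 1))" for a unfolding T_def using circle_harmonic.monom[of a 1] by blast
    show "\<exists>f. T f \<and> f x \<noteq> f y"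
    proof (cases "Re x = Re y")
      case True
      then have "Im x \<noteq> Im y" using xy by (auto simp: complex_eq_iff)
      then show ?thesis using 1[of "-\<i>"] by (intro exI[of _ "\<lambda>z. Re (-\<i> * z ^ 1)"]) auto
    next
      case False
      then show ?thesis using 1[of 1] by (intro exI[of _ "\<lambda>z. Re (1 * z ^ 1)"]) auto
    qed
  qed (use assms in auto)
  then obtain g h where "circle_harmonic h" "\<forall>z\<in>sphere 0 1. g z = h z" "\<forall>z\<in>sphere 0 1. \<bar>\<phi> z - g z\<bar> < e"
    unfolding T_def by blast
  moreover then obtain P where "P holomorphic_on UNIV" "h = (\<lambda>z. Re (P z))" using circle_harmonic_entire by blast
  ultimately show thesis by (intro that[of P]) auto
qed

text \<open>\<open>ln (cmod (f z) + 1/2)\<close> is continuous even at zeros of \<open>f\<close>. If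
  the real part of an entire \<open>P\<close> is uniformly close to it, then \<open>exp P\<close>
  has no zeros anywhere and the required modulus on the circle.\<close>

lemma zero_free_majorant:
  assumes "continuous_on (sphere 0 1) (f :: complex \<Rightarrow> complex)"
  obtains P where "P holomorphic_on UNIV"
    "\<And>z. z \<in> sphere 0 1 \<Longrightarrow> cmod (f z) \<le> exp (Re (P z))"
    "\<And>z. z \<in> sphere 0 1 \<Longrightarrow> exp (Re (P z)) \<le> cmod (f z) + 1"
proof -
  have "bounded (f ` sphere 0 1)" by (intro compact_imp_bounded compact_continuous_image assms) auto
  then obtain M where M: "\<And>z. z \<in> sphere 0 1 \<Longrightarrow> cmod (f z) \<le> M" unfolding bounded_iff by blast
  have M0: "M \<ge> 0" using M[of 1] norm_ge_zero[of "f 1"] by (simp del: norm_ge_zero)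
  \<comment> \<open>The tolerance \<open>ln q\<close> must respect two margins of 1/2: for
    \<open>0 \<le> x \<le> M\<close> both \<open>x * q \<le> x + 1/2\<close> and
    \<open>(x + 1/2) * q \<le> x + 1\<close>, the latter with equality at
    \<open>x = M\<close>.\<close>
  define q where "q = 1 + 1 / (2 * M + 1)"
  have q: "q > 1" using M0 by (simp add: q_def)
  obtain P where P: "P holomorphic_on UNIV" "\<And>z. z \<in> sphere 0 1 \<Longrightarrow> \<bar>ln (cmod (f z) + 1/2) - Re (P z)\<bar> < ln q"
  proof (rule circle_real_part_approximation)
    show "continuous_on (sphere 0 1) (\<lambda>z. ln (cmod (f z) + 1/2))"
    proof -
      have "cmod (f z) + 1/2 \<noteq> 0" for z using norm_ge_zero[of "f z"] by linarith
      then show ?thesis by (intro continuous_intros assms) auto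
    qed
  qed (use q in auto)
  show thesis
  proof (rule that[OF P(1)])
    fix z :: complex assume z: "z \<in> sphere 0 1"
    define x where "x = cmod (f z)"
    have x: "0 \<le> x" "x \<le> M" using M[OF z] by (auto simp: x_def)
    have x2: "x + 1/2 > 0" using x by linarith
    have u: "Re (P z) < ln (x + 1/2) + ln q" "ln (x + 1/2) < Re (P z) + ln q" using P(2)[OF z] by (auto simp: x_def abs_less_iff)
    have "exp (Re (P z)) \<le> exp (ln (x + 1/2) + ln q)" using u by simp
    also have "\<dots> = (x + 1/2) * q" using q x2 by (simp add: exp_add)
    also have "\<dots> \<le> x + 1" using x M0 by (simp add: q_def field_simps)
    finally show "exp (Re (P z)) \<le> cmod (f z) + 1" by (simp add: x_def)
    have "x * q \<le> x + 1/2"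
    proof -
      have "x / (2 * M + 1) \<le> 1/2" using x M0 by (simp add: field_simps)
      then show ?thesis by (simp add: q_def distrib_left)
    qed
    also have "x + 1/2 = exp (ln (x + 1/2))" using x2 by simp
    also have "\<dots> \<le> exp (Re (P z) + ln q)" using u by simp
    also have "\<dots> = exp (Re (P z)) * q" using q by (simp add: exp_add)
    finally show "cmod (f z) \<le> exp (Re (P z))" using q by (simp add: x_def)
  qed
qed

section \<open>Factorization and boundary values for arbitrary exponents\<close>

text \<open>Bundles the conclusions of the theorem, so that they are transported together when
  \<open>f\<close> is reassembled from its components.\<close>

definition hardy_boundary :: "real \<Rightarrow> (complex \<Rightarrow> complex) \<Rightarrow> (complex \<Rightarrow> complex) \<Rightarrow> bool" where
  "hardy_boundary p F Fp \<longleftrightarrow> Fp \<in> Lp_circle p \<and>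
     (AE \<theta> in lebesgue_on {0..2*pi}. nontangential_limit F (cis \<theta>) (Fp (cis \<theta>))) \<and>
     ((\<lambda>r. circle_integral p (\<lambda>\<zeta>. Fp \<zeta> - F (of_real r * \<zeta>))) \<longlongrightarrow> 0) (at_left 1)"

text \<open>Takes the place of the triangle inequality, which fails for \<open>p < 1\<close>; it
  holds because \<open>x + y \<le> 2 * max x y\<close>.\<close>

lemma powr_add_le:
  fixes x y p :: real
  assumes "0 \<le> x" "0 \<le> y" "0 < p"
  shows "(x + y) powr p \<le> 2 powr p * (x powr p + y powr p)"
proof -
  have "(x + y) powr p \<le> (2 * max x y) powr p" using assms by (intro powr_mono2) auto
  also have "\<dots> = 2 powr p * (max x y) powr p" using assms by (simp add: powr_mult)
  also have "\<dots> \<le> 2 powr p * (x powr p + y powr p)"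
    by (intro mult_left_mono) (auto simp: max_def)
  finally show ?thesis .
qed

text \<open>By Parseval the square means of an entire function increase with the radius, so the
  bound on the unit circle holds on smaller circles. On these, \<open>bnd\<close> permits dominated
  convergence in \<open>k\<close>.\<close>

lemma hardy2_limit_mean:
  assumes G: "G holomorphic_on unit_disk"
    and gk: "\<And>k. g k holomorphic_on UNIV" "\<And>k. integral {0..2*pi} (\<lambda>t. (cmod (g k (cis t)))\<^sup>2) \<le> I"
    and lim: "\<And>z. z \<in> unit_disk \<Longrightarrow> (\<lambda>k. g k z) \<longlonglongrightarrow> G z"
    and bnd: "\<And>k z. cmod z < 1 \<Longrightarrow> cmod (g k z) \<le> C / (1 - cmod z)"
    and r: "0 < r" "r < 1"
  shows "integral {0..2*pi} (\<lambda>t. (cmod (G (of_real r * cis t)))\<^sup>2) \<le> I"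
proof (rule tendsto_upperbound)
  have c: "continuous_on T (\<lambda>t. (cmod (g k (of_real r * cis t)))\<^sup>2)" for k T
    by (intro continuous_intros continuous_on_compose2[OF holomorphic_on_imp_continuous_on[OF gk(1)[of k]]]) auto
  show "(\<lambda>k. integral {0..2*pi} (\<lambda>t. (cmod (g k (of_real r * cis t)))\<^sup>2)) \<longlonglongrightarrow>
        integral {0..2*pi} (\<lambda>t. (cmod (G (of_real r * cis t)))\<^sup>2)"
  proof (rule dominated_convergence(2))
    show "(\<lambda>t. (cmod (g k (of_real r * cis t)))\<^sup>2) integrable_on {0..2*pi}" for k
      by (intro integrable_continuous_real c)
    show "(\<lambda>t::real. (C / (1 - r))\<^sup>2) integrable_on {0..2*pi}" by (intro integrable_continuous_real continuous_intros)
    show "norm ((cmod (g k (of_real r * cis t)))\<^sup>2) \<le> (C / (1 - r))\<^sup>2" for k t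
    proof -
      have "cmod (g k (of_real r * cis t)) \<le> C / (1 - r)"
        using bnd[of "of_real r * cis t" k] r by (simp add: norm_mult)
      then show ?thesis by (simp add: power_mono)
    qed
    show "(\<lambda>k. (cmod (g k (of_real r * cis t)))\<^sup>2) \<longlonglongrightarrow> (cmod (G (of_real r * cis t)))\<^sup>2" for t
      by (intro tendsto_intros lim) (use r in \<open>simp add: norm_mult\<close>)
  qed
  have "integral {0..2*pi} (\<lambda>t. (cmod (g k (of_real r * cis t)))\<^sup>2) \<le> I" for k
  proof -
    have h2: "g k holomorphic_on ball 0 2" by (rule holomorphic_on_subset[OF gk(1)]) simp
    obtain a where a: "\<And>z. cmod z < 2 \<Longrightarrow> (\<lambda>n. a n * z ^ n) sums g k z"
      "\<And>z. cmod z < 2 \<Longrightarrow> summable (\<lambda>n. norm (a n * z ^ n))"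
      by (rule holomorphic_circle_mean_sums[OF h2]) (use that in blast)
    have "integral {0..2*pi} (\<lambda>t. (cmod (g k (of_real r * cis t)))\<^sup>2) \<le> integral {0..2*pi} (\<lambda>t. (cmod (g k (of_real 1 * cis t)))\<^sup>2)"
    proof (rule sums_le[OF _ power_series_circle_mean[OF a] power_series_circle_mean[OF a]])
      show "2 * pi * ((cmod (a n))\<^sup>2 * (r ^ n)\<^sup>2) \<le> 2 * pi * ((cmod (a n))\<^sup>2 * (1 ^ n)\<^sup>2)" for n
        using r by (intro mult_left_mono power_mono) (auto intro: power_le_one)
    qed (use r in auto)
    then show ?thesis using gk(2)[of k] by simp
  qed
  then show "\<forall>\<^sub>F k in sequentially. integral {0..2*pi} (\<lambda>t. (cmod (g k (of_real r * cis t)))\<^sup>2) \<le> I" by simp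
qed simp

text \<open>The Poisson kernel at \<open>z\<close> is at most
  \<open>1 / (1 - cmod z)\<^sup>2\<close>. The resulting bound depends on \<open>g\<close> only
  through its mean, which is the local boundedness that Montel's theorem asks of a family.\<close>

lemma entire_bound_by_circle_mean:
  assumes g: "g holomorphic_on UNIV" and z: "cmod z < 1"
    and I: "integral {0..2*pi} (\<lambda>t. (cmod (g (cis t)))\<^sup>2) \<le> I"
  shows "cmod (g z) \<le> sqrt I / (1 - cmod z)"
proof -
  have c: "continuous_on T (\<lambda>t. g (cis t))" for T
    by (rule continuous_on_cis_compose[OF holomorphic_on_imp_continuous_on[OF g]]) auto
  have ne: "cis t \<noteq> z" for t using z by auto
  have i: "(\<lambda>t. (cmod (g (cis t)))\<^sup>2) integrable_on {0..2*pi}" by (intro integrable_continuous_real continuous_intros c)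
  have "0 \<le> integral {0..2*pi} (\<lambda>t. (cmod (g (cis t)))\<^sup>2)" by (rule integral_nonneg[OF i]) simp
  then have I0: "I \<ge> 0" using I by linarith
  have "(cmod (g z))\<^sup>2 \<le> integral {0..0 + 2*pi} (\<lambda>t. (cmod (g (cis t)))\<^sup>2 * ((1 - (cmod z)\<^sup>2) / (cmod (cis t - z))\<^sup>2)) / (2*pi)"
    by (rule poisson_representation_sq[of UNIV]) (use g z in auto)
  also have "\<dots> \<le> integral {0..2*pi} (\<lambda>t. (cmod (g (cis t)))\<^sup>2 * (1 / (1 - cmod z)\<^sup>2)) / (2*pi)"
  proof (rule divide_right_mono)
    have "integral {0..2*pi} (\<lambda>t. (cmod (g (cis t)))\<^sup>2 * ((1 - (cmod z)\<^sup>2) / (cmod (cis t - z))\<^sup>2))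
       \<le> integral {0..2*pi} (\<lambda>t. (cmod (g (cis t)))\<^sup>2 * (1 / (1 - cmod z)\<^sup>2))"
    proof (rule integral_le)
      show "(\<lambda>t. (cmod (g (cis t)))\<^sup>2 * ((1 - (cmod z)\<^sup>2) / (cmod (cis t - z))\<^sup>2)) integrable_on {0..2*pi}"
        by (intro integrable_continuous_real continuous_intros c) (use ne in auto)
      show "(\<lambda>t. (cmod (g (cis t)))\<^sup>2 * (1 / (1 - cmod z)\<^sup>2)) integrable_on {0..2*pi}"
        by (intro integrable_continuous_real continuous_intros c)
      fix t
      have "1 - cmod z \<le> cmod (cis t - z)" using norm_triangle_ineq2[of "cis t" z] by simp
      then have "(1 - (cmod z)\<^sup>2) / (cmod (cis t - z))\<^sup>2 \<le> 1 / (1 - cmod z)\<^sup>2"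
        using z by (intro frac_le power_mono) auto
      then show "(cmod (g (cis t)))\<^sup>2 * ((1 - (cmod z)\<^sup>2) / (cmod (cis t - z))\<^sup>2) \<le> (cmod (g (cis t)))\<^sup>2 * (1 / (1 - cmod z)\<^sup>2)"
        by (rule mult_left_mono) simp
    qed
    then show "integral {0..0 + 2*pi} (\<lambda>t. (cmod (g (cis t)))\<^sup>2 * ((1 - (cmod z)\<^sup>2) / (cmod (cis t - z))\<^sup>2))
       \<le> integral {0..2*pi} (\<lambda>t. (cmod (g (cis t)))\<^sup>2 * (1 / (1 - cmod z)\<^sup>2))" by simp
  qed simp
  also have "\<dots> = integral {0..2*pi} (\<lambda>t. (cmod (g (cis t)))\<^sup>2) / (1 - cmod z)\<^sup>2 / (2*pi)" by simp
  also have "\<dots> \<le> I / (1 - cmod z)\<^sup>2 / 1"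
    using I I0 pi_ge_two by (intro frac_le divide_right_mono) auto
  also have "\<dots> = (sqrt I / (1 - cmod z))\<^sup>2" using I0 by (simp add: power_divide)
  finally show ?thesis by (rule power2_le_imp_le) (use I0 z in simp)
qed

lemma Montel_locally_bounded:
  assumes hol: "\<And>k::nat. g k holomorphic_on unit_disk" and bnd: "\<And>k z. cmod z < 1 \<Longrightarrow> cmod (g k z) \<le> C / (1 - cmod z)"
  obtains G s where "G holomorphic_on unit_disk" "strict_mono (s :: nat \<Rightarrow> nat)"
    "\<And>z. z \<in> unit_disk \<Longrightarrow> (\<lambda>k. g (s k) z) \<longlonglongrightarrow> G z"
proof -
  have C0: "C \<ge> 0" using bnd[of 0 0] norm_ge_zero[of "g 0 0"] by (simp del: norm_ge_zero)
  have bd: "\<exists>B. \<forall>h\<in>range g. \<forall>z\<in>K. norm (h z) \<le> B" if K: "compact K" "K \<subseteq> unit_disk" for K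
  proof (cases "K = {}")
    case False
    obtain w where w: "w \<in> K" "\<And>z. z \<in> K \<Longrightarrow> cmod z \<le> cmod w"
      using continuous_attains_sup[OF K(1) False, of cmod] by (auto intro: continuous_intros)
    have "cmod (g k z) \<le> C / (1 - cmod w)" if z: "z \<in> K" for k z
    proof -
      have zw: "cmod z < 1" "cmod w < 1" using z w K by auto
      have "C / (1 - cmod z) \<le> C / (1 - cmod w)" using zw w(2)[OF z] C0 by (intro divide_left_mono) auto
      then show ?thesis using bnd[OF zw(1), of k] by simp
    qed
    then show ?thesis by blast
  qed auto
  show thesis
  proof (rule Montel[of unit_disk "range g" g])
    show "h holomorphic_on unit_disk" if "h \<in> range g" for h using hol that by auto
    show "\<exists>B. \<forall>h\<in>range g. \<forall>z\<in>K. norm (h z) \<le> B" if "compact K" "K \<subseteq> unit_disk" for K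
      by (rule bd[OF that])
    fix G s assume "G holomorphic_on unit_disk" "strict_mono (s :: nat \<Rightarrow> nat)"
      "\<And>z. z \<in> unit_disk \<Longrightarrow> (\<lambda>k. g (s k) z) \<longlonglongrightarrow> G z"
    then show thesis by (rule that)
  qed auto
qed

text \<open>If the zero-free \<open>exp P\<close> majorizes a dilate of \<open>\<psi>\<close> on the
  circle, put \<open>b = \<psi> * exp (- P)\<close>, \<open>g = exp (P / m)\<close> and
  \<open>f = exp (p * P / 2)\<close>. The maximum principle gives \<open>cmod b \<le> 1\<close>, and
  the identities between \<open>b\<close>, \<open>g\<close> and \<open>f\<close> are exact. All
  bounds are uniform in the dilation, so everything passes to the limit.\<close>

theorem hardy_factorization:
  assumes \<psi>: "\<psi> holomorphic_on unit_disk" and p: "p > 0"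
    and mean: "\<And>r. 0 < r \<Longrightarrow> r < 1 \<Longrightarrow> integral {0..2*pi} (\<lambda>t. cmod (\<psi> (of_real r * cis t)) powr p) \<le> I"
    and m: "real m * p \<ge> 2"
  obtains B G F J where "B holomorphic_on unit_disk" "G holomorphic_on unit_disk" "F holomorphic_on unit_disk"
    "\<And>z. z \<in> unit_disk \<Longrightarrow> cmod (B z) \<le> 1"
    "\<And>z. z \<in> unit_disk \<Longrightarrow> \<psi> z = B z * G z ^ m"
    "\<And>z. z \<in> unit_disk \<Longrightarrow> (cmod (G z) ^ m) powr p = (cmod (F z))\<^sup>2"
    "\<And>r. 0 < r \<Longrightarrow> r < 1 \<Longrightarrow> integral {0..2*pi} (\<lambda>t. (cmod (G (of_real r * cis t)))\<^sup>2) \<le> J"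
    "\<And>r. 0 < r \<Longrightarrow> r < 1 \<Longrightarrow> integral {0..2*pi} (\<lambda>t. (cmod (F (of_real r * cis t)))\<^sup>2) \<le> J"
proof -
  have m0: "m > 0" using m by (cases m) auto
  have cont\<psi>: "continuous_on unit_disk \<psi>" by (rule holomorphic_on_imp_continuous_on[OF \<psi>])
  define \<rho> where "\<rho> k = 1 - 1 / (real k + 2)" for k
  have \<rho>: "0 < \<rho> k" "\<rho> k < 1" "\<rho> \<longlonglongrightarrow> 1" for k unfolding \<rho>_def[abs_def] by (rule radial_seq)+
  have hol\<psi>: "(\<lambda>z. \<psi> (of_real (\<rho> k) * z)) holomorphic_on ball 0 (1 / \<rho> k)" for k
  proof -
    have "(\<psi> \<circ> (\<lambda>z. of_real (\<rho> k) * z)) holomorphic_on ball 0 (1 / \<rho> k)"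
      by (rule holomorphic_on_compose_gen[OF _ \<psi>])
         (use \<rho>(1,2)[of k] in \<open>auto intro!: holomorphic_intros simp: norm_mult field_simps\<close>)
    then show ?thesis by (simp add: o_def)
  qed
  have sub: "cball (0::complex) 1 \<subseteq> ball 0 (1 / \<rho> k)" for k
    using \<rho>(1,2)[of k] by (simp add: cball_subset_ball_iff field_simps)
  have "\<exists>P. P holomorphic_on UNIV \<and> (\<forall>z\<in>sphere 0 1. cmod (\<psi> (of_real (\<rho> k) * z)) \<le> exp (Re (P z)) \<and>
      exp (Re (P z)) \<le> cmod (\<psi> (of_real (\<rho> k) * z)) + 1)" for k
  proof -
    have "continuous_on (sphere 0 1) (\<lambda>z. \<psi> (of_real (\<rho> k) * z))"
      using sub[of k] by (intro continuous_on_subset[OF holomorphic_on_imp_continuous_on[OF hol\<psi>]]) auto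
    then show ?thesis by (rule zero_free_majorant) blast
  qed
  then obtain P where P: "\<And>k. P k holomorphic_on UNIV"
    "\<And>k z. z \<in> sphere 0 1 \<Longrightarrow> cmod (\<psi> (of_real (\<rho> k) * z)) \<le> exp (Re (P k z))"
    "\<And>k z. z \<in> sphere 0 1 \<Longrightarrow> exp (Re (P k z)) \<le> cmod (\<psi> (of_real (\<rho> k) * z)) + 1"
    by metis
  \<comment> \<open>From \<open>exp (Re P) \<le> cmod \<psi> + 1\<close> and
    \<open>powr_add_le\<close>; the \<open>2 * pi\<close> is the integral of 1.\<close>
  define J0 where "J0 = 2 powr p * (I + 2 * pi)"
  define J where "J = 2 * pi + J0"
  have contP: "continuous_on T (\<lambda>t. P k (cis t))" for k T
    by (rule continuous_on_cis_compose[OF holomorphic_on_imp_continuous_on[OF P(1)]]) auto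
  have meanP: "integral {0..2*pi} (\<lambda>t. exp (p * Re (P k (cis t)))) \<le> J0" for k
  proof -
    have c: "continuous_on T (\<lambda>t. cmod (\<psi> (of_real (\<rho> k) * cis t)) powr p)" for T
      using \<rho>(1,2)[of k] p by (intro continuous_on_powr' continuous_intros continuous_dilate_cis[OF cont\<psi>]) auto
    have "integral {0..2*pi} (\<lambda>t. exp (p * Re (P k (cis t)))) \<le>
        integral {0..2*pi} (\<lambda>t. 2 powr p * (cmod (\<psi> (of_real (\<rho> k) * cis t)) powr p + 1))"
    proof (rule integral_le)
      show "(\<lambda>t. exp (p * Re (P k (cis t)))) integrable_on {0..2*pi}"
        by (intro integrable_continuous_real continuous_intros contP)
      show "(\<lambda>t. 2 powr p * (cmod (\<psi> (of_real (\<rho> k) * cis t)) powr p + 1)) integrable_on {0..2*pi}"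
        by (intro integrable_continuous_real continuous_intros c)
      fix t
      have "exp (p * Re (P k (cis t))) = exp (Re (P k (cis t))) powr p" by (simp add: powr_def)
      also have "\<dots> \<le> (cmod (\<psi> (of_real (\<rho> k) * cis t)) + 1) powr p"
        using P(3)[of "cis t" k] p by (intro powr_mono2) auto
      also have "\<dots> \<le> 2 powr p * (cmod (\<psi> (of_real (\<rho> k) * cis t)) powr p + 1 powr p)"
        by (rule powr_add_le) (use p in auto)
      finally show "exp (p * Re (P k (cis t))) \<le> 2 powr p * (cmod (\<psi> (of_real (\<rho> k) * cis t)) powr p + 1)" by simp
    qed
    also have "\<dots> = 2 powr p * (integral {0..2*pi} (\<lambda>t. cmod (\<psi> (of_real (\<rho> k) * cis t)) powr p) + 2 * pi)"
      by (subst Henstock_Kurzweil_Integration.integral_mult_right,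
          subst Henstock_Kurzweil_Integration.integral_add) (auto intro!: integrable_continuous_real c)
    also have "\<dots> \<le> J0" unfolding J0_def using mean[OF \<rho>(1,2)] by (intro mult_left_mono add_right_mono) auto
    finally show ?thesis .
  qed
  define f where "f k z = exp (of_real (p/2) * P k z)" for k z
  define g where "g k z = exp (of_real (1/real m) * P k z)" for k z
  define b where "b k z = \<psi> (of_real (\<rho> k) * z) * exp (- P k z)" for k z
  have nf: "(cmod (f k z))\<^sup>2 = exp (p * Re (P k z))" for k z
    by (simp add: f_def power2_eq_square flip: exp_add)
  have ng: "(cmod (g k z))\<^sup>2 = exp (2 / real m * Re (P k z))" for k z
    by (simp add: g_def power2_eq_square flip: exp_add)
  have gm: "g k z ^ m = exp (P k z)" for k z
    using m0 unfolding g_def by (simp flip: exp_of_nat_mult)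
  have fhol: "f k holomorphic_on UNIV" for k unfolding f_def[abs_def] by (intro holomorphic_intros P)
  have ghol: "g k holomorphic_on UNIV" for k unfolding g_def[abs_def] by (intro holomorphic_intros P)
  have fmean: "integral {0..2*pi} (\<lambda>t. (cmod (f k (cis t)))\<^sup>2) \<le> J" for k
    using meanP[of k] by (simp add: nf J_def) (use pi_gt_zero in linarith)
  have gmean: "integral {0..2*pi} (\<lambda>t. (cmod (g k (cis t)))\<^sup>2) \<le> J" for k
  proof -
    have "integral {0..2*pi} (\<lambda>t. (cmod (g k (cis t)))\<^sup>2) \<le> integral {0..2*pi} (\<lambda>t. 1 + exp (p * Re (P k (cis t))))"
    proof (rule integral_le)
      show "(\<lambda>t. (cmod (g k (cis t)))\<^sup>2) integrable_on {0..2*pi}"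
        unfolding ng by (intro integrable_continuous_real continuous_intros contP)
      show "(\<lambda>t. 1 + exp (p * Re (P k (cis t)))) integrable_on {0..2*pi}"
        by (intro integrable_continuous_real continuous_intros contP)
      fix t
      define x where "x = Re (P k (cis t))"
      \<comment> \<open>The squared modulus of \<open>g\<close> is therefore at most that of
        \<open>f\<close> where \<open>Re P \<ge> 0\<close>, and at most 1 elsewhere. The sum covers
        both cases and accounts for the \<open>2 * pi\<close> in \<open>J\<close>.\<close>
      have "2 / real m \<le> p" using m m0 by (simp add: field_simps)
      then have "exp (2 / real m * x) \<le> 1 + exp (p * x)"
      proof (cases "x \<ge> 0")
        case True
        then have "exp (2 / real m * x) \<le> exp (p * x)" using \<open>2 / real m \<le> p\<close> by (simp only: exp_le_cancel_iff mult_right_mono)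
        then show ?thesis by linarith
      next
        case False
        then have "2 / real m * x \<le> 0" by (intro mult_nonneg_nonpos) auto
        then have "exp (2 / real m * x) \<le> 1" by simp
        then show ?thesis using exp_ge_zero[of "p * x"] by linarith
      qed
      then show "(cmod (g k (cis t)))\<^sup>2 \<le> 1 + exp (p * Re (P k (cis t)))" by (simp add: ng x_def)
    qed
    also have "\<dots> = 2 * pi + integral {0..2*pi} (\<lambda>t. exp (p * Re (P k (cis t))))"
      by (subst Henstock_Kurzweil_Integration.integral_add) (auto intro!: integrable_continuous_real continuous_intros contP)
    also have "\<dots> \<le> J" using meanP[of k] by (simp add: J_def)
    finally show ?thesis .
  qed
  have b1: "cmod (b k z) \<le> 1" if z: "cmod z < 1" for k z
  proof (rule maximum_modulus_frontier[of "b k" "ball 0 1"])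
    have hb: "b k holomorphic_on ball 0 (1 / \<rho> k)"
      unfolding b_def[abs_def] by (intro holomorphic_intros hol\<psi> holomorphic_on_subset[OF P(1)]) auto
    have "ball (0::complex) 1 \<subseteq> ball 0 (1 / \<rho> k)" using sub[of k] ball_subset_cball by blast
    then show "b k holomorphic_on interior (ball 0 1)"
      unfolding interior_open[OF open_ball] by (rule holomorphic_on_subset[OF hb])
    have "closure (ball (0::complex) 1) = cball 0 1" by simp
    then show "continuous_on (closure (ball 0 1)) (b k)"
      using continuous_on_subset[OF holomorphic_on_imp_continuous_on[OF hb] sub] by simp
    fix w :: complex assume "w \<in> frontier (ball 0 1)"
    then have "w \<in> sphere 0 1" by simp
    have "cmod (b k w) = cmod (\<psi> (of_real (\<rho> k) * w)) * exp (- Re (P k w))"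
      by (simp only: b_def norm_mult norm_exp_eq_Re uminus_complex.sel)
    also have "\<dots> \<le> exp (Re (P k w)) * exp (- Re (P k w))"
      using P(2)[OF \<open>w \<in> sphere 0 1\<close>, of k] by (intro mult_right_mono) auto
    also have "\<dots> = 1" by (simp flip: exp_add)
    finally show "cmod (b k w) \<le> 1" .
  qed (use z in auto)
  have f_disk: "f k holomorphic_on unit_disk" for k by (rule holomorphic_on_subset[OF fhol]) simp
  have g_disk: "g k holomorphic_on unit_disk" for k by (rule holomorphic_on_subset[OF ghol]) simp
  have fb: "cmod (f k z) \<le> sqrt J / (1 - cmod z)" if "cmod z < 1" for k z
    by (rule entire_bound_by_circle_mean[OF fhol that fmean])
  have gb: "cmod (g k z) \<le> sqrt J / (1 - cmod z)" if "cmod z < 1" for k z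
    by (rule entire_bound_by_circle_mean[OF ghol that gmean])
  obtain F s1 where F: "F holomorphic_on unit_disk" "strict_mono (s1 :: nat \<Rightarrow> nat)"
    "\<And>z. z \<in> unit_disk \<Longrightarrow> (\<lambda>k. f (s1 k) z) \<longlonglongrightarrow> F z"
    by (rule Montel_locally_bounded[of f "sqrt J"])
       (use f_disk fb that in blast)+
  obtain G s2 where G: "G holomorphic_on unit_disk" "strict_mono (s2 :: nat \<Rightarrow> nat)"
    "\<And>z. z \<in> unit_disk \<Longrightarrow> (\<lambda>k. g (s1 (s2 k)) z) \<longlonglongrightarrow> G z"
    by (rule Montel_locally_bounded[of "\<lambda>k. g (s1 k)" "sqrt J"])
       (use g_disk gb that in blast)+
  have bhol: "b k holomorphic_on unit_disk" for k
  proof -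
    have "ball (0::complex) 1 \<subseteq> ball 0 (1 / \<rho> k)" using sub[of k] ball_subset_cball by blast
    then show ?thesis unfolding b_def[abs_def]
      by (intro holomorphic_intros holomorphic_on_subset[OF hol\<psi>] holomorphic_on_subset[OF P(1)]) auto
  qed
  have bb: "cmod (b k z) \<le> 1 / (1 - cmod z)" if "cmod z < 1" for k z
  proof -
    have "1 \<le> 1 / (1 - cmod z)" using that by simp
    then show ?thesis using b1[OF that, of k] by linarith
  qed
  obtain B s3 where B: "B holomorphic_on unit_disk" "strict_mono (s3 :: nat \<Rightarrow> nat)"
    "\<And>z. z \<in> unit_disk \<Longrightarrow> (\<lambda>k. b (s1 (s2 (s3 k))) z) \<longlonglongrightarrow> B z"
    by (rule Montel_locally_bounded[of "\<lambda>k. b (s1 (s2 k))" 1]) (use bhol bb that in blast)+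
  \<comment> \<open>Subsequences of subsequences: the three families converge along common indices,
    so the identities between them survive.\<close>
  define s where "s k = s1 (s2 (s3 k))" for k
  have s: "strict_mono s" unfolding s_def using F(2) G(2) B(2) by (simp add: strict_mono_def)
  have limB: "(\<lambda>k. b (s k) z) \<longlonglongrightarrow> B z" if "z \<in> unit_disk" for z using B(3)[OF that] by (simp add: s_def)
  have limG: "(\<lambda>k. g (s k) z) \<longlonglongrightarrow> G z" if "z \<in> unit_disk" for z
    using LIMSEQ_subseq_LIMSEQ[OF G(3)[OF that] B(2)] by (simp add: s_def o_def)
  have limF: "(\<lambda>k. f (s k) z) \<longlonglongrightarrow> F z" if "z \<in> unit_disk" for z
    using LIMSEQ_subseq_LIMSEQ[OF LIMSEQ_subseq_LIMSEQ[OF F(3)[OF that] G(2)] B(2)] by (simp add: s_def o_def)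
  show thesis
  proof (rule that[OF B(1) G(1) F(1)])
    fix z :: complex assume z: "z \<in> unit_disk"
    show "cmod (B z) \<le> 1"
      by (rule tendsto_upperbound[OF tendsto_norm[OF limB[OF z]]]) (use b1 z in auto)
    show "\<psi> z = B z * G z ^ m"
    proof (rule LIMSEQ_unique)
      show "(\<lambda>k. b (s k) z * g (s k) z ^ m) \<longlonglongrightarrow> B z * G z ^ m"
        by (intro tendsto_intros limB limG z)
      have "b k z * g k z ^ m = \<psi> (of_real (\<rho> k) * z)" for k
        unfolding gm b_def by (simp add: mult.assoc flip: exp_add)
      moreover have "(\<lambda>k. \<psi> (of_real (\<rho> (s k)) * z)) \<longlonglongrightarrow> \<psi> z"
      proof -
        have c: "isCont \<psi> z" using cont\<psi> z by (simp add: continuous_on_eq_continuous_at)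
        have "(\<lambda>k. \<rho> (s k)) \<longlonglongrightarrow> 1" using LIMSEQ_subseq_LIMSEQ[OF \<rho>(3) s] by (simp add: o_def)
        then have "(\<lambda>k. of_real (\<rho> (s k)) * z) \<longlonglongrightarrow> of_real 1 * z" by (intro tendsto_intros)
        then have l: "(\<lambda>k. of_real (\<rho> (s k)) * z) \<longlonglongrightarrow> z" by simp
        show ?thesis by (rule isCont_tendsto_compose[OF c l])
      qed
      ultimately show "(\<lambda>k. b (s k) z * g (s k) z ^ m) \<longlonglongrightarrow> \<psi> z" by simp
    qed
    show "(cmod (G z) ^ m) powr p = (cmod (F z))\<^sup>2"
    proof (rule LIMSEQ_unique)
      show "(\<lambda>k. (cmod (f (s k) z))\<^sup>2) \<longlonglongrightarrow> (cmod (F z))\<^sup>2"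
        by (intro tendsto_intros limF z)
      have "(\<lambda>k. (cmod (g (s k) z) ^ m) powr p) \<longlonglongrightarrow> (cmod (G z) ^ m) powr p"
        by (rule tendsto_powr') (use p in \<open>auto intro!: tendsto_intros limG z\<close>)
      moreover have "(cmod (g k z) ^ m) powr p = (cmod (f k z))\<^sup>2" for k
      proof -
        have "cmod (g k z) ^ m = exp (Re (P k z))" by (simp add: gm flip: norm_power)
        then show ?thesis by (simp add: nf powr_def)
      qed
      ultimately show "(\<lambda>k. (cmod (f (s k) z))\<^sup>2) \<longlonglongrightarrow> (cmod (G z) ^ m) powr p" by simp
    qed
  next
    fix r :: real assume r: "0 < r" "r < 1"
    show "integral {0..2*pi} (\<lambda>t. (cmod (G (of_real r * cis t)))\<^sup>2) \<le> J"
      by (rule hardy2_limit_mean[where g="\<lambda>k. g (s k)", OF G(1) ghol gmean limG gb r])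
    show "integral {0..2*pi} (\<lambda>t. (cmod (F (of_real r * cis t)))\<^sup>2) \<le> J"
      by (rule hardy2_limit_mean[where g="\<lambda>k. f (s k)", OF F(1) fhol fmean limF fb r])
  qed
qed

lemma tendsto_at_left_1_sequentially:
  fixes X :: "real \<Rightarrow> 'b :: first_countable_topology"
  assumes "\<And>S. (\<And>n::nat. 0 < S n) \<Longrightarrow> (\<And>n. S n < 1) \<Longrightarrow> S \<longlonglongrightarrow> 1 \<Longrightarrow> (\<lambda>n. X (S n)) \<longlonglongrightarrow> L"
  shows "(X \<longlongrightarrow> L) (at_left 1)"
  by (rule tendsto_at_left_sequentially[of 0]) (use assms in auto)

lemma nontangential_limit_mult:
  assumes "nontangential_limit F \<zeta> a" "nontangential_limit G \<zeta> b"
  shows "nontangential_limit (\<lambda>z. F z * G z) \<zeta> (a * b)"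
  using assms unfolding nontangential_limit_def by (auto intro: tendsto_mult)

lemma nontangential_limit_power:
  assumes "nontangential_limit F \<zeta> a"
  shows "nontangential_limit (\<lambda>z. F z ^ m) \<zeta> (a ^ m)"
  using assms unfolding nontangential_limit_def by (auto intro: tendsto_power)

lemma nontangential_limit_cong:
  assumes "\<And>z. z \<in> unit_disk \<Longrightarrow> F z = G z" "nontangential_limit F \<zeta> a"
  shows "nontangential_limit G \<zeta> a"
  unfolding nontangential_limit_def
proof (intro allI impI)
  fix \<alpha> :: real assume "\<alpha> > 1"
  then have "(F \<longlongrightarrow> a) (at \<zeta> within stolz_region \<alpha> \<zeta>)" using assms(2) by (simp add: nontangential_limit_def)
  then show "(G \<longlongrightarrow> a) (at \<zeta> within stolz_region \<alpha> \<zeta>)"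
    by (rule Lim_transform_within[OF _ zero_less_one]) (use assms(1) in \<open>auto simp: stolz_region_def\<close>)
qed

text \<open>Dominated convergence with a moving majorant \<open>w n + v\<close>, where
  \<open>w n\<close> vanishes in mean. The positive part of \<open>u n - w n\<close> lies below the
  fixed \<open>v\<close> and below \<open>u n\<close>, so its integral tends to 0.\<close>

lemma nn_integral_tendsto_0_perturbed_domination:
  fixes u w :: "nat \<Rightarrow> 'a \<Rightarrow> real"
  assumes [measurable]: "\<And>n. u n \<in> borel_measurable M" "\<And>n. w n \<in> borel_measurable M" "v \<in> borel_measurable M"
    and nn: "\<And>n x. 0 \<le> u n x" "\<And>n x. 0 \<le> w n x" "\<And>x. 0 \<le> v x"
    and le: "\<And>n. AE x in M. u n x \<le> w n x + v x"
    and v: "(\<integral>\<^sup>+x. ennreal (v x) \<partial>M) < \<infinity>"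
    and w: "(\<lambda>n. \<integral>\<^sup>+x. ennreal (w n x) \<partial>M) \<longlonglongrightarrow> 0"
    and u: "AE x in M. (\<lambda>n. u n x) \<longlonglongrightarrow> 0"
  shows "(\<lambda>n. \<integral>\<^sup>+x. ennreal (u n x) \<partial>M) \<longlonglongrightarrow> 0"
proof -
  define y where "y n x = max 0 (u n x - w n x)" for n x
  have [measurable]: "y n \<in> borel_measurable M" for n unfolding y_def[abs_def] by measurable
  have "(\<lambda>n. \<integral>\<^sup>+x. ennreal (y n x) \<partial>M) \<longlonglongrightarrow> (\<integral>\<^sup>+x. ennreal 0 \<partial>M)"
  proof (rule nn_integral_dominated_convergence[where w="\<lambda>x. ennreal (v x)"])
    show "AE x in M. ennreal (y n x) \<le> ennreal (v x)" for n
      using le[of n] by eventually_elim (use nn in \<open>auto simp: y_def intro!: ennreal_leI\<close>)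
    show "AE x in M. (\<lambda>n. ennreal (y n x)) \<longlonglongrightarrow> ennreal 0"
      using u
    proof eventually_elim
      case (elim x)
      have "(\<lambda>n. y n x) \<longlonglongrightarrow> 0"
        by (rule tendsto_sandwich[OF _ _ tendsto_const elim]) (use nn in \<open>auto simp: y_def intro!: always_eventually\<close>)
      then show ?case by (rule tendsto_ennrealI)
    qed
  qed (use v in auto)
  then have "(\<lambda>n. (\<integral>\<^sup>+x. ennreal (y n x) \<partial>M) + (\<integral>\<^sup>+x. ennreal (w n x) \<partial>M)) \<longlonglongrightarrow> 0 + 0"
    using w by (intro tendsto_add) simp_all
  then have lim: "(\<lambda>n. (\<integral>\<^sup>+x. ennreal (y n x) \<partial>M) + (\<integral>\<^sup>+x. ennreal (w n x) \<partial>M)) \<longlonglongrightarrow> 0" by simp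
  have "(\<integral>\<^sup>+x. ennreal (u n x) \<partial>M) \<le> (\<integral>\<^sup>+x. ennreal (y n x) \<partial>M) + (\<integral>\<^sup>+x. ennreal (w n x) \<partial>M)" for n
  proof -
    have "(\<integral>\<^sup>+x. ennreal (u n x) \<partial>M) \<le> (\<integral>\<^sup>+x. ennreal (y n x) + ennreal (w n x) \<partial>M)"
    proof (rule nn_integral_mono)
      fix x
      have "u n x \<le> y n x + w n x" by (simp add: y_def)
      then show "ennreal (u n x) \<le> ennreal (y n x) + ennreal (w n x)"
        using nn(2)[of n x] by (simp add: y_def ennreal_leI flip: ennreal_plus)
    qed
    also have "\<dots> = (\<integral>\<^sup>+x. ennreal (y n x) \<partial>M) + (\<integral>\<^sup>+x. ennreal (w n x) \<partial>M)"
      by (rule nn_integral_add) auto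
    finally show ?thesis .
  qed
  then show ?thesis by (intro tendsto_sandwich[OF _ _ tendsto_const lim] always_eventually allI) auto
qed

text \<open>Write \<open>F_r\<close>, \<open>G_r\<close> for the values on the circle of radius
  \<open>r\<close>. Then \<open>cmod (Fp - F_r) powr p\<close> is at most a constant times
  \<open>(cmod Gp)\<^sup>2 + (cmod (Gp - G_r))\<^sup>2\<close>, and the second summand vanishes in
  mean, so pointwise convergence upgrades to convergence in the mean of order
  \<open>p\<close>.\<close>

lemma circle_sequence_integral_tendsto_0:
  fixes F G :: "complex \<Rightarrow> complex" and Fp Gp :: "complex \<Rightarrow> complex"
  assumes p: "p > 0"
    and m: "(\<lambda>t. Fp (cis t)) \<in> borel_measurable (lebesgue_on {0..2*pi})" "(\<lambda>t. Gp (cis t)) \<in> borel_measurable (lebesgue_on {0..2*pi})"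
    and cF: "continuous_on unit_disk F" and cG: "continuous_on unit_disk G"
    and dom: "\<And>z. z \<in> unit_disk \<Longrightarrow> cmod (F z) powr p \<le> (cmod (G z))\<^sup>2"
    and ntF: "AE t in lebesgue_on {0..2*pi}. nontangential_limit F (cis t) (Fp (cis t))"
    and ntG: "AE t in lebesgue_on {0..2*pi}. nontangential_limit G (cis t) (Gp (cis t))"
    and G2: "((\<lambda>r. \<integral>\<^sup>+t. ennreal ((cmod (Gp (cis t) - G (of_real r * cis t)))\<^sup>2) \<partial>lebesgue_on {0..2*pi}) \<longlongrightarrow> 0) (at_left 1)"
    and Gf: "(\<integral>\<^sup>+t. ennreal ((cmod (Gp (cis t)))\<^sup>2) \<partial>lebesgue_on {0..2*pi}) < \<infinity>"
  shows "hardy_boundary p F Fp"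
proof -
  note [measurable] = m
  define \<rho> where "\<rho> k = 1 - 1 / (real k + 2)" for k
  have \<rho>: "0 < \<rho> k" "\<rho> k < 1" "\<rho> \<longlonglongrightarrow> 1" for k unfolding \<rho>_def[abs_def] by (rule radial_seq)+
  have bd: "AE t in lebesgue_on {0..2*pi}. cmod (Fp (cis t)) powr p \<le> (cmod (Gp (cis t)))\<^sup>2"
    using ntF ntG
  proof eventually_elim
    case (elim t)
    have F: "(\<lambda>n. F (of_real (\<rho> n) * cis t)) \<longlonglongrightarrow> Fp (cis t)"
      by (rule nontangential_limit_radial[OF elim(1)]) (use \<rho> in auto)
    have G: "(\<lambda>n. G (of_real (\<rho> n) * cis t)) \<longlonglongrightarrow> Gp (cis t)"
      by (rule nontangential_limit_radial[OF elim(2)]) (use \<rho> in auto)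
    show ?case
    proof (rule LIMSEQ_le)
      show "(\<lambda>n. (cmod (G (of_real (\<rho> n) * cis t)))\<^sup>2) \<longlonglongrightarrow> (cmod (Gp (cis t)))\<^sup>2" by (intro tendsto_intros G)
      show "(\<lambda>n. cmod (F (of_real (\<rho> n) * cis t)) powr p) \<longlonglongrightarrow> cmod (Fp (cis t)) powr p"
        by (rule tendsto_powr') (use p in \<open>auto intro!: tendsto_intros F\<close>)
      have "cmod (F (of_real (\<rho> n) * cis t)) powr p \<le> (cmod (G (of_real (\<rho> n) * cis t)))\<^sup>2" for n
        by (rule dom) (use \<rho>(1,2)[of n] in \<open>simp add: norm_mult\<close>)
      then show "\<exists>N. \<forall>n\<ge>N. cmod (F (of_real (\<rho> n) * cis t)) powr p \<le> (cmod (G (of_real (\<rho> n) * cis t)))\<^sup>2" by blast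
    qed
  qed
  have "circle_integral p Fp \<le> (\<integral>\<^sup>+t. ennreal ((cmod (Gp (cis t)))\<^sup>2) \<partial>lebesgue_on {0..2*pi})"
    unfolding circle_integral_def
    by (rule nn_integral_mono_AE) (use bd in eventually_elim, auto intro: ennreal_leI)
  then have Lp: "Fp \<in> Lp_circle p" unfolding Lp_circle_def using Gf m by (auto intro: le_less_trans)
  have "((\<lambda>r. circle_integral p (\<lambda>\<zeta>. Fp \<zeta> - F (of_real r * \<zeta>))) \<longlongrightarrow> 0) (at_left 1)"
  proof (rule tendsto_at_left_1_sequentially)
    fix S :: "nat \<Rightarrow> real" assume S: "\<And>n. 0 < S n" "\<And>n. S n < 1" "S \<longlonglongrightarrow> 1"
    have "filterlim S (at_left 1) sequentially"
      unfolding filterlim_at using S(3) by (intro conjI always_eventually allI) (auto simp: S(2) less_imp_neq[OF S(2)])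
    from filterlim_compose[OF G2 this]
    have G2S: "(\<lambda>n. \<integral>\<^sup>+t. ennreal ((cmod (Gp (cis t) - G (of_real (S n) * cis t)))\<^sup>2) \<partial>lebesgue_on {0..2*pi}) \<longlonglongrightarrow> 0" .
    have [measurable]: "(\<lambda>t. F (of_real (S n) * cis t)) \<in> borel_measurable (lebesgue_on {0..2*pi})"
      "(\<lambda>t. G (of_real (S n) * cis t)) \<in> borel_measurable (lebesgue_on {0..2*pi})" for n
      using S(1,2)[of n] by (auto intro!: continuous_on_circle_measurable continuous_dilate_cis[OF cF] continuous_dilate_cis[OF cG])
    define c where "c = 2 powr p"
    have c: "c > 0" by (simp add: c_def)
    \<comment> \<open>With \<open>x = cmod Gp\<close> and \<open>y = cmod (Gp - G_r)\<close> the
      estimate is \<open>c * (x\<^sup>2 + (x + y)\<^sup>2) \<le> c * (3 * x\<^sup>2 + 2 *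
      y\<^sup>2)\<close>, which gives the coefficients of \<open>v\<close> and
      \<open>w\<close>.\<close>
    have "(\<lambda>n. \<integral>\<^sup>+t. ennreal (cmod (Fp (cis t) - F (of_real (S n) * cis t)) powr p) \<partial>lebesgue_on {0..2*pi}) \<longlonglongrightarrow> 0"
    proof (rule nn_integral_tendsto_0_perturbed_domination[where
          w="\<lambda>n t. 2 * c * (cmod (Gp (cis t) - G (of_real (S n) * cis t)))\<^sup>2" and v="\<lambda>t. 3 * c * (cmod (Gp (cis t)))\<^sup>2"])
      show "AE t in lebesgue_on {0..2*pi}. cmod (Fp (cis t) - F (of_real (S n) * cis t)) powr p \<le>
          2 * c * (cmod (Gp (cis t) - G (of_real (S n) * cis t)))\<^sup>2 + 3 * c * (cmod (Gp (cis t)))\<^sup>2" for n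
        using bd
      proof eventually_elim
        case (elim t)
        define x where "x = cmod (Gp (cis t))"
        define y where "y = cmod (Gp (cis t) - G (of_real (S n) * cis t))"
        have xy: "cmod (G (of_real (S n) * cis t)) \<le> x + y"
          unfolding x_def y_def using norm_triangle_ineq4[of "Gp (cis t)" "Gp (cis t) - G (of_real (S n) * cis t)"] by simp
        have sq: "(x + y)\<^sup>2 \<le> 2 * x\<^sup>2 + 2 * y\<^sup>2"
          using sum_squares_ge_zero[of "x - y" 0] by (simp add: power2_eq_square algebra_simps)
        have "cmod (Fp (cis t) - F (of_real (S n) * cis t)) powr p \<le> (cmod (Fp (cis t)) + cmod (F (of_real (S n) * cis t))) powr p"
          using p norm_triangle_ineq4 by (intro powr_mono2) auto
        also have "\<dots> \<le> c * (cmod (Fp (cis t)) powr p + cmod (F (of_real (S n) * cis t)) powr p)"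
          unfolding c_def by (rule powr_add_le) (use p in auto)
        also have "\<dots> \<le> c * (x\<^sup>2 + (cmod (G (of_real (S n) * cis t)))\<^sup>2)"
          using c elim S(1,2)[of n] unfolding x_def by (intro mult_left_mono add_mono dom) (auto simp: norm_mult)
        also have "\<dots> \<le> c * (x\<^sup>2 + (x + y)\<^sup>2)" using c xy by (intro mult_left_mono add_left_mono power_mono) auto
        also have "\<dots> \<le> c * (x\<^sup>2 + (2 * x\<^sup>2 + 2 * y\<^sup>2))" using c sq by (intro mult_left_mono add_left_mono) auto
        finally show ?case by (simp add: x_def y_def algebra_simps)
      qed
      show "(\<integral>\<^sup>+t. ennreal (3 * c * (cmod (Gp (cis t)))\<^sup>2) \<partial>lebesgue_on {0..2*pi}) < \<infinity>"
        using Gf c by (simp add: ennreal_mult' nn_integral_cmult ennreal_mult_less_top)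
      have "(\<lambda>n. ennreal (2 * c) * (\<integral>\<^sup>+t. ennreal ((cmod (Gp (cis t) - G (of_real (S n) * cis t)))\<^sup>2) \<partial>lebesgue_on {0..2*pi})) \<longlonglongrightarrow> ennreal (2 * c) * 0"
        by (rule tendsto_mult_ennreal[OF tendsto_const G2S]) auto
      then show "(\<lambda>n. \<integral>\<^sup>+t. ennreal (2 * c * (cmod (Gp (cis t) - G (of_real (S n) * cis t)))\<^sup>2) \<partial>lebesgue_on {0..2*pi}) \<longlonglongrightarrow> 0"
        using c by (simp add: ennreal_mult' nn_integral_cmult)
      show "AE t in lebesgue_on {0..2*pi}. (\<lambda>n. cmod (Fp (cis t) - F (of_real (S n) * cis t)) powr p) \<longlonglongrightarrow> 0"
        using ntF
      proof eventually_elim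
        case (elim t)
        have "(\<lambda>n. F (of_real (S n) * cis t)) \<longlonglongrightarrow> Fp (cis t)"
          by (rule nontangential_limit_radial[OF elim]) (use S in auto)
        then have "(\<lambda>n. cmod (Fp (cis t) - F (of_real (S n) * cis t))) \<longlonglongrightarrow> cmod (Fp (cis t) - Fp (cis t))"
          by (intro tendsto_intros)
        from tendsto_powr'[OF this tendsto_const, of p]
        show ?case using p by simp
      qed
    qed (use c in \<open>auto intro!: mult_nonneg_nonneg\<close>)
    then show "(\<lambda>n. circle_integral p (\<lambda>\<zeta>. Fp \<zeta> - F (of_real (S n) * \<zeta>))) \<longlonglongrightarrow> 0"
      unfolding circle_integral_def .
  qed
  then show ?thesis unfolding hardy_boundary_def using Lp ntF by blast
qed

text \<open>In \<open>\<psi> = B * G ^ m\<close> both factors have bounded square means, hence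
  nontangential limits almost everywhere. Convergence in mean is inherited from \<open>F\<close>,
  since \<open>cmod \<psi> powr p \<le> (cmod F)\<^sup>2\<close>.\<close>

theorem hardy_space_boundary:
  assumes \<psi>: "\<psi> holomorphic_on unit_disk" and p: "p > 0"
    and mean: "\<And>r. 0 < r \<Longrightarrow> r < 1 \<Longrightarrow> circle_integral p (\<lambda>\<zeta>. \<psi> (of_real r * \<zeta>)) \<le> ennreal I"
  shows "hardy_boundary p \<psi> (radial_limit \<psi>)"
proof -
  have cont: "continuous_on unit_disk \<psi>" by (rule holomorphic_on_imp_continuous_on[OF \<psi>])
  obtain m :: nat where "2 / p \<le> real m" using real_arch_simple by blast
  then have m: "real m * p \<ge> 2" using p by (simp add: field_simps)
  \<comment> \<open>\<open>ennreal I\<close> is 0 for negative \<open>I\<close>, hence the real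
    bound \<open>max I 0\<close>.\<close>
  have mean': "integral {0..2*pi} (\<lambda>t. cmod (\<psi> (of_real r * cis t)) powr p) \<le> max I 0" if r: "0 < r" "r < 1" for r
  proof -
    have c: "continuous_on UNIV (\<lambda>t. cmod (\<psi> (of_real r * cis t)) powr p)"
      using r p by (intro continuous_on_powr' continuous_intros continuous_dilate_cis[OF cont]) auto
    have "ennreal (integral {0..2*pi} (\<lambda>t. cmod (\<psi> (of_real r * cis t)) powr p)) \<le> ennreal I"
      using mean[OF r] nn_integral_circle_continuous[OF c] by (simp add: circle_integral_def)
    then show ?thesis by (cases "I \<ge> 0") (auto simp: ennreal_neg ennreal_eq_0_iff)
  qed
  obtain B G F J where BGF: "B holomorphic_on unit_disk" "G holomorphic_on unit_disk" "F holomorphic_on unit_disk"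
    and B1: "\<And>z. z \<in> unit_disk \<Longrightarrow> cmod (B z) \<le> 1"
    and fac: "\<And>z. z \<in> unit_disk \<Longrightarrow> \<psi> z = B z * G z ^ m"
    and GF: "\<And>z. z \<in> unit_disk \<Longrightarrow> (cmod (G z) ^ m) powr p = (cmod (F z))\<^sup>2"
    and GJ: "\<And>r. 0 < r \<Longrightarrow> r < 1 \<Longrightarrow> integral {0..2*pi} (\<lambda>t. (cmod (G (of_real r * cis t)))\<^sup>2) \<le> J"
    and FJ: "\<And>r. 0 < r \<Longrightarrow> r < 1 \<Longrightarrow> integral {0..2*pi} (\<lambda>t. (cmod (F (of_real r * cis t)))\<^sup>2) \<le> J"
    by (rule hardy_factorization[OF \<psi> p _ m]) (use mean' that in blast)+
  have BJ: "integral {0..2*pi} (\<lambda>t. (cmod (B (of_real r * cis t)))\<^sup>2) \<le> 2 * pi" if r: "0 < r" "r < 1" for r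
  proof -
    have "integral {0..2*pi} (\<lambda>t. (cmod (B (of_real r * cis t)))\<^sup>2) \<le> integral {0..2*pi} (\<lambda>t. 1)"
    proof (rule integral_le)
      show "(\<lambda>t. (cmod (B (of_real r * cis t)))\<^sup>2) integrable_on {0..2*pi}"
        using r by (intro integrable_continuous_real continuous_intros continuous_dilate_cis[OF holomorphic_on_imp_continuous_on[OF BGF(1)]]) auto
      show "(cmod (B (of_real r * cis t)))\<^sup>2 \<le> 1" for t
        using B1[of "of_real r * cis t"] r by (intro power_le_one) (auto simp: norm_mult)
    qed auto
    then show ?thesis by simp
  qed
  have ntB: "AE \<theta> in lebesgue_on {0..2*pi}. nontangential_limit B (cis \<theta>) (radial_limit B (cis \<theta>))"
    by (rule hardy2_boundary(1)[OF BGF(1)]) (rule BJ)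
  have ntG: "AE \<theta> in lebesgue_on {0..2*pi}. nontangential_limit G (cis \<theta>) (radial_limit G (cis \<theta>))"
    by (rule hardy2_boundary(1)[OF BGF(2)]) (rule GJ)
  have ntF: "AE \<theta> in lebesgue_on {0..2*pi}. nontangential_limit F (cis \<theta>) (radial_limit F (cis \<theta>))"
    by (rule hardy2_boundary(1)[OF BGF(3)]) (rule FJ)
  have F2: "((\<lambda>r. \<integral>\<^sup>+t. ennreal ((cmod (radial_limit F (cis t) - F (of_real r * cis t)))\<^sup>2) \<partial>lebesgue_on {0..2*pi}) \<longlongrightarrow> 0) (at_left 1)"
    by (rule hardy2_boundary(2)[OF BGF(3)]) (rule FJ)
  have Ffin: "(\<integral>\<^sup>+t. ennreal ((cmod (radial_limit F (cis t)))\<^sup>2) \<partial>lebesgue_on {0..2*pi}) < \<infinity>"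
    by (rule hardy2_boundary(3)[OF BGF(3)]) (rule FJ)
  have "AE t in lebesgue_on {0..2*pi}. nontangential_limit \<psi> (cis t) (radial_limit B (cis t) * radial_limit G (cis t) ^ m)"
    using ntB ntG
  proof eventually_elim
    case (elim t)
    show ?case
      by (rule nontangential_limit_cong[OF _ nontangential_limit_mult[OF elim(1) nontangential_limit_power[OF elim(2), of m]]])
         (use fac in simp)
  qed
  then have nt: "AE t in lebesgue_on {0..2*pi}. nontangential_limit \<psi> (cis t) (radial_limit \<psi> (cis t))"
    by eventually_elim (use radial_limit_eq(2) in \<open>metis norm_cis\<close>)
  show ?thesis
  proof (rule circle_sequence_integral_tendsto_0[OF p _ _ cont holomorphic_on_imp_continuous_on[OF BGF(3)] _ nt
        ntF F2 Ffin])
    show "(\<lambda>t. radial_limit \<psi> (cis t)) \<in> borel_measurable (lebesgue_on {0..2*pi})"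
      by (rule radial_limit_measurable_circle[OF cont])
    show "(\<lambda>t. radial_limit F (cis t)) \<in> borel_measurable (lebesgue_on {0..2*pi})"
      by (rule radial_limit_measurable_circle[OF holomorphic_on_imp_continuous_on[OF BGF(3)]])
    fix z :: complex assume z: "z \<in> unit_disk"
    have "cmod (\<psi> z) \<le> 1 * cmod (G z) ^ m"
      unfolding fac[OF z] norm_mult norm_power using B1[OF z] by (intro mult_right_mono) auto
    then have "cmod (\<psi> z) powr p \<le> (cmod (G z) ^ m) powr p" using p by (intro powr_mono2) auto
    then show "cmod (\<psi> z) powr p \<le> (cmod (F z))\<^sup>2" using GF[OF z] by simp
  qed
qed

section \<open>Smooth functions and the Cauchy--Pompeiu formula\<close>

definition smooth :: "(complex \<Rightarrow> complex) \<Rightarrow> bool" where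
  "smooth \<phi> \<longleftrightarrow> (\<forall>vs. foldr partial_deriv vs \<phi> differentiable_on UNIV)"

text \<open>For \<open>k = 0\<close> this is the classical flat function. The powers of
  \<open>x\<close> in the denominator close the family under differentiation, up to linear
  combinations.\<close>

definition bump :: "nat \<Rightarrow> real \<Rightarrow> real" where
  "bump k x = (if x > 0 then exp (- (1 / x)) / x ^ k else 0)"

lemma power_le_fact_exp:
  fixes y :: real
  assumes "y \<ge> 0" shows "y ^ n \<le> fact n * exp y"
proof -
  have "(\<Sum>i\<in>{n}. y ^ i /\<^sub>R fact i) \<le> (\<Sum>i. y ^ i /\<^sub>R fact i)"
    by (rule sum_le_suminf) (use assms summable_exp[of y] in auto)
  then show ?thesis by (simp add: exp_def field_simps)
qed

text \<open>From \<open>y ^ n \<le> fact n * exp y\<close> at \<open>y = 1 / x\<close> and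
  \<open>n = k + 2\<close>. Quadratic decay makes the difference quotient at 0 tend to 0.\<close>

lemma bump_le: "\<bar>bump k x\<bar> \<le> fact (k + 2) * x\<^sup>2"
proof (cases "x > 0")
  case True
  have "(1 / x) ^ (k + 2) \<le> fact (k + 2) * exp (1 / x)" by (rule power_le_fact_exp) (use True in simp)
  then have "exp (- (1 / x)) * (1 / x) ^ (k + 2) \<le> exp (- (1 / x)) * (fact (k + 2) * exp (1 / x))"
    by (intro mult_left_mono) auto
  also have "\<dots> = fact (k + 2)" by (simp add: mult.left_commute flip: exp_add)
  finally have "exp (- (1 / x)) * (1 / x) ^ (k + 2) * x\<^sup>2 \<le> fact (k + 2) * x\<^sup>2"
    by (intro mult_right_mono) auto
  also have "exp (- (1 / x)) * (1 / x) ^ (k + 2) * x\<^sup>2 = exp (- (1 / x)) / x ^ k"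
    using True by (simp add: power_one_over power2_eq_square)
  finally show ?thesis using True by (simp add: bump_def)
qed (simp add: bump_def)

lemma has_derivative_bump:
  "(bump k has_real_derivative (bump (k + 2) x - real k * bump (k + 1) x)) (at x)"
proof -
  consider "x > 0" | "x < 0" | "x = 0" by linarith
  then show ?thesis
  proof cases
    case 1
    have "((\<lambda>x. exp (- (1 / x)) / x ^ k) has_real_derivative (bump (k + 2) x - real k * bump (k + 1) x)) (at x)"
    proof -
      have "((\<lambda>x. exp (- (1 / x)) / x ^ k) has_real_derivative
          ((exp (- (1 / x)) * (1 / x\<^sup>2)) * x ^ k - exp (- (1 / x)) * (real k * x ^ (k - 1))) / (x ^ k * x ^ k)) (at x)"
        using 1 by (auto intro!: derivative_eq_intros simp: power2_eq_square)
      also have "((exp (- (1 / x)) * (1 / x\<^sup>2)) * x ^ k - exp (- (1 / x)) * (real k * x ^ (k - 1))) / (x ^ k * x ^ k)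
          = bump (k + 2) x - real k * bump (k + 1) x"
        using 1 by (cases k) (auto simp: bump_def field_simps power2_eq_square)
      finally show ?thesis .
    qed
    then show ?thesis
      by (rule has_field_derivative_transform_within_open[where S="{0<..}"]) (use 1 in \<open>auto simp: bump_def\<close>)
  next
    case 2
    have "((\<lambda>_. 0) has_real_derivative (bump (k + 2) x - real k * bump (k + 1) x)) (at x)"
      using 2 by (auto simp: bump_def)
    then show ?thesis
      by (rule has_field_derivative_transform_within_open[where S="{..<0}"]) (use 2 in \<open>auto simp: bump_def\<close>)
  next
    case 3
    have "((\<lambda>h. bump k h / h) \<longlongrightarrow> 0) (at 0)"
    proof (rule Lim_null_comparison)
      show "\<forall>\<^sub>F h in at 0. norm (bump k h / h) \<le> fact (k + 2) * \<bar>h\<bar>"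
      proof (rule always_eventually, rule allI)
        fix h :: real
        show "norm (bump k h / h) \<le> fact (k + 2) * \<bar>h\<bar>"
        proof (cases "h = 0")
          case False
          have "\<bar>bump k h\<bar> \<le> fact (k + 2) * \<bar>h\<bar> * \<bar>h\<bar>" using bump_le[of k h] by (simp add: power2_eq_square mult.assoc flip: abs_mult)
          then show ?thesis using False by (simp add: abs_divide divide_le_eq)
        qed simp
      qed
      show "((\<lambda>h::real. fact (k + 2) * \<bar>h\<bar>) \<longlongrightarrow> 0) (at 0)"
        by (auto intro!: tendsto_eq_intros)
    qed
    then show ?thesis using 3 by (simp add: DERIV_def bump_def)
  qed
qed

text \<open>\<open>smooth\<close> speaks of all iterated derivatives at once, so its closure under
  products, inverses or exponentials has no direct induction. This class is stable under a single
  differentiation, which then iterates; \<open>base\<close> feeds in functions already known to be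
  smooth.\<close>

inductive smooth_gen :: "(complex \<Rightarrow> complex) \<Rightarrow> bool" where
  base: "smooth f \<Longrightarrow> smooth_gen f"
| const: "smooth_gen (\<lambda>_. c)"
| ident: "smooth_gen (\<lambda>z. z)"
| cnj: "smooth_gen f \<Longrightarrow> smooth_gen (\<lambda>z. cnj (f z))"
| add: "smooth_gen f \<Longrightarrow> smooth_gen g \<Longrightarrow> smooth_gen (\<lambda>z. f z + g z)"
| mult: "smooth_gen f \<Longrightarrow> smooth_gen g \<Longrightarrow> smooth_gen (\<lambda>z. f z * g z)"
| exp: "smooth_gen f \<Longrightarrow> smooth_gen (\<lambda>z. exp (f z))"
| inverse: "smooth_gen f \<Longrightarrow> (\<And>z. f z \<noteq> 0) \<Longrightarrow> smooth_gen (\<lambda>z. inverse (f z))"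
| bump: "smooth_gen f \<Longrightarrow> smooth_gen (\<lambda>z. of_real (bump k (Re (f z))))"

lemma partial_deriv_eq:
  assumes "\<And>z. (f has_derivative f' z) (at z)"
  shows "partial_deriv v f = (\<lambda>z. f' z v)"
proof
  fix z
  show "partial_deriv v f z = f' z v"
    unfolding partial_deriv_def using frechet_derivative_at[OF assms] by metis
qed

text \<open>Each differentiation rule expresses the derivative in a fixed direction through the same
  constructors; the division by \<open>x\<close> in \<open>bump\<close> is absorbed by raising
  \<open>k\<close>.\<close>

lemma smooth_gen_derivative:
  "smooth_gen f \<Longrightarrow> \<exists>f'. (\<forall>z. (f has_derivative f' z) (at z)) \<and> (\<forall>v. smooth_gen (\<lambda>z. f' z v))"
proof (induction rule: smooth_gen.induct)
  case (base f)
  have d: "(f has_derivative frechet_derivative f (at z)) (at z)" for z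
    using base[unfolded smooth_def, rule_format, of "[]"] by (simp add: differentiable_on_def frechet_derivative_works)
  have "smooth (\<lambda>z. frechet_derivative f (at z) v)" for v
    unfolding smooth_def
  proof
    fix vs
    have "(\<lambda>z. frechet_derivative f (at z) v) = partial_deriv v f" by (simp add: partial_deriv_def[abs_def])
    then show "foldr partial_deriv vs (\<lambda>z. frechet_derivative f (at z) v) differentiable_on UNIV"
      using base[unfolded smooth_def, rule_format, of "vs @ [v]"] by simp
  qed
  then show ?case using d by (intro exI[of _ "\<lambda>z. frechet_derivative f (at z)"]) (auto intro: smooth_gen.base)
next
  case (const c)
  show ?case by (intro exI[of _ "\<lambda>z v. 0"]) (auto intro: smooth_gen.const)
next
  case ident
  show ?case by (intro exI[of _ "\<lambda>z v. v"]) (auto intro: smooth_gen.const)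
next
  case (cnj f)
  then obtain f' where f': "\<And>z. (f has_derivative f' z) (at z)" "\<And>v. smooth_gen (\<lambda>z. f' z v)" by blast
  show ?case
    by (intro exI[of _ "\<lambda>z v. cnj (f' z v)"]) (auto intro: smooth_gen.cnj f'(2) has_derivative_cnj[OF f'(1)])
next
  case (add f g)
  then obtain f' g' where f': "\<And>z. (f has_derivative f' z) (at z)" "\<And>v. smooth_gen (\<lambda>z. f' z v)"
     and g': "\<And>z. (g has_derivative g' z) (at z)" "\<And>v. smooth_gen (\<lambda>z. g' z v)" by blast
  show ?case
    by (intro exI[of _ "\<lambda>z v. f' z v + g' z v"]) (auto intro: smooth_gen.add f'(2) g'(2) has_derivative_add[OF f'(1) g'(1)])
next
  case (mult f g)
  then obtain f' g' where f': "\<And>z. (f has_derivative f' z) (at z)" "\<And>v. smooth_gen (\<lambda>z. f' z v)"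
     and g': "\<And>z. (g has_derivative g' z) (at z)" "\<And>v. smooth_gen (\<lambda>z. g' z v)" by blast
  show ?case
    by (intro exI[of _ "\<lambda>z v. f z * g' z v + f' z v * g z"])
       (auto intro!: smooth_gen.add smooth_gen.mult f'(2) g'(2) mult.hyps has_derivative_mult[OF f'(1) g'(1)])
next
  case (exp f)
  then obtain f' where f': "\<And>z. (f has_derivative f' z) (at z)" "\<And>v. smooth_gen (\<lambda>z. f' z v)" by blast
  have "((\<lambda>z. exp (f z)) has_derivative (\<lambda>v. exp (f z) * f' z v)) (at z)" for z
  proof -
    have "(exp has_derivative (*) (exp (f z))) (at (f z))"
      using DERIV_exp[of "f z"] by (simp add: has_field_derivative_def)
    from has_derivative_compose[OF f'(1)[of z] this] show ?thesis .
  qed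
  then show ?case
    by (intro exI[of _ "\<lambda>z v. exp (f z) * f' z v"]) (auto intro!: smooth_gen.mult smooth_gen.exp f'(2) exp.hyps)
next
  case (inverse f)
  then obtain f' where f': "\<And>z. (f has_derivative f' z) (at z)" "\<And>v. smooth_gen (\<lambda>z. f' z v)" by blast
  have "((\<lambda>z. inverse (f z)) has_derivative (\<lambda>v. - (inverse (f z) * f' z v * inverse (f z)))) (at z)" for z
    by (rule Deriv.has_derivative_inverse[OF inverse.hyps(2) f'(1)])
  moreover have "smooth_gen (\<lambda>z. - (inverse (f z) * f' z v * inverse (f z)))" for v
  proof -
    have "smooth_gen (\<lambda>z. (-1) * (inverse (f z) * f' z v * inverse (f z)))"
      by (intro smooth_gen.mult smooth_gen.const smooth_gen.inverse f'(2) inverse.hyps)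
    then show ?thesis by simp
  qed
  ultimately show ?case by (intro exI[of _ "\<lambda>z v. - (inverse (f z) * f' z v * inverse (f z))"]) auto
next
  case (bump f k)
  then obtain f' where f': "\<And>z. (f has_derivative f' z) (at z)" "\<And>v. smooth_gen (\<lambda>z. f' z v)" by blast
  define b where "b x = bump (k + 2) x - real k * bump (k + 1) x" for x
  have "((\<lambda>z. complex_of_real (bump k (Re (f z)))) has_derivative (\<lambda>v. of_real (b (Re (f z)) * Re (f' z v)))) (at z)" for z
  proof -
    have "(bump k has_derivative (*) (b (Re (f z)))) (at (Re (f z)))"
      using has_derivative_bump[of k "Re (f z)"] by (simp add: has_field_derivative_def b_def)
    from has_derivative_compose[OF has_derivative_Re[OF f'(1)[of z]] this]
    show ?thesis by (rule has_derivative_of_real)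
  qed
  moreover have "smooth_gen (\<lambda>z. of_real (b (Re (f z)) * Re (f' z v)))" for v
  proof -
    \<comment> \<open>A plain real part is not among the constructors, so \<open>Re (f' z v)\<close>
      is written as half of \<open>f' z v + cnj (f' z v)\<close>.\<close>
    have "smooth_gen (\<lambda>z. (of_real (bump (k + 2) (Re (f z))) + (- of_nat k) * of_real (bump (k + 1) (Re (f z)))) *
        ((1/2) * (f' z v + cnj (f' z v))))"
      by (intro smooth_gen.mult smooth_gen.add smooth_gen.const smooth_gen.bump smooth_gen.cnj f'(2) bump.hyps)
    moreover have "(of_real (bump (k + 2) (Re (f z))) + (- of_nat k) * of_real (bump (k + 1) (Re (f z)))) * ((1/2) * (f' z v + cnj (f' z v)))
       = of_real (b (Re (f z)) * Re (f' z v))" for z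
      by (simp add: b_def complex_add_cnj)
    ultimately show ?thesis by simp
  qed
  ultimately show ?case by (intro exI[of _ "\<lambda>z v. of_real (b (Re (f z)) * Re (f' z v))"]) auto
qed

lemma smooth_gen_partial_deriv: "smooth_gen f \<Longrightarrow> smooth_gen (partial_deriv v f)"
proof -
  assume "smooth_gen f"
  then obtain f' where f': "\<And>z. (f has_derivative f' z) (at z)" "\<And>v. smooth_gen (\<lambda>z. f' z v)"
    using smooth_gen_derivative by blast
  show ?thesis unfolding partial_deriv_eq[OF f'(1)] by (rule f'(2))
qed

lemma smooth_gen_imp_smooth:
  assumes "smooth_gen f" shows "smooth f"
  unfolding smooth_def
proof
  fix vs
  have "smooth_gen (foldr partial_deriv vs f)"
    by (induction vs) (auto intro: assms smooth_gen_partial_deriv)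
  then obtain f' where "\<And>z. (foldr partial_deriv vs f has_derivative f' z) (at z)"
    using smooth_gen_derivative by blast
  then show "foldr partial_deriv vs f differentiable_on UNIV"
    unfolding differentiable_on_def by (auto intro: differentiableI)
qed

lemma smooth_const: "smooth (\<lambda>_. c)"
  by (rule smooth_gen_imp_smooth[OF smooth_gen.const])
lemma smooth_ident: "smooth (\<lambda>z. z)"
  by (rule smooth_gen_imp_smooth[OF smooth_gen.ident])
lemma smooth_cnj: "smooth f \<Longrightarrow> smooth (\<lambda>z. cnj (f z))"
  by (rule smooth_gen_imp_smooth, intro smooth_gen.cnj smooth_gen.base)
lemma smooth_add: "smooth f \<Longrightarrow> smooth g \<Longrightarrow> smooth (\<lambda>z. f z + g z)"
  by (rule smooth_gen_imp_smooth, intro smooth_gen.add smooth_gen.base)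
lemma smooth_mult: "smooth f \<Longrightarrow> smooth g \<Longrightarrow> smooth (\<lambda>z. f z * g z)"
  by (rule smooth_gen_imp_smooth, intro smooth_gen.mult smooth_gen.base)
lemma smooth_exp: "smooth f \<Longrightarrow> smooth (\<lambda>z. exp (f z))"
  by (rule smooth_gen_imp_smooth, intro smooth_gen.exp smooth_gen.base)
lemma smooth_inverse: "smooth f \<Longrightarrow> (\<And>z. f z \<noteq> 0) \<Longrightarrow> smooth (\<lambda>z. inverse (f z))"
  by (rule smooth_gen_imp_smooth, intro smooth_gen.inverse smooth_gen.base)
lemma smooth_bump: "smooth f \<Longrightarrow> smooth (\<lambda>z. of_real (bump k (Re (f z))))"
  by (rule smooth_gen_imp_smooth, intro smooth_gen.bump smooth_gen.base)
lemma smooth_partial_deriv: "smooth f \<Longrightarrow> smooth (partial_deriv v f)"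
  by (rule smooth_gen_imp_smooth, intro smooth_gen_partial_deriv smooth_gen.base)

lemma smooth_has_derivative:
  assumes "smooth f" shows "(f has_derivative (\<lambda>v. partial_deriv v f z)) (at z)"
  using assms[unfolded smooth_def, rule_format, of "[]"]
  by (simp add: differentiable_on_def frechet_derivative_works partial_deriv_def)

lemma smooth_continuous: "smooth f \<Longrightarrow> continuous_on S f"
  by (intro continuous_at_imp_continuous_on ballI has_derivative_continuous[OF smooth_has_derivative])

lemma dbar_eq:
  assumes "(f has_derivative f') (at z)"
  shows "dbar f z = (f' 1 + \<i> * f' \<i>) / 2"
  using frechet_derivative_at[OF assms] by (simp add: dbar_def partial_deriv_def)

lemma smooth_dbar:
  assumes "smooth f" shows "smooth (dbar f)"
proof -
  have "smooth (\<lambda>z. (1/2) * (partial_deriv 1 f z + \<i> * partial_deriv \<i> f z))"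
    by (intro smooth_mult smooth_add smooth_const smooth_partial_deriv assms)
  then show ?thesis by (simp add: dbar_def[abs_def])
qed

lemma dbar_mult:
  assumes "(f has_derivative f') (at z)" "(g has_derivative g') (at z)"
  shows "dbar (\<lambda>z. f z * g z) z = f z * dbar g z + dbar f z * g z"
  unfolding dbar_eq[OF assms(1)] dbar_eq[OF assms(2)] dbar_eq[OF has_derivative_mult[OF assms]]
  by (simp add: field_simps)

lemma dbar_smooth_mult: "smooth f \<Longrightarrow> smooth g \<Longrightarrow> dbar (\<lambda>z. f z * g z) z = f z * dbar g z + dbar f z * g z"
  by (rule dbar_mult[OF smooth_has_derivative smooth_has_derivative])

lemma dbar_smooth_exp:
  assumes "smooth f" shows "dbar (\<lambda>z. exp (f z)) z = exp (f z) * dbar f z"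
proof -
  have "(exp has_derivative (*) (exp (f z))) (at (f z))"
    using DERIV_exp[of "f z"] by (simp add: has_field_derivative_def)
  note d = has_derivative_compose[OF smooth_has_derivative[OF assms, of z] this]
  show ?thesis
    unfolding dbar_eq[OF d] dbar_eq[OF smooth_has_derivative[OF assms, of z]]
    by (simp add: algebra_simps)
qed

lemma dbar_holomorphic:
  assumes "(f has_field_derivative f') (at z)" shows "dbar f z = 0"
proof -
  have "f' * 1 + \<i> * (f' * \<i>) = 0" by (simp add: algebra_simps)
  then show ?thesis using dbar_eq[OF assms[unfolded has_field_derivative_def]] by simp
qed

section \<open>Test functions and cutoffs\<close>

lemma test_function_iff:
  "test_function \<phi> \<longleftrightarrow> smooth \<phi> \<and> (\<exists>K. compact K \<and> K \<subseteq> unit_disk \<and> (\<forall>z. z \<notin> K \<longrightarrow> \<phi> z = 0))"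
  by (simp add: test_function_def smooth_def)

lemma test_function_mult:
  assumes "smooth f" "test_function \<phi>" shows "test_function (\<lambda>z. f z * \<phi> z)"
  using assms unfolding test_function_iff by (auto intro: smooth_mult)

lemma compact_in_disk:
  assumes "compact K" "K \<subseteq> unit_disk"
  obtains r where "0 < r" "r < 1" "K \<subseteq> cball 0 r"
proof (cases "K = {}")
  case True
  show thesis by (rule that[of "1/2"]) (use True in auto)
next
  case False
  obtain w where w: "w \<in> K" "\<And>z. z \<in> K \<Longrightarrow> cmod z \<le> cmod w"
    using continuous_attains_sup[OF assms(1) False, of cmod] by (auto intro: continuous_intros)
  have "cmod w < 1" using w assms by auto
  show thesis
    by (rule that[of "max (cmod w) (1/2)"]) (use w \<open>cmod w < 1\<close> in \<open>auto simp: le_max_iff_disj\<close>)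
qed

lemma test_function_support:
  assumes "test_function \<phi>"
  obtains r where "0 < r" "r < 1" "\<And>z. r < cmod z \<Longrightarrow> \<phi> z = 0"
proof -
  obtain K where K: "compact K" "K \<subseteq> unit_disk" "\<And>z. z \<notin> K \<Longrightarrow> \<phi> z = 0" using assms unfolding test_function_iff by blast
  obtain r where r: "0 < r" "r < 1" "K \<subseteq> cball 0 r" by (rule compact_in_disk[OF K(1,2)])
  show thesis
  proof (rule that[OF r(1,2)])
    fix z :: complex assume "r < cmod z"
    then have "z \<notin> K" using r(3) by auto
    then show "\<phi> z = 0" by (rule K(3))
  qed
qed

lemma test_functionI:
  assumes "smooth \<phi>" "r < 1" "\<And>z. r < cmod z \<Longrightarrow> \<phi> z = 0"
  shows "test_function \<phi>"
  unfolding test_function_iff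
proof (intro conjI exI[of _ "cball 0 r"] allI impI)
  show "\<phi> z = 0" if "z \<notin> cball 0 r" for z using assms(3) that by auto
qed (use assms in auto)

lemma partial_deriv_zero:
  assumes "\<And>z. r < cmod z \<Longrightarrow> \<phi> z = 0" "r < cmod z"
  shows "partial_deriv v \<phi> z = 0"
proof -
  have "open {z::complex. r < cmod z}" by (intro open_Collect_less continuous_intros)
  have "((\<lambda>_. 0) has_derivative (\<lambda>_. 0)) (at z)" by simp
  then have "(\<phi> has_derivative (\<lambda>_. 0)) (at z)"
    by (rule has_derivative_transform_within_open[OF _ \<open>open {z. r < cmod z}\<close>]) (use assms in auto)
  then show ?thesis by (simp add: partial_deriv_def flip: frechet_derivative_at)
qed

lemma test_function_dbar: "test_function \<phi> \<Longrightarrow> test_function (dbar \<phi>)"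
proof -
  assume t: "test_function \<phi>"
  obtain r where r: "0 < r" "r < 1" "\<And>z. r < cmod z \<Longrightarrow> \<phi> z = 0" by (rule test_function_support[OF t]) blast
  show "test_function (dbar \<phi>)"
    by (rule test_functionI[OF smooth_dbar r(2)]) (use t r(3) partial_deriv_zero[of r \<phi>] in \<open>auto simp: test_function_iff dbar_def\<close>)
qed

text \<open>A quotient \<open>a / (a + b)\<close> of flat functions of the squared modulus:
  \<open>a\<close> vanishes outside radius \<open>R\<close> and \<open>b\<close> inside radius
  \<open>r\<close>, and \<open>r < R\<close> keeps the denominator positive.\<close>

lemma cutoff_exists:
  assumes "0 < r" "r < R" "R < 1"
  obtains \<eta> where "test_function \<eta>" "\<And>z. cmod z \<le> r \<Longrightarrow> \<eta> z = 1" "\<And>z. R < cmod z \<Longrightarrow> \<eta> z = 0" "\<And>z. cmod (\<eta> z) \<le> 1"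
proof -
  define a where "a z = bump 0 (R\<^sup>2 - (cmod z)\<^sup>2)" for z :: complex
  define b where "b z = bump 0 ((cmod z)\<^sup>2 - r\<^sup>2)" for z :: complex
  have nn: "a z \<ge> 0" "b z \<ge> 0" for z by (auto simp: a_def b_def bump_def)
  have "r\<^sup>2 < R\<^sup>2" using assms by (intro power_strict_mono) auto
  then have pos: "a z + b z > 0" for z
    unfolding a_def b_def bump_def by (auto intro: add_pos_nonneg add_nonneg_pos add_pos_pos)
  define \<eta> where "\<eta> z = complex_of_real (a z) * inverse (of_real (a z) + of_real (b z))" for z
  have \<eta>: "\<eta> z = of_real (a z / (a z + b z))" for z by (simp add: \<eta>_def divide_inverse)
  have ne: "complex_of_real (a z) + of_real (b z) \<noteq> 0" for z
    using pos[of z] by (simp only: of_real_eq_0_iff flip: of_real_add)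
  have sq: "(cmod z)\<^sup>2 = Re (z * cnj z)" for z by (metis Re_complex_of_real complex_norm_square)
  have sa: "smooth (\<lambda>z. of_real (a z))"
  proof -
    have "smooth (\<lambda>z. of_real (bump 0 (Re (of_real (R\<^sup>2) + (-1) * (z * cnj z)))))"
      by (intro smooth_bump smooth_add smooth_mult smooth_const smooth_ident smooth_cnj)
    then show ?thesis unfolding a_def sq by simp
  qed
  have sb: "smooth (\<lambda>z. of_real (b z))"
  proof -
    have "smooth (\<lambda>z. of_real (bump 0 (Re (z * cnj z + (- of_real (r\<^sup>2))))))"
      by (intro smooth_bump smooth_add smooth_mult smooth_const smooth_ident smooth_cnj)
    then show ?thesis unfolding b_def sq by simp
  qed
  have s\<eta>: "smooth \<eta>" unfolding \<eta>_def[abs_def] by (intro smooth_mult sa smooth_inverse smooth_add sb ne)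
  have out: "\<eta> z = 0" if "R < cmod z" for z
  proof -
    have "R\<^sup>2 < (cmod z)\<^sup>2" using that assms by (intro power_strict_mono) auto
    then show ?thesis by (simp add: \<eta> a_def bump_def)
  qed
  show thesis
  proof
    show "test_function \<eta>" by (rule test_functionI[OF s\<eta> assms(3) out])
    show "\<eta> z = 1" if "cmod z \<le> r" for z
    proof -
      have "(cmod z)\<^sup>2 \<le> r\<^sup>2" using that by (intro power_mono) auto
      then have "b z = 0" by (simp add: b_def bump_def)
      then show ?thesis using pos[of z] by (simp add: \<eta>)
    qed
    show "cmod (\<eta> z) \<le> 1" for z
    proof -
      have "\<bar>a z / (a z + b z)\<bar> \<le> 1" using nn[of z] pos[of z] by (simp add: abs_divide)
      then show ?thesis unfolding \<eta> norm_of_real .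
    qed
  qed (use out in auto)
qed

section \<open>Integrable kernels and integration by parts in the plane\<close>

lemma emeasure_cball_complex:
  "R \<ge> 0 \<Longrightarrow> emeasure lborel (cball (c::complex) R) = ennreal (unit_ball_vol 2 * R\<^sup>2)"
  by (simp add: emeasure_cball)

text \<open>Radial integrals are estimated by layers of disks: layer \<open>k\<close> costs its
  height times an area proportional to \<open>(r k)\<^sup>2\<close>, and overlaps only enlarge the
  bound.\<close>

lemma nn_integral_dyadic_finite:
  fixes f :: "complex \<Rightarrow> real"
  assumes f: "\<And>w. ennreal (f w) \<le> (\<Sum>k. ennreal (a k) * indicator (cball 0 (r k)) w)"
    and r: "\<And>k. r k \<ge> 0" and a: "\<And>k. a k \<ge> 0" and s: "summable (\<lambda>k. a k * (r k)\<^sup>2)"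
  shows "(\<integral>\<^sup>+w. ennreal (f w) \<partial>lborel) < \<infinity>"
proof -
  have "(\<integral>\<^sup>+w. ennreal (f w) \<partial>lborel) \<le> (\<integral>\<^sup>+w. (\<Sum>k. ennreal (a k) * indicator (cball 0 (r k)) (w::complex)) \<partial>lborel)"
    by (rule nn_integral_mono) (rule f)
  also have "\<dots> = (\<Sum>k. \<integral>\<^sup>+w. ennreal (a k) * indicator (cball 0 (r k)) (w::complex) \<partial>lborel)"
    by (rule nn_integral_suminf) (auto intro!: borel_measurable_times_ennreal borel_measurable_indicator)
  also have "\<dots> = (\<Sum>k. ennreal (unit_ball_vol 2 * (a k * (r k)\<^sup>2)))"
  proof (rule suminf_cong)
    fix k
    have "(\<integral>\<^sup>+w. ennreal (a k) * indicator (cball 0 (r k)) (w::complex) \<partial>lborel) = ennreal (a k) * emeasure lborel (cball (0::complex) (r k))"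
      by (rule nn_integral_cmult_indicator) simp
    also have "\<dots> = ennreal (unit_ball_vol 2 * (a k * (r k)\<^sup>2))"
      using a by (simp add: emeasure_cball_complex[OF r] mult_ac flip: ennreal_mult')
    finally show "(\<integral>\<^sup>+w. ennreal (a k) * indicator (cball 0 (r k)) (w::complex) \<partial>lborel) = ennreal (unit_ball_vol 2 * (a k * (r k)\<^sup>2))" .
  qed
  also have "\<dots> < \<infinity>"
  proof -
    have "(\<Sum>k. ennreal (unit_ball_vol 2 * (a k * (r k)\<^sup>2))) \<noteq> top"
      by (rule ennreal_suminf_neq_top) (use s a in \<open>auto intro: summable_mult\<close>)
    then show ?thesis by (simp add: less_top)
  qed
  finally show ?thesis .
qed

lemma single_le_suminf_indicator:
  fixes a :: "nat \<Rightarrow> real" and w :: complex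
  assumes "x \<le> a k" "cmod w \<le> r k"
  shows "ennreal x \<le> (\<Sum>k. ennreal (a k) * indicator (cball 0 (r k)) w)"
proof -
  have "ennreal x \<le> (\<Sum>k\<in>{k}. ennreal (a k) * indicator (cball 0 (r k)) w)"
    using assms by (simp add: ennreal_leI)
  also have "\<dots> \<le> (\<Sum>k. ennreal (a k) * indicator (cball 0 (r k)) w)"
    by (rule sum_le_suminf) auto
  finally show ?thesis .
qed

text \<open>Between the radii \<open>R / 2 ^ (k + 1)\<close> and \<open>R / 2 ^ k\<close> the value
  is at most \<open>2 ^ (k + 1) / R\<close>, while the area shrinks like \<open>4 ^ k\<close>; the
  products form a geometric series of ratio 1/2.\<close>

lemma integrable_kernel:
  assumes R: "R > 0"
  shows "integrable lborel (\<lambda>w::complex. indicator (cball 0 R) w / cmod w)"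
proof (rule integrableI_nonneg)
  have "(\<integral>\<^sup>+w. ennreal (indicator (cball 0 R) w / cmod w) \<partial>lborel) < \<infinity>"
  proof (rule nn_integral_dyadic_finite[where a="\<lambda>k. 2 ^ (k + 1) / R" and r="\<lambda>k. R / 2 ^ k"])
    fix w :: complex
    show "ennreal (indicator (cball 0 R) w / cmod w) \<le> (\<Sum>k. ennreal (2 ^ (k + 1) / R) * indicator (cball 0 (R / 2 ^ k)) w)"
    proof (cases "w \<noteq> 0 \<and> cmod w \<le> R")
      case True
      then have w: "cmod w > 0" "cmod w \<le> R" by auto
      obtain n where n: "R / cmod w < 2 ^ n" using real_arch_pow[of 2] by auto
      define m where "m = (LEAST n. R / cmod w < 2 ^ n)"
      have m: "R / cmod w < 2 ^ m" unfolding m_def by (rule LeastI[of _ n]) (rule n)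
      have "m \<noteq> 0" using m w by (intro notI) (simp add: field_simps)
      then obtain k where k: "m = Suc k" by (cases m) auto
      then have "\<not> R / cmod w < 2 ^ k" using not_less_Least[of k "\<lambda>n. R / cmod w < 2 ^ n"] by (simp add: m_def)
      then have "cmod w \<le> R / 2 ^ k" using w by (simp add: field_simps)
      moreover have "1 / cmod w \<le> 2 ^ (k + 1) / R" using m w R by (simp add: k field_simps)
      ultimately show ?thesis using w by (intro single_le_suminf_indicator[of _ _ k]) auto
    qed auto
    have "(\<lambda>k. 2 ^ (k + 1) / R * (R / 2 ^ k)\<^sup>2) = (\<lambda>k. 2 * R * (1/2) ^ k)"
      using R by (intro ext) (simp add: field_simps power2_eq_square flip: power_add)
    then show "summable (\<lambda>k. 2 ^ (k + 1) / R * (R / 2 ^ k)\<^sup>2)" by (simp add: summable_mult summable_geometric)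
  qed (use R in auto)
  then show "(\<integral>\<^sup>+w. ennreal (indicator (cball 0 R) w / cmod w) \<partial>lborel) < \<infinity>" .
next
  show "(\<lambda>w::complex. indicator (cball 0 R) w / cmod w) \<in> borel_measurable lborel"
    by (intro borel_measurable_divide borel_measurable_indicator) auto
qed simp

text \<open>Here the rings grow: between the radii \<open>2 ^ (k - 1)\<close> and
  \<open>2 ^ k\<close> the fourth power in the denominator gives the height
  \<open>16 * (1/16) ^ k\<close>, against areas of order \<open>4 ^ k\<close>.\<close>

lemma integrable_plane_weight: "integrable lborel (\<lambda>w::complex. 1 / (1 + (cmod w)\<^sup>2)\<^sup>2)"
proof (rule integrableI_nonneg)
  have pos: "0 < (1 + (cmod w)\<^sup>2)\<^sup>2" for w by (intro zero_less_power add_pos_nonneg) auto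
  have [simp]: "1 + (cmod w)\<^sup>2 \<noteq> 0" for w using pos[of w] by auto
  show "(\<integral>\<^sup>+w. ennreal (1 / (1 + (cmod w)\<^sup>2)\<^sup>2) \<partial>lborel) < \<infinity>"
  proof (rule nn_integral_dyadic_finite[where a="\<lambda>k. 16 * (1/16) ^ k" and r="\<lambda>k. 2 ^ k"])
    fix w :: complex
    obtain n where n: "cmod w < 2 ^ n" using real_arch_pow[of 2] by auto
    define k where "k = (LEAST n. cmod w \<le> 2 ^ n)"
    have k: "cmod w \<le> 2 ^ k" unfolding k_def by (rule LeastI[of _ n]) (use n in simp)
    have "1 / (1 + (cmod w)\<^sup>2)\<^sup>2 \<le> 16 * (1/16) ^ k"
    proof (cases k)
      case 0
      have "1 / (1 + (cmod w)\<^sup>2)\<^sup>2 \<le> 1 / 1" by (intro divide_left_mono one_le_power) (simp_all add: pos)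
      also have "1 / 1 \<le> 16 * (1/16::real) ^ k" using 0 by simp
      finally show ?thesis .
    next
      case (Suc j)
      then have "\<not> cmod w \<le> 2 ^ j" using not_less_Least[of j "\<lambda>n. cmod w \<le> 2 ^ n"] by (simp add: k_def)
      then have "(2 ^ j) ^ 4 \<le> cmod w ^ 4" by (intro power_mono) auto
      also have "cmod w ^ 4 = ((cmod w)\<^sup>2)\<^sup>2" by simp
      also have "\<dots> \<le> (1 + (cmod w)\<^sup>2)\<^sup>2" by (intro power_mono) auto
      finally have "16 ^ j \<le> (1 + (cmod w)\<^sup>2)\<^sup>2" by (simp flip: power_mult add: mult.commute[of j]) (simp add: power_mult)
      then have "1 / (1 + (cmod w)\<^sup>2)\<^sup>2 \<le> 1 / 16 ^ j" by (intro divide_left_mono) (simp_all add: pos)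
      then show ?thesis using Suc by (simp add: power_one_over)
    qed
    then show "ennreal (1 / (1 + (cmod w)\<^sup>2)\<^sup>2) \<le> (\<Sum>k. ennreal (16 * (1/16) ^ k) * indicator (cball 0 (2 ^ k)) w)"
      using k by (intro single_le_suminf_indicator[of _ _ k]) auto
    have "(\<lambda>k. 16 * (1/16) ^ k * (2 ^ k)\<^sup>2) = (\<lambda>k. 16 * (1/4::real) ^ k)"
    proof
      fix k
      have "(2 ^ k)\<^sup>2 = (4::real) ^ k" by (simp add: power2_eq_square flip: power_mult_distrib)
      then show "16 * (1/16) ^ k * (2 ^ k)\<^sup>2 = 16 * (1/4::real) ^ k" by (simp flip: power_mult_distrib)
    qed
    then show "summable (\<lambda>k. 16 * (1/16) ^ k * (2 ^ k)\<^sup>2 :: real)" by (simp add: summable_mult summable_geometric)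
  qed auto
next
  show "(\<lambda>w::complex. 1 / (1 + (cmod w)\<^sup>2)\<^sup>2) \<in> borel_measurable lborel" by measurable
qed simp

text \<open>The value is pi. It is the total mass of the approximate identity behind the
  Cauchy-Pompeiu formula, and it enters the argument in that role.\<close>

definition cauchy_const :: real where
  "cauchy_const = (\<integral>w. 1 / (1 + (cmod w)\<^sup>2)\<^sup>2 \<partial>lborel)"

lemma cauchy_const_pos: "cauchy_const > 0"
proof -
  have "cauchy_const \<ge> 0" unfolding cauchy_const_def by (rule integral_nonneg_AE) auto
  moreover have "cauchy_const \<noteq> 0"
  proof
    assume "cauchy_const = 0"
    then have "AE w::complex in lborel. 1 / (1 + (cmod w)\<^sup>2)\<^sup>2 = 0"
      unfolding cauchy_const_def by (subst (asm) integral_nonneg_eq_0_iff_AE[OF integrable_plane_weight]) auto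
    moreover have "1 / (1 + (cmod w)\<^sup>2)\<^sup>2 \<noteq> 0" for w
    proof -
      have "0 < 1 / (1 + (cmod w)\<^sup>2)\<^sup>2" by (intro divide_pos_pos zero_less_power add_pos_nonneg) auto
      then show ?thesis by linarith
    qed
    ultimately have "AE w::complex in lborel. False" by simp
    then have "ae_filter (lborel :: complex measure) = bot" by (simp add: eventually_False)
    then show False by (simp add: ae_filter_eq_bot_iff emeasure_lborel_UNIV)
  qed
  ultimately show ?thesis by simp
qed

lemma lborel_integral_affine:
  fixes f :: "complex \<Rightarrow> complex"
  assumes f: "f \<in> borel_measurable borel" and c: "c \<noteq> 0"
  shows "integral\<^sup>L lborel f = \<bar>c\<bar>\<^sup>2 *\<^sub>R (\<integral>x. f (t + c *\<^sub>R x) \<partial>lborel)"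
proof -
  have "integral\<^sup>L lborel f = integral\<^sup>L (density (distr lborel borel (\<lambda>x. t + c *\<^sub>R x)) (\<lambda>_. ennreal (\<bar>c\<bar>^2))) f"
    by (subst lborel_affine[OF c, of t]) (simp add: ennreal_power)
  also have "\<dots> = (\<integral>x. \<bar>c\<bar>\<^sup>2 *\<^sub>R f x \<partial>distr lborel borel (\<lambda>x. t + c *\<^sub>R x))"
    by (rule integral_density) (use f in auto)
  also have "\<dots> = \<bar>c\<bar>\<^sup>2 *\<^sub>R (\<integral>x. f x \<partial>distr lborel borel (\<lambda>x. t + c *\<^sub>R x))"
    by simp
  also have "(\<integral>x. f x \<partial>distr lborel borel (\<lambda>x. t + c *\<^sub>R x)) = (\<integral>x. f (t + c *\<^sub>R x) \<partial>lborel)"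
    by (rule integral_distr) (use f in auto)
  finally show ?thesis .
qed

lemma integrable_bounded_support:
  fixes f :: "complex \<Rightarrow> complex"
  assumes "f \<in> borel_measurable borel" "\<And>z. cmod (f z) \<le> B" "\<And>z. R < cmod z \<Longrightarrow> f z = 0"
  shows "integrable lborel f"
proof (rule Bochner_Integration.integrable_bound)
  have "emeasure lborel (cball (0::complex) R) < \<infinity>" by (rule emeasure_lborel_cball_finite)
  then show "integrable lborel (\<lambda>z::complex. B * indicator (cball 0 R) z)" by (intro integrable_mult_right integrable_real_indicator) auto
  show "AE z in lborel. norm (f z) \<le> norm (B * indicator (cball 0 R) z)"
  proof (rule AE_I2)
    fix z
    have "0 \<le> B" using assms(2)[of 0] norm_ge_zero order_trans by blast
    then show "norm (f z) \<le> norm (B * indicator (cball 0 R) z)" using assms(2,3)[of z] by (cases "cmod z \<le> R") auto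
  qed
qed (use assms in auto)

text \<open>Lebesgue measure is invariant under translation, so every difference quotient of
  \<open>F\<close> in direction \<open>v\<close> integrates to 0. The quotients are bounded by the
  Lipschitz constant \<open>B\<close> and live in a common disk, so the limit may be taken under the
  integral.\<close>

lemma integral_directional_derivative_zero:
  fixes F :: "complex \<Rightarrow> complex"
  assumes d: "\<And>z. (F has_derivative F' z) (at z)"
    and B: "\<And>z w. cmod (F' z w) \<le> B * cmod w"
    and R: "\<And>z. R < cmod z \<Longrightarrow> F z = 0" and v: "cmod v = 1"
  shows "integrable lborel (\<lambda>z. F' z v)" "(\<integral>z. F' z v \<partial>lborel) = 0"
proof -
  have contF: "continuous_on UNIV F"
    by (intro continuous_at_imp_continuous_on ballI has_derivative_continuous[OF d])
  then have mF [measurable]: "F \<in> borel_measurable borel" by (rule borel_measurable_continuous_onI)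
  have B0: "B \<ge> 0" using B[of 0 1] norm_ge_zero[of "F' 0 1"] by (simp del: norm_ge_zero)
  have lip: "cmod (F x - F y) \<le> B * cmod (x - y)" for x y
  proof (rule differentiable_bound[of UNIV F F'])
    show "onorm (F' z) \<le> B" for z by (rule onorm_bound) (use B B0 in \<open>auto simp: mult.commute\<close>)
  qed (use d in auto)
  have bF: "\<exists>C. \<forall>z. cmod (F z) \<le> C"
  proof -
    have "bounded (F ` cball 0 R)" by (intro compact_imp_bounded compact_continuous_image continuous_on_subset[OF contF]) auto
    then obtain C where C: "\<And>z. z \<in> cball 0 R \<Longrightarrow> cmod (F z) \<le> C" unfolding bounded_iff by blast
    have "cmod (F z) \<le> max C 0" for z using C[of z] R[of z] by (cases "cmod z \<le> R") (auto simp: le_max_iff_disj)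
    then show ?thesis by blast
  qed
  then obtain C where C: "\<And>z. cmod (F z) \<le> C" by blast
  define h where "h n = 1 / real (Suc n)" for n
  have h: "0 < h n" "h n \<le> 1" for n by (auto simp: h_def)
  have hl: "h \<longlonglongrightarrow> 0" unfolding h_def[abs_def] using LIMSEQ_inverse_real_of_nat by (simp add: inverse_eq_divide)
  define Q where "Q n z = (F (z + of_real (h n) * v) - F z) / of_real (h n)" for n z
  have mQ [measurable]: "Q n \<in> borel_measurable borel" for n unfolding Q_def[abs_def] by measurable
  have Qlim: "(\<lambda>n. Q n z) \<longlonglongrightarrow> F' z v" for z
  proof -
    have lin: "F' z (of_real (h n) * v) = of_real (h n) * F' z v" for n
      using linear_scale[OF has_derivative_linear[OF d[of z]], of "h n" v] by (simp add: scaleR_conv_of_real)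
    have "((\<lambda>w. norm (F (z + w) - F z - F' z w) / norm w) \<longlongrightarrow> 0) (at 0)"
      using d[of z] unfolding has_derivative_at by blast
    moreover have "filterlim (\<lambda>n. of_real (h n) * v) (at 0) sequentially"
      unfolding filterlim_at
    proof (intro conjI always_eventually allI)
      have "(\<lambda>n. of_real (h n) * v) \<longlonglongrightarrow> of_real 0 * v" by (intro tendsto_intros hl)
      then show "(\<lambda>n. of_real (h n) * v) \<longlonglongrightarrow> 0" by simp
      show "of_real (h n) * v \<noteq> 0" for n using h(1)[of n] v by auto
    qed simp
    ultimately have "(\<lambda>n. norm (F (z + of_real (h n) * v) - F z - F' z (of_real (h n) * v)) / norm (of_real (h n) * v)) \<longlonglongrightarrow> 0"
      by (rule filterlim_compose)
    moreover have "norm (F (z + of_real (h n) * v) - F z - F' z (of_real (h n) * v)) / norm (of_real (h n) * v) = norm (Q n z - F' z v)" for n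
    proof -
      have "Q n z - F' z v = (F (z + of_real (h n) * v) - F z - F' z (of_real (h n) * v)) / of_real (h n)"
        using h(1)[of n] unfolding lin Q_def by (simp add: field_simps)
      then show ?thesis using h(1)[of n] v by (simp add: norm_divide norm_mult)
    qed
    ultimately have "(\<lambda>n. Q n z - F' z v) \<longlonglongrightarrow> 0" by (simp add: tendsto_norm_zero_iff)
    then show ?thesis by (simp add: LIM_zero_iff)
  qed
  have mF' [measurable]: "(\<lambda>z. F' z v) \<in> borel_measurable borel" by (rule borel_measurable_LIMSEQ_metric[OF mQ Qlim])
  \<comment> \<open>The steps \<open>h n \<le> 1\<close> shift the support by at most 1, hence the
    radius \<open>R + 1\<close> here and in the dominating function.\<close>
  have F'0: "F' z v = 0" if "R + 1 < cmod z" for z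
  proof -
    have "F (z + of_real (h n) * v) = 0" for n
    proof (rule R)
      have "cmod z - h n \<le> cmod (z + of_real (h n) * v)"
        using norm_triangle_ineq4[of "z + of_real (h n) * v" "of_real (h n) * v"] h(1)[of n] v by (simp add: norm_mult)
      then show "R < cmod (z + of_real (h n) * v)" using that h(2)[of n] by linarith
    qed
    moreover have "F z = 0" using R that by simp
    ultimately have "Q n z = 0" for n by (simp add: Q_def)
    then show ?thesis using LIMSEQ_unique[OF Qlim[of z]] by simp
  qed
  show "integrable lborel (\<lambda>z. F' z v)"
    by (rule integrable_bounded_support[where B=B and R="R+1"]) (use B[of _ v] v F'0 in auto)
  have Q0: "integral\<^sup>L lborel (Q n) = 0" for n
  proof -
    have i1: "integrable lborel F" by (rule integrable_bounded_support[where B=C and R=R]) (use C R in auto)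
    have i2: "integrable lborel (\<lambda>z. F (z + of_real (h n) * v))"
    proof (rule integrable_bounded_support[where B=C and R="R+1"])
      fix z :: complex assume "R + 1 < cmod z"
      moreover have "cmod z - h n \<le> cmod (z + of_real (h n) * v)"
        using norm_triangle_ineq4[of "z + of_real (h n) * v" "of_real (h n) * v"] h(1)[of n] v by (simp add: norm_mult)
      ultimately show "F (z + of_real (h n) * v) = 0" using h(2)[of n] by (intro R) linarith
    qed (use C in auto)
    have "integral\<^sup>L lborel F = (\<integral>z. F (z + of_real (h n) * v) \<partial>lborel)"
      using lborel_integral_affine[OF mF, of 1 "of_real (h n) * v"] by (simp add: add.commute)
    then show ?thesis unfolding Q_def[abs_def] using i1 i2 by simp
  qed
  have "(\<lambda>n. integral\<^sup>L lborel (Q n)) \<longlonglongrightarrow> (\<integral>z. F' z v \<partial>lborel)"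
  proof (rule integral_dominated_convergence[where w="\<lambda>z. B * indicator (cball 0 (R + 1)) z"])
    have "emeasure lborel (cball (0::complex) (R+1)) < \<infinity>" by (rule emeasure_lborel_cball_finite)
    then show "integrable lborel (\<lambda>z::complex. B * indicator (cball 0 (R + 1)) z)" by (intro integrable_mult_right integrable_real_indicator) auto
    show "AE z in lborel. norm (Q n z) \<le> B * indicator (cball 0 (R + 1)) z" for n
    proof (rule AE_I2)
      fix z
      show "norm (Q n z) \<le> B * indicator (cball 0 (R + 1)) z"
      proof (cases "cmod z \<le> R + 1")
        case True
        have "cmod (F (z + of_real (h n) * v) - F z) \<le> B * h n" using lip[of "z + of_real (h n) * v" z] h(1)[of n] v by (simp add: norm_mult)
        then show ?thesis using True h(1)[of n] by (simp add: Q_def norm_divide divide_le_eq)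
      next
        case False
        have "cmod z - h n \<le> cmod (z + of_real (h n) * v)"
          using norm_triangle_ineq4[of "z + of_real (h n) * v" "of_real (h n) * v"] h(1)[of n] v by (simp add: norm_mult)
        then have "F (z + of_real (h n) * v) = 0" using False h(2)[of n] by (intro R) linarith
        moreover have "F z = 0" using False by (intro R) linarith
        ultimately show ?thesis using False by (simp add: Q_def)
      qed
    qed
  qed (use Qlim in auto)
  then show "(\<integral>z. F' z v \<partial>lborel) = 0" using LIMSEQ_unique[of "\<lambda>n. integral\<^sup>L lborel (Q n)" _ 0] by (simp add: Q0)
qed

lemma integral_dbar_zero:
  fixes F :: "complex \<Rightarrow> complex"
  assumes d: "\<And>z. (F has_derivative F' z) (at z)"
    and B: "\<And>z w. cmod (F' z w) \<le> B * cmod w" and R: "\<And>z. R < cmod z \<Longrightarrow> F z = 0"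
  shows "integrable lborel (dbar F)" "(\<integral>z. dbar F z \<partial>lborel) = 0"
proof -
  have i: "integrable lborel (\<lambda>z. F' z 1)" "integrable lborel (\<lambda>z. F' z \<i>)" "(\<integral>z. F' z 1 \<partial>lborel) = 0" "(\<integral>z. F' z \<i> \<partial>lborel) = 0"
    using integral_directional_derivative_zero[of F F' B R] d B R by auto
  have e: "dbar F = (\<lambda>z. (F' z 1 + \<i> * F' z \<i>) / 2)" using dbar_eq[OF d] by blast
  show "integrable lborel (dbar F)" unfolding e using i by simp
  show "(\<integral>z. dbar F z \<partial>lborel) = 0" unfolding e using i by simp
qed

lemma partial_deriv_decompose:
  assumes "smooth \<psi>"
  shows "partial_deriv v \<psi> z = of_real (Re v) * partial_deriv 1 \<psi> z + of_real (Im v) * partial_deriv \<i> \<psi> z"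
proof -
  have lin: "linear (\<lambda>v. partial_deriv v \<psi> z)" using smooth_has_derivative[OF assms] by (rule has_derivative_linear)
  have "v = Re v *\<^sub>R 1 + Im v *\<^sub>R \<i>" by (simp add: complex_eq_iff)
  then have "partial_deriv v \<psi> z = partial_deriv (Re v *\<^sub>R 1 + Im v *\<^sub>R \<i>) \<psi> z" by simp
  also have "\<dots> = Re v *\<^sub>R partial_deriv 1 \<psi> z + Im v *\<^sub>R partial_deriv \<i> \<psi> z"
    using linear_add[OF lin] linear_scale[OF lin] by simp
  finally show ?thesis by (simp add: scaleR_conv_of_real)
qed

lemma continuous_compact_support_bounded:
  fixes f :: "complex \<Rightarrow> complex"
  assumes "continuous_on UNIV f" "\<And>z. R < cmod z \<Longrightarrow> f z = 0"
  obtains C where "C \<ge> 0" "\<And>z. cmod (f z) \<le> C"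
proof -
  have "bounded (f ` cball 0 R)" by (intro compact_imp_bounded compact_continuous_image continuous_on_subset[OF assms(1)]) auto
  then obtain C where C: "\<And>z. z \<in> cball 0 R \<Longrightarrow> cmod (f z) \<le> C" unfolding bounded_iff by blast
  have "cmod (f z) \<le> max C 0" for z using C[of z] assms(2)[of z] by (cases "cmod z \<le> R") (auto simp: le_max_iff_disj)
  then show thesis by (intro that[of "max C 0"]) auto
qed

lemma smooth_compact_support_derivative_bound:
  assumes s: "smooth \<psi>" and z: "\<And>z. R < cmod z \<Longrightarrow> \<psi> z = 0"
  obtains B where "B \<ge> 0" "\<And>z v. cmod (partial_deriv v \<psi> z) \<le> B * cmod v"
proof -
  obtain B1 where B1: "B1 \<ge> 0" "\<And>z. cmod (partial_deriv 1 \<psi> z) \<le> B1"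
    using continuous_compact_support_bounded[of "partial_deriv 1 \<psi>" R] smooth_continuous[OF smooth_partial_deriv[OF s]] partial_deriv_zero[of R \<psi>] z
    by blast
  obtain B2 where B2: "B2 \<ge> 0" "\<And>z. cmod (partial_deriv \<i> \<psi> z) \<le> B2"
    using continuous_compact_support_bounded[of "partial_deriv \<i> \<psi>" R] smooth_continuous[OF smooth_partial_deriv[OF s]] partial_deriv_zero[of R \<psi>] z
    by blast
  show thesis
  proof (rule that[of "B1 + B2"])
    fix z v
    have "cmod (partial_deriv v \<psi> z) \<le> cmod (of_real (Re v) * partial_deriv 1 \<psi> z) + cmod (of_real (Im v) * partial_deriv \<i> \<psi> z)"
      unfolding partial_deriv_decompose[OF s, of v] by (rule norm_triangle_ineq)
    also have "\<dots> \<le> cmod v * B1 + cmod v * B2"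
      unfolding norm_mult norm_of_real using B1 B2 abs_Re_le_cmod abs_Im_le_cmod by (intro add_mono mult_mono) auto
    finally show "cmod (partial_deriv v \<psi> z) \<le> (B1 + B2) * cmod v" by (simp add: algebra_simps)
  qed (use B1 B2 in auto)
qed

lemma smooth_measurable: "smooth f \<Longrightarrow> f \<in> borel_measurable borel"
  by (intro borel_measurable_continuous_onI smooth_continuous)

text \<open>The regularised kernel \<open>cnj w / (cmod w^2 + d^2)\<close> is smooth and has \<open>dbar\<close>-derivative
  \<open>d^2 / (cmod w^2 + d^2)^2\<close>, an approximate identity up to the factor \<open>cauchy_const\<close>.\<close>

definition reg_kernel :: "real \<Rightarrow> complex \<Rightarrow> complex" where
  "reg_kernel d w = cnj w * inverse (w * cnj w + of_real (d\<^sup>2))"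

lemma reg_kernel_denominator:
  assumes "d > 0" shows "w * cnj w + of_real (d\<^sup>2) = of_real ((cmod w)\<^sup>2 + d\<^sup>2)" "w * cnj w + of_real (d\<^sup>2) \<noteq> 0"
proof -
  show e: "w * cnj w + of_real (d\<^sup>2) = of_real ((cmod w)\<^sup>2 + d\<^sup>2)" using complex_norm_square[of w] by simp
  have "(cmod w)\<^sup>2 + d\<^sup>2 > 0" using assms by (intro add_nonneg_pos) auto
  then show "w * cnj w + of_real (d\<^sup>2) \<noteq> 0" unfolding e of_real_eq_0_iff by linarith
qed

lemma smooth_reg_kernel: "d > 0 \<Longrightarrow> smooth (reg_kernel d)"
  unfolding reg_kernel_def[abs_def]
  by (intro smooth_mult smooth_inverse smooth_add smooth_cnj smooth_ident smooth_const reg_kernel_denominator(2))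

lemma dbar_reg_kernel:
  assumes "d > 0" shows "dbar (reg_kernel d) w = of_real (d\<^sup>2 / ((cmod w)\<^sup>2 + d\<^sup>2)\<^sup>2)"
proof -
  define q where "q = w * cnj w + of_real (d\<^sup>2)"
  have q: "q \<noteq> 0" "q = of_real ((cmod w)\<^sup>2 + d\<^sup>2)" unfolding q_def using reg_kernel_denominator[OF assms, of w] by auto
  have c: "(cnj has_derivative cnj) (at w)" by (rule bounded_linear_imp_has_derivative[OF bounded_linear_cnj])
  have d1: "((\<lambda>w. w * cnj w + of_real (d\<^sup>2)) has_derivative (\<lambda>v. w * cnj v + v * cnj w)) (at w)"
    by (auto intro!: derivative_eq_intros c)
  have "(reg_kernel d has_derivative (\<lambda>v. cnj w * (- (inverse q * (w * cnj v + v * cnj w) * inverse q)) + cnj v * inverse q)) (at w)"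
    unfolding reg_kernel_def[abs_def] q_def
    by (rule has_derivative_mult[OF c Deriv.has_derivative_inverse[OF reg_kernel_denominator(2)[OF assms] d1]])
  then have "dbar (reg_kernel d) w = inverse q - w * cnj w * inverse q * inverse q"
    by (subst dbar_eq) (auto simp: algebra_simps diff_divide_distrib)
  also have "\<dots> = (q - w * cnj w) / q\<^sup>2" using q(1) by (simp add: field_simps power2_eq_square)
  also have "q - w * cnj w = of_real (d\<^sup>2)" by (simp add: q_def)
  finally show ?thesis by (simp add: q(2))
qed

lemma cmod_reg_kernel_le:
  assumes "d > 0" shows "cmod (reg_kernel d w) \<le> 1 / cmod w"
proof (cases "w = 0")
  case False
  have "cmod (reg_kernel d w) = cmod w / ((cmod w)\<^sup>2 + d\<^sup>2)"
    unfolding reg_kernel_def reg_kernel_denominator(1)[OF assms]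
    by (simp add: norm_mult norm_inverse divide_inverse del: of_real_add of_real_power)
  also have "\<dots> \<le> cmod w / (cmod w)\<^sup>2" using False by (intro divide_left_mono) (auto intro!: mult_pos_pos add_pos_nonneg)
  finally show ?thesis using False by (simp add: power2_eq_square)
qed (simp add: reg_kernel_def)

text \<open>By the inequality of arithmetic and geometric means. The bound \<open>1 / cmod w\<close>
  is uniform in \<open>d\<close> and dominates the limit \<open>d\<close> to 0; the present one is
  uniform in \<open>w\<close> and keeps integrands bounded for fixed \<open>d\<close>.\<close>

lemma cmod_reg_kernel_le_const:
  assumes "d > 0" shows "cmod (reg_kernel d w) \<le> 1 / d"
proof -
  have pos: "(cmod w)\<^sup>2 + d\<^sup>2 > 0" using assms by (intro add_nonneg_pos) auto
  have "cmod (reg_kernel d w) = cmod w / ((cmod w)\<^sup>2 + d\<^sup>2)"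
    unfolding reg_kernel_def reg_kernel_denominator(1)[OF assms]
    by (simp add: norm_mult norm_inverse divide_inverse del: of_real_add of_real_power)
  also have "\<dots> \<le> 1 / d"
  proof -
    have "0 \<le> (cmod w - d)\<^sup>2" by simp
    then have "2 * (cmod w * d) \<le> (cmod w)\<^sup>2 + d\<^sup>2" by (simp add: power2_eq_square algebra_simps)
    moreover have "0 \<le> cmod w * d" using assms by simp
    ultimately have "cmod w * d \<le> (cmod w)\<^sup>2 + d\<^sup>2" by linarith
    then show ?thesis using pos assms by (simp add: field_simps)
  qed
  finally show ?thesis .
qed

lemma reg_kernel_tendsto:
  assumes "\<And>n. 0 < d n" "d \<longlonglongrightarrow> 0"
  shows "(\<lambda>n. reg_kernel (d n) w) \<longlonglongrightarrow> 1 / w"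
proof (cases "w = 0")
  case False
  have "(\<lambda>n. reg_kernel (d n) w) \<longlonglongrightarrow> cnj w * inverse (w * cnj w + of_real (0\<^sup>2))"
    unfolding reg_kernel_def by (intro tendsto_intros assms) (use False in auto)
  then show ?thesis using False by (simp add: field_simps)
qed (simp add: reg_kernel_def)

definition dseq :: "nat \<Rightarrow> real" where "dseq n = 1 / real (Suc n)"

lemma dseq: "0 < dseq n" "dseq n \<le> 1" "dseq \<longlonglongrightarrow> 0"
  using LIMSEQ_inverse_real_of_nat by (auto simp: dseq_def[abs_def] inverse_eq_divide)

lemma reflect_support:
  assumes "\<And>z. R < cmod z \<Longrightarrow> f z = 0" "cmod z + R < cmod w" shows "f (z - w) = 0"
  using assms(2) norm_triangle_ineq4[of z "z - w"] by (intro assms(1)) simp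

lemma kernel_dominator:
  fixes f :: "complex \<Rightarrow> complex"
  assumes "\<And>z. cmod (f z) \<le> C" "\<And>w. S < cmod w \<Longrightarrow> f w = 0" "cmod k \<le> 1 / cmod w"
  shows "cmod (f w * k) \<le> C * (indicator (cball 0 S) w / cmod w)"
proof (cases "cmod w \<le> S")
  case True
  have "cmod (f w) * cmod k \<le> C * (1 / cmod w)" using assms(1)[of w] assms(3) by (intro mult_mono) (auto intro: order_trans[OF norm_ge_zero])
  then show ?thesis using True by (simp add: norm_mult)
qed (use assms(2)[of w] in auto)

text \<open>The integral of \<open>dbar\<close> of \<open>\<psi> (z - w) * reg_kernel d w\<close>
  vanishes. Leibniz's rule splits it into the wanted integral and one against the approximate
  identity \<open>dbar (reg_kernel d)\<close>. As \<open>d\<close> tends to 0, one side acquires the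
  kernel \<open>1 / w\<close> and the other the value at \<open>z\<close>.\<close>

lemma cauchy_pompeiu:
  fixes \<psi> :: "complex \<Rightarrow> complex"
  assumes s: "smooth \<psi>" and R: "\<And>z. R < cmod z \<Longrightarrow> \<psi> z = 0" "R \<ge> 0"
  shows "(\<integral>w. dbar \<psi> (z - w) / w \<partial>lborel) = of_real cauchy_const * \<psi> z"
proof -
  define S where "S = cmod z + R + 1"
  have S: "S > 0" using R(2) norm_ge_zero[of z] by (simp add: S_def del: norm_ge_zero)
  have sr: "smooth (\<lambda>w. \<psi> (z - w))"
  proof -
    have "smooth_gen (\<lambda>w. \<psi> (z - w))" if "smooth \<psi>" for \<psi>
    proof -
      \<comment> \<open>Reflection changes an iterated derivative by one sign per direction, so
        smoothness is checked on the list of directions.\<close>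
      have fold: "foldr partial_deriv vs (\<lambda>w. \<psi> (z - w)) = (\<lambda>w. (-1) ^ length vs * foldr partial_deriv vs \<psi> (z - w))" for vs
      proof (induction vs)
        case (Cons v vs)
        have sm: "smooth (foldr partial_deriv vs \<psi>)" for vs by (induction vs) (auto intro: smooth_partial_deriv that)
        have d: "((\<lambda>w. (-1) ^ length vs * foldr partial_deriv vs \<psi> (z - w)) has_derivative
            (\<lambda>v. (-1) ^ length vs * partial_deriv (- v) (foldr partial_deriv vs \<psi>) (z - w))) (at w)" for w
        proof -
          have "((\<lambda>w. z - w) has_derivative (\<lambda>v. - v)) (at w)" by (auto intro!: derivative_eq_intros)
          from has_derivative_compose[OF this smooth_has_derivative[OF sm, of vs "z - w"]]
          show ?thesis by (rule has_derivative_mult_right)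
        qed
        have neg: "partial_deriv (- v) (foldr partial_deriv vs \<psi>) x = - partial_deriv v (foldr partial_deriv vs \<psi>) x" for x
          using partial_deriv_decompose[OF sm[of vs], of "- v" x] partial_deriv_decompose[OF sm[of vs], of v x] by simp
        show ?case by (simp add: Cons.IH partial_deriv_eq[OF d] neg)
      qed simp
      have "smooth (\<lambda>w. \<psi> (z - w))"
        unfolding smooth_def fold
      proof
        fix vs
        have sm: "smooth (foldr partial_deriv vs \<psi>)" by (induction vs) (auto intro: smooth_partial_deriv that)
        have "((\<lambda>w. (-1) ^ length vs * foldr partial_deriv vs \<psi> (z - w)) has_derivative
            (\<lambda>v. (-1) ^ length vs * partial_deriv (- v) (foldr partial_deriv vs \<psi>) (z - w))) (at w)" for w
        proof -
          have "((\<lambda>w. z - w) has_derivative (\<lambda>v. - v)) (at w)" by (auto intro!: derivative_eq_intros)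
          from has_derivative_compose[OF this smooth_has_derivative[OF sm, of "z - w"]]
          show ?thesis by (rule has_derivative_mult_right)
        qed
        then show "(\<lambda>w. (-1) ^ length vs * foldr partial_deriv vs \<psi> (z - w)) differentiable_on UNIV"
          unfolding differentiable_on_def using differentiableI by blast
      qed
      then show ?thesis by (rule smooth_gen.base)
    qed
    then show ?thesis using s smooth_gen_imp_smooth by blast
  qed
  have dr: "dbar (\<lambda>w. \<psi> (z - w)) w = - dbar \<psi> (z - w)" for w
  proof -
    have "((\<lambda>w. z - w) has_derivative (\<lambda>v. - v)) (at w)" by (auto intro!: derivative_eq_intros)
    from dbar_eq[OF has_derivative_compose[OF this smooth_has_derivative[OF s, of "z - w"]]]
    show ?thesis using partial_deriv_decompose[OF s, of "-1" "z - w"] partial_deriv_decompose[OF s, of "-\<i>" "z - w"]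
      by (simp add: dbar_def field_simps)
  qed
  have sup: "\<psi> (z - w) = 0" "dbar \<psi> (z - w) = 0" if "S < cmod w" for w
  proof -
    have w: "cmod z + R < cmod w" using that by (simp add: S_def)
    show "\<psi> (z - w) = 0" by (rule reflect_support[OF R(1) w])
    have "dbar \<psi> x = 0" if "R < cmod x" for x using partial_deriv_zero[of R \<psi> x] R that by (simp add: dbar_def)
    then show "dbar \<psi> (z - w) = 0" by (rule reflect_support[OF _ w])
  qed
  obtain C where C: "C \<ge> 0" "\<And>x. cmod (\<psi> x) \<le> C"
    using continuous_compact_support_bounded[OF smooth_continuous[OF s] R(1)] by blast
  obtain C' where C': "C' \<ge> 0" "\<And>x. cmod (dbar \<psi> x) \<le> C'"
  proof (rule continuous_compact_support_bounded[OF smooth_continuous[OF smooth_dbar[OF s]]])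
    show "dbar \<psi> x = 0" if "R < cmod x" for x using partial_deriv_zero[of R \<psi> x] R that by (simp add: dbar_def)
  qed (use that in blast)
  have [measurable]: "\<psi> \<in> borel_measurable borel" "dbar \<psi> \<in> borel_measurable borel"
    by (intro smooth_measurable s smooth_dbar)+
  have key: "(\<integral>w. dbar \<psi> (z - w) * reg_kernel d w \<partial>lborel) = (\<integral>w. \<psi> (z - of_real d * w) * of_real (1 / (1 + (cmod w)\<^sup>2)\<^sup>2) \<partial>lborel)"
    if d: "d > 0" for d
  proof -
    have [measurable]: "reg_kernel d \<in> borel_measurable borel" by (intro smooth_measurable smooth_reg_kernel d)
    define F where "F w = \<psi> (z - w) * reg_kernel d w" for w
    have sF: "smooth F" unfolding F_def[abs_def] by (intro smooth_mult sr smooth_reg_kernel d)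
    have F0: "F w = 0" if "S < cmod w" for w using sup[OF that] by (simp add: F_def)
    obtain B where B: "\<And>z v. cmod (partial_deriv v F z) \<le> B * cmod v"
      using smooth_compact_support_derivative_bound[OF sF F0] by blast
    have z0: "(\<integral>w. dbar F w \<partial>lborel) = 0" by (rule integral_dbar_zero(2)[OF smooth_has_derivative[OF sF] B F0])
    have eF: "dbar F w = \<psi> (z - w) * of_real (d\<^sup>2 / ((cmod w)\<^sup>2 + d\<^sup>2)\<^sup>2) - dbar \<psi> (z - w) * reg_kernel d w" for w
      unfolding F_def dbar_smooth_mult[OF sr smooth_reg_kernel[OF d]] dr dbar_reg_kernel[OF d] by simp
    have i1: "integrable lborel (\<lambda>w. dbar \<psi> (z - w) * reg_kernel d w)"
    proof (rule integrable_bounded_support[where R=S and B="C' * (1 / d)"])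
      show "cmod (dbar \<psi> (z - w) * reg_kernel d w) \<le> C' * (1 / d)" for w
        unfolding norm_mult by (intro mult_mono C' cmod_reg_kernel_le_const d) auto
    qed (use sup in auto)
    have i2: "integrable lborel (\<lambda>w. \<psi> (z - w) * of_real (d\<^sup>2 / ((cmod w)\<^sup>2 + d\<^sup>2)\<^sup>2))"
    proof -
      have "integrable lborel (\<lambda>w. dbar F w + dbar \<psi> (z - w) * reg_kernel d w)"
        by (intro Bochner_Integration.integrable_add i1 integral_dbar_zero(1)[OF smooth_has_derivative[OF sF] B F0])
      then show ?thesis by (simp add: eF)
    qed
    have "(\<integral>w. dbar \<psi> (z - w) * reg_kernel d w \<partial>lborel) = (\<integral>w. \<psi> (z - w) * of_real (d\<^sup>2 / ((cmod w)\<^sup>2 + d\<^sup>2)\<^sup>2) \<partial>lborel)"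
      using z0 i1 i2 by (simp add: eF)
    \<comment> \<open>Scaling \<open>w\<close> by \<open>d\<close> turns the approximate identity
      into the fixed weight \<open>1 / (1 + (cmod w)\<^sup>2)\<^sup>2\<close> and moves the
      dependence on \<open>d\<close> into the argument of \<open>\<psi>\<close>.\<close>
    also have "\<dots> = \<bar>d\<bar>\<^sup>2 *\<^sub>R (\<integral>w. \<psi> (z - (0 + d *\<^sub>R w)) * of_real (d\<^sup>2 / ((cmod (0 + d *\<^sub>R w))\<^sup>2 + d\<^sup>2)\<^sup>2) \<partial>lborel)"
    proof (rule lborel_integral_affine)
      show "(\<lambda>w. \<psi> (z - w) * of_real (d\<^sup>2 / ((cmod w)\<^sup>2 + d\<^sup>2)\<^sup>2)) \<in> borel_measurable borel" by measurable
    qed (use d in simp)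
    also have "\<dots> = (\<integral>w. d\<^sup>2 *\<^sub>R (\<psi> (z - (0 + d *\<^sub>R w)) * of_real (d\<^sup>2 / ((cmod (0 + d *\<^sub>R w))\<^sup>2 + d\<^sup>2)\<^sup>2)) \<partial>lborel)"
      by simp
    also have "\<dots> = (\<integral>w. \<psi> (z - of_real d * w) * of_real (1 / (1 + (cmod w)\<^sup>2)\<^sup>2) \<partial>lborel)"
    proof (rule Bochner_Integration.integral_cong[OF refl])
      fix w :: complex
      have p: "1 + (cmod w)\<^sup>2 > 0" by (intro add_pos_nonneg) auto
      have "(d * cmod w)\<^sup>2 + d\<^sup>2 = d\<^sup>2 * (1 + (cmod w)\<^sup>2)" by (simp add: algebra_simps power_mult_distrib)
      moreover have "d\<^sup>2 * (d\<^sup>2 / (d\<^sup>2 * s)\<^sup>2) = 1 / s\<^sup>2" if "s \<noteq> 0" for s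
        using d that by (simp add: power2_eq_square)
      ultimately have "d\<^sup>2 * (d\<^sup>2 / ((d * cmod w)\<^sup>2 + d\<^sup>2)\<^sup>2) = 1 / (1 + (cmod w)\<^sup>2)\<^sup>2"
        using p by simp
      then have "complex_of_real (d\<^sup>2) * of_real (d\<^sup>2 / ((cmod (0 + d *\<^sub>R w))\<^sup>2 + d\<^sup>2)\<^sup>2) = of_real (1 / (1 + (cmod w)\<^sup>2)\<^sup>2)"
        using d by (simp only: of_real_mult[symmetric] add_0_left norm_scaleR abs_of_pos)
      then show "d\<^sup>2 *\<^sub>R (\<psi> (z - (0 + d *\<^sub>R w)) * of_real (d\<^sup>2 / ((cmod (0 + d *\<^sub>R w))\<^sup>2 + d\<^sup>2)\<^sup>2)) =
        \<psi> (z - of_real d * w) * of_real (1 / (1 + (cmod w)\<^sup>2)\<^sup>2)"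
        by (simp only: scaleR_conv_of_real mult.left_commute[of "of_real (d\<^sup>2)"] add_0_left)
    qed
    finally show ?thesis .
  qed
  have l1: "(\<lambda>n. \<integral>w. dbar \<psi> (z - w) * reg_kernel (dseq n) w \<partial>lborel) \<longlonglongrightarrow> (\<integral>w. dbar \<psi> (z - w) * (1 / w) \<partial>lborel)"
  proof (rule integral_dominated_convergence[where w="\<lambda>w. C' * (indicator (cball 0 S) w / cmod w)"])
    show "integrable lborel (\<lambda>w::complex. C' * (indicator (cball 0 S) w / cmod w))" by (intro integrable_mult_right integrable_kernel S)
    show "AE w in lborel. norm (dbar \<psi> (z - w) * reg_kernel (dseq n) w) \<le> C' * (indicator (cball 0 S) w / cmod w)" for n
      by (rule AE_I2, rule kernel_dominator[where f="\<lambda>w. dbar \<psi> (z - w)"]) (use C' sup dseq in \<open>auto intro: cmod_reg_kernel_le\<close>)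
    show "AE w in lborel. (\<lambda>n. dbar \<psi> (z - w) * reg_kernel (dseq n) w) \<longlonglongrightarrow> dbar \<psi> (z - w) * (1 / w)"
      by (intro AE_I2 tendsto_intros reg_kernel_tendsto dseq)
    have [measurable]: "reg_kernel (dseq n) \<in> borel_measurable borel" for n by (intro smooth_measurable smooth_reg_kernel dseq)
    show "(\<lambda>w. dbar \<psi> (z - w) * reg_kernel (dseq n) w) \<in> borel_measurable lborel" for n by measurable
  qed measurable
  have l2: "(\<lambda>n. \<integral>w. \<psi> (z - of_real (dseq n) * w) * of_real (1 / (1 + (cmod w)\<^sup>2)\<^sup>2) \<partial>lborel) \<longlonglongrightarrow>
     (\<integral>w. \<psi> z * of_real (1 / (1 + (cmod w)\<^sup>2)\<^sup>2) \<partial>lborel)"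
  proof (rule integral_dominated_convergence[where w="\<lambda>w. C * (1 / (1 + (cmod w)\<^sup>2)\<^sup>2)"])
    show "integrable lborel (\<lambda>w::complex. C * (1 / (1 + (cmod w)\<^sup>2)\<^sup>2))" by (intro integrable_mult_right integrable_plane_weight)
    show "AE w in lborel. norm (\<psi> (z - of_real (dseq n) * w) * of_real (1 / (1 + (cmod w)\<^sup>2)\<^sup>2)) \<le> C * (1 / (1 + (cmod w)\<^sup>2)\<^sup>2)" for n
      by (rule AE_I2) (use C in \<open>simp add: norm_mult norm_divide norm_power divide_right_mono del: of_real_add of_real_power of_real_divide\<close>)
    show "AE w in lborel. (\<lambda>n. \<psi> (z - of_real (dseq n) * w) * of_real (1 / (1 + (cmod w)\<^sup>2)\<^sup>2)) \<longlonglongrightarrow> \<psi> z * of_real (1 / (1 + (cmod w)\<^sup>2)\<^sup>2)"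
    proof (rule AE_I2)
      fix w
      have "(\<lambda>n. z - of_real (dseq n) * w) \<longlonglongrightarrow> z - of_real 0 * w" by (intro tendsto_intros dseq)
      moreover have "isCont \<psi> (z - of_real 0 * w)" using smooth_continuous[OF s, of UNIV] by (simp add: continuous_on_eq_continuous_at)
      ultimately have "(\<lambda>n. \<psi> (z - of_real (dseq n) * w)) \<longlonglongrightarrow> \<psi> (z - of_real 0 * w)" by (rule isCont_tendsto_compose[rotated])
      then show "(\<lambda>n. \<psi> (z - of_real (dseq n) * w) * of_real (1 / (1 + (cmod w)\<^sup>2)\<^sup>2)) \<longlonglongrightarrow> \<psi> z * of_real (1 / (1 + (cmod w)\<^sup>2)\<^sup>2)"
        by (intro tendsto_intros) simp
    qed
  qed measurable
  have "(\<integral>w. dbar \<psi> (z - w) * (1 / w) \<partial>lborel) = (\<integral>w. \<psi> z * of_real (1 / (1 + (cmod w)\<^sup>2)\<^sup>2) \<partial>lborel)"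
    using LIMSEQ_unique[OF l1[unfolded key[OF dseq(1)]] l2] .
  also have "\<dots> = \<psi> z * of_real cauchy_const"
    unfolding cauchy_const_def by (simp only: integral_mult_right_zero integral_complex_of_real)
  finally show ?thesis by (simp add: mult.commute)
qed

section \<open>The Cauchy transform\<close>

abbreviation disk_measure :: "complex measure" where
  "disk_measure \<equiv> lebesgue_on unit_disk"

lemma integral_norm_bound_AE:
  fixes f :: "'a \<Rightarrow> complex"
  assumes "integrable M f" "integrable M g" "AE x in M. norm (f x) \<le> g x"
  shows "norm (integral\<^sup>L M f) \<le> integral\<^sup>L M g"
  by (rule order_trans[OF integral_norm_bound integral_mono_AE]) (use assms in auto)

lemma integral_disk_eq:
  fixes f :: "complex \<Rightarrow> complex"
  assumes "f \<in> borel_measurable borel" "\<And>z. z \<notin> unit_disk \<Longrightarrow> f z = 0"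
  shows "integral\<^sup>L disk_measure f = integral\<^sup>L lborel f"
proof -
  have "integral\<^sup>L disk_measure f = (\<integral>z. indicator unit_disk z *\<^sub>R f z \<partial>lebesgue)"
    by (rule integral_restrict_space) simp
  also have "(\<lambda>z. indicator unit_disk z *\<^sub>R f z) = f" using assms(2) by (auto simp: fun_eq_iff indicator_def)
  also have "integral\<^sup>L lebesgue f = integral\<^sup>L lborel f" by (rule integral_completion) (use assms in simp)
  finally show ?thesis .
qed

lemma integrable_disk_lborel:
  fixes f :: "complex \<Rightarrow> 'a :: {banach, second_countable_topology}"
  assumes "integrable lborel f"
  shows "integrable disk_measure f"
proof -
  have "integrable lebesgue f" using assms by (simp add: integrable_completion)
  then show ?thesis by (subst integrable_restrict_space) (auto intro: integrable_mult_indicator)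
qed

lemma measurable_disk_borel: "f \<in> borel_measurable borel \<Longrightarrow> f \<in> borel_measurable disk_measure"
  by (intro measurable_restrict_space1 measurable_completion) simp

lemma finite_measure_disk: "finite_measure disk_measure"
  by (rule finite_measure_lebesgue_on) simp

lemma lborel_reflect: "distr lborel borel (\<lambda>x. z - x) = (lborel :: complex measure)"
  by (subst lborel_affine[of "-1" z]) (simp_all add: density_1)

lemma lborel_integral_reflect:
  fixes f :: "complex \<Rightarrow> 'a :: {banach, second_countable_topology}"
  assumes "f \<in> borel_measurable borel"
  shows "(\<integral>w. f (z - w) \<partial>lborel) = integral\<^sup>L lborel f" "integrable lborel (\<lambda>w. f (z - w)) \<longleftrightarrow> integrable lborel f"
proof -
  have m: "(\<lambda>x. z - x) \<in> measurable lborel borel" by measurable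
  show "(\<integral>w. f (z - w) \<partial>lborel) = integral\<^sup>L lborel f"
    using integral_distr[OF m assms] by (simp add: lborel_reflect)
  show "integrable lborel (\<lambda>w. f (z - w)) \<longleftrightarrow> integrable lborel f"
    using integrable_distr_eq[OF m assms] by (simp add: lborel_reflect)
qed

definition kernel_mass :: "real \<Rightarrow> real" where
  "kernel_mass R = (\<integral>w. indicator (cball (0::complex) R) w / cmod w \<partial>lborel)"

text \<open>For \<open>w\<close> in the unit disk, \<open>z - w\<close> stays in
  \<open>cball 0 (S + 1)\<close>, so after a reflection the bound no longer depends on
  \<open>z\<close>. It is applied to \<open>1 / cmod w\<close> and to the distance of the
  regularised kernel from \<open>1 / w\<close>.\<close>

lemma disk_convolution_bound:
  fixes k :: "complex \<Rightarrow> real"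
  assumes k: "k \<in> borel_measurable borel" "\<And>w. 0 \<le> k w" "integrable lborel (\<lambda>w. indicator (cball 0 (S + 1)) w * k w)"
    and z: "cmod z \<le> S"
  shows "integrable disk_measure (\<lambda>w. k (z - w))"
    "(\<integral>w. k (z - w) \<partial>disk_measure) \<le> (\<integral>w. indicator (cball 0 (S + 1)) w * k w \<partial>lborel)"
proof -
  define f where "f w = indicator (cball 0 (S + 1)) w * k w" for w
  have fm: "f \<in> borel_measurable borel" unfolding f_def[abs_def] by (intro borel_measurable_times borel_measurable_indicator k) simp
  have fi: "integrable lborel f" unfolding f_def[abs_def] by (rule k(3))
  then have fi': "integrable lborel (\<lambda>w. f (z - w))" using lborel_integral_reflect(2)[OF fm] by blast
  have fi'': "integrable disk_measure (\<lambda>w. f (z - w))" by (rule integrable_disk_lborel[OF fi'])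
  have eq: "f (z - w) = k (z - w)" if "w \<in> unit_disk" for w
  proof -
    have "cmod (z - w) \<le> S + 1" using z that norm_triangle_ineq4[of z w] by simp
    then show ?thesis by (simp add: f_def)
  qed
  show "integrable disk_measure (\<lambda>w. k (z - w))"
    using fi'' by (rule Bochner_Integration.integrable_cong[OF refl, THEN iffD1, rotated]) (simp add: eq)
  have "(\<integral>w. k (z - w) \<partial>disk_measure) = (\<integral>w. f (z - w) \<partial>disk_measure)"
    by (rule Bochner_Integration.integral_cong) (auto simp: eq)
  also have "\<dots> = (\<integral>w. indicator unit_disk w *\<^sub>R f (z - w) \<partial>lebesgue)" by (rule integral_restrict_space) simp
  also have "\<dots> = (\<integral>w. indicator unit_disk w *\<^sub>R f (z - w) \<partial>lborel)"
  proof (rule integral_completion)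
    have "(\<lambda>w. f (z - w)) \<in> borel_measurable borel"
      by (rule measurable_compose[OF _ fm]) measurable
    then show "(\<lambda>w. indicator unit_disk w *\<^sub>R f (z - w)) \<in> borel_measurable lborel"
      by (intro borel_measurable_scaleR borel_measurable_indicator) auto
  qed
  also have "\<dots> \<le> (\<integral>w. f (z - w) \<partial>lborel)"
  proof (rule integral_mono)
    have "integrable lborel (\<lambda>w. f (z - w) * indicator unit_disk w)" by (rule integrable_real_mult_indicator) (use fi' in auto)
    then show "integrable lborel (\<lambda>w. indicator unit_disk w *\<^sub>R f (z - w))" by (simp add: mult.commute)
    show "indicator unit_disk w *\<^sub>R f (z - w) \<le> f (z - w)" for w using k(2) by (auto simp: indicator_def f_def)
  qed (rule fi')
  also have "\<dots> = integral\<^sup>L lborel f" by (rule lborel_integral_reflect(1)[OF fm])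
  finally show "(\<integral>w. k (z - w) \<partial>disk_measure) \<le> (\<integral>w. indicator (cball 0 (S + 1)) w * k w \<partial>lborel)" by (simp add: f_def[abs_def])
qed

lemma disk_kernel_bound:
  assumes "cmod z \<le> S"
  shows "integrable disk_measure (\<lambda>w. 1 / cmod (z - w))" "(\<integral>w. 1 / cmod (z - w) \<partial>disk_measure) \<le> kernel_mass (S + 1)"
proof -
  have "S + 1 > 0" using assms norm_ge_zero[of z] by (simp del: norm_ge_zero)
  from integrable_kernel[OF this] have i: "integrable lborel (\<lambda>w::complex. indicator (cball 0 (S + 1)) w * (1 / cmod w))" by simp
  have m: "(\<lambda>w::complex. 1 / cmod w) \<in> borel_measurable borel" by measurable
  show "integrable disk_measure (\<lambda>w. 1 / cmod (z - w))" by (rule disk_convolution_bound(1)[OF m _ i assms]) simp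
  show "(\<integral>w. 1 / cmod (z - w) \<partial>disk_measure) \<le> kernel_mass (S + 1)"
    using disk_convolution_bound(2)[OF m _ i assms] by (simp add: kernel_mass_def)
qed

text \<open>Normalised so that \<open>dbar\<close> undoes it weakly. Integration is over the disk
  alone, and at \<open>w = z\<close> the quotient is 0 by the convention for division, on a null
  set.\<close>

definition cauchy_transform :: "(complex \<Rightarrow> complex) \<Rightarrow> complex \<Rightarrow> complex" where
  "cauchy_transform g z = (\<integral>w. g w / (z - w) \<partial>disk_measure) / of_real cauchy_const"

lemma cauchy_transform_integrable:
  assumes "g \<in> borel_measurable disk_measure" "AE w in disk_measure. cmod (g w) \<le> C"
  shows "integrable disk_measure (\<lambda>w. g w / (z - w))"
proof (rule Bochner_Integration.integrable_bound)
  show "integrable disk_measure (\<lambda>w. C * (1 / cmod (z - w)))" by (intro integrable_mult_right disk_kernel_bound(1)[of z "cmod z"]) simp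
  have "(\<lambda>w. z - w) \<in> borel_measurable disk_measure" by (rule measurable_disk_borel) measurable
  then show "(\<lambda>w. g w / (z - w)) \<in> borel_measurable disk_measure" using assms(1) by measurable
  show "AE w in disk_measure. norm (g w / (z - w)) \<le> norm (C * (1 / cmod (z - w)))"
    using assms(2)
  proof eventually_elim
    case (elim w)
    have "norm (g w / (z - w)) \<le> C / cmod (z - w)" unfolding norm_divide by (rule divide_right_mono[OF elim]) simp
    also have "\<dots> \<le> norm (C * (1 / cmod (z - w)))" by (simp add: divide_right_mono abs_divide)
    finally show ?case .
  qed
qed

lemma cauchy_transform_bound:
  assumes "g \<in> borel_measurable disk_measure" "AE w in disk_measure. cmod (g w) \<le> C" "cmod z \<le> S" "C \<ge> 0"
  shows "cmod (cauchy_transform g z) \<le> C * kernel_mass (S + 1) / cauchy_const"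
proof -
  have "cmod (\<integral>w. g w / (z - w) \<partial>disk_measure) \<le> (\<integral>w. C * (1 / cmod (z - w)) \<partial>disk_measure)"
  proof (rule integral_norm_bound_AE)
    show "integrable disk_measure (\<lambda>w. C * (1 / cmod (z - w)))" by (intro integrable_mult_right disk_kernel_bound(1)[OF assms(3)])
    show "AE w in disk_measure. norm (g w / (z - w)) \<le> C * (1 / cmod (z - w))"
      using assms(2) by eventually_elim (simp add: norm_divide divide_right_mono)
  qed (rule cauchy_transform_integrable[OF assms(1,2)])
  also have "\<dots> = C * (\<integral>w. 1 / cmod (z - w) \<partial>disk_measure)" by (rule integral_mult_right_zero)
  also have "\<dots> \<le> C * kernel_mass (S + 1)" by (intro mult_left_mono disk_kernel_bound(2) assms)
  finally show ?thesis
    unfolding cauchy_transform_def norm_divide using cauchy_const_pos by (simp add: divide_right_mono)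
qed

lemma cauchy_transform_tendsto:
  assumes "\<And>n. g n \<in> borel_measurable disk_measure" "h \<in> borel_measurable disk_measure"
    "\<And>n. AE w in disk_measure. cmod (g n w) \<le> C" "AE w in disk_measure. (\<lambda>n. g n w) \<longlonglongrightarrow> h w"
  shows "(\<lambda>n. cauchy_transform (g n) z) \<longlonglongrightarrow> cauchy_transform h z"
proof -
  have [measurable]: "(\<lambda>w. z - w) \<in> borel_measurable disk_measure" by (rule measurable_disk_borel) measurable
  note [measurable] = assms(1,2)
  have "(\<lambda>n. \<integral>w. g n w / (z - w) \<partial>disk_measure) \<longlonglongrightarrow> (\<integral>w. h w / (z - w) \<partial>disk_measure)"
  proof (rule integral_dominated_convergence[where w="\<lambda>w. C * (1 / cmod (z - w))"])
    show "integrable disk_measure (\<lambda>w. C * (1 / cmod (z - w)))" by (intro integrable_mult_right disk_kernel_bound(1)[of z "cmod z"]) simp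
    show "AE w in disk_measure. norm (g n w / (z - w)) \<le> C * (1 / cmod (z - w))" for n
      using assms(3)[of n] by eventually_elim (simp add: norm_divide divide_right_mono)
    show "AE w in disk_measure. (\<lambda>n. g n w / (z - w)) \<longlonglongrightarrow> h w / (z - w)"
      using assms(4)
    proof eventually_elim
      case (elim w)
      show ?case unfolding divide_inverse by (intro tendsto_intros elim)
    qed
  qed measurable
  then show ?thesis unfolding cauchy_transform_def using cauchy_const_pos by (intro tendsto_intros) auto
qed

lemma reg_kernel_mass_tendsto:
  assumes "S > 0"
  shows "(\<lambda>n. \<integral>w. indicator (cball 0 S) w * cmod (reg_kernel (dseq n) w - 1 / w) \<partial>lborel) \<longlonglongrightarrow> 0"
    "integrable lborel (\<lambda>w. indicator (cball 0 S) w * cmod (reg_kernel (dseq n) w - 1 / w))"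
proof -
  have rm [measurable]: "reg_kernel (dseq n) \<in> borel_measurable borel" for n by (intro smooth_measurable smooth_reg_kernel dseq)
  have b: "norm (indicator (cball 0 S) w * cmod (reg_kernel (dseq n) w - 1 / w)) \<le> 2 * (indicator (cball 0 S) w / cmod w)" for n w
  proof -
    have "cmod (reg_kernel (dseq n) w - 1 / w) \<le> 1 / cmod w + 1 / cmod w"
      using norm_triangle_ineq4[of "reg_kernel (dseq n) w" "1 / w"] cmod_reg_kernel_le[OF dseq(1)[of n], of w] by (simp add: norm_divide)
    then show ?thesis by (simp add: indicator_def)
  qed
  have i: "integrable lborel (\<lambda>w::complex. 2 * (indicator (cball 0 S) w / cmod w))" by (intro integrable_mult_right integrable_kernel assms)
  have m: "(\<lambda>w. indicator (cball 0 S) w * cmod (reg_kernel (dseq n) w - 1 / w)) \<in> borel_measurable lborel" for n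
    by (intro borel_measurable_times borel_measurable_indicator) (simp, measurable)
  show "integrable lborel (\<lambda>w. indicator (cball 0 S) w * cmod (reg_kernel (dseq n) w - 1 / w))"
    by (rule Bochner_Integration.integrable_bound[OF i m]) (use b in \<open>auto intro: order_trans[OF _ abs_ge_self]\<close>)
  have "(\<lambda>n. \<integral>w. indicator (cball 0 S) w * cmod (reg_kernel (dseq n) w - 1 / w) \<partial>lborel) \<longlonglongrightarrow> integral\<^sup>L lborel (\<lambda>w::complex. 0)"
  proof (rule integral_dominated_convergence[OF _ m i])
    show "AE w in lborel. (\<lambda>n. indicator (cball 0 S) w * cmod (reg_kernel (dseq n) w - 1 / w)) \<longlonglongrightarrow> 0"
    proof (rule AE_I2)
      fix w :: complex
      have "(\<lambda>n. indicator (cball 0 S) w * cmod (reg_kernel (dseq n) w - 1 / w)) \<longlonglongrightarrow> indicator (cball 0 S) w * cmod (1 / w - 1 / w)"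
        by (intro tendsto_intros reg_kernel_tendsto dseq)
      then show "(\<lambda>n. indicator (cball 0 S) w * cmod (reg_kernel (dseq n) w - 1 / w)) \<longlonglongrightarrow> 0" by simp
    qed
  qed (use b in auto)
  then show "(\<lambda>n. \<integral>w. indicator (cball 0 S) w * cmod (reg_kernel (dseq n) w - 1 / w) \<partial>lborel) \<longlonglongrightarrow> 0" by simp
qed

text \<open>With the regularised kernel the integral is continuous by dominated convergence. On
  balls it converges uniformly to the true one: the error is at most the bound on \<open>g\<close>
  times the L1 distance of the two kernels.\<close>

lemma cauchy_transform_continuous:
  assumes g: "g \<in> borel_measurable disk_measure" "AE w in disk_measure. cmod (g w) \<le> C"
  shows "continuous_on UNIV (cauchy_transform g)"
proof -
  note [measurable] = g(1)
  have C: "AE w in disk_measure. cmod (g w) \<le> max C 0" using g(2) by eventually_elim simp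
  have meas [measurable]: "(\<lambda>w. z - w) \<in> borel_measurable disk_measure" for z by (rule measurable_disk_borel) measurable
  have rm: "(\<lambda>w. reg_kernel (dseq n) (z - w)) \<in> borel_measurable disk_measure" for n z
  proof (rule measurable_disk_borel)
    have [measurable]: "reg_kernel (dseq n) \<in> borel_measurable borel" by (intro smooth_measurable smooth_reg_kernel dseq)
    show "(\<lambda>w. reg_kernel (dseq n) (z - w)) \<in> borel_measurable borel" by measurable
  qed
  define H where "H n z = (\<integral>w. g w * reg_kernel (dseq n) (z - w) \<partial>disk_measure)" for n z
  interpret finite_measure disk_measure by (rule finite_measure_disk)
  have bd: "AE w in disk_measure. norm (g w * reg_kernel (dseq n) (z - w)) \<le> max C 0 * (1 / dseq n)" for n z
    using C
  proof eventually_elim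
    case (elim w)
    show ?case unfolding norm_mult by (intro mult_mono elim cmod_reg_kernel_le_const dseq) auto
  qed
  have iH: "integrable disk_measure (\<lambda>w. g w * reg_kernel (dseq n) (z - w))" for n z
    by (rule integrable_const_bound[OF bd]) (use rm in measurable)
  have contH: "continuous_on T (H n)" for n T
    unfolding continuous_on_sequentially
  proof (intro allI ballI impI)
    fix x and a :: complex assume "a \<in> T" and x: "(\<forall>k. x k \<in> T) \<and> x \<longlonglongrightarrow> a"
    have "(\<lambda>k. \<integral>w. g w * reg_kernel (dseq n) (x k - w) \<partial>disk_measure) \<longlonglongrightarrow> (\<integral>w. g w * reg_kernel (dseq n) (a - w) \<partial>disk_measure)"
    proof (rule integral_dominated_convergence[where w="\<lambda>_. max C 0 * (1 / dseq n)"])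
      show "AE w in disk_measure. (\<lambda>k. g w * reg_kernel (dseq n) (x k - w)) \<longlonglongrightarrow> g w * reg_kernel (dseq n) (a - w)"
      proof (rule AE_I2)
        fix w
        have "isCont (reg_kernel (dseq n)) (a - w)"
          using smooth_continuous[OF smooth_reg_kernel[OF dseq(1)], of UNIV] by (simp add: continuous_on_eq_continuous_at)
        moreover have "(\<lambda>k. x k - w) \<longlonglongrightarrow> a - w" using x by (intro tendsto_intros) auto
        ultimately have "(\<lambda>k. reg_kernel (dseq n) (x k - w)) \<longlonglongrightarrow> reg_kernel (dseq n) (a - w)" by (rule isCont_tendsto_compose)
        then show "(\<lambda>k. g w * reg_kernel (dseq n) (x k - w)) \<longlonglongrightarrow> g w * reg_kernel (dseq n) (a - w)" by (intro tendsto_intros)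
      qed
    qed (use bd rm in auto)
    then show "(H n \<circ> x) \<longlonglongrightarrow> H n a" by (simp add: H_def o_def)
  qed
  define Q where "Q z = (\<integral>w. g w / (z - w) \<partial>disk_measure)" for z
  have "continuous_on (ball 0 S) Q" if S: "S > 0" for S
  proof (rule uniform_limit_theorem[where F=sequentially and f=H])
    define e where "e n = (\<integral>w. indicator (cball 0 (S+1)) w * cmod (reg_kernel (dseq n) w - 1 / w) \<partial>lborel)" for n
    have el: "e \<longlonglongrightarrow> 0" unfolding e_def[abs_def] by (rule reg_kernel_mass_tendsto) (use S in simp)
    have est: "cmod (H n z - Q z) \<le> max C 0 * e n" if z: "z \<in> ball 0 S" for n z
    proof -
      define k where "k w = cmod (reg_kernel (dseq n) w - 1 / w)" for w
      have km: "k \<in> borel_measurable borel"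
      proof -
        have [measurable]: "reg_kernel (dseq n) \<in> borel_measurable borel" by (intro smooth_measurable smooth_reg_kernel dseq)
        show ?thesis unfolding k_def[abs_def] by measurable
      qed
      have ki: "integrable lborel (\<lambda>w. indicator (cball 0 (S + 1)) w * k w)"
        unfolding k_def by (rule reg_kernel_mass_tendsto) (use S in simp)
      have zS: "cmod z \<le> S" using z by simp
      have k0: "0 \<le> k w" for w by (simp add: k_def)
      note kb = disk_convolution_bound[OF km k0 ki zS]
      have i2: "integrable disk_measure (\<lambda>w. g w / (z - w))" by (rule cauchy_transform_integrable[OF g])
      have "H n z - Q z = (\<integral>w. g w * reg_kernel (dseq n) (z - w) - g w / (z - w) \<partial>disk_measure)"
        unfolding H_def Q_def by (rule Bochner_Integration.integral_diff[symmetric, OF iH i2])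
      also have "cmod \<dots> \<le> (\<integral>w. max C 0 * k (z - w) \<partial>disk_measure)"
      proof (rule integral_norm_bound_AE)
        show "integrable disk_measure (\<lambda>w. g w * reg_kernel (dseq n) (z - w) - g w / (z - w))"
          by (intro Bochner_Integration.integrable_diff iH i2)
        show "integrable disk_measure (\<lambda>w. max C 0 * k (z - w))" by (intro integrable_mult_right kb)
        show "AE w in disk_measure. norm (g w * reg_kernel (dseq n) (z - w) - g w / (z - w)) \<le> max C 0 * k (z - w)"
          using C
        proof eventually_elim
          case (elim w)
          have "g w * reg_kernel (dseq n) (z - w) - g w / (z - w) = g w * (reg_kernel (dseq n) (z - w) - 1 / (z - w))"
            by (simp add: algebra_simps)
          then show ?case unfolding k_def using elim by (simp only: norm_mult) (intro mult_right_mono, auto)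
        qed
      qed
      also have "\<dots> = max C 0 * (\<integral>w. k (z - w) \<partial>disk_measure)" by simp
      also have "\<dots> \<le> max C 0 * e n" using kb(2) by (intro mult_left_mono) (auto simp: e_def k_def)
      finally show ?thesis .
    qed
    show "uniform_limit (ball 0 S) H Q sequentially"
      unfolding uniform_limit_iff
    proof (intro allI impI)
      fix \<epsilon> :: real assume \<epsilon>: "\<epsilon> > 0"
      have "(\<lambda>n. max C 0 * e n) \<longlonglongrightarrow> max C 0 * 0" by (intro tendsto_intros el)
      then have "(\<lambda>n. max C 0 * e n) \<longlonglongrightarrow> 0" by simp
      from order_tendstoD(2)[OF this \<epsilon>]
      show "\<forall>\<^sub>F n in sequentially. \<forall>z\<in>ball 0 S. dist (H n z) (Q z) < \<epsilon>"
        by eventually_elim (use est in \<open>auto simp only: dist_norm intro: le_less_trans\<close>)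
    qed
  qed (auto intro: contH always_eventually)
  then have "isCont Q z" for z
    using continuous_on_eq_continuous_at[OF open_ball, of 0 "cmod z + 1" Q] by (simp add: add_nonneg_pos)
  then have "continuous_on UNIV Q" by (simp add: continuous_at_imp_continuous_on)
  then show ?thesis
    unfolding cauchy_transform_def Q_def using cauchy_const_pos by (intro continuous_intros) auto
qed

section \<open>Cauchy transforms of test functions\<close>

text \<open>Convolution with \<open>1 / w\<close>, with the difference in the smooth factor so that
  derivatives fall on \<open>\<psi>\<close> under the integral.\<close>

definition plane_convolution :: "(complex \<Rightarrow> complex) \<Rightarrow> complex \<Rightarrow> complex" where
  "plane_convolution \<psi> z = (\<integral>w. \<psi> (z - w) / w \<partial>lborel)"

lemma plane_convolution_integrable:
  assumes "\<psi> \<in> borel_measurable borel" "\<And>z. cmod (\<psi> z) \<le> C" "\<And>z. R < cmod z \<Longrightarrow> \<psi> z = 0" "R \<ge> 0"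
  shows "integrable lborel (\<lambda>w. \<psi> (z - w) / w)"
proof (rule Bochner_Integration.integrable_bound)
  have S: "cmod z + R + 1 > 0" using assms(4) norm_ge_zero[of z] by (simp del: norm_ge_zero)
  show "integrable lborel (\<lambda>w::complex. C * (indicator (cball 0 (cmod z + R + 1)) w / cmod w))"
    by (intro integrable_mult_right integrable_kernel S)
  show "(\<lambda>w. \<psi> (z - w) / w) \<in> borel_measurable lborel"
    using measurable_compose[OF _ assms(1), of "\<lambda>w. z - w"] by measurable
  show "AE w in lborel. norm (\<psi> (z - w) / w) \<le> norm (C * (indicator (cball 0 (cmod z + R + 1)) w / cmod w))"
  proof (rule AE_I2)
    fix w
    have "cmod (\<psi> (z - w) * (1 / w)) \<le> C * (indicator (cball 0 (cmod z + R + 1)) w / cmod w)"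
    proof (rule kernel_dominator[where f="\<lambda>w. \<psi> (z - w)"])
      show "\<psi> (z - x) = 0" if "cmod z + R + 1 < cmod x" for x
        by (rule reflect_support[OF assms(3)]) (use that in auto)
    qed (use assms in \<open>auto simp: norm_divide\<close>)
    also have "\<dots> \<le> norm (C * (indicator (cball 0 (cmod z + R + 1)) w / cmod w))" unfolding real_norm_def by (rule abs_ge_self)
    finally show "norm (\<psi> (z - w) / w) \<le> norm (C * (indicator (cball 0 (cmod z + R + 1)) w / cmod w))" by simp
  qed
qed

lemma integral_linear_combination:
  fixes f g :: "'a \<Rightarrow> complex"
  assumes "integrable M f" "integrable M g"
  shows "(\<integral>x. a * f x + b * g x \<partial>M) = a * integral\<^sup>L M f + b * integral\<^sup>L M g"
  using assms by simp

text \<open>The error quotients \<open>e n\<close> are bounded by \<open>2 * B\<close> and vanish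
  outside a disk common to all \<open>n\<close>. A multiple of \<open>1 / cmod w\<close> on that
  disk dominates, so the limit may be taken under the integral.\<close>

lemma has_derivative_plane_convolution:
  assumes s: "smooth \<psi>" and R: "\<And>z. R < cmod z \<Longrightarrow> \<psi> z = 0" "R \<ge> 0"
  shows "(plane_convolution \<psi> has_derivative (\<lambda>v. plane_convolution (partial_deriv v \<psi>) z)) (at z)"
  unfolding has_derivative_at
proof
  obtain B where B: "B \<ge> 0" "\<And>z v. cmod (partial_deriv v \<psi> z) \<le> B * cmod v"
    using smooth_compact_support_derivative_bound[OF s R(1)] by blast
  obtain C where C: "C \<ge> 0" "\<And>z. cmod (\<psi> z) \<le> C"
    using continuous_compact_support_bounded[OF smooth_continuous[OF s] R(1)] by blast
  have i0: "integrable lborel (\<lambda>w. \<psi> (z - w) / w)" for z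
    by (rule plane_convolution_integrable[OF smooth_measurable[OF s] C(2) R])
  have z1: "partial_deriv v \<psi> x = 0" if "R < cmod x" for v x
    by (rule partial_deriv_zero[of R]) (use R that in auto)
  have i1: "integrable lborel (\<lambda>w. partial_deriv v \<psi> (z - w) / w)" for v
    by (rule plane_convolution_integrable[OF smooth_measurable[OF smooth_partial_deriv[OF s]] B(2) _ R(2)]) (rule z1)
  have dec: "plane_convolution (partial_deriv v \<psi>) z = of_real (Re v) * plane_convolution (partial_deriv 1 \<psi>) z + of_real (Im v) * plane_convolution (partial_deriv \<i> \<psi>) z" for v
  proof -
    have "plane_convolution (partial_deriv v \<psi>) z = (\<integral>w. of_real (Re v) * (partial_deriv 1 \<psi> (z - w) / w) + of_real (Im v) * (partial_deriv \<i> \<psi> (z - w) / w) \<partial>lborel)"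
      unfolding plane_convolution_def partial_deriv_decompose[OF s, of v]
      by (rule Bochner_Integration.integral_cong) (auto simp: add_divide_distrib)
    also have "\<dots> = of_real (Re v) * plane_convolution (partial_deriv 1 \<psi>) z + of_real (Im v) * plane_convolution (partial_deriv \<i> \<psi>) z"
      unfolding plane_convolution_def by (rule integral_linear_combination[OF i1 i1])
    finally show ?thesis .
  qed
  show "bounded_linear (\<lambda>v. plane_convolution (partial_deriv v \<psi>) z)"
  proof -
    define a b where "a = plane_convolution (partial_deriv 1 \<psi>) z" and "b = plane_convolution (partial_deriv \<i> \<psi>) z"
    have "bounded_linear (\<lambda>v. of_real (Re v) * a + of_real (Im v) * b)"
      by (intro bounded_linear_add bounded_linear_mult_const bounded_linear_compose[OF bounded_linear_of_real] bounded_linear_Re bounded_linear_Im)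
    also have "(\<lambda>v. of_real (Re v) * a + of_real (Im v) * b) = (\<lambda>v. plane_convolution (partial_deriv v \<psi>) z)"
      by (rule ext) (simp only: a_def b_def dec[symmetric])
    finally show ?thesis .
  qed
  show "(\<lambda>h. norm (plane_convolution \<psi> (z + h) - plane_convolution \<psi> z - plane_convolution (partial_deriv h \<psi>) z) / norm h) \<midarrow>0\<rightarrow> 0"
    unfolding tendsto_at_iff_sequentially
  proof (intro allI impI)
    fix h :: "nat \<Rightarrow> complex" assume h0: "\<forall>n. h n \<in> UNIV - {0}" and h: "h \<longlonglongrightarrow> 0"
    obtain H where H: "\<And>n. cmod (h n) \<le> H" using convergent_imp_Bseq[OF convergentI[OF h]] by (auto simp: Bseq_def)
    have H0: "H \<ge> 0" using H[of 0] norm_ge_zero order_trans by blast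
    \<comment> \<open>\<open>H\<close> bounds all increments \<open>h n\<close>, so this radius
      covers the supports for every \<open>n\<close>.\<close>
    define S where "S = cmod z + H + R + 1"
    have S: "S > 0" using H0 R(2) norm_ge_zero[of z] by (simp add: S_def del: norm_ge_zero)
    define e where "e n w = (\<psi> (z + h n - w) - \<psi> (z - w) - partial_deriv (h n) \<psi> (z - w)) / of_real (cmod (h n))" for n w
    have lip: "cmod (\<psi> x - \<psi> y) \<le> B * cmod (x - y)" for x y
    proof (rule differentiable_bound[of UNIV \<psi> "\<lambda>z v. partial_deriv v \<psi> z"])
      show "onorm (\<lambda>v. partial_deriv v \<psi> z) \<le> B" for z by (rule onorm_bound) (use B in \<open>auto simp: mult.commute\<close>)
    qed (use smooth_has_derivative[OF s] in auto)
    have eb: "cmod (e n w) \<le> 2 * B" for n w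
    proof -
      have hp: "cmod (h n) > 0" using h0 by simp
      have "cmod (\<psi> (z + h n - w) - \<psi> (z - w) - partial_deriv (h n) \<psi> (z - w)) \<le> B * cmod (h n) + B * cmod (h n)"
        using norm_triangle_ineq4[of "\<psi> (z + h n - w) - \<psi> (z - w)" "partial_deriv (h n) \<psi> (z - w)"]
          lip[of "z + h n - w" "z - w"] B(2)[of "h n" "z - w"] by (simp add: algebra_simps)
      then show ?thesis using hp by (simp add: e_def norm_divide divide_le_eq)
    qed
    have e0: "e n w = 0" if "S < cmod w" for n w
    proof -
      have "cmod (z + h n) \<le> cmod z + H" using norm_triangle_ineq[of z "h n"] H[of n] by simp
      then have "\<psi> (z + h n - w) = 0" by (intro reflect_support[OF R(1)]) (use that in \<open>auto simp: S_def\<close>)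
      moreover have "\<psi> (z - w) = 0" by (rule reflect_support[OF R(1)]) (use that H0 in \<open>auto simp: S_def\<close>)
      moreover have "partial_deriv (h n) \<psi> (z - w) = 0" by (rule reflect_support[OF z1]) (use that H0 in \<open>auto simp: S_def\<close>)
      ultimately show ?thesis by (simp add: e_def)
    qed
    have em [measurable]: "e n \<in> borel_measurable borel" for n
    proof -
      have [measurable]: "\<psi> \<in> borel_measurable borel" "partial_deriv (h n) \<psi> \<in> borel_measurable borel"
        by (intro smooth_measurable s smooth_partial_deriv)+
      show ?thesis unfolding e_def[abs_def] by measurable
    qed
    have lim: "(\<lambda>n. \<integral>w. e n w * (1 / w) \<partial>lborel) \<longlonglongrightarrow> integral\<^sup>L lborel (\<lambda>w::complex. 0)"
    proof (rule integral_dominated_convergence[where w="\<lambda>w. 2 * B * (indicator (cball 0 S) w / cmod w)"])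
      show "integrable lborel (\<lambda>w::complex. 2 * B * (indicator (cball 0 S) w / cmod w))" by (intro integrable_mult_right integrable_kernel S)
      show "AE w in lborel. norm (e n w * (1 / w)) \<le> 2 * B * (indicator (cball 0 S) w / cmod w)" for n
        by (rule AE_I2, rule kernel_dominator[where f="e n"]) (use eb e0 in \<open>auto simp: norm_divide\<close>)
      show "AE w in lborel. (\<lambda>n. e n w * (1 / w)) \<longlonglongrightarrow> 0"
      proof (rule AE_I2)
        fix w
        have "(\<lambda>h. norm (\<psi> (z - w + h) - \<psi> (z - w) - partial_deriv h \<psi> (z - w)) / norm h) \<midarrow>0\<rightarrow> 0"
          using smooth_has_derivative[OF s, of "z - w"] unfolding has_derivative_at by blast
        then have "((\<lambda>h. norm (\<psi> (z - w + h) - \<psi> (z - w) - partial_deriv h \<psi> (z - w)) / norm h) \<circ> h) \<longlonglongrightarrow> 0"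
          using h0 h unfolding tendsto_at_iff_sequentially by blast
        moreover have "norm (\<psi> (z - w + h n) - \<psi> (z - w) - partial_deriv (h n) \<psi> (z - w)) / norm (h n) = norm (e n w)" for n
          by (simp add: e_def norm_divide algebra_simps)
        ultimately have "(\<lambda>n. e n w) \<longlonglongrightarrow> 0" by (simp add: o_def tendsto_norm_zero_iff)
        then have "(\<lambda>n. e n w * (1 / w)) \<longlonglongrightarrow> 0 * (1 / w)" by (intro tendsto_intros)
        then show "(\<lambda>n. e n w * (1 / w)) \<longlonglongrightarrow> 0" by simp
      qed
    qed measurable
    have "(\<integral>w. e n w * (1 / w) \<partial>lborel) = (plane_convolution \<psi> (z + h n) - plane_convolution \<psi> z - plane_convolution (partial_deriv (h n) \<psi>) z) / of_real (cmod (h n))" for n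
    proof -
      have "(\<integral>w. e n w * (1 / w) \<partial>lborel) = (\<integral>w. (\<psi> (z + h n - w) / w - \<psi> (z - w) / w - partial_deriv (h n) \<psi> (z - w) / w) / of_real (cmod (h n)) \<partial>lborel)"
        by (rule Bochner_Integration.integral_cong) (auto simp: e_def diff_divide_distrib mult.commute)
      then show ?thesis unfolding plane_convolution_def using i0[of "z + h n"] i0[of z] i1[of "h n"] by simp
    qed
    then have "(\<lambda>n. (plane_convolution \<psi> (z + h n) - plane_convolution \<psi> z - plane_convolution (partial_deriv (h n) \<psi>) z) / of_real (cmod (h n))) \<longlonglongrightarrow> 0"
      using lim by simp
    from tendsto_norm_zero[OF this]
    show "((\<lambda>h. norm (plane_convolution \<psi> (z + h) - plane_convolution \<psi> z - plane_convolution (partial_deriv h \<psi>) z) / norm h) \<circ> h) \<longlonglongrightarrow> 0"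
      by (simp add: o_def norm_divide)
  qed
qed

lemma smooth_plane_convolution:
  assumes s: "smooth \<psi>" and R: "\<And>z. R < cmod z \<Longrightarrow> \<psi> z = 0" "R \<ge> 0"
  shows "smooth (plane_convolution \<psi>)"
proof -
  have sm: "smooth (foldr partial_deriv vs \<psi>)" for vs by (induction vs) (auto intro: smooth_partial_deriv s)
  have zr: "\<forall>z. R < cmod z \<longrightarrow> foldr partial_deriv vs \<psi> z = 0" for vs
  proof (induction vs)
    case (Cons v vs)
    then show ?case using partial_deriv_zero[of R "foldr partial_deriv vs \<psi>"] by simp
  qed (use R in auto)
  have d: "(plane_convolution (foldr partial_deriv vs \<psi>) has_derivative (\<lambda>v. plane_convolution (partial_deriv v (foldr partial_deriv vs \<psi>)) z)) (at z)" for vs z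
    by (rule has_derivative_plane_convolution[OF sm _ R(2)]) (use zr in blast)
  have fold: "foldr partial_deriv vs (plane_convolution \<psi>) = plane_convolution (foldr partial_deriv vs \<psi>)" for vs
  proof (induction vs)
    case (Cons v vs)
    show ?case by (simp add: Cons.IH partial_deriv_eq[OF d])
  qed simp
  show ?thesis unfolding smooth_def fold
  proof
    fix vs
    show "plane_convolution (foldr partial_deriv vs \<psi>) differentiable_on UNIV"
      unfolding differentiable_on_def using d[of vs] differentiableI by blast
  qed
qed

lemma test_function_measurable: "test_function \<psi> \<Longrightarrow> \<psi> \<in> borel_measurable borel"
  unfolding test_function_iff by (auto intro: smooth_measurable)

lemma test_function_zero: "test_function \<psi> \<Longrightarrow> z \<notin> unit_disk \<Longrightarrow> \<psi> z = 0"
  by (erule test_function_support) auto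

lemma test_function_bounded:
  assumes "test_function \<psi>" obtains C where "C \<ge> 0" "\<And>z. cmod (\<psi> z) \<le> C"
proof -
  obtain r where r: "0 < r" "r < 1" "\<And>z. r < cmod z \<Longrightarrow> \<psi> z = 0" by (rule test_function_support[OF assms]) blast
  have "continuous_on UNIV \<psi>" using assms by (auto simp: test_function_iff intro: smooth_continuous)
  then show thesis using continuous_compact_support_bounded[of \<psi> r] r(3) that by blast
qed

lemma cauchy_transform_test:
  assumes t: "test_function \<psi>"
  shows "cauchy_transform \<psi> = (\<lambda>z. plane_convolution \<psi> z * (1 / of_real cauchy_const))"
proof
  fix z
  have [measurable]: "\<psi> \<in> borel_measurable borel" by (rule test_function_measurable[OF t])
  have "(\<integral>w. \<psi> w / (z - w) \<partial>disk_measure) = (\<integral>w. \<psi> w / (z - w) \<partial>lborel)"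
    by (rule integral_disk_eq) (use test_function_zero[OF t] in auto)
  also have "\<dots> = (\<integral>w. \<psi> (z - w) / (z - (z - w)) \<partial>lborel)"
    by (rule lborel_integral_reflect(1)[symmetric]) measurable
  finally show "cauchy_transform \<psi> z = plane_convolution \<psi> z * (1 / of_real cauchy_const)"
    by (simp add: cauchy_transform_def plane_convolution_def)
qed

lemma smooth_cauchy_transform_test:
  assumes t: "test_function \<psi>" shows "smooth (cauchy_transform \<psi>)"
proof -
  obtain r where r: "0 < r" "r < 1" "\<And>z. r < cmod z \<Longrightarrow> \<psi> z = 0" by (rule test_function_support[OF t]) blast
  have "smooth (plane_convolution \<psi>)" by (rule smooth_plane_convolution[of _ r]) (use t r in \<open>auto simp: test_function_iff\<close>)
  then show ?thesis unfolding cauchy_transform_test[OF t] by (intro smooth_mult smooth_const)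
qed

lemma cauchy_transform_dbar_test:
  assumes t: "test_function \<psi>" shows "cauchy_transform (dbar \<psi>) z = \<psi> z"
proof -
  obtain r where r: "0 < r" "r < 1" "\<And>z. r < cmod z \<Longrightarrow> \<psi> z = 0" by (rule test_function_support[OF t]) blast
  have "plane_convolution (dbar \<psi>) z = of_real cauchy_const * \<psi> z"
    unfolding plane_convolution_def by (rule cauchy_pompeiu[of _ r]) (use t r in \<open>auto simp: test_function_iff\<close>)
  then show ?thesis using cauchy_const_pos by (simp add: cauchy_transform_test[OF test_function_dbar[OF t]])
qed

text \<open>Under the convolution \<open>dbar\<close> falls on \<open>\<psi>\<close>, so this is
  \<open>cauchy_transform (dbar \<psi>)\<close>, which the Cauchy-Pompeiu formula evaluates.\<close>

lemma dbar_cauchy_transform_test: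
  assumes t: "test_function \<psi>" shows "dbar (cauchy_transform \<psi>) z = \<psi> z"
proof -
  have s: "smooth \<psi>" using t by (simp add: test_function_iff)
  obtain r where r: "0 < r" "r < 1" "\<And>z. r < cmod z \<Longrightarrow> \<psi> z = 0" by (rule test_function_support[OF t]) blast
  have d: "(plane_convolution \<psi> has_derivative (\<lambda>v. plane_convolution (partial_deriv v \<psi>) z)) (at z)"
    by (rule has_derivative_plane_convolution[of _ r]) (use s r in auto)
  have i: "integrable lborel (\<lambda>w. partial_deriv v \<psi> (z - w) / w)" for v
  proof -
    obtain B where B: "B \<ge> 0" "\<And>z v. cmod (partial_deriv v \<psi> z) \<le> B * cmod v"
      using smooth_compact_support_derivative_bound[OF s r(3)] by blast
    show ?thesis
      by (rule plane_convolution_integrable[OF smooth_measurable[OF smooth_partial_deriv[OF s]] B(2), of r])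
         (use r partial_deriv_zero[of r \<psi>] in auto)
  qed
  have "dbar (cauchy_transform \<psi>) z = (plane_convolution (partial_deriv 1 \<psi>) z + \<i> * plane_convolution (partial_deriv \<i> \<psi>) z) / 2 * (1 / of_real cauchy_const)"
    unfolding cauchy_transform_test[OF t] dbar_eq[OF has_derivative_mult_left[OF d]]
    by (simp add: add_divide_distrib mult.commute)
  also have "(plane_convolution (partial_deriv 1 \<psi>) z + \<i> * plane_convolution (partial_deriv \<i> \<psi>) z) / 2 = plane_convolution (dbar \<psi>) z"
  proof -
    have "plane_convolution (dbar \<psi>) z = (\<integral>w. (1/2) * (partial_deriv 1 \<psi> (z - w) / w) + (\<i>/2) * (partial_deriv \<i> \<psi> (z - w) / w) \<partial>lborel)"
      unfolding plane_convolution_def dbar_def by (rule Bochner_Integration.integral_cong) (auto simp: add_divide_distrib)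
    also have "\<dots> = (1/2) * plane_convolution (partial_deriv 1 \<psi>) z + (\<i>/2) * plane_convolution (partial_deriv \<i> \<psi>) z"
      unfolding plane_convolution_def by (rule integral_linear_combination[OF i i])
    finally show ?thesis by (simp add: add_divide_distrib)
  qed
  also have "plane_convolution (dbar \<psi>) z * (1 / of_real cauchy_const) = \<psi> z"
    using cauchy_transform_dbar_test[OF t, of z] by (simp add: cauchy_transform_test[OF test_function_dbar[OF t]])
  finally show ?thesis .
qed

section \<open>Approximation of bounded functions by test functions\<close>

lemma smooth_real_polynomial:
  "real_polynomial_function f \<Longrightarrow> smooth (\<lambda>z. complex_of_real (f z))"
proof (induction rule: real_polynomial_function.induct)
  case (linear f)
  interpret bounded_linear f by fact
  have eq: "complex_of_real (f z) = of_real (f 1) * ((1/2) * (z + cnj z)) + of_real (f \<i>) * ((- \<i>/2) * (z + (-1) * cnj z))" for z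
  proof -
    have "f z = f (Re z *\<^sub>R 1 + Im z *\<^sub>R \<i>)" by (rule arg_cong[where f=f]) (simp add: complex_eq_iff)
    then have "f z = Re z * f 1 + Im z * f \<i>" by (simp only: add scaleR) simp
    moreover have "(1/2) * (z + cnj z) = of_real (Re z)" by (simp add: complex_add_cnj)
    moreover have "(- \<i>/2) * (z + (-1) * cnj z) = of_real (Im z)" by (simp add: complex_eq_iff)
    ultimately show ?thesis by (simp add: mult.commute)
  qed
  have "smooth (\<lambda>z. of_real (f 1) * ((1/2) * (z + cnj z)) + of_real (f \<i>) * ((- \<i>/2) * (z + (-1) * cnj z)))"
    by (intro smooth_add smooth_mult smooth_const smooth_ident smooth_cnj)
  then show ?case by (simp only: eq[symmetric])
qed (auto intro: smooth_const smooth_add smooth_mult)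

lemma smooth_polynomial_function:
  assumes "polynomial_function (f :: complex \<Rightarrow> complex)" shows "smooth f"
proof -
  have "real_polynomial_function (\<lambda>z. Re (f z))" "real_polynomial_function (\<lambda>z. Im (f z))"
    using assms bounded_linear_Re bounded_linear_Im unfolding polynomial_function_def by (auto simp: o_def)
  then have "smooth (\<lambda>z. of_real (Re (f z)) + \<i> * of_real (Im (f z)))"
    by (intro smooth_add smooth_mult smooth_const smooth_real_polynomial)
  then show ?thesis by (simp flip: complex_eq)
qed

text \<open>For \<open>C > 0\<close> this is the radial retraction onto the closed disk of radius
  \<open>C\<close>.\<close>

definition clip :: "real \<Rightarrow> complex \<Rightarrow> complex" where
  "clip C y = y * of_real (C / max C (cmod y))"

lemma clip:
  assumes "C > 0" shows "cmod (clip C y) \<le> C" "cmod y \<le> C \<Longrightarrow> clip C y = y" "continuous_on UNIV (clip C)"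
proof -
  have "cmod y * C \<le> C * max C (cmod y)" using assms by (simp add: mult.commute)
  then show "cmod (clip C y) \<le> C" using assms by (simp add: clip_def norm_mult norm_divide divide_le_eq max_def split: if_splits)
  show "cmod y \<le> C \<Longrightarrow> clip C y = y" using assms by (simp add: clip_def max_def)
  have "max C (cmod y) \<noteq> 0" for y using assms max.cobounded1[of C "cmod y"] by linarith
  then show "continuous_on UNIV (clip C)" unfolding clip_def[abs_def] by (intro continuous_intros) auto
qed

text \<open>A measurable function is an almost everywhere limit of continuous ones. Clipping
  restores the bound, polynomials within \<open>dseq n \<le> 1\<close> bring smoothness at the cost
  of 1 in the bound, and cutoffs that exhaust the disk make the supports compact.\<close>

theorem bounded_approximation_by_tests:
  assumes g: "g \<in> borel_measurable disk_measure" and C: "C > 0" "\<And>z. z \<in> unit_disk \<Longrightarrow> cmod (g z) \<le> C"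
  obtains \<psi> where "\<And>n. test_function (\<psi> n)" "\<And>n z. cmod (\<psi> n z) \<le> C + 1"
    "AE z in disk_measure. (\<lambda>n. \<psi> n z) \<longlonglongrightarrow> g z"
proof -
  have "g measurable_on unit_disk" using g by (simp add: measurable_on_iff_borel_measurable)
  then obtain N h where N: "negligible N" and h: "\<And>n. continuous_on UNIV (h n)"
     and hl: "\<And>x. x \<notin> N \<Longrightarrow> (\<lambda>n. h n x) \<longlonglongrightarrow> (if x \<in> unit_disk then g x else 0)"
    unfolding measurable_on_def by blast
  have "\<exists>p. polynomial_function p \<and> (\<forall>z\<in>cball 0 1. cmod (clip C (h n z) - p z) < dseq n)" for n
  proof (rule Stone_Weierstrass_polynomial_function)
    show "continuous_on (cball 0 1) (\<lambda>z. clip C (h n z))"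
      by (rule continuous_on_compose2[OF clip(3)[OF C(1)] continuous_on_subset[OF h]]) auto
  qed (use dseq in auto)
  then obtain p where p: "\<And>n. polynomial_function (p n)" "\<And>n z. z \<in> cball 0 1 \<Longrightarrow> cmod (clip C (h n z) - p n z) < dseq n"
    by metis
  define r where "r n = 1 - 1 / (real n + 2)" for n
  have r: "0 < r n" "r n < 1" for n by (auto simp: r_def field_simps)
  have "\<exists>\<eta>. test_function \<eta> \<and> (\<forall>z. cmod z \<le> r n \<longrightarrow> \<eta> z = 1) \<and> (\<forall>z. cmod (\<eta> z) \<le> 1)" for n
  proof -
    have R: "r n < (1 + r n) / 2" "(1 + r n) / 2 < 1" using r[of n] by auto
    show ?thesis by (rule cutoff_exists[OF r(1) R]) blast
  qed
  then obtain \<eta> where \<eta>: "\<And>n. test_function (\<eta> n)" "\<And>n z. cmod z \<le> r n \<Longrightarrow> \<eta> n z = 1" "\<And>n z. cmod (\<eta> n z) \<le> 1"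
    by metis
  have pb: "cmod (p n z) \<le> C + 1" if "z \<in> cball 0 1" for n z
  proof -
    have "cmod (p n z) \<le> cmod (clip C (h n z)) + cmod (clip C (h n z) - p n z)"
      using norm_triangle_ineq4[of "clip C (h n z)" "clip C (h n z) - p n z"] by simp
    then show ?thesis using clip(1)[OF C(1), of "h n z"] p(2)[OF that, of n] dseq(2)[of n] by linarith
  qed
  show thesis
  proof
    show "test_function (\<lambda>z. p n z * \<eta> n z)" for n by (intro test_function_mult smooth_polynomial_function p \<eta>)
    show "cmod (p n z * \<eta> n z) \<le> C + 1" for n z
    proof (cases "z \<in> unit_disk")
      case True
      have "cmod (p n z) * cmod (\<eta> n z) \<le> (C + 1) * 1" using True C pb[of z n] \<eta>(3)[of n z] by (intro mult_mono) auto
      then show ?thesis by (simp add: norm_mult)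
    next
      case False
      then show ?thesis using C by (simp add: test_function_zero[OF \<eta>(1)])
    qed
    have "N \<in> null_sets lebesgue" using N by (simp add: negligible_iff_null_sets)
    then have "AE z in lebesgue. z \<notin> N" by (rule AE_not_in)
    then have "AE z in disk_measure. z \<notin> N" by (subst AE_restrict_space_iff) auto
    then show "AE z in disk_measure. (\<lambda>n. p n z * \<eta> n z) \<longlonglongrightarrow> g z"
    proof (rule AE_mp, intro AE_I2 impI)
      fix z assume z: "z \<in> space disk_measure" "z \<notin> N"
      then have zD: "z \<in> unit_disk" by simp
      have "isCont (clip C) (g z)" using clip(3)[OF C(1)] by (simp add: continuous_on_eq_continuous_at)
      moreover have "(\<lambda>n. h n z) \<longlonglongrightarrow> g z" using hl[OF z(2)] zD by simp
      ultimately have "(\<lambda>n. clip C (h n z)) \<longlonglongrightarrow> clip C (g z)" by (rule isCont_tendsto_compose)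
      then have 1: "(\<lambda>n. clip C (h n z)) \<longlonglongrightarrow> g z" using clip(2)[OF C(1) C(2)[OF zD]] by simp
      have 2: "(\<lambda>n. clip C (h n z) - p n z) \<longlonglongrightarrow> 0"
        by (rule Lim_null_comparison[OF _ dseq(3)]) (use p(2)[of z] zD in \<open>auto intro!: always_eventually less_imp_le\<close>)
      from tendsto_diff[OF 1 2] have 3: "(\<lambda>n. p n z) \<longlonglongrightarrow> g z" by simp
      have "r \<longlonglongrightarrow> 1"
      proof -
        have "(\<lambda>n. dseq (Suc n)) \<longlonglongrightarrow> 0" using LIMSEQ_Suc[OF dseq(3)] .
        from tendsto_diff[OF tendsto_const this, of 1] show ?thesis by (simp add: r_def[abs_def] dseq_def add.commute)
      qed
      then have "\<forall>\<^sub>F n in sequentially. cmod z < r n" by (rule order_tendstoD(1)) (use zD in simp)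
      then have "\<forall>\<^sub>F n in sequentially. p n z = p n z * \<eta> n z" by eventually_elim (use \<eta>(2) in simp)
      from Lim_transform_eventually[OF 3 this] show "(\<lambda>n. p n z * \<eta> n z) \<longlonglongrightarrow> g z" .
    qed
  qed
qed

section \<open>Weak dbar-derivatives\<close>

lemma locally_integrable_mult:
  assumes f: "locally_integrable f" and b: "b \<in> borel_measurable disk_measure" "AE z in disk_measure. cmod (b z) \<le> C"
    and r: "r < 1" "\<And>z. r < cmod z \<Longrightarrow> b z = 0"
  shows "integrable disk_measure (\<lambda>z. f z * b z)"
proof -
  define K where "K = cball (0::complex) r"
  have K: "compact K" "K \<subseteq> unit_disk" using r(1) by (auto simp: K_def)
  have fK: "integrable (lebesgue_on K) f" using f K unfolding locally_integrable_def by blast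
  have bK: "b \<in> borel_measurable (lebesgue_on K)" by (rule measurable_restrict_mono[OF b(1) K(2)])
  have "AE z in lebesgue. z \<in> unit_disk \<longrightarrow> cmod (b z) \<le> C" using b(2) by (subst (asm) AE_restrict_space_iff) auto
  then have "AE z in lebesgue. z \<in> K \<longrightarrow> cmod (b z) \<le> C" by eventually_elim (use K(2) in auto)
  then have AEK: "AE z in lebesgue_on K. cmod (b z) \<le> C" by (subst AE_restrict_space_iff) (auto simp: K_def)
  have "integrable (lebesgue_on K) (\<lambda>z. f z * b z)"
  proof (rule Bochner_Integration.integrable_bound)
    show "integrable (lebesgue_on K) (\<lambda>z. C * norm (f z))" using fK by simp
    show "(\<lambda>z. f z * b z) \<in> borel_measurable (lebesgue_on K)" using bK borel_measurable_integrable[OF fK] by measurable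
    show "AE z in lebesgue_on K. norm (f z * b z) \<le> norm (C * norm (f z))"
      using AEK
    proof eventually_elim
      case (elim z)
      have "norm (f z * b z) \<le> C * norm (f z)" unfolding norm_mult using elim by (subst mult.commute) (rule mult_right_mono, auto)
      then show ?case unfolding real_norm_def by (rule order_trans[OF _ abs_ge_self])
    qed
  qed
  then have "integrable lebesgue (\<lambda>z. indicator K z *\<^sub>R (f z * b z))" by (subst (asm) integrable_restrict_space) (auto simp: K_def)
  also have "(\<lambda>z. indicator K z *\<^sub>R (f z * b z)) = (\<lambda>z. indicator unit_disk z *\<^sub>R (f z * b z))"
    using r K(2) by (auto simp: fun_eq_iff indicator_def K_def not_le)
  finally show ?thesis by (subst integrable_restrict_space) auto
qed

lemma locally_integrableI:
  assumes "\<And>r. 0 < r \<Longrightarrow> r < 1 \<Longrightarrow> integrable disk_measure (\<lambda>z. indicator (cball 0 r) z * f z)"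
  shows "locally_integrable f"
  unfolding locally_integrable_def
proof (intro allI impI, elim conjE)
  fix K assume K: "compact K" "K \<subseteq> unit_disk"
  then obtain r where r: "0 < r" "r < 1" "K \<subseteq> cball 0 r" by (rule compact_in_disk)
  have Km: "K \<in> sets lebesgue" using K by (simp add: compact_imp_closed)
  have "integrable lebesgue (\<lambda>z. indicator unit_disk z *\<^sub>R (indicator (cball 0 r) z * f z))"
    using assms[OF r(1,2)] by (subst (asm) integrable_restrict_space) auto
  then have "integrable lebesgue (\<lambda>z. indicator K z *\<^sub>R (indicator unit_disk z *\<^sub>R (indicator (cball 0 r) z * f z)))"
    by (rule integrable_mult_indicator[OF Km])
  also have "(\<lambda>z. indicator K z *\<^sub>R (indicator unit_disk z *\<^sub>R (indicator (cball 0 r) z * f z))) = (\<lambda>z. indicator K z *\<^sub>R f z)"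
    using r(3) K(2) by (auto simp: fun_eq_iff indicator_def)
  finally show "integrable (lebesgue_on K) f" by (subst integrable_restrict_space) (use Km in auto)
qed

lemma locally_integrable_cball:
  assumes "locally_integrable f" "r < 1"
  shows "integrable disk_measure (\<lambda>z. indicator (cball 0 r) z * f z)"
proof -
  have "integrable disk_measure (\<lambda>z. f z * indicator (cball 0 r) z)"
  proof (rule locally_integrable_mult[OF assms(1) _ _ assms(2)])
    show "(indicator (cball 0 r) :: complex \<Rightarrow> complex) \<in> borel_measurable disk_measure" by (rule measurable_disk_borel) (rule borel_measurable_indicator, simp)
    show "AE z in disk_measure. cmod (indicator (cball 0 r) z) \<le> 1" by (intro AE_I2) (simp add: indicator_def)
  qed auto
  then show ?thesis by (simp add: mult.commute)
qed

lemma locally_integrable_measurable: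
  assumes "locally_integrable f" shows "f \<in> borel_measurable disk_measure"
proof (rule borel_measurable_LIMSEQ_metric)
  show "(\<lambda>z. indicator (cball 0 (1 - dseq n)) z * f z) \<in> borel_measurable disk_measure" for n
    by (rule borel_measurable_integrable, rule locally_integrable_cball[OF assms]) (use dseq in auto)
  fix z assume "z \<in> space disk_measure"
  then have "cmod z < 1" by simp
  then have "\<forall>\<^sub>F n in sequentially. dseq n < 1 - cmod z" by (intro order_tendstoD(2)[OF dseq(3)]) simp
  then have "\<forall>\<^sub>F n in sequentially. f z = indicator (cball 0 (1 - dseq n)) z * f z" by eventually_elim (simp add: indicator_def)
  then show "(\<lambda>n. indicator (cball 0 (1 - dseq n)) z * f z) \<longlonglongrightarrow> f z"
    by (rule Lim_transform_eventually[OF tendsto_const])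
qed

lemma locally_integrable_integrable:
  assumes "integrable disk_measure f" shows "locally_integrable f"
proof (rule locally_integrableI)
  fix r :: real
  show "integrable disk_measure (\<lambda>z. indicator (cball 0 r) z * f z)"
  proof (rule Bochner_Integration.integrable_bound[OF assms])
    have "(indicator (cball 0 r) :: complex \<Rightarrow> complex) \<in> borel_measurable disk_measure" by (rule measurable_disk_borel) (rule borel_measurable_indicator, simp)
    then show "(\<lambda>z. indicator (cball 0 r) z * f z) \<in> borel_measurable disk_measure" using borel_measurable_integrable[OF assms] by measurable
  qed (auto simp: norm_mult indicator_def)
qed

lemma L_inf_integrable:
  assumes "f \<in> L_inf" shows "integrable disk_measure f"
proof -
  interpret finite_measure disk_measure by (rule finite_measure_disk)
  from assms obtain C where "f \<in> borel_measurable disk_measure" "AE z in disk_measure. cmod (f z) \<le> C" by (auto simp: L_inf_def)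
  then show ?thesis by (intro integrable_const_bound[of f C]) auto
qed

lemma L_inf_locally_integrable: "f \<in> L_inf \<Longrightarrow> locally_integrable f"
  by (intro locally_integrable_integrable L_inf_integrable)

lemma locally_integrable_add:
  assumes "locally_integrable f" "locally_integrable g" shows "locally_integrable (\<lambda>z. f z + g z)"
proof (rule locally_integrableI)
  fix r :: real assume "r < 1"
  then have "integrable disk_measure (\<lambda>z. indicator (cball 0 r) z * f z + indicator (cball 0 r) z * g z)"
    by (intro Bochner_Integration.integrable_add locally_integrable_cball assms)
  then show "integrable disk_measure (\<lambda>z. indicator (cball 0 r) z * (f z + g z))" by (simp add: distrib_left)
qed

lemma locally_integrable_L_inf_mult:
  assumes "a \<in> L_inf" "locally_integrable f" shows "locally_integrable (\<lambda>z. a z * f z)"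
proof (rule locally_integrableI)
  fix r :: real assume r: "r < 1"
  obtain C where C: "a \<in> borel_measurable disk_measure" "AE z in disk_measure. cmod (a z) \<le> C" using assms(1) by (auto simp: L_inf_def)
  have "integrable disk_measure (\<lambda>z. f z * (indicator (cball 0 r) z * a z))"
  proof (rule locally_integrable_mult[OF assms(2) _ _ r])
    have "(indicator (cball 0 r) :: complex \<Rightarrow> complex) \<in> borel_measurable disk_measure" by (rule measurable_disk_borel) (rule borel_measurable_indicator, simp)
    then show "(\<lambda>z. indicator (cball 0 r) z * a z) \<in> borel_measurable disk_measure" using C(1) by measurable
    show "AE z in disk_measure. cmod (indicator (cball 0 r) z * a z) \<le> C"
      using C(2) by eventually_elim (auto simp: indicator_def norm_mult intro: order_trans[OF norm_ge_zero])
  qed auto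
  then show "integrable disk_measure (\<lambda>z. indicator (cball 0 r) z * (a z * f z))" by (simp add: mult_ac)
qed

lemma test_function_L_inf:
  assumes "test_function \<psi>" shows "\<psi> \<in> L_inf"
proof -
  obtain C where "\<And>z. cmod (\<psi> z) \<le> C" by (rule test_function_bounded[OF assms]) blast
  then show ?thesis unfolding L_inf_def using measurable_disk_borel[OF test_function_measurable[OF assms]] by auto
qed

lemma locally_integrable_test:
  assumes "locally_integrable f" "test_function \<psi>" shows "integrable disk_measure (\<lambda>z. f z * \<psi> z)"
proof -
  obtain C where C: "\<And>z. cmod (\<psi> z) \<le> C" by (rule test_function_bounded[OF assms(2)]) blast
  obtain r where r: "0 < r" "r < 1" "\<And>z. r < cmod z \<Longrightarrow> \<psi> z = 0" by (rule test_function_support[OF assms(2)]) blast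
  show ?thesis
    by (rule locally_integrable_mult[OF assms(1) measurable_disk_borel[OF test_function_measurable[OF assms(2)]] _ r(2,3), of C])
       (use C in auto)
qed

lemma L_inf_approximation_by_tests:
  assumes "g \<in> L_inf"
  obtains \<psi> C where "\<And>n. test_function (\<psi> n)" "C \<ge> 0" "\<And>n z. cmod (\<psi> n z) \<le> C"
    "AE z in disk_measure. (\<lambda>n. \<psi> n z) \<longlonglongrightarrow> g z"
proof -
  obtain C0 where C0: "g \<in> borel_measurable disk_measure" "AE z in disk_measure. cmod (g z) \<le> C0" using assms by (auto simp: L_inf_def)
  \<comment> \<open>\<open>clip\<close> needs a positive radius. It is the identity wherever the
    essential bound holds and forces the bound on the remaining null set.\<close>
  define C where "C = max C0 1"
  have C: "C > 0" by (simp add: C_def)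
  have m: "(\<lambda>z. clip C (g z)) \<in> borel_measurable disk_measure"
    using measurable_compose[OF C0(1) borel_measurable_continuous_onI[OF clip(3)[OF C]]] .
  have b: "cmod (clip C (g z)) \<le> C" if "z \<in> unit_disk" for z by (rule clip(1)[OF C])
  obtain \<psi> where \<psi>: "\<And>n. test_function (\<psi> n)" "\<And>n z. cmod (\<psi> n z) \<le> C + 1"
    "AE z in disk_measure. (\<lambda>n. \<psi> n z) \<longlonglongrightarrow> clip C (g z)"
    by (rule bounded_approximation_by_tests[OF m C b]) (use that in blast)+
  have lim: "AE z in disk_measure. (\<lambda>n. \<psi> n z) \<longlonglongrightarrow> g z"
    using \<psi>(3) C0(2)
  proof eventually_elim
    case (elim z)
    have "cmod (g z) \<le> C" using elim(2) by (simp add: C_def)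
    then show ?case using elim(1) clip(2)[OF C, of "g z"] by simp
  qed
  have "C + 1 \<ge> 0" using C by simp
  from \<psi>(1) this \<psi>(2) lim show thesis by (rule that)
qed

text \<open>Paired with \<open>cnj u / cmod u\<close>, the function \<open>u\<close> yields its own
  L1 norm. That quotient is a bounded limit of test functions on a smaller disk, and a cutoff
  confines the pairing to a region where \<open>u\<close> is integrable.\<close>

theorem fundamental_lemma:
  assumes u: "locally_integrable u" and z: "\<And>\<psi>. test_function \<psi> \<Longrightarrow> (\<integral>z. u z * \<psi> z \<partial>disk_measure) = 0"
  shows "AE z in disk_measure. u z = 0"
proof -
  have um: "u \<in> borel_measurable disk_measure" by (rule locally_integrable_measurable[OF u])
  have main: "AE z in disk_measure. cmod z \<le> r \<longrightarrow> u z = 0" if r: "0 < r" "r < 1" for r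
  proof -
    \<comment> \<open>At zeros of \<open>u\<close> the quotient is 0 by convention, so
      \<open>u z * g z = cmod (u z)\<close> holds on all of \<open>cball 0 r\<close>.\<close>
    define g where "g z = indicator (cball 0 r) z * (cnj (u z) / of_real (cmod (u z)))" for z
    have "(cnj :: complex \<Rightarrow> complex) \<in> borel_measurable borel"
      by (rule borel_measurable_continuous_onI) (intro continuous_intros)
    from measurable_compose[OF um this] have [measurable]: "(\<lambda>z. cnj (u z)) \<in> borel_measurable disk_measure" .
    have [measurable]: "(indicator (cball 0 r) :: complex \<Rightarrow> complex) \<in> borel_measurable disk_measure"
      by (rule measurable_disk_borel) (rule borel_measurable_indicator, simp)
    have gm: "g \<in> borel_measurable disk_measure" unfolding g_def[abs_def] using um by measurable
    have gb: "cmod (g z) \<le> 1" for z by (simp add: g_def norm_divide norm_mult indicator_def)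
    have "g \<in> L_inf" unfolding L_inf_def using gm gb by auto
    then obtain \<psi> C where \<psi>: "\<And>n. test_function (\<psi> n)" "C \<ge> 0" "\<And>n z. cmod (\<psi> n z) \<le> C"
      "AE z in disk_measure. (\<lambda>n. \<psi> n z) \<longlonglongrightarrow> g z"
      by (rule L_inf_approximation_by_tests) (use that in blast)
    have R: "r < (1 + r) / 2" "(1 + r) / 2 < 1" using r by auto
    obtain \<eta> where \<eta>: "test_function \<eta>" "\<And>z. cmod z \<le> r \<Longrightarrow> \<eta> z = 1" "\<And>z. (1 + r) / 2 < cmod z \<Longrightarrow> \<eta> z = 0" "\<And>z. cmod (\<eta> z) \<le> 1"
      by (rule cutoff_exists[OF r(1) R]) blast
    have zero: "(\<integral>z. u z * (\<psi> n z * \<eta> z) \<partial>disk_measure) = 0" for n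
    proof (rule z, rule test_function_mult[OF _ \<eta>(1)])
      show "smooth (\<psi> n)" using \<psi>(1)[of n] by (simp add: test_function_iff)
    qed
    have iu: "integrable disk_measure (\<lambda>z. u z * \<eta> z)" by (rule locally_integrable_test[OF u \<eta>(1)])
    have [measurable]: "\<psi> n \<in> borel_measurable disk_measure" "\<eta> \<in> borel_measurable disk_measure" for n
      by (intro measurable_disk_borel test_function_measurable \<psi> \<eta>)+
    have "(\<lambda>n. \<integral>z. u z * (\<psi> n z * \<eta> z) \<partial>disk_measure) \<longlonglongrightarrow> (\<integral>z. u z * (g z * \<eta> z) \<partial>disk_measure)"
    proof (rule integral_dominated_convergence[where w="\<lambda>z. C * norm (u z * \<eta> z)"])
      show "AE z in disk_measure. (\<lambda>n. u z * (\<psi> n z * \<eta> z)) \<longlonglongrightarrow> u z * (g z * \<eta> z)"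
        using \<psi>(4) by eventually_elim (intro tendsto_intros)
      show "AE z in disk_measure. norm (u z * (\<psi> n z * \<eta> z)) \<le> C * norm (u z * \<eta> z)" for n
      proof (rule AE_I2)
        fix z
        have "cmod (\<psi> n z) * norm (u z * \<eta> z) \<le> C * norm (u z * \<eta> z)" by (rule mult_right_mono[OF \<psi>(3)]) simp
        then show "norm (u z * (\<psi> n z * \<eta> z)) \<le> C * norm (u z * \<eta> z)" by (simp add: norm_mult mult_ac)
      qed
      show "integrable disk_measure (\<lambda>z. C * norm (u z * \<eta> z))" using iu by simp
    qed (use um gm in measurable)
    then have "(\<integral>z. u z * (g z * \<eta> z) \<partial>disk_measure) = 0" using LIMSEQ_unique[OF _ tendsto_const] by (simp add: zero)
    moreover have "u z * (g z * \<eta> z) = of_real (if cmod z \<le> r then cmod (u z) else 0)" for z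
    proof (cases "cmod z \<le> r \<and> u z \<noteq> 0")
      case True
      have "u z * cnj (u z) = of_real (cmod (u z)) * of_real (cmod (u z))" using complex_norm_square[of "u z"] by (simp add: power2_eq_square)
      then show ?thesis using True \<eta>(2)[of z] by (simp add: g_def)
    qed (auto simp: g_def)
    ultimately have "(\<integral>z. complex_of_real (if cmod z \<le> r then cmod (u z) else 0) \<partial>disk_measure) = 0" by simp
    then have 0: "(\<integral>z. (if cmod z \<le> r then cmod (u z) else 0) \<partial>disk_measure) = 0"
      by (simp only: integral_complex_of_real of_real_eq_0_iff)
    have "integrable disk_measure (\<lambda>z. if cmod z \<le> r then cmod (u z) else 0)"
      using integrable_norm[OF locally_integrable_cball[OF u r(2)]]
      by (rule Bochner_Integration.integrable_cong[OF refl, THEN iffD1, rotated]) (auto simp: indicator_def norm_mult)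
    from integral_nonneg_eq_0_iff_AE[OF this] 0
    have "AE z in disk_measure. (if cmod z \<le> r then cmod (u z) else 0) = 0" by simp
    then show ?thesis by eventually_elim (auto split: if_splits)
  qed
  have "AE z in disk_measure. \<forall>n. cmod z \<le> 1 - dseq (Suc n) \<longrightarrow> u z = 0"
    unfolding AE_all_countable by (intro allI main) (auto simp: dseq_def field_simps)
  then show ?thesis
  proof (rule AE_mp, intro AE_I2 impI)
    fix z assume z: "z \<in> space disk_measure" and all: "\<forall>n. cmod z \<le> 1 - dseq (Suc n) \<longrightarrow> u z = 0"
    have "\<forall>\<^sub>F n in sequentially. dseq (Suc n) < 1 - cmod z"
      by (rule order_tendstoD(2)[OF LIMSEQ_Suc[OF dseq(3)]]) (use z in simp)
    then obtain n where "dseq (Suc n) < 1 - cmod z" by (auto simp: eventually_sequentially)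
    then have "cmod z \<le> 1 - dseq (Suc n)" by linarith
    then show "u z = 0" using all by blast
  qed
qed

text \<open>The kernel \<open>1 / (z - w)\<close> changes sign when its variables are exchanged,
  hence the minus sign. Its absolute integral over the disk is at most \<open>kernel_mass 2\<close>
  uniformly in the pole, so integrability of \<open>g\<close> is enough for Fubini's
  theorem.\<close>

lemma cauchy_transform_fubini:
  assumes g: "integrable disk_measure g" and b: "b \<in> borel_measurable disk_measure" "\<And>z. z \<in> unit_disk \<Longrightarrow> cmod (b z) \<le> C"
  shows "integrable disk_measure (\<lambda>z. cauchy_transform g z * b z)"
    "(\<integral>z. cauchy_transform g z * b z \<partial>disk_measure) = - (\<integral>w. g w * cauchy_transform b w \<partial>disk_measure)"
proof -
  interpret fm: finite_measure disk_measure by (rule finite_measure_disk)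
  interpret pair_sigma_finite disk_measure disk_measure by (intro pair_sigma_finite.intro fm.sigma_finite_measure_axioms)
  note gm = borel_measurable_integrable[OF g]
  have "cmod (b 0) \<le> C" by (rule b(2)) simp
  then have C0: "C \<ge> 0" by (rule order_trans[OF norm_ge_zero])
  define f where "f w z = g w * (b z / (z - w))" for w z
  have bAE: "AE z in disk_measure. cmod (b z) \<le> C" by (rule AE_I2) (use b(2) in simp)
  have ib: "integrable disk_measure (\<lambda>z. b z / (z - w))" for w
  proof -
    have "integrable disk_measure (\<lambda>z. - (b z / (w - z)))"
      by (rule integrable_minus[OF cauchy_transform_integrable[OF b(1) bAE]])
    also have "(\<lambda>z. - (b z / (w - z))) = (\<lambda>z. b z / (z - w))" by (simp add: minus_divide_right)
    finally show ?thesis .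
  qed
  have idm: "(\<lambda>x. x) \<in> borel_measurable disk_measure" by (rule measurable_disk_borel) simp
  have fmeas: "case_prod f \<in> borel_measurable (disk_measure \<Otimes>\<^sub>M disk_measure)"
  proof -
    have "(\<lambda>x. g (fst x)) \<in> borel_measurable (disk_measure \<Otimes>\<^sub>M disk_measure)" by (rule measurable_compose[OF measurable_fst gm])
    moreover have "(\<lambda>x. b (snd x)) \<in> borel_measurable (disk_measure \<Otimes>\<^sub>M disk_measure)" by (rule measurable_compose[OF measurable_snd b(1)])
    moreover have "(\<lambda>x. fst x) \<in> borel_measurable (disk_measure \<Otimes>\<^sub>M disk_measure)" by (rule measurable_compose[OF measurable_fst idm])
    moreover have "(\<lambda>x. snd x) \<in> borel_measurable (disk_measure \<Otimes>\<^sub>M disk_measure)" by (rule measurable_compose[OF measurable_snd idm])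
    ultimately have "(\<lambda>x. g (fst x) * (b (snd x) / (snd x - fst x))) \<in> borel_measurable (disk_measure \<Otimes>\<^sub>M disk_measure)"
      by (intro borel_measurable_times borel_measurable_divide borel_measurable_diff)
    then show ?thesis by (simp add: f_def case_prod_beta')
  qed
  have int: "integrable (disk_measure \<Otimes>\<^sub>M disk_measure) (case_prod f)"
  proof (rule Fubini_integrable[OF fmeas])
    show "AE w in disk_measure. integrable disk_measure (\<lambda>z. case_prod f (w, z))"
      unfolding f_def by (intro AE_I2) (simp only: prod.case, rule integrable_mult_right, rule ib)
    show "integrable disk_measure (\<lambda>w. \<integral>z. norm (case_prod f (w, z)) \<partial>disk_measure)"
    proof (rule Bochner_Integration.integrable_bound)
      show "integrable disk_measure (\<lambda>w. norm (g w) * (C * kernel_mass 2))" using g by simp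
      show "(\<lambda>w. \<integral>z. norm (case_prod f (w, z)) \<partial>disk_measure) \<in> borel_measurable disk_measure"
      proof (rule fm.borel_measurable_lebesgue_integral)
        show "(\<lambda>(w, z). norm (case_prod f (w, z))) \<in> borel_measurable (disk_measure \<Otimes>\<^sub>M disk_measure)"
          using measurable_compose[OF fmeas borel_measurable_norm] by (simp add: case_prod_beta')
      qed
      show "AE w in disk_measure. norm (\<integral>z. norm (case_prod f (w, z)) \<partial>disk_measure) \<le> norm (norm (g w) * (C * kernel_mass 2))"
      proof (rule AE_I2)
        fix w assume w: "w \<in> space disk_measure"
        have "(\<integral>z. norm (f w z) \<partial>disk_measure) = norm (g w) * (\<integral>z. norm (b z / (z - w)) \<partial>disk_measure)"
          unfolding f_def norm_mult by (rule integral_mult_right_zero)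
        also have "\<dots> \<le> norm (g w) * (\<integral>z. C * (1 / cmod (w - z)) \<partial>disk_measure)"
        proof (intro mult_left_mono integral_mono_AE)
          show "integrable disk_measure (\<lambda>z. norm (b z / (z - w)))" using ib by simp
          show "integrable disk_measure (\<lambda>z. C * (1 / cmod (w - z)))" by (intro integrable_mult_right disk_kernel_bound(1)[of w "cmod w"]) simp
          show "AE z in disk_measure. norm (b z / (z - w)) \<le> C * (1 / cmod (w - z))"
            using bAE by eventually_elim (simp add: norm_divide norm_minus_commute divide_right_mono)
        qed simp
        also have "(\<integral>z. C * (1 / cmod (w - z)) \<partial>disk_measure) = C * (\<integral>z. 1 / cmod (w - z) \<partial>disk_measure)" by (rule integral_mult_right_zero)
        also have "\<dots> \<le> C * kernel_mass 2"
          using disk_kernel_bound(2)[of w 1] w C0 by (intro mult_left_mono) auto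
        finally have "(\<integral>z. norm (f w z) \<partial>disk_measure) \<le> norm (g w) * (C * kernel_mass 2)" by (simp add: mult_left_mono)
        moreover have "0 \<le> (\<integral>z. norm (f w z) \<partial>disk_measure)" by (rule integral_nonneg_AE) simp
        ultimately show "norm (\<integral>z. norm (case_prod f (w, z)) \<partial>disk_measure) \<le> norm (norm (g w) * (C * kernel_mass 2))"
          by simp
      qed
    qed
  qed
  have inner: "(\<integral>w. f w z \<partial>disk_measure) = of_real cauchy_const * (cauchy_transform g z * b z)" for z
  proof -
    have "(\<integral>w. f w z \<partial>disk_measure) = (\<integral>w. (g w / (z - w)) * b z \<partial>disk_measure)"
      unfolding f_def by (rule Bochner_Integration.integral_cong) auto
    also have "\<dots> = (\<integral>w. g w / (z - w) \<partial>disk_measure) * b z" by (rule integral_mult_left_zero)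
    finally show ?thesis using cauchy_const_pos by (simp add: cauchy_transform_def)
  qed
  have outer: "(\<integral>z. f w z \<partial>disk_measure) = - (of_real cauchy_const * (g w * cauchy_transform b w))" for w
  proof -
    have "(\<integral>z. f w z \<partial>disk_measure) = (\<integral>z. (- g w) * (b z / (w - z)) \<partial>disk_measure)"
      unfolding f_def by (rule Bochner_Integration.integral_cong) (auto simp: minus_divide_right)
    also have "\<dots> = (- g w) * (\<integral>z. b z / (w - z) \<partial>disk_measure)" by (rule integral_mult_right_zero)
    finally show ?thesis using cauchy_const_pos by (simp add: cauchy_transform_def)
  qed
  have "integrable disk_measure (\<lambda>z. \<integral>w. f w z \<partial>disk_measure)" using integrable_snd[OF int] .
  then have "integrable disk_measure (\<lambda>z. (1 / of_real cauchy_const) * (of_real cauchy_const * (cauchy_transform g z * b z)))"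
    unfolding inner by (rule integrable_mult_right)
  then show "integrable disk_measure (\<lambda>z. cauchy_transform g z * b z)" using cauchy_const_pos by simp
  have "(\<integral>z. \<integral>w. f w z \<partial>disk_measure \<partial>disk_measure) = (\<integral>w. \<integral>z. f w z \<partial>disk_measure \<partial>disk_measure)"
    by (rule Fubini_integral[OF int])
  then have "of_real cauchy_const * (\<integral>z. cauchy_transform g z * b z \<partial>disk_measure) = - (of_real cauchy_const * (\<integral>w. g w * cauchy_transform b w \<partial>disk_measure))"
    unfolding inner outer by simp
  then have "of_real cauchy_const * (\<integral>z. cauchy_transform g z * b z \<partial>disk_measure) = of_real cauchy_const * (- (\<integral>w. g w * cauchy_transform b w \<partial>disk_measure))"
    by simp
  then show "(\<integral>z. cauchy_transform g z * b z \<partial>disk_measure) = - (\<integral>w. g w * cauchy_transform b w \<partial>disk_measure)"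
    using cauchy_const_pos by (subst (asm) mult_cancel_left) auto
qed

lemma cauchy_transform_locally_integrable:
  assumes g: "integrable disk_measure g" shows "locally_integrable (cauchy_transform g)"
proof (rule locally_integrable_integrable)
  have "integrable disk_measure (\<lambda>z. cauchy_transform g z * 1)"
    by (rule cauchy_transform_fubini(1)[OF g, where C=1]) auto
  then show "integrable disk_measure (cauchy_transform g)" by simp
qed

lemma cauchy_transform_test_pairing:
  assumes g: "integrable disk_measure g" and t: "test_function \<psi>"
  shows "(\<integral>z. cauchy_transform g z * \<psi> z \<partial>disk_measure) = - (\<integral>w. g w * cauchy_transform \<psi> w \<partial>disk_measure)"
proof -
  obtain C where C: "\<And>z. cmod (\<psi> z) \<le> C" by (rule test_function_bounded[OF t]) blast
  show ?thesis
    by (rule cauchy_transform_fubini(2)[OF g measurable_disk_borel[OF test_function_measurable[OF t]] C])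
qed

text \<open>Antisymmetry moves the transform onto \<open>dbar \<psi>\<close>, where it returns
  \<open>\<psi>\<close> by \<open>cauchy_transform_dbar_test\<close>.\<close>

lemma weak_deriv_cauchy_transform:
  assumes g: "integrable disk_measure g" shows "weak_deriv dbar (cauchy_transform g) g"
  unfolding weak_deriv_def
proof (intro conjI allI impI)
  fix \<psi> assume t: "test_function \<psi>"
  show "(\<integral>z. cauchy_transform g z * dbar \<psi> z \<partial>disk_measure) = - (\<integral>z. g z * \<psi> z \<partial>disk_measure)"
    using cauchy_transform_test_pairing[OF g test_function_dbar[OF t]] by (simp add: cauchy_transform_dbar_test[OF t])
qed (intro cauchy_transform_locally_integrable locally_integrable_integrable g)+

text \<open>By duality: \<open>cauchy_transform \<psi>\<close> is smooth with \<open>dbar\<close>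
  equal to \<open>\<psi>\<close>, and after multiplication by \<open>\<eta>\<close> it has compact
  support and may be inserted into the weak equation. This gives the identity tested against every
  \<open>\<psi>\<close>, and the fundamental lemma removes the test.\<close>

theorem weak_deriv_representation:
  assumes w: "weak_deriv dbar u h" and t: "test_function \<eta>"
  shows "integrable disk_measure (\<lambda>z. u z * dbar \<eta> z + h z * \<eta> z)"
    "AE z in disk_measure. u z * \<eta> z = cauchy_transform (\<lambda>z. u z * dbar \<eta> z + h z * \<eta> z) z"
proof -
  have lu: "locally_integrable u" and lh: "locally_integrable h" using w by (auto simp: weak_deriv_def)
  define g where "g z = u z * dbar \<eta> z + h z * \<eta> z" for z
  have g: "integrable disk_measure g"
    unfolding g_def[abs_def] by (intro Bochner_Integration.integrable_add locally_integrable_test lu lh t test_function_dbar)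
  then show "integrable disk_measure (\<lambda>z. u z * dbar \<eta> z + h z * \<eta> z)" by (simp add: g_def[abs_def])
  have iu: "integrable disk_measure (\<lambda>z. u z * \<eta> z)" by (rule locally_integrable_test[OF lu t])
  have "AE z in disk_measure. u z * \<eta> z + (- 1) * cauchy_transform g z = 0"
  proof (rule fundamental_lemma)
    have "integrable disk_measure (\<lambda>z. cauchy_transform g z * 1)"
      by (rule cauchy_transform_fubini(1)[OF g, where C=1]) auto
    then have ig: "integrable disk_measure (cauchy_transform g)" by simp
    show "locally_integrable (\<lambda>z. u z * \<eta> z + (- 1) * cauchy_transform g z)"
      by (intro locally_integrable_integrable Bochner_Integration.integrable_add iu integrable_mult_right ig)
    fix \<psi> assume p: "test_function \<psi>"
    have s: "smooth (cauchy_transform \<psi>)" by (rule smooth_cauchy_transform_test[OF p])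
    have tt: "test_function (\<lambda>z. cauchy_transform \<psi> z * \<eta> z)" by (rule test_function_mult[OF s t])
    have s\<eta>: "smooth \<eta>" "smooth \<psi>" using t p by (auto simp: test_function_iff)
    have t1: "test_function (\<lambda>z. \<psi> z * \<eta> z)" by (rule test_function_mult[OF s\<eta>(2) t])
    have t2: "test_function (\<lambda>z. cauchy_transform \<psi> z * dbar \<eta> z)" by (rule test_function_mult[OF s test_function_dbar[OF t]])
    have d: "dbar (\<lambda>z. cauchy_transform \<psi> z * \<eta> z) z = cauchy_transform \<psi> z * dbar \<eta> z + \<psi> z * \<eta> z" for z
      using dbar_smooth_mult[OF s s\<eta>(1)] dbar_cauchy_transform_test[OF p] by simp
    have "(\<integral>z. u z * dbar (\<lambda>z. cauchy_transform \<psi> z * \<eta> z) z \<partial>disk_measure) = - (\<integral>z. h z * (cauchy_transform \<psi> z * \<eta> z) \<partial>disk_measure)"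
      using w tt unfolding weak_deriv_def by blast
    then have 1: "(\<integral>z. u z * (cauchy_transform \<psi> z * dbar \<eta> z) \<partial>disk_measure) + (\<integral>z. u z * (\<psi> z * \<eta> z) \<partial>disk_measure) = - (\<integral>z. h z * (cauchy_transform \<psi> z * \<eta> z) \<partial>disk_measure)"
      unfolding d distrib_left using locally_integrable_test[OF lu t2] locally_integrable_test[OF lu t1] by simp
    have 2: "(\<integral>z. g z * cauchy_transform \<psi> z \<partial>disk_measure) = (\<integral>z. u z * (cauchy_transform \<psi> z * dbar \<eta> z) \<partial>disk_measure) + (\<integral>z. h z * (cauchy_transform \<psi> z * \<eta> z) \<partial>disk_measure)"
    proof -
      have "(\<integral>z. g z * cauchy_transform \<psi> z \<partial>disk_measure) = (\<integral>z. u z * (cauchy_transform \<psi> z * dbar \<eta> z) + h z * (cauchy_transform \<psi> z * \<eta> z) \<partial>disk_measure)"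
        unfolding g_def by (rule Bochner_Integration.integral_cong) (auto simp: algebra_simps)
      then show ?thesis using locally_integrable_test[OF lu t2] locally_integrable_test[OF lh tt] by simp
    qed
    \<comment> \<open>Antisymmetry, the splitting of \<open>g\<close> and the weak equation are
      three linear relations; eliminating the terms with \<open>cauchy_transform \<psi>\<close>
      leaves this one.\<close>
    have 3: "(\<integral>z. cauchy_transform g z * \<psi> z \<partial>disk_measure) = (\<integral>z. u z * (\<psi> z * \<eta> z) \<partial>disk_measure)"
    proof -
      have "P = Y" if "P = - Q" "Q = X + Z" "X + Y = - Z" for P Q X Y Z :: complex
        using that by algebra
      from this[OF cauchy_transform_test_pairing[OF g p] 2 1] show ?thesis .
    qed
    have "(\<integral>z. (u z * \<eta> z + (- 1) * cauchy_transform g z) * \<psi> z \<partial>disk_measure) = (\<integral>z. 1 * (u z * (\<psi> z * \<eta> z)) + (- 1) * (cauchy_transform g z * \<psi> z) \<partial>disk_measure)"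
      by (rule Bochner_Integration.integral_cong) (auto simp: algebra_simps)
    also have "\<dots> = 1 * (\<integral>z. u z * (\<psi> z * \<eta> z) \<partial>disk_measure) + (- 1) * (\<integral>z. cauchy_transform g z * \<psi> z \<partial>disk_measure)"
      by (rule integral_linear_combination[OF locally_integrable_test[OF lu t1] locally_integrable_test[OF locally_integrable_integrable[OF ig] p]])
    finally show "(\<integral>z. (u z * \<eta> z + (- 1) * cauchy_transform g z) * \<psi> z \<partial>disk_measure) = 0" using 3 by simp
  qed
  then show "AE z in disk_measure. u z * \<eta> z = cauchy_transform (\<lambda>z. u z * dbar \<eta> z + h z * \<eta> z) z"
    by eventually_elim (simp add: g_def[abs_def])
qed

text \<open>The pole stays away from the mass of \<open>g\<close>, so differentiation under the
  integral is dominated although \<open>g\<close> is merely integrable.\<close>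

lemma cauchy_transform_holomorphic:
  assumes g: "integrable disk_measure g" and z: "\<And>w. cmod w < r \<Longrightarrow> g w = 0"
  shows "cauchy_transform g holomorphic_on ball 0 r"
  unfolding holomorphic_on_def
proof
  fix z0 :: complex assume z0: "z0 \<in> ball 0 r"
  \<comment> \<open>Half the distance from \<open>z0\<close> to the circle of radius
    \<open>r\<close>: for \<open>z\<close> within \<open>\<delta>\<close> of \<open>z0\<close>,
    every point with \<open>g \<noteq> 0\<close> is still at distance at least
    \<open>\<delta>\<close>.\<close>
  define \<delta> where "\<delta> = (r - cmod z0) / 2"
  have \<delta>: "\<delta> > 0" using z0 by (simp add: \<delta>_def)
  note gm = borel_measurable_integrable[OF g]
  have zm [measurable]: "(\<lambda>w. z - w) \<in> borel_measurable disk_measure" for z by (rule measurable_disk_borel) measurable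
  have far: "g w = 0 \<or> \<delta> \<le> cmod (z - w)" if "z \<in> ball z0 \<delta>" for z w
  proof (cases "cmod w < r")
    case False
    have "cmod w \<le> cmod (z - w) + cmod (z - z0) + cmod z0"
      using norm_triangle_ineq4[of z "z - w"] norm_triangle_ineq[of "z - z0" z0] by simp
    moreover have "cmod (z - z0) < \<delta>" using that by (simp add: dist_norm norm_minus_commute)
    ultimately show ?thesis using False by (simp add: \<delta>_def field_simps)
  qed (use z in simp)
  have i: "integrable disk_measure (\<lambda>w. g w / (z - w))" if "z \<in> ball z0 \<delta>" for z
  proof (rule Bochner_Integration.integrable_bound)
    show "integrable disk_measure (\<lambda>w. norm (g w) / \<delta>)" using g by simp
    show "AE w in disk_measure. norm (g w / (z - w)) \<le> norm (norm (g w) / \<delta>)"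
    proof (rule AE_I2)
      fix w
      show "norm (g w / (z - w)) \<le> norm (norm (g w) / \<delta>)"
      proof (cases "g w = 0")
        case False
        then have "\<delta> \<le> cmod (z - w)" using far[OF that, of w] by auto
        then show ?thesis using \<delta> by (simp add: norm_divide frac_le)
      qed simp
    qed
  qed (use gm in measurable)
  define D where "D = (\<integral>w. - (g w / ((z0 - w) * (z0 - w))) \<partial>disk_measure) / of_real cauchy_const"
  have "((\<lambda>z. (cauchy_transform g z - cauchy_transform g z0) / (z - z0)) \<longlongrightarrow> D) (at z0 within ball z0 \<delta>)"
    unfolding tendsto_at_iff_sequentially
  proof (intro allI impI)
    fix x :: "nat \<Rightarrow> complex" assume x: "\<forall>n. x n \<in> ball z0 \<delta> - {z0}" "x \<longlonglongrightarrow> z0"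
    have zb: "z0 \<in> ball z0 \<delta>" using \<delta> by simp
    have "(\<lambda>n. \<integral>w. - (g w / ((x n - w) * (z0 - w))) \<partial>disk_measure) \<longlonglongrightarrow> (\<integral>w. - (g w / ((z0 - w) * (z0 - w))) \<partial>disk_measure)"
    proof (rule integral_dominated_convergence[where w="\<lambda>w. norm (g w) / (\<delta> * \<delta>)"])
      show "integrable disk_measure (\<lambda>w. norm (g w) / (\<delta> * \<delta>))" using g by simp
      show "AE w in disk_measure. norm (- (g w / ((x n - w) * (z0 - w)))) \<le> norm (g w) / (\<delta> * \<delta>)" for n
      proof (rule AE_I2)
        fix w
        have xn: "x n \<in> ball z0 \<delta>" using x by blast
        show "norm (- (g w / ((x n - w) * (z0 - w)))) \<le> norm (g w) / (\<delta> * \<delta>)"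
        proof (cases "g w = 0")
          case False
          then have "\<delta> \<le> cmod (x n - w)" "\<delta> \<le> cmod (z0 - w)" using far[OF xn, of w] far[OF zb, of w] by auto
          then have "\<delta> * \<delta> \<le> cmod (x n - w) * cmod (z0 - w)" using \<delta> by (intro mult_mono) auto
          then show ?thesis using \<delta> by (simp add: norm_divide norm_mult frac_le)
        qed simp
      qed
      show "AE w in disk_measure. (\<lambda>n. - (g w / ((x n - w) * (z0 - w)))) \<longlonglongrightarrow> - (g w / ((z0 - w) * (z0 - w)))"
      proof (rule AE_I2)
        fix w
        show "(\<lambda>n. - (g w / ((x n - w) * (z0 - w)))) \<longlonglongrightarrow> - (g w / ((z0 - w) * (z0 - w)))"
        proof (cases "g w = 0")
          case False
          then have "z0 - w \<noteq> 0" using far[OF zb, of w] \<delta> by auto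
          then show ?thesis by (intro tendsto_intros x) auto
        qed simp
      qed
    qed (use gm in measurable)
    then have "(\<lambda>n. (\<integral>w. - (g w / ((x n - w) * (z0 - w))) \<partial>disk_measure) / of_real cauchy_const) \<longlonglongrightarrow> D"
      unfolding D_def using cauchy_const_pos by (intro tendsto_intros) auto
    moreover have "(\<integral>w. - (g w / ((x n - w) * (z0 - w))) \<partial>disk_measure) / of_real cauchy_const = (cauchy_transform g (x n) - cauchy_transform g z0) / (x n - z0)" for n
    proof -
      have xn: "x n \<in> ball z0 \<delta>" "x n \<noteq> z0" using x by blast+
      have "(\<integral>w. - (g w / ((x n - w) * (z0 - w))) \<partial>disk_measure) = (\<integral>w. (g w / (x n - w) - g w / (z0 - w)) / (x n - z0) \<partial>disk_measure)"
      proof (rule Bochner_Integration.integral_cong[OF refl])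
        fix w
        show "- (g w / ((x n - w) * (z0 - w))) = (g w / (x n - w) - g w / (z0 - w)) / (x n - z0)"
        proof (cases "g w = 0")
          case False
          then have "x n - w \<noteq> 0" "z0 - w \<noteq> 0" using far[OF xn(1), of w] far[OF zb, of w] \<delta> by auto
          moreover have "x n - z0 \<noteq> 0" using xn by simp
          moreover have "- (g w / (a * b)) = (g w / a - g w / b) / (a - b)" if "a \<noteq> 0" "b \<noteq> 0" "a - b \<noteq> 0" for a b :: complex
            using that by (simp add: field_simps)
          from this[of "x n - w" "z0 - w"] calculation show ?thesis by simp
        qed simp
      qed
      also have "\<dots> = ((\<integral>w. g w / (x n - w) \<partial>disk_measure) - (\<integral>w. g w / (z0 - w) \<partial>disk_measure)) / (x n - z0)"
        using i[OF xn(1)] i[OF zb] by simp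
      finally show ?thesis by (simp add: cauchy_transform_def diff_divide_distrib mult.commute)
    qed
    ultimately show "((\<lambda>z. (cauchy_transform g z - cauchy_transform g z0) / (z - z0)) \<circ> x) \<longlonglongrightarrow> D" by (simp add: o_def)
  qed
  then have "((\<lambda>z. (cauchy_transform g z - cauchy_transform g z0) / (z - z0)) \<longlongrightarrow> D) (at z0)"
    using at_within_open[of z0 "ball z0 \<delta>"] \<delta> by simp
  then have "(cauchy_transform g has_field_derivative D) (at z0)" by (simp add: has_field_derivative_iff)
  then show "cauchy_transform g field_differentiable at z0 within ball 0 r"
    unfolding field_differentiable_def using has_field_derivative_at_within by blast
qed

text \<open>The set where two continuous functions differ is open, and a nonempty open set is not
  null. This turns identities almost everywhere into identities on circles.\<close>

lemma AE_disk_eq_imp_eq: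
  fixes f g :: "complex \<Rightarrow> complex"
  assumes S: "open S" "S \<subseteq> unit_disk" and c: "continuous_on S f" "continuous_on S g"
    and ae: "AE z in disk_measure. z \<in> S \<longrightarrow> f z = g z" and z: "z \<in> S"
  shows "f z = g z"
proof (rule ccontr)
  assume ne: "f z \<noteq> g z"
  define U where "U = S \<inter> (\<lambda>z. f z - g z) -` (- {0})"
  have "open U" unfolding U_def
    by (rule continuous_open_preimage) (use S c in \<open>auto intro!: continuous_intros\<close>)
  have "AE z in lebesgue. z \<in> unit_disk \<longrightarrow> (z \<in> S \<longrightarrow> f z = g z)" using ae by (subst (asm) AE_restrict_space_iff) auto
  then have "AE z in lebesgue. z \<notin> U" by eventually_elim (use S(2) in \<open>auto simp: U_def\<close>)
  then have "U \<in> null_sets lebesgue" using \<open>open U\<close> by (subst AE_iff_null_sets) auto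
  then have "negligible U" by (simp add: negligible_iff_null_sets)
  moreover have "z \<in> U" using ne z by (simp add: U_def)
  ultimately show False using open_not_negligible[OF \<open>open U\<close>] by blast
qed

lemma weak_deriv_unique:
  assumes "weak_deriv dbar u h" "weak_deriv dbar u' h'" "AE z in disk_measure. u z = u' z"
  shows "AE z in disk_measure. h z = h' z"
proof -
  have l: "locally_integrable u" "locally_integrable u'" "locally_integrable h" "locally_integrable h'" using assms by (auto simp: weak_deriv_def)
  have l': "locally_integrable (\<lambda>z. - 1 * h' z)"
    by (rule locally_integrable_L_inf_mult[OF _ l(4)]) (auto simp: L_inf_def)
  have "AE z in disk_measure. h z + (- 1 * h' z) = 0"
  proof (rule fundamental_lemma[OF locally_integrable_add[OF l(3) l']])
    fix \<psi> assume t: "test_function \<psi>"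
    have "(\<integral>z. u z * dbar \<psi> z \<partial>disk_measure) = (\<integral>z. u' z * dbar \<psi> z \<partial>disk_measure)"
      by (rule integral_cong_AE)
         (use assms(3) locally_integrable_test[OF l(1) test_function_dbar[OF t]] locally_integrable_test[OF l(2) test_function_dbar[OF t]] in auto)
    then have eq: "(\<integral>z. h z * \<psi> z \<partial>disk_measure) = (\<integral>z. h' z * \<psi> z \<partial>disk_measure)"
      using assms(1,2) t by (simp add: weak_deriv_def)
    have "(\<integral>z. (h z + (- 1 * h' z)) * \<psi> z \<partial>disk_measure) = (\<integral>z. 1 * (h z * \<psi> z) + (- 1) * (h' z * \<psi> z) \<partial>disk_measure)"
      by (rule Bochner_Integration.integral_cong) (auto simp: algebra_simps)
    also have "\<dots> = 1 * (\<integral>z. h z * \<psi> z \<partial>disk_measure) + (- 1) * (\<integral>z. h' z * \<psi> z \<partial>disk_measure)"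
      by (rule integral_linear_combination[OF locally_integrable_test[OF l(3) t] locally_integrable_test[OF l(4) t]])
    finally show "(\<integral>z. (h z + (- 1 * h' z)) * \<psi> z \<partial>disk_measure) = 0" using eq by simp
  qed
  then show ?thesis by eventually_elim simp
qed

lemma weak_deriv_cong:
  assumes "weak_deriv dbar u h" "AE z in disk_measure. u z = u' z" "AE z in disk_measure. h z = h' z"
    and l': "locally_integrable u'" "locally_integrable h'"
  shows "weak_deriv dbar u' h'"
  unfolding weak_deriv_def
proof (intro conjI l' allI impI)
  have l: "locally_integrable u" "locally_integrable h" using assms by (auto simp: weak_deriv_def)
  fix \<psi> assume t: "test_function \<psi>"
  have "(\<integral>z. u z * dbar \<psi> z \<partial>disk_measure) = (\<integral>z. u' z * dbar \<psi> z \<partial>disk_measure)"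
    by (rule integral_cong_AE)
       (use assms(2) locally_integrable_test[OF l(1) test_function_dbar[OF t]] locally_integrable_test[OF l'(1) test_function_dbar[OF t]] in auto)
  moreover have "(\<integral>z. h z * \<psi> z \<partial>disk_measure) = (\<integral>z. h' z * \<psi> z \<partial>disk_measure)"
    by (rule integral_cong_AE)
       (use assms(3) locally_integrable_test[OF l(2) t] locally_integrable_test[OF l'(2) t] in auto)
  ultimately show "(\<integral>z. u' z * dbar \<psi> z \<partial>disk_measure) = - (\<integral>z. h' z * \<psi> z \<partial>disk_measure)"
    using assms(1) t by (simp add: weak_deriv_def)
qed

lemma weak_deriv_add:
  assumes "weak_deriv dbar u h" "weak_deriv dbar u' h'"
  shows "weak_deriv dbar (\<lambda>z. u z + u' z) (\<lambda>z. h z + h' z)"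
  unfolding weak_deriv_def
proof (intro conjI allI impI)
  have l: "locally_integrable u" "locally_integrable u'" "locally_integrable h" "locally_integrable h'" using assms by (auto simp: weak_deriv_def)
  show "locally_integrable (\<lambda>z. u z + u' z)" "locally_integrable (\<lambda>z. h z + h' z)" by (intro locally_integrable_add l)+
  fix \<psi> assume t: "test_function \<psi>"
  show "(\<integral>z. (u z + u' z) * dbar \<psi> z \<partial>disk_measure) = - (\<integral>z. (h z + h' z) * \<psi> z \<partial>disk_measure)"
    using locally_integrable_test[OF l(1) test_function_dbar[OF t]] locally_integrable_test[OF l(2) test_function_dbar[OF t]]
      locally_integrable_test[OF l(3) t] locally_integrable_test[OF l(4) t] assms t
    by (simp add: distrib_right weak_deriv_def)
qed

text \<open>Where the cutoff \<open>\<eta>\<close> is 1, \<open>u\<close> equals the Cauchy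
  transform of \<open>u * dbar \<eta>\<close>, and \<open>dbar \<eta>\<close> vanishes there, so the
  transform is holomorphic. The versions on growing disks agree by continuity.\<close>

theorem weyl_lemma:
  assumes w: "weak_deriv dbar u (\<lambda>_. 0)"
  obtains \<phi> where "\<phi> holomorphic_on unit_disk" "AE z in disk_measure. u z = \<phi> z"
proof -
  define r where "r n = 1 - dseq (Suc n)" for n
  have r: "0 < r n" "r n < 1" for n by (auto simp: r_def dseq_def field_simps)
  have rmono: "r m \<le> r n" if "m \<le> n" for m n using that by (simp add: r_def dseq_def frac_le)
  have rlim: "r \<longlonglongrightarrow> 1"
    using tendsto_diff[OF tendsto_const LIMSEQ_Suc[OF dseq(3)], of 1] by (simp add: r_def[abs_def])
  have "\<exists>G. G holomorphic_on ball 0 (r n) \<and> (AE z in disk_measure. z \<in> ball 0 (r n) \<longrightarrow> u z = G z)" for n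
  proof -
    have R: "r n < (1 + r n) / 2" "(1 + r n) / 2 < 1" using r[of n] by auto
    obtain \<eta> where \<eta>: "test_function \<eta>" "\<And>z. cmod z \<le> r n \<Longrightarrow> \<eta> z = 1"
      by (rule cutoff_exists[OF r(1) R]) blast
    note rep = weak_deriv_representation[OF w \<eta>(1)]
    have "dbar \<eta> z = 0" if "cmod z < r n" for z
    proof -
      have "((\<lambda>_. 1) has_derivative (\<lambda>_. 0)) (at z)" by simp
      then have "(\<eta> has_derivative (\<lambda>_. 0)) (at z)"
        by (rule has_derivative_transform_within_open[OF _ open_ball[of 0 "r n"]]) (use that \<eta>(2) in auto)
      from dbar_eq[OF this] show ?thesis by simp
    qed
    then have "cauchy_transform (\<lambda>z. u z * dbar \<eta> z + 0 * \<eta> z) holomorphic_on ball 0 (r n)"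
      by (intro cauchy_transform_holomorphic rep(1)) simp
    moreover have "AE z in disk_measure. z \<in> ball 0 (r n) \<longrightarrow> u z = cauchy_transform (\<lambda>z. u z * dbar \<eta> z + 0 * \<eta> z) z"
      using rep(2)
    proof eventually_elim
      case (elim z)
      show ?case
      proof
        assume "z \<in> ball 0 (r n)"
        then have "\<eta> z = 1" by (intro \<eta>(2)) simp
        with elim show "u z = cauchy_transform (\<lambda>z. u z * dbar \<eta> z + 0 * \<eta> z) z" by simp
      qed
    qed
    ultimately show ?thesis by blast
  qed
  then obtain G where G: "\<And>n. G n holomorphic_on ball 0 (r n)" "\<And>n. AE z in disk_measure. z \<in> ball 0 (r n) \<longrightarrow> u z = G n z"
    by metis
  have agree: "G m z = G n z" if mn: "m \<le> n" and z: "z \<in> ball 0 (r m)" for m n z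
  proof (rule AE_disk_eq_imp_eq[OF open_ball _ _ _ _ z])
    have sub: "ball (0::complex) (r m) \<subseteq> ball 0 (r n)" using rmono[OF mn] by auto
    show "ball 0 (r m) \<subseteq> unit_disk" using r[of m] by auto
    show "continuous_on (ball 0 (r m)) (G m)" by (rule holomorphic_on_imp_continuous_on[OF G(1)])
    show "continuous_on (ball 0 (r m)) (G n)" by (rule continuous_on_subset[OF holomorphic_on_imp_continuous_on[OF G(1)] sub])
    show "AE z in disk_measure. z \<in> ball 0 (r m) \<longrightarrow> G m z = G n z"
      using G(2)[of m] G(2)[of n] by eventually_elim (use sub in auto)
  qed
  have ex: "\<exists>n. z \<in> ball 0 (r n)" if "z \<in> unit_disk" for z
  proof -
    have "\<forall>\<^sub>F n in sequentially. cmod z < r n" by (rule order_tendstoD(1)[OF rlim]) (use that in simp)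
    then show ?thesis by (auto simp: eventually_sequentially)
  qed
  \<comment> \<open>By \<open>agree\<close> the value does not depend on the index; the least one
    serves as a definite choice.\<close>
  define N where "N z = (LEAST n. z \<in> ball 0 (r n))" for z :: complex
  define \<phi> where "\<phi> z = G (N z) z" for z :: complex
  have eq: "\<phi> z = G n z" if "z \<in> ball 0 (r n)" for z n
    unfolding \<phi>_def by (rule agree) (use that in \<open>auto simp: N_def intro: LeastI Least_le\<close>)
  show thesis
  proof
    show "\<phi> holomorphic_on unit_disk"
      unfolding holomorphic_on_open[OF open_ball]
    proof
      fix z assume "z \<in> unit_disk"
      then obtain n where n: "z \<in> ball 0 (r n)" using ex by blast
      then obtain d where "(G n has_field_derivative d) (at z)" using G(1)[of n] holomorphic_on_open[OF open_ball] by blast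
      then have "(\<phi> has_field_derivative d) (at z)"
        by (rule has_field_derivative_transform_within_open[OF _ open_ball n]) (use eq in auto)
      then show "\<exists>d. (\<phi> has_field_derivative d) (at z)" by blast
    qed
    have "AE z in disk_measure. \<forall>n. z \<in> ball 0 (r n) \<longrightarrow> u z = G n z" using G(2) by (simp add: AE_all_countable)
    then show "AE z in disk_measure. u z = \<phi> z"
    proof (rule AE_mp, intro AE_I2 impI)
      fix z assume "z \<in> space disk_measure" and a: "\<forall>n. z \<in> ball 0 (r n) \<longrightarrow> u z = G n z"
      then have "z \<in> unit_disk" by simp
      then obtain n where "z \<in> ball 0 (r n)" using ex by blast
      then show "u z = \<phi> z" using a eq by auto
    qed
  qed
qed

section \<open>Product and exponential rules for weak derivatives\<close>

lemma L_inf_mult: "a \<in> L_inf \<Longrightarrow> b \<in> L_inf \<Longrightarrow> (\<lambda>z. a z * b z) \<in> L_inf"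
proof -
  assume "a \<in> L_inf" "b \<in> L_inf"
  then obtain C C' where m: "a \<in> borel_measurable disk_measure" "b \<in> borel_measurable disk_measure"
    and C: "AE z in disk_measure. cmod (a z) \<le> C" "AE z in disk_measure. cmod (b z) \<le> C'" by (auto simp: L_inf_def)
  have "AE z in disk_measure. cmod (a z * b z) \<le> C * C'"
    using C by eventually_elim (auto simp: norm_mult intro!: mult_mono intro: order_trans[OF norm_ge_zero])
  then show ?thesis unfolding L_inf_def using m by auto
qed

lemma L_inf_add: "a \<in> L_inf \<Longrightarrow> b \<in> L_inf \<Longrightarrow> (\<lambda>z. a z + b z) \<in> L_inf"
proof -
  assume "a \<in> L_inf" "b \<in> L_inf"
  then obtain C C' where m: "a \<in> borel_measurable disk_measure" "b \<in> borel_measurable disk_measure"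
    and C: "AE z in disk_measure. cmod (a z) \<le> C" "AE z in disk_measure. cmod (b z) \<le> C'" by (auto simp: L_inf_def)
  have "AE z in disk_measure. cmod (a z + b z) \<le> C + C'"
    using C by eventually_elim (auto intro: norm_triangle_mono)
  then show ?thesis unfolding L_inf_def using m by auto
qed

lemma L_inf_const: "(\<lambda>_. c) \<in> L_inf"
  by (auto simp: L_inf_def)

lemma weak_deriv_test_product:
  assumes "weak_deriv dbar u h" "smooth a" "test_function \<psi>"
  shows "(\<integral>z. u z * (a z * dbar \<psi> z + dbar a z * \<psi> z) \<partial>disk_measure) = - (\<integral>z. h z * (a z * \<psi> z) \<partial>disk_measure)"
proof -
  have "smooth \<psi>" using assms by (simp add: test_function_iff)
  then have d: "dbar (\<lambda>z. a z * \<psi> z) z = a z * dbar \<psi> z + dbar a z * \<psi> z" for z by (rule dbar_smooth_mult[OF assms(2)])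
  have "(\<integral>z. u z * dbar (\<lambda>z. a z * \<psi> z) z \<partial>disk_measure) = - (\<integral>z. h z * (a z * \<psi> z) \<partial>disk_measure)"
    using assms(1) test_function_mult[OF assms(2,3)] unfolding weak_deriv_def by blast
  then show ?thesis unfolding d .
qed

text \<open>For smooth \<open>a\<close> this is the weak equation tested with
  \<open>a * \<psi>\<close>. In general \<open>a\<close> times a cutoff is the transform of a
  bounded \<open>g\<close>, and test functions tending boundedly to \<open>g\<close> have smooth
  transforms that converge boundedly at every point. Bounded convergence suffices because
  \<open>u\<close> and \<open>h\<close> are integrable on the support of
  \<open>\<psi>\<close>.\<close>

theorem weak_deriv_mult:
  assumes a: "a \<in> L_inf" "a' \<in> L_inf" "weak_deriv dbar a a'" and u: "weak_deriv dbar u h"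
  shows "weak_deriv dbar (\<lambda>z. a z * u z) (\<lambda>z. a' z * u z + a z * h z)"
  unfolding weak_deriv_def
proof (intro conjI allI impI)
  have lu: "locally_integrable u" and lh: "locally_integrable h" using u by (auto simp: weak_deriv_def)
  show "locally_integrable (\<lambda>z. a z * u z)" "locally_integrable (\<lambda>z. a' z * u z + a z * h z)"
    by (intro locally_integrable_add locally_integrable_L_inf_mult a lu lh)+
  fix \<psi> assume t: "test_function \<psi>"
  obtain r where r: "0 < r" "r < 1" "\<And>z. r < cmod z \<Longrightarrow> \<psi> z = 0" by (rule test_function_support[OF t]) blast
  \<comment> \<open>The cutoff equals 1 on a disk strictly larger than the support of
    \<open>\<psi>\<close>. Hence \<open>dbar \<eta>\<close> vanishes on that support, where
    \<open>g\<close> reduces to \<open>a'\<close>.\<close>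
  define r1 where "r1 = (1 + r) / 2"
  have r1: "0 < r1" "r < r1" "r1 < (1 + r1) / 2" "(1 + r1) / 2 < 1" using r by (auto simp: r1_def)
  obtain \<eta> where \<eta>: "test_function \<eta>" "\<And>z. cmod z \<le> r1 \<Longrightarrow> \<eta> z = 1" by (rule cutoff_exists[OF r1(1,3,4)]) blast
  define g where "g z = a z * dbar \<eta> z + a' z * \<eta> z" for z
  have gL: "g \<in> L_inf" unfolding g_def[abs_def] by (intro L_inf_add L_inf_mult a test_function_L_inf test_function_dbar \<eta>(1))
  have rep: "AE z in disk_measure. a z * \<eta> z = cauchy_transform g z"
    using weak_deriv_representation(2)[OF a(3) \<eta>(1)] by (simp add: g_def[abs_def])
  have dpsi: "dbar \<psi> z = 0" if "r < cmod z" for z using partial_deriv_zero[of r \<psi> z] r(3) that by (simp add: dbar_def)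
  have deta: "dbar \<eta> z = 0" if "cmod z < r1" for z
  proof -
    have "((\<lambda>_. 1) has_derivative (\<lambda>_. 0)) (at z)" by simp
    then have "(\<eta> has_derivative (\<lambda>_. 0)) (at z)"
      by (rule has_derivative_transform_within_open[OF _ open_ball[of 0 r1]]) (use that \<eta>(2) in auto)
    from dbar_eq[OF this] show ?thesis by simp
  qed
  obtain \<gamma> C where \<gamma>: "\<And>n. test_function (\<gamma> n)" "C \<ge> 0" "\<And>n z. cmod (\<gamma> n z) \<le> C"
    "AE z in disk_measure. (\<lambda>n. \<gamma> n z) \<longlonglongrightarrow> g z"
    by (rule L_inf_approximation_by_tests[OF gL]) (use that in blast)
  define a_n where "a_n n = cauchy_transform (\<gamma> n)" for n
  have an_smooth: "smooth (a_n n)" for n unfolding a_n_def by (rule smooth_cauchy_transform_test[OF \<gamma>(1)])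
  have \<gamma>m: "\<gamma> n \<in> borel_measurable disk_measure" for n by (intro measurable_disk_borel test_function_measurable \<gamma>)
  have gm: "g \<in> borel_measurable disk_measure" using gL by (simp add: L_inf_def)
  have an_lim: "(\<lambda>n. a_n n z) \<longlonglongrightarrow> cauchy_transform g z" for z
    unfolding a_n_def by (rule cauchy_transform_tendsto[OF \<gamma>m gm _ \<gamma>(4)]) (use \<gamma>(3) in auto)
  define C1 where "C1 = C * kernel_mass 2 / cauchy_const"
  have an_b: "cmod (a_n n z) \<le> C1" if "cmod z \<le> 1" for n z
    using cauchy_transform_bound[OF \<gamma>m _ that \<gamma>(2), of n] \<gamma>(3) by (auto simp: a_n_def C1_def)
  have C10: "C1 \<ge> 0" using an_b[of 0 0] by (auto intro: order_trans[OF norm_ge_zero])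
  have dpt: "test_function (dbar \<psi>)" by (rule test_function_dbar[OF t])
  have [measurable]: "\<psi> \<in> borel_measurable disk_measure" "dbar \<psi> \<in> borel_measurable disk_measure" "u \<in> borel_measurable disk_measure"
     "h \<in> borel_measurable disk_measure" "\<gamma> n \<in> borel_measurable disk_measure" "a_n n \<in> borel_measurable disk_measure" "g \<in> borel_measurable disk_measure" for n
    by (intro measurable_disk_borel test_function_measurable t dpt locally_integrable_measurable lu lh \<gamma> smooth_measurable an_smooth gm)+
  have "continuous_on UNIV (cauchy_transform g)"
    using gL cauchy_transform_continuous[of g] by (auto simp: L_inf_def)
  then have [measurable]: "cauchy_transform g \<in> borel_measurable disk_measure" by (intro measurable_disk_borel borel_measurable_continuous_onI)
  have lim1: "(\<lambda>n. \<integral>z. u z * (a_n n z * dbar \<psi> z + \<gamma> n z * \<psi> z) \<partial>disk_measure) \<longlonglongrightarrow> (\<integral>z. u z * (cauchy_transform g z * dbar \<psi> z + g z * \<psi> z) \<partial>disk_measure)"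
  proof (rule integral_dominated_convergence[where w="\<lambda>z. C1 * norm (u z * dbar \<psi> z) + C * norm (u z * \<psi> z)"])
    show "integrable disk_measure (\<lambda>z. C1 * norm (u z * dbar \<psi> z) + C * norm (u z * \<psi> z))"
      using locally_integrable_test[OF lu dpt] locally_integrable_test[OF lu t] by simp
    show "AE z in disk_measure. norm (u z * (a_n n z * dbar \<psi> z + \<gamma> n z * \<psi> z)) \<le> C1 * norm (u z * dbar \<psi> z) + C * norm (u z * \<psi> z)" for n
    proof (rule AE_I2)
      fix z assume "z \<in> space disk_measure"
      then have z: "cmod z \<le> 1" by simp
      have "norm (u z * (a_n n z * dbar \<psi> z + \<gamma> n z * \<psi> z)) \<le> norm (a_n n z * (u z * dbar \<psi> z)) + norm (\<gamma> n z * (u z * \<psi> z))"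
        by (rule order_trans[OF _ norm_triangle_ineq]) (simp add: algebra_simps)
      also have "\<dots> \<le> C1 * norm (u z * dbar \<psi> z) + C * norm (u z * \<psi> z)"
        unfolding norm_mult[of "a_n n z"] norm_mult[of "\<gamma> n z"] by (intro add_mono mult_right_mono an_b z \<gamma>(3)) auto
      finally show "norm (u z * (a_n n z * dbar \<psi> z + \<gamma> n z * \<psi> z)) \<le> C1 * norm (u z * dbar \<psi> z) + C * norm (u z * \<psi> z)" .
    qed
    show "AE z in disk_measure. (\<lambda>n. u z * (a_n n z * dbar \<psi> z + \<gamma> n z * \<psi> z)) \<longlonglongrightarrow> u z * (cauchy_transform g z * dbar \<psi> z + g z * \<psi> z)"
      using \<gamma>(4) by eventually_elim (intro tendsto_intros an_lim)
  qed measurable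
  have lim2: "(\<lambda>n. - (\<integral>z. h z * (a_n n z * \<psi> z) \<partial>disk_measure)) \<longlonglongrightarrow> - (\<integral>z. h z * (cauchy_transform g z * \<psi> z) \<partial>disk_measure)"
  proof (rule tendsto_minus, rule integral_dominated_convergence[where w="\<lambda>z. C1 * norm (h z * \<psi> z)"])
    show "integrable disk_measure (\<lambda>z. C1 * norm (h z * \<psi> z))" using locally_integrable_test[OF lh t] by simp
    show "AE z in disk_measure. norm (h z * (a_n n z * \<psi> z)) \<le> C1 * norm (h z * \<psi> z)" for n
    proof (rule AE_I2)
      fix z assume "z \<in> space disk_measure"
      then have "cmod z \<le> 1" by simp
      from mult_right_mono[OF an_b[OF this, of n], of "norm (h z * \<psi> z)"]
      show "norm (h z * (a_n n z * \<psi> z)) \<le> C1 * norm (h z * \<psi> z)" by (simp add: norm_mult mult_ac)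
    qed
    show "AE z in disk_measure. (\<lambda>n. h z * (a_n n z * \<psi> z)) \<longlonglongrightarrow> h z * (cauchy_transform g z * \<psi> z)"
      by (intro AE_I2 tendsto_intros an_lim)
  qed measurable
  have eqn: "(\<integral>z. u z * (a_n n z * dbar \<psi> z + \<gamma> n z * \<psi> z) \<partial>disk_measure) = - (\<integral>z. h z * (a_n n z * \<psi> z) \<partial>disk_measure)" for n
  proof -
    have "dbar (a_n n) z = \<gamma> n z" for z unfolding a_n_def by (rule dbar_cauchy_transform_test[OF \<gamma>(1)])
    then show ?thesis using weak_deriv_test_product[OF u an_smooth t, of n] by simp
  qed
  have lim: "(\<integral>z. u z * (cauchy_transform g z * dbar \<psi> z + g z * \<psi> z) \<partial>disk_measure) = - (\<integral>z. h z * (cauchy_transform g z * \<psi> z) \<partial>disk_measure)"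
    by (rule LIMSEQ_unique[OF lim1[unfolded eqn] lim2])
  have am [measurable]: "a \<in> borel_measurable disk_measure" "a' \<in> borel_measurable disk_measure" using a by (auto simp: L_inf_def)
  have "(\<integral>z. u z * (cauchy_transform g z * dbar \<psi> z + g z * \<psi> z) \<partial>disk_measure) = (\<integral>z. a z * u z * dbar \<psi> z + a' z * u z * \<psi> z \<partial>disk_measure)"
  proof (rule integral_cong_AE)
    show "AE z in disk_measure. u z * (cauchy_transform g z * dbar \<psi> z + g z * \<psi> z) = a z * u z * dbar \<psi> z + a' z * u z * \<psi> z"
      using rep
    proof eventually_elim
      case (elim z)
      show ?case
      proof (cases "r < cmod z")
        case False
        then have "cmod z < r1" using r1 by simp
        then have "\<eta> z = 1" "dbar \<eta> z = 0" using \<eta>(2) deta by auto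
        then show ?thesis using elim by (simp add: g_def algebra_simps flip: elim)
      qed (simp add: r(3) dpsi)
    qed
  qed measurable
  moreover have "(\<integral>z. h z * (cauchy_transform g z * \<psi> z) \<partial>disk_measure) = (\<integral>z. a z * h z * \<psi> z \<partial>disk_measure)"
  proof (rule integral_cong_AE)
    show "AE z in disk_measure. h z * (cauchy_transform g z * \<psi> z) = a z * h z * \<psi> z"
      using rep
    proof eventually_elim
      case (elim z)
      show ?case
      proof (cases "r < cmod z")
        case False
        then have "\<eta> z = 1" using r1 \<eta>(2) by auto
        then show ?thesis by (simp flip: elim)
      qed (simp add: r(3))
    qed
  qed measurable
  ultimately have fin: "(\<integral>z. a z * u z * dbar \<psi> z + a' z * u z * \<psi> z \<partial>disk_measure) = - (\<integral>z. a z * h z * \<psi> z \<partial>disk_measure)"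
    using lim by simp
  have i: "integrable disk_measure (\<lambda>z. a z * u z * dbar \<psi> z)" "integrable disk_measure (\<lambda>z. a' z * u z * \<psi> z)" "integrable disk_measure (\<lambda>z. a z * h z * \<psi> z)"
    by (intro locally_integrable_test locally_integrable_L_inf_mult a lu lh t dpt)+
  show "(\<integral>z. a z * u z * dbar \<psi> z \<partial>disk_measure) = - (\<integral>z. (a' z * u z + a z * h z) * \<psi> z \<partial>disk_measure)"
  proof -
    have "X = - (Y + Z)" if "X + Y = - Z" for X Y Z :: complex using that by algebra
    from this[OF fin[unfolded Bochner_Integration.integral_add[OF i(1,2)]]]
    show ?thesis unfolding distrib_right Bochner_Integration.integral_add[OF i(2,3)] .
  qed
qed

lemma integral_dbar_test_zero:
  assumes "test_function \<psi>" shows "(\<integral>z. dbar \<psi> z \<partial>disk_measure) = 0"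
proof -
  obtain r where r: "0 < r" "r < 1" "\<And>z. r < cmod z \<Longrightarrow> \<psi> z = 0" by (rule test_function_support[OF assms]) blast
  have s: "smooth \<psi>" using assms by (simp add: test_function_iff)
  obtain B where B: "\<And>z v. cmod (partial_deriv v \<psi> z) \<le> B * cmod v" using smooth_compact_support_derivative_bound[OF s r(3)] by blast
  have "(\<integral>z. dbar \<psi> z \<partial>disk_measure) = (\<integral>z. dbar \<psi> z \<partial>lborel)"
    by (rule integral_disk_eq) (use test_function_zero[OF test_function_dbar[OF assms]] test_function_measurable[OF test_function_dbar[OF assms]] in auto)
  also have "\<dots> = 0" by (rule integral_dbar_zero(2)[OF smooth_has_derivative[OF s] B r(3)])
  finally show ?thesis .
qed

text \<open>The chain rule holds for the smooth transforms \<open>S n\<close> of test functions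
  tending boundedly to \<open>A\<close>, and dominated convergence passes it on. The parameter
  \<open>c\<close> provides both \<open>exp s\<close> and the integrating factor
  \<open>exp (- s)\<close>.\<close>

theorem weak_deriv_exp_cauchy_transform:
  assumes A: "A \<in> L_inf"
  shows "weak_deriv dbar (\<lambda>z. exp (c * cauchy_transform A z)) (\<lambda>z. c * A z * exp (c * cauchy_transform A z))"
    "(\<lambda>z. exp (c * cauchy_transform A z)) \<in> L_inf"
proof -
  define s where "s = cauchy_transform A"
  have cs: "continuous_on UNIV s" using A cauchy_transform_continuous[of A] by (auto simp: L_inf_def s_def)
  have sm [measurable]: "s \<in> borel_measurable disk_measure" by (intro measurable_disk_borel borel_measurable_continuous_onI cs)
  have em [measurable]: "(\<lambda>z. exp (c * s z)) \<in> borel_measurable disk_measure"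
    by (intro measurable_disk_borel borel_measurable_continuous_onI continuous_intros cs)
  have eL: "(\<lambda>z. exp (c * s z)) \<in> L_inf"
  proof -
    have "bounded ((\<lambda>z. exp (c * s z)) ` cball 0 1)"
      by (intro compact_imp_bounded compact_continuous_image continuous_intros continuous_on_subset[OF cs]) auto
    then obtain B where B: "\<And>z. z \<in> cball 0 1 \<Longrightarrow> cmod (exp (c * s z)) \<le> B" unfolding bounded_iff by blast
    have "AE z in disk_measure. cmod (exp (c * s z)) \<le> B" by (rule AE_I2, rule B) simp
    then show ?thesis unfolding L_inf_def using em by blast
  qed
  then show "(\<lambda>z. exp (c * cauchy_transform A z)) \<in> L_inf" by (simp add: s_def)
  have eL': "(\<lambda>z. c * A z * exp (c * s z)) \<in> L_inf" by (intro L_inf_mult L_inf_const A eL)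
  have Am [measurable]: "A \<in> borel_measurable disk_measure" using A by (simp add: L_inf_def)
  obtain \<gamma> C where \<gamma>: "\<And>n. test_function (\<gamma> n)" "C \<ge> 0" "\<And>n z. cmod (\<gamma> n z) \<le> C"
    "AE z in disk_measure. (\<lambda>n. \<gamma> n z) \<longlonglongrightarrow> A z"
    by (rule L_inf_approximation_by_tests[OF A]) (use that in blast)
  have \<gamma>m [measurable]: "\<gamma> n \<in> borel_measurable disk_measure" for n by (intro measurable_disk_borel test_function_measurable \<gamma>)
  define S where "S n = cauchy_transform (\<gamma> n)" for n
  have Ss: "smooth (S n)" for n unfolding S_def by (rule smooth_cauchy_transform_test[OF \<gamma>(1)])
  have Sd: "dbar (S n) z = \<gamma> n z" for n z unfolding S_def by (rule dbar_cauchy_transform_test[OF \<gamma>(1)])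
  have Slim: "(\<lambda>n. S n z) \<longlonglongrightarrow> s z" for z
    unfolding S_def s_def by (rule cauchy_transform_tendsto[OF \<gamma>m Am _ \<gamma>(4)]) (use \<gamma>(3) in auto)
  define C1 where "C1 = exp (cmod c * (C * kernel_mass 2 / cauchy_const))"
  have Sb: "cmod (exp (c * S n z)) \<le> C1" if "cmod z \<le> 1" for n z
  proof -
    have "cmod (S n z) \<le> C * kernel_mass 2 / cauchy_const"
      using cauchy_transform_bound[OF \<gamma>m _ that \<gamma>(2), of n] \<gamma>(3) by (auto simp: S_def)
    then have "cmod (c * S n z) \<le> cmod c * (C * kernel_mass 2 / cauchy_const)" unfolding norm_mult by (rule mult_left_mono) simp
    then show ?thesis using norm_exp[of "c * S n z"] by (simp add: C1_def order_trans)
  qed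
  have C10: "C1 \<ge> 0" by (simp add: C1_def)
  have es: "smooth (\<lambda>z. exp (c * S n z))" for n by (intro smooth_exp smooth_mult smooth_const Ss)
  have [measurable]: "(\<lambda>z. exp (c * S n z)) \<in> borel_measurable disk_measure" for n by (intro measurable_disk_borel smooth_measurable es)
  have ed: "dbar (\<lambda>z. exp (c * S n z)) z = c * \<gamma> n z * exp (c * S n z)" for n z
  proof -
    have "dbar (\<lambda>z. c * S n z) z = c * \<gamma> n z"
      using dbar_smooth_mult[OF smooth_const[of c] Ss, of n z] dbar_holomorphic[of "\<lambda>_. c" 0 z] by (simp add: Sd)
    then show ?thesis using dbar_smooth_exp[OF smooth_mult[OF smooth_const Ss], of c n z] by simp
  qed
  show "weak_deriv dbar (\<lambda>z. exp (c * cauchy_transform A z)) (\<lambda>z. c * A z * exp (c * cauchy_transform A z))"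
    unfolding weak_deriv_def s_def[symmetric]
  proof (intro conjI allI impI)
    show "locally_integrable (\<lambda>z. exp (c * s z))" "locally_integrable (\<lambda>z. c * A z * exp (c * s z))"
      by (intro L_inf_locally_integrable eL eL')+
    fix \<psi> assume t: "test_function \<psi>"
    have dpt: "test_function (dbar \<psi>)" by (rule test_function_dbar[OF t])
    have ps: "smooth \<psi>" using t by (simp add: test_function_iff)
    have [measurable]: "\<psi> \<in> borel_measurable disk_measure" "dbar \<psi> \<in> borel_measurable disk_measure"
      by (intro measurable_disk_borel test_function_measurable t dpt)+
    have ti: "integrable disk_measure \<psi>" "integrable disk_measure (dbar \<psi>)" by (intro L_inf_integrable test_function_L_inf t dpt)+
    have "(\<lambda>n. \<integral>z. exp (c * S n z) * dbar \<psi> z + c * \<gamma> n z * exp (c * S n z) * \<psi> z \<partial>disk_measure) \<longlonglongrightarrow>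
       (\<integral>z. exp (c * s z) * dbar \<psi> z + c * A z * exp (c * s z) * \<psi> z \<partial>disk_measure)"
    proof (rule integral_dominated_convergence[where w="\<lambda>z. C1 * norm (dbar \<psi> z) + cmod c * C * C1 * norm (\<psi> z)"])
      show "integrable disk_measure (\<lambda>z. C1 * norm (dbar \<psi> z) + cmod c * C * C1 * norm (\<psi> z))" using ti by simp
      show "AE z in disk_measure. norm (exp (c * S n z) * dbar \<psi> z + c * \<gamma> n z * exp (c * S n z) * \<psi> z) \<le> C1 * norm (dbar \<psi> z) + cmod c * C * C1 * norm (\<psi> z)" for n
      proof (rule AE_I2)
        fix z assume "z \<in> space disk_measure"
        then have z: "cmod z \<le> 1" by simp
        have "norm (exp (c * S n z) * dbar \<psi> z + c * \<gamma> n z * exp (c * S n z) * \<psi> z) \<le> norm (exp (c * S n z) * dbar \<psi> z) + norm (c * \<gamma> n z * exp (c * S n z) * \<psi> z)"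
          by (rule norm_triangle_ineq)
        also have "\<dots> \<le> C1 * norm (dbar \<psi> z) + cmod c * C * C1 * norm (\<psi> z)"
          unfolding norm_mult using \<gamma>(2) C10 by (intro add_mono mult_mono Sb z \<gamma>(3)) auto
        finally show "norm (exp (c * S n z) * dbar \<psi> z + c * \<gamma> n z * exp (c * S n z) * \<psi> z) \<le> C1 * norm (dbar \<psi> z) + cmod c * C * C1 * norm (\<psi> z)" .
      qed
      show "AE z in disk_measure. (\<lambda>n. exp (c * S n z) * dbar \<psi> z + c * \<gamma> n z * exp (c * S n z) * \<psi> z) \<longlonglongrightarrow> exp (c * s z) * dbar \<psi> z + c * A z * exp (c * s z) * \<psi> z"
        using \<gamma>(4) by eventually_elim (intro tendsto_intros Slim)
    qed measurable
    moreover have "(\<integral>z. exp (c * S n z) * dbar \<psi> z + c * \<gamma> n z * exp (c * S n z) * \<psi> z \<partial>disk_measure) = 0" for n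
      using integral_dbar_test_zero[OF test_function_mult[OF es t]] by (simp add: dbar_smooth_mult[OF es ps] ed)
    ultimately have "(\<integral>z. exp (c * s z) * dbar \<psi> z + c * A z * exp (c * s z) * \<psi> z \<partial>disk_measure) = 0"
      using LIMSEQ_unique[OF _ tendsto_const[of 0]] by simp
    moreover have "integrable disk_measure (\<lambda>z. exp (c * s z) * dbar \<psi> z)" "integrable disk_measure (\<lambda>z. c * A z * exp (c * s z) * \<psi> z)"
      by (intro locally_integrable_test L_inf_locally_integrable eL eL' t dpt)+
    ultimately show "(\<integral>z. exp (c * s z) * dbar \<psi> z \<partial>disk_measure) = - (\<integral>z. c * A z * exp (c * s z) * \<psi> z \<partial>disk_measure)"
      by (simp add: eq_neg_iff_add_eq_0)
  qed
qed

section \<open>The meta-Hardy space\<close>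

text \<open>The Hardy condition detached from any equation. \<open>ennreal I\<close> with a real
  \<open>I\<close> expresses finiteness, uniformly in the radius, and continuity makes the
  integrands on circles measurable.\<close>

definition bounded_means :: "real \<Rightarrow> (complex \<Rightarrow> complex) \<Rightarrow> bool" where
  "bounded_means p g \<longleftrightarrow> continuous_on unit_disk g \<and>
     (\<exists>I. \<forall>r\<in>{0<..<1}. circle_integral p (\<lambda>\<zeta>. g (of_real r * \<zeta>)) \<le> ennreal I)"

lemma circle_integral_add_le:
  assumes p: "p > 0" and m: "(\<lambda>t. cmod (f (cis t)) powr p) \<in> borel_measurable (lebesgue_on {0..2*pi})"
    "(\<lambda>t. cmod (g (cis t)) powr p) \<in> borel_measurable (lebesgue_on {0..2*pi})"
  shows "circle_integral p (\<lambda>\<zeta>. f \<zeta> + g \<zeta>) \<le> ennreal (2 powr p) * (circle_integral p f + circle_integral p g)"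
proof -
  have "circle_integral p (\<lambda>\<zeta>. f \<zeta> + g \<zeta>) \<le> (\<integral>\<^sup>+t. ennreal (2 powr p) * (ennreal (cmod (f (cis t)) powr p) + ennreal (cmod (g (cis t)) powr p)) \<partial>lebesgue_on {0..2*pi})"
    unfolding circle_integral_def
  proof (rule nn_integral_mono)
    fix t
    have "cmod (f (cis t) + g (cis t)) powr p \<le> (cmod (f (cis t)) + cmod (g (cis t))) powr p"
      using p norm_triangle_ineq by (intro powr_mono2) auto
    also have "\<dots> \<le> 2 powr p * (cmod (f (cis t)) powr p + cmod (g (cis t)) powr p)"
      by (rule powr_add_le) (use p in auto)
    finally have "ennreal (cmod (f (cis t) + g (cis t)) powr p) \<le> ennreal (2 powr p * (cmod (f (cis t)) powr p + cmod (g (cis t)) powr p))"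
      by (rule ennreal_leI)
    also have "\<dots> = ennreal (2 powr p) * (ennreal (cmod (f (cis t)) powr p) + ennreal (cmod (g (cis t)) powr p))"
      by (simp add: ennreal_mult')
    finally show "ennreal (cmod (f (cis t) + g (cis t)) powr p) \<le> \<dots>" .
  qed
  also have "\<dots> = ennreal (2 powr p) * (circle_integral p f + circle_integral p g)"
    unfolding circle_integral_def using m by (subst nn_integral_cmult) (auto simp: nn_integral_add)
  finally show ?thesis .
qed

lemma circle_integral_mult_le:
  assumes p: "p > 0" and c: "\<And>t. cmod (c (cis t)) \<le> C" and m: "(\<lambda>t. cmod (f (cis t)) powr p) \<in> borel_measurable (lebesgue_on {0..2*pi})"
  shows "circle_integral p (\<lambda>\<zeta>. c \<zeta> * f \<zeta>) \<le> ennreal (C powr p) * circle_integral p f"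
proof -
  have "circle_integral p (\<lambda>\<zeta>. c \<zeta> * f \<zeta>) \<le> (\<integral>\<^sup>+t. ennreal (C powr p) * ennreal (cmod (f (cis t)) powr p) \<partial>lebesgue_on {0..2*pi})"
    unfolding circle_integral_def
  proof (rule nn_integral_mono)
    fix t
    have "cmod (c (cis t) * f (cis t)) powr p = cmod (c (cis t)) powr p * cmod (f (cis t)) powr p" by (simp add: norm_mult powr_mult)
    also have "\<dots> \<le> C powr p * cmod (f (cis t)) powr p" using p c[of t] by (intro mult_right_mono powr_mono2) auto
    finally show "ennreal (cmod (c (cis t) * f (cis t)) powr p) \<le> ennreal (C powr p) * ennreal (cmod (f (cis t)) powr p)"
      by (simp add: ennreal_leI flip: ennreal_mult')
  qed
  also have "\<dots> = ennreal (C powr p) * circle_integral p f"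
    unfolding circle_integral_def using m by (subst nn_integral_cmult) auto
  finally show ?thesis .
qed

lemma measurable_powr_dilate:
  assumes "continuous_on unit_disk g" "0 < r" "r < 1"
  shows "(\<lambda>t. cmod (g (of_real r * cis t)) powr p) \<in> borel_measurable (lebesgue_on {0..2*pi})"
proof -
  have "(\<lambda>t. g (of_real r * cis t)) \<in> borel_measurable (lebesgue_on {0..2*pi})"
    by (rule continuous_on_circle_measurable, rule continuous_dilate_cis[OF assms(1)]) (use assms in auto)
  then show ?thesis by measurable
qed

lemma bounded_means_add:
  assumes p: "p > 0" and f: "bounded_means p f" "bounded_means p g"
  shows "bounded_means p (\<lambda>z. f z + g z)"
proof -
  have cf: "continuous_on unit_disk f" "continuous_on unit_disk g" using f by (auto simp: bounded_means_def)
  obtain I J where IJ: "\<And>r. r \<in> {0<..<1} \<Longrightarrow> circle_integral p (\<lambda>\<zeta>. f (of_real r * \<zeta>)) \<le> ennreal I"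
    "\<And>r. r \<in> {0<..<1} \<Longrightarrow> circle_integral p (\<lambda>\<zeta>. g (of_real r * \<zeta>)) \<le> ennreal J" using f unfolding bounded_means_def by blast
  have "circle_integral p (\<lambda>\<zeta>. f (of_real r * \<zeta>) + g (of_real r * \<zeta>)) \<le> ennreal (2 powr p * (max I 0 + max J 0))"
    if r: "r \<in> {0<..<1}" for r
  proof -
    have "circle_integral p (\<lambda>\<zeta>. f (of_real r * \<zeta>) + g (of_real r * \<zeta>)) \<le>
        ennreal (2 powr p) * (circle_integral p (\<lambda>\<zeta>. f (of_real r * \<zeta>)) + circle_integral p (\<lambda>\<zeta>. g (of_real r * \<zeta>)))"
      by (rule circle_integral_add_le[OF p]) (use r cf measurable_powr_dilate in auto)
    also have "\<dots> \<le> ennreal (2 powr p) * (ennreal (max I 0) + ennreal (max J 0))"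
      by (intro mult_left_mono add_mono order_trans[OF IJ(1)[OF r]] order_trans[OF IJ(2)[OF r]] ennreal_leI) auto
    also have "\<dots> = ennreal (2 powr p * (max I 0 + max J 0))" by (simp add: ennreal_mult')
    finally show ?thesis .
  qed
  then have "\<exists>I. \<forall>r\<in>{0<..<1}. circle_integral p (\<lambda>\<zeta>. f (of_real r * \<zeta>) + g (of_real r * \<zeta>)) \<le> ennreal I" by blast
  then show ?thesis unfolding bounded_means_def using cf by (auto intro!: continuous_intros)
qed

lemma bounded_means_mult:
  assumes p: "p > 0" and f: "bounded_means p f" and c: "continuous_on unit_disk c" "\<And>z. z \<in> unit_disk \<Longrightarrow> cmod (c z) \<le> C"
  shows "bounded_means p (\<lambda>z. c z * f z)"
proof -
  have cf: "continuous_on unit_disk f" using f by (auto simp: bounded_means_def)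
  obtain I where I: "\<And>r. r \<in> {0<..<1} \<Longrightarrow> circle_integral p (\<lambda>\<zeta>. f (of_real r * \<zeta>)) \<le> ennreal I" using f unfolding bounded_means_def by blast
  have "circle_integral p (\<lambda>\<zeta>. c (of_real r * \<zeta>) * f (of_real r * \<zeta>)) \<le> ennreal (C powr p * max I 0)" if r: "r \<in> {0<..<1}" for r
  proof -
    have "circle_integral p (\<lambda>\<zeta>. c (of_real r * \<zeta>) * f (of_real r * \<zeta>)) \<le> ennreal (C powr p) * circle_integral p (\<lambda>\<zeta>. f (of_real r * \<zeta>))"
    proof (rule circle_integral_mult_le[OF p])
      show "cmod (c (of_real r * cis t)) \<le> C" for t by (rule c(2)) (use r in \<open>simp add: norm_mult\<close>)
    qed (use r cf measurable_powr_dilate in auto)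
    also have "\<dots> \<le> ennreal (C powr p) * ennreal (max I 0)"
      by (intro mult_left_mono order_trans[OF I[OF r]] ennreal_leI) auto
    also have "\<dots> = ennreal (C powr p * max I 0)" by (simp add: ennreal_mult')
    finally show ?thesis .
  qed
  then have "\<exists>I. \<forall>r\<in>{0<..<1}. circle_integral p (\<lambda>\<zeta>. c (of_real r * \<zeta>) * f (of_real r * \<zeta>)) \<le> ennreal I" by blast
  then show ?thesis unfolding bounded_means_def using cf c(1) by (auto intro!: continuous_intros)
qed

lemma bounded_means_cong:
  assumes "\<And>z. z \<in> unit_disk \<Longrightarrow> f z = g z" "bounded_means p f"
  shows "bounded_means p g"
proof -
  have "circle_integral p (\<lambda>\<zeta>. f (of_real r * \<zeta>)) = circle_integral p (\<lambda>\<zeta>. g (of_real r * \<zeta>))" if "r \<in> {0<..<1}" for r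
    unfolding circle_integral_def by (rule nn_integral_cong) (use that assms(1) in \<open>simp add: norm_mult\<close>)
  moreover have "continuous_on unit_disk f \<longleftrightarrow> continuous_on unit_disk g" by (rule continuous_on_cong) (use assms(1) in auto)
  ultimately show ?thesis using assms(2) unfolding bounded_means_def by auto
qed

lemma bounded_means_zero: "p > 0 \<Longrightarrow> bounded_means p (\<lambda>_. 0)"
  unfolding bounded_means_def circle_integral_def by auto

lemma bounded_means_sum:
  assumes "p > 0" "finite S" "\<And>j. j \<in> S \<Longrightarrow> bounded_means p (f j)"
  shows "bounded_means p (\<lambda>z. \<Sum>j\<in>S. f j z)"
  using assms(2,3)
proof (induction S rule: finite_induct)
  case empty
  then show ?case using bounded_means_zero[OF assms(1)] by simp
next
  case (insert x S)
  have "bounded_means p (\<lambda>z. f x z + (\<Sum>j\<in>S. f j z))"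
    by (rule bounded_means_add[OF assms(1)]) (use insert in auto)
  then show ?case using insert by simp
qed

lemma hardy_boundary_cong:
  assumes "\<And>z. z \<in> unit_disk \<Longrightarrow> F z = G z" "hardy_boundary p F Fp"
  shows "hardy_boundary p G Fp"
proof -
  have nt: "AE \<theta> in lebesgue_on {0..2*pi}. nontangential_limit G (cis \<theta>) (Fp (cis \<theta>))"
  proof -
    have "AE \<theta> in lebesgue_on {0..2*pi}. nontangential_limit F (cis \<theta>) (Fp (cis \<theta>))" using assms(2) by (simp add: hardy_boundary_def)
    then show ?thesis by eventually_elim (rule nontangential_limit_cong[OF assms(1)])
  qed
  have "circle_integral p (\<lambda>\<zeta>. Fp \<zeta> - F (of_real r * \<zeta>)) = circle_integral p (\<lambda>\<zeta>. Fp \<zeta> - G (of_real r * \<zeta>))" if "0 < r" "r < 1" for r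
    unfolding circle_integral_def by (rule nn_integral_cong) (use that assms(1) in \<open>simp add: norm_mult\<close>)
  then have "\<forall>\<^sub>F r in at_left 1. circle_integral p (\<lambda>\<zeta>. Fp \<zeta> - F (of_real r * \<zeta>)) = circle_integral p (\<lambda>\<zeta>. Fp \<zeta> - G (of_real r * \<zeta>))"
    by (rule eventually_at_left_1I)
  then have "((\<lambda>r. circle_integral p (\<lambda>\<zeta>. Fp \<zeta> - G (of_real r * \<zeta>))) \<longlongrightarrow> 0) (at_left 1)"
    using assms(2) unfolding hardy_boundary_def by (auto intro: Lim_transform_eventually)
  then show ?thesis using nt assms(2) by (simp add: hardy_boundary_def)
qed

lemma measurable_powr_circle:
  assumes "(\<lambda>t. f (cis t)) \<in> borel_measurable (lebesgue_on {0..2*pi})"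
  shows "(\<lambda>t. cmod (f (cis t)) powr p) \<in> borel_measurable (lebesgue_on {0..2*pi})"
  using assms by measurable

lemma tendsto_0_ennreal_squeeze:
  fixes f g :: "real \<Rightarrow> ennreal"
  assumes "(g \<longlongrightarrow> 0) (at_left 1)" "\<And>r. 0 < r \<Longrightarrow> r < 1 \<Longrightarrow> f r \<le> g r"
  shows "(f \<longlongrightarrow> 0) (at_left 1)"
  by (rule tendsto_sandwich[OF _ _ tendsto_const assms(1)]) (auto intro: eventually_at_left_1I assms(2) always_eventually)

lemma hardy_boundary_add:
  assumes p: "p > 0" and F: "hardy_boundary p F Fp" "continuous_on unit_disk F" and G: "hardy_boundary p G Gp" "continuous_on unit_disk G"
  shows "hardy_boundary p (\<lambda>z. F z + G z) (\<lambda>\<zeta>. Fp \<zeta> + Gp \<zeta>)"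
proof -
  have m: "(\<lambda>t. Fp (cis t)) \<in> borel_measurable (lebesgue_on {0..2*pi})" "(\<lambda>t. Gp (cis t)) \<in> borel_measurable (lebesgue_on {0..2*pi})"
    and fin: "circle_integral p Fp < \<infinity>" "circle_integral p Gp < \<infinity>" using F G by (auto simp: hardy_boundary_def Lp_circle_def)
  have "circle_integral p (\<lambda>\<zeta>. Fp \<zeta> + Gp \<zeta>) \<le> ennreal (2 powr p) * (circle_integral p Fp + circle_integral p Gp)"
    by (rule circle_integral_add_le[OF p]) (intro measurable_powr_circle m)+
  also have "\<dots> < \<infinity>" using fin by (simp add: ennreal_mult_less_top)
  finally have Lp: "(\<lambda>\<zeta>. Fp \<zeta> + Gp \<zeta>) \<in> Lp_circle p" using m by (simp add: Lp_circle_def)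
  have ntF: "AE \<theta> in lebesgue_on {0..2*pi}. nontangential_limit F (cis \<theta>) (Fp (cis \<theta>))" using F by (simp add: hardy_boundary_def)
  have ntG: "AE \<theta> in lebesgue_on {0..2*pi}. nontangential_limit G (cis \<theta>) (Gp (cis \<theta>))" using G by (simp add: hardy_boundary_def)
  have nt: "AE \<theta> in lebesgue_on {0..2*pi}. nontangential_limit (\<lambda>z. F z + G z) (cis \<theta>) (Fp (cis \<theta>) + Gp (cis \<theta>))"
    using ntF ntG by eventually_elim (auto simp: nontangential_limit_def intro: tendsto_add)
  have "((\<lambda>r. circle_integral p (\<lambda>\<zeta>. Fp \<zeta> + Gp \<zeta> - (F (of_real r * \<zeta>) + G (of_real r * \<zeta>)))) \<longlongrightarrow> 0) (at_left 1)"
  proof (rule tendsto_0_ennreal_squeeze)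
    have "((\<lambda>r. ennreal (2 powr p) * (circle_integral p (\<lambda>\<zeta>. Fp \<zeta> - F (of_real r * \<zeta>)) + circle_integral p (\<lambda>\<zeta>. Gp \<zeta> - G (of_real r * \<zeta>)))) \<longlongrightarrow> ennreal (2 powr p) * (0 + 0)) (at_left 1)"
      by (rule tendsto_mult_ennreal[OF tendsto_const tendsto_add]) (use F G in \<open>auto simp: hardy_boundary_def\<close>)
    then show "((\<lambda>r. ennreal (2 powr p) * (circle_integral p (\<lambda>\<zeta>. Fp \<zeta> - F (of_real r * \<zeta>)) + circle_integral p (\<lambda>\<zeta>. Gp \<zeta> - G (of_real r * \<zeta>)))) \<longlongrightarrow> 0) (at_left 1)" by simp
    fix r :: real assume r: "0 < r" "r < 1"
    have mr: "(\<lambda>t. Fp (cis t) - F (of_real r * cis t)) \<in> borel_measurable (lebesgue_on {0..2*pi})"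
      "(\<lambda>t. Gp (cis t) - G (of_real r * cis t)) \<in> borel_measurable (lebesgue_on {0..2*pi})"
      using r by (intro borel_measurable_diff m continuous_on_circle_measurable continuous_dilate_cis F G, auto)+
    have "circle_integral p (\<lambda>\<zeta>. (Fp \<zeta> - F (of_real r * \<zeta>)) + (Gp \<zeta> - G (of_real r * \<zeta>))) \<le> ennreal (2 powr p) * (circle_integral p (\<lambda>\<zeta>. Fp \<zeta> - F (of_real r * \<zeta>)) + circle_integral p (\<lambda>\<zeta>. Gp \<zeta> - G (of_real r * \<zeta>)))"
      by (rule circle_integral_add_le[OF p]) (use mr in measurable)
    moreover have "(\<lambda>\<zeta>. Fp \<zeta> + Gp \<zeta> - (F (of_real r * \<zeta>) + G (of_real r * \<zeta>))) = (\<lambda>\<zeta>. (Fp \<zeta> - F (of_real r * \<zeta>)) + (Gp \<zeta> - G (of_real r * \<zeta>)))"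
      by (simp add: algebra_simps)
    ultimately show "circle_integral p (\<lambda>\<zeta>. Fp \<zeta> + Gp \<zeta> - (F (of_real r * \<zeta>) + G (of_real r * \<zeta>))) \<le> ennreal (2 powr p) * (circle_integral p (\<lambda>\<zeta>. Fp \<zeta> - F (of_real r * \<zeta>)) + circle_integral p (\<lambda>\<zeta>. Gp \<zeta> - G (of_real r * \<zeta>)))"
      by simp
  qed
  then show ?thesis unfolding hardy_boundary_def using Lp nt by blast
qed

text \<open>The multiplier varies with the radius, so with \<open>c_r\<close>, \<open>F_r\<close>
  for the values on the circle of radius \<open>r\<close> the difference is split as
  \<open>c_r * (Fp - F_r) + (c - c_r) * Fp\<close>. The first part vanishes in mean and the second
  is at most \<open>2 * C * cmod Fp\<close>, which is the setting of a moving majorant.\<close>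

lemma hardy_boundary_mult:
  assumes p: "p > 0" and F: "hardy_boundary p F Fp" "continuous_on unit_disk F" and c: "continuous_on UNIV c"
  shows "hardy_boundary p (\<lambda>z. c z * F z) (\<lambda>\<zeta>. c \<zeta> * Fp \<zeta>)"
proof -
  have m: "(\<lambda>t. Fp (cis t)) \<in> borel_measurable (lebesgue_on {0..2*pi})"
    and fin: "circle_integral p Fp < \<infinity>" using F by (auto simp: hardy_boundary_def Lp_circle_def)
  have cm: "(\<lambda>t. c (cis t)) \<in> borel_measurable (lebesgue_on {0..2*pi})" "(\<lambda>t. c (of_real r * cis t)) \<in> borel_measurable (lebesgue_on {0..2*pi})" for r :: real
    by (rule continuous_on_circle_measurable, rule continuous_on_compose2[OF c], auto intro!: continuous_intros)+
  have "bounded (c ` cball 0 1)" by (intro compact_imp_bounded compact_continuous_image continuous_on_subset[OF c]) auto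
  then obtain C where C: "\<And>z. z \<in> cball 0 1 \<Longrightarrow> cmod (c z) \<le> C" unfolding bounded_iff by blast
  have "circle_integral p (\<lambda>\<zeta>. c \<zeta> * Fp \<zeta>) \<le> ennreal (C powr p) * circle_integral p Fp"
    by (rule circle_integral_mult_le[OF p]) (use C m in \<open>auto intro: measurable_powr_circle\<close>)
  also have "\<dots> < \<infinity>" using fin by (simp add: ennreal_mult_less_top)
  finally have Lp: "(\<lambda>\<zeta>. c \<zeta> * Fp \<zeta>) \<in> Lp_circle p" using m cm by (simp add: Lp_circle_def)
  have ntF: "AE \<theta> in lebesgue_on {0..2*pi}. nontangential_limit F (cis \<theta>) (Fp (cis \<theta>))" using F by (simp add: hardy_boundary_def)
  have nt: "AE \<theta> in lebesgue_on {0..2*pi}. nontangential_limit (\<lambda>z. c z * F z) (cis \<theta>) (c (cis \<theta>) * Fp (cis \<theta>))"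
    using ntF
  proof eventually_elim
    case (elim \<theta>)
    have "isCont c (cis \<theta>)" using c by (simp add: continuous_on_eq_continuous_at)
    then have "nontangential_limit c (cis \<theta>) (c (cis \<theta>))"
      unfolding nontangential_limit_def isCont_def using tendsto_within_subset[OF _ subset_UNIV] by blast
    then show ?case using elim by (rule nontangential_limit_mult)
  qed
  have "((\<lambda>r. circle_integral p (\<lambda>\<zeta>. c \<zeta> * Fp \<zeta> - c (of_real r * \<zeta>) * F (of_real r * \<zeta>))) \<longlongrightarrow> 0) (at_left 1)"
  proof (rule tendsto_at_left_1_sequentially)
    fix S :: "nat \<Rightarrow> real" assume S: "\<And>n. 0 < S n" "\<And>n. S n < 1" "S \<longlonglongrightarrow> 1"
    have flim: "filterlim S (at_left 1) sequentially"
      unfolding filterlim_at using S(3) by (intro conjI always_eventually allI) (auto simp: S(2) less_imp_neq[OF S(2)])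
    have L: "((\<lambda>r. circle_integral p (\<lambda>\<zeta>. Fp \<zeta> - F (of_real r * \<zeta>))) \<longlongrightarrow> 0) (at_left 1)" using F by (simp add: hardy_boundary_def)
    have FS: "(\<lambda>t. F (of_real (S n) * cis t)) \<in> borel_measurable (lebesgue_on {0..2*pi})" for n
      by (rule continuous_on_circle_measurable, rule continuous_dilate_cis[OF F(2)]) (use S(1,2)[of n] in auto)
    note [measurable] = m cm FS
    have "(\<lambda>n. \<integral>\<^sup>+t. ennreal (cmod (c (cis t) * Fp (cis t) - c (of_real (S n) * cis t) * F (of_real (S n) * cis t)) powr p) \<partial>lebesgue_on {0..2*pi}) \<longlonglongrightarrow> 0"
    proof (rule nn_integral_tendsto_0_perturbed_domination[where
          w="\<lambda>n t. (2 powr p * C powr p) * cmod (Fp (cis t) - F (of_real (S n) * cis t)) powr p" and v="\<lambda>t. (2 powr p * (2 * C) powr p) * cmod (Fp (cis t)) powr p"])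
      have C0: "C \<ge> 0" using C[of 0] by (auto intro: order_trans[OF norm_ge_zero])
      show "AE t in lebesgue_on {0..2*pi}. cmod (c (cis t) * Fp (cis t) - c (of_real (S n) * cis t) * F (of_real (S n) * cis t)) powr p
          \<le> (2 powr p * C powr p) * cmod (Fp (cis t) - F (of_real (S n) * cis t)) powr p + (2 powr p * (2 * C) powr p) * cmod (Fp (cis t)) powr p" for n
      proof (rule AE_I2)
        fix t
        define X where "X = c (of_real (S n) * cis t) * (Fp (cis t) - F (of_real (S n) * cis t))"
        define Y where "Y = (c (cis t) - c (of_real (S n) * cis t)) * Fp (cis t)"
        have cb: "cmod (c (of_real (S n) * cis t)) \<le> C" "cmod (c (cis t)) \<le> C"
          using S(1,2)[of n] by (auto intro!: C simp: norm_mult)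
        have XY: "c (cis t) * Fp (cis t) - c (of_real (S n) * cis t) * F (of_real (S n) * cis t) = X + Y"
          by (simp add: X_def Y_def algebra_simps)
        have X: "cmod X powr p \<le> C powr p * cmod (Fp (cis t) - F (of_real (S n) * cis t)) powr p"
          unfolding X_def norm_mult powr_mult using cb p by (intro mult_right_mono powr_mono2) auto
        have "cmod (c (cis t) - c (of_real (S n) * cis t)) \<le> 2 * C"
          using norm_triangle_ineq4[of "c (cis t)" "c (of_real (S n) * cis t)"] cb by linarith
        then have "cmod (c (cis t) - c (of_real (S n) * cis t)) powr p \<le> (2 * C) powr p" using p by (intro powr_mono2) auto
        from mult_right_mono[OF this, of "cmod (Fp (cis t)) powr p"]
        have Y: "cmod Y powr p \<le> (2 * C) powr p * cmod (Fp (cis t)) powr p"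
          by (simp only: Y_def norm_mult powr_mult powr_ge_zero simp_thms)
        have "cmod (X + Y) powr p \<le> (cmod X + cmod Y) powr p" using p norm_triangle_ineq by (intro powr_mono2) auto
        also have "\<dots> \<le> 2 powr p * (cmod X powr p + cmod Y powr p)" by (rule powr_add_le) (use p in auto)
        also have "\<dots> \<le> 2 powr p * (C powr p * cmod (Fp (cis t) - F (of_real (S n) * cis t)) powr p + (2 * C) powr p * cmod (Fp (cis t)) powr p)"
          by (intro mult_left_mono add_mono X Y) auto
        finally show "cmod (c (cis t) * Fp (cis t) - c (of_real (S n) * cis t) * F (of_real (S n) * cis t)) powr p
          \<le> (2 powr p * C powr p) * cmod (Fp (cis t) - F (of_real (S n) * cis t)) powr p + (2 powr p * (2 * C) powr p) * cmod (Fp (cis t)) powr p"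
          unfolding XY by (simp add: distrib_left mult.assoc)
      qed
      have "(\<integral>\<^sup>+t. ennreal ((2 powr p * (2 * C) powr p) * cmod (Fp (cis t)) powr p) \<partial>lebesgue_on {0..2*pi}) = ennreal (2 powr p * (2 * C) powr p) * circle_integral p Fp"
        unfolding circle_integral_def by (subst nn_integral_cmult[symmetric]) (auto simp: ennreal_mult' intro!: measurable_compose[OF measurable_powr_circle[OF m]])
      then show "(\<integral>\<^sup>+t. ennreal ((2 powr p * (2 * C) powr p) * cmod (Fp (cis t)) powr p) \<partial>lebesgue_on {0..2*pi}) < \<infinity>"
        using fin by (simp add: ennreal_mult_less_top)
      have "(\<lambda>n. ennreal (2 powr p * C powr p) * circle_integral p (\<lambda>\<zeta>. Fp \<zeta> - F (of_real (S n) * \<zeta>))) \<longlonglongrightarrow> ennreal (2 powr p * C powr p) * 0"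
        by (rule tendsto_mult_ennreal[OF tendsto_const filterlim_compose[OF L flim]]) auto
      moreover have "(\<integral>\<^sup>+t. ennreal ((2 powr p * C powr p) * cmod (Fp (cis t) - F (of_real (S n) * cis t)) powr p) \<partial>lebesgue_on {0..2*pi}) = ennreal (2 powr p * C powr p) * circle_integral p (\<lambda>\<zeta>. Fp \<zeta> - F (of_real (S n) * \<zeta>))" for n
      proof -
        have "(\<lambda>t. ennreal (cmod (Fp (cis t) - F (of_real (S n) * cis t)) powr p)) \<in> borel_measurable (lebesgue_on {0..2*pi})" by measurable
        then show ?thesis unfolding circle_integral_def by (subst nn_integral_cmult[symmetric]) (auto simp: ennreal_mult')
      qed
      ultimately show "(\<lambda>n. \<integral>\<^sup>+t. ennreal ((2 powr p * C powr p) * cmod (Fp (cis t) - F (of_real (S n) * cis t)) powr p) \<partial>lebesgue_on {0..2*pi}) \<longlonglongrightarrow> 0"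
        by simp
      show "AE t in lebesgue_on {0..2*pi}. (\<lambda>n. cmod (c (cis t) * Fp (cis t) - c (of_real (S n) * cis t) * F (of_real (S n) * cis t)) powr p) \<longlonglongrightarrow> 0"
        using nt
      proof eventually_elim
        case (elim t)
        have "(\<lambda>n. c (of_real (S n) * cis t) * F (of_real (S n) * cis t)) \<longlonglongrightarrow> c (cis t) * Fp (cis t)"
          by (rule nontangential_limit_radial[OF elim]) (use S in auto)
        from tendsto_norm[OF tendsto_diff[OF tendsto_const this]]
        have "(\<lambda>n. cmod (c (cis t) * Fp (cis t) - c (of_real (S n) * cis t) * F (of_real (S n) * cis t))) \<longlonglongrightarrow> cmod (c (cis t) * Fp (cis t) - c (cis t) * Fp (cis t))" .
        from tendsto_powr'[OF this tendsto_const, of p] show ?case using p by simp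
      qed
    qed auto
    then show "(\<lambda>n. circle_integral p (\<lambda>\<zeta>. c \<zeta> * Fp \<zeta> - c (of_real (S n) * \<zeta>) * F (of_real (S n) * \<zeta>))) \<longlonglongrightarrow> 0"
      unfolding circle_integral_def .
  qed
  then show ?thesis unfolding hardy_boundary_def using Lp nt by blast
qed

lemma hardy_boundary_sum:
  assumes p: "p > 0" and S: "finite S" and F: "\<And>j. j \<in> S \<Longrightarrow> hardy_boundary p (F j) (Fp j)" "\<And>j. j \<in> S \<Longrightarrow> continuous_on unit_disk (F j)"
  shows "hardy_boundary p (\<lambda>z. \<Sum>j\<in>S. F j z) (\<lambda>\<zeta>. \<Sum>j\<in>S. Fp j \<zeta>)"
  using S F
proof (induction S rule: finite_induct)
  case empty
  then show ?case using p by (simp add: hardy_boundary_def Lp_circle_def circle_integral_def nontangential_limit_def)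
next
  case (insert x S)
  have "hardy_boundary p (\<lambda>z. F x z + (\<Sum>j\<in>S. F j z)) (\<lambda>\<zeta>. Fp x \<zeta> + (\<Sum>j\<in>S. Fp j \<zeta>))"
    by (rule hardy_boundary_add[OF p]) (use insert in \<open>auto intro!: continuous_intros\<close>)
  then show ?case using insert by simp
qed

section \<open>Classical derivatives as weak derivatives\<close>

lemma smooth_L_inf:
  assumes "smooth f" shows "f \<in> L_inf"
proof -
  have "bounded (f ` cball 0 1)" by (intro compact_imp_bounded compact_continuous_image smooth_continuous[OF assms]) auto
  then obtain B where B: "\<And>z. z \<in> cball 0 1 \<Longrightarrow> cmod (f z) \<le> B" unfolding bounded_iff by blast
  have "AE z in disk_measure. cmod (f z) \<le> B" by (rule AE_I2, rule B) simp
  then show ?thesis unfolding L_inf_def using measurable_disk_borel[OF smooth_measurable[OF assms]] by blast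
qed

lemma weak_deriv_smooth:
  assumes "smooth a" shows "weak_deriv dbar a (dbar a)"
proof -
  have l: "locally_integrable a" "locally_integrable (dbar a)" by (intro L_inf_locally_integrable smooth_L_inf smooth_dbar assms)+
  show ?thesis unfolding weak_deriv_def
  proof (intro conjI l allI impI)
    fix \<psi> assume t: "test_function \<psi>"
    have ps: "smooth \<psi>" using t by (simp add: test_function_iff)
    have "(\<integral>z. a z * dbar \<psi> z + dbar a z * \<psi> z \<partial>disk_measure) = 0"
      using integral_dbar_test_zero[OF test_function_mult[OF assms t]] by (simp add: dbar_smooth_mult[OF assms ps])
    then show "(\<integral>z. a z * dbar \<psi> z \<partial>disk_measure) = - (\<integral>z. dbar a z * \<psi> z \<partial>disk_measure)"
      using locally_integrable_test[OF l(1) test_function_dbar[OF t]] locally_integrable_test[OF l(2) t]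
      by (simp add: eq_neg_iff_add_eq_0)
  qed
qed

lemma continuous_locally_integrable:
  assumes "continuous_on unit_disk f" shows "locally_integrable f"
proof (rule locally_integrableI)
  interpret finite_measure disk_measure by (rule finite_measure_disk)
  fix r :: real assume r: "r < 1"
  have "bounded (f ` cball 0 r)" by (intro compact_imp_bounded compact_continuous_image continuous_on_subset[OF assms]) (use r in auto)
  then obtain B where B: "\<And>z. z \<in> cball 0 r \<Longrightarrow> cmod (f z) \<le> B" unfolding bounded_iff by blast
  have [measurable]: "f \<in> borel_measurable disk_measure" by (rule continuous_imp_measurable_on_sets_lebesgue[OF assms]) simp
  have [measurable]: "(indicator (cball 0 r) :: complex \<Rightarrow> complex) \<in> borel_measurable disk_measure"
    by (rule measurable_disk_borel) (rule borel_measurable_indicator, simp)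
  show "integrable disk_measure (\<lambda>z. indicator (cball 0 r) z * f z)"
  proof (rule integrable_const_bound)
    show "AE z in disk_measure. norm (indicator (cball 0 r) z * f z) \<le> max B 0"
      using B by (intro AE_I2) (auto simp: indicator_def norm_mult le_max_iff_disj)
  qed measurable
qed

text \<open>\<open>\<phi>\<close> is given only inside the disk, whereas \<open>smooth\<close>
  refers to the whole plane. Taylor polynomials are smooth everywhere with zero \<open>dbar\<close>,
  and they are uniformly bounded on the support of a test function.\<close>

lemma weak_deriv_holomorphic:
  assumes "\<phi> holomorphic_on unit_disk" shows "weak_deriv dbar \<phi> (\<lambda>_. 0)"
  unfolding weak_deriv_def
proof (intro conjI allI impI)
  show "locally_integrable \<phi>" by (intro continuous_locally_integrable holomorphic_on_imp_continuous_on assms)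
  show "locally_integrable (\<lambda>_. 0)" by (intro L_inf_locally_integrable L_inf_const)
  fix \<psi> assume t: "test_function \<psi>"
  obtain a where a: "\<And>z. cmod z < 1 \<Longrightarrow> (\<lambda>n. a n * z ^ n) sums \<phi> z" "\<And>z. cmod z < 1 \<Longrightarrow> summable (\<lambda>n. norm (a n * z ^ n))"
    by (rule holomorphic_circle_mean_sums[OF assms]) (use that in blast)
  obtain r where r: "0 < r" "r < 1" "\<And>z. r < cmod z \<Longrightarrow> \<psi> z = 0" by (rule test_function_support[OF t]) blast
  have dpsi: "dbar \<psi> z = 0" if "r < cmod z" for z using partial_deriv_zero[of r \<psi> z] r(3) that by (simp add: dbar_def)
  define P where "P N z = (\<Sum>n<N. a n * z ^ n)" for N z
  have pow: "smooth (\<lambda>z. c * z ^ n) \<and> dbar (\<lambda>z. c * z ^ n) = (\<lambda>_. 0)" for c n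
  proof
    have "smooth (\<lambda>z. z ^ n)" by (induction n) (auto intro: smooth_const smooth_mult smooth_ident)
    then show "smooth (\<lambda>z. c * z ^ n)" by (intro smooth_mult smooth_const)
    show "dbar (\<lambda>z. c * z ^ n) = (\<lambda>_. 0)"
    proof
      fix z
      have "((\<lambda>z. c * z ^ n) has_field_derivative (c * (of_nat n * z ^ (n - 1)))) (at z)" by (auto intro!: derivative_eq_intros)
      then show "dbar (\<lambda>z. c * z ^ n) z = 0" by (rule dbar_holomorphic)
    qed
  qed
  have Pw: "weak_deriv dbar (P N) (\<lambda>_. 0)" for N
  proof (induction N)
    case 0
    have "dbar (\<lambda>_. 0) = (\<lambda>_. 0)" by (rule ext) (rule dbar_holomorphic[of _ 0], simp)
    then show ?case using weak_deriv_smooth[OF smooth_const[of 0]] by (simp add: P_def[abs_def])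
  next
    case (Suc N)
    have "weak_deriv dbar (\<lambda>z. a N * z ^ N) (\<lambda>_. 0)" using weak_deriv_smooth[of "\<lambda>z. a N * z ^ N"] pow[of "a N" N] by simp
    from weak_deriv_add[OF Suc this] show ?case by (simp add: P_def)
  qed
  have "summable (\<lambda>n. norm (a n * of_real r ^ n))" using a(2)[of "of_real r"] r by simp
  then have sr: "summable (\<lambda>n. norm (a n) * r ^ n)" using r by (simp add: norm_mult norm_power)
  define M where "M = (\<Sum>n. norm (a n) * r ^ n)"
  have PM: "cmod (P N z) \<le> M" if "cmod z \<le> r" for N z
  proof -
    have "cmod (P N z) \<le> (\<Sum>n<N. norm (a n) * r ^ n)"
      unfolding P_def by (rule sum_norm_le) (use that in \<open>simp add: norm_mult norm_power mult_left_mono power_mono\<close>)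
    also have "\<dots> \<le> M" unfolding M_def by (rule sum_le_suminf[OF sr]) (use r in auto)
    finally show ?thesis .
  qed
  have mm [measurable]: "dbar \<psi> \<in> borel_measurable disk_measure" by (intro measurable_disk_borel test_function_measurable test_function_dbar t)
  have [measurable]: "\<phi> \<in> borel_measurable disk_measure"
    by (rule continuous_imp_measurable_on_sets_lebesgue[OF holomorphic_on_imp_continuous_on[OF assms]]) simp
  have [measurable]: "P N \<in> borel_measurable disk_measure" for N using Pw[of N] by (auto simp: weak_deriv_def intro: locally_integrable_measurable)
  have "(\<lambda>N. \<integral>z. P N z * dbar \<psi> z \<partial>disk_measure) \<longlonglongrightarrow> (\<integral>z. \<phi> z * dbar \<psi> z \<partial>disk_measure)"
  proof (rule integral_dominated_convergence[where w="\<lambda>z. M * norm (dbar \<psi> z)"])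
    show "integrable disk_measure (\<lambda>z. M * norm (dbar \<psi> z))"
      using L_inf_integrable[OF test_function_L_inf[OF test_function_dbar[OF t]]] by simp
    show "AE z in disk_measure. norm (P N z * dbar \<psi> z) \<le> M * norm (dbar \<psi> z)" for N
    proof (rule AE_I2)
      fix z
      show "norm (P N z * dbar \<psi> z) \<le> M * norm (dbar \<psi> z)"
        using dpsi[of z] mult_right_mono[OF PM, of z "norm (dbar \<psi> z)" N] by (cases "cmod z \<le> r") (auto simp: norm_mult)
    qed
    show "AE z in disk_measure. (\<lambda>N. P N z * dbar \<psi> z) \<longlonglongrightarrow> \<phi> z * dbar \<psi> z"
    proof (rule AE_I2)
      fix z assume "z \<in> space disk_measure"
      then have "(\<lambda>N. P N z) \<longlonglongrightarrow> \<phi> z" using a(1)[of z] by (simp add: sums_def P_def)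
      then show "(\<lambda>N. P N z * dbar \<psi> z) \<longlonglongrightarrow> \<phi> z * dbar \<psi> z" by (intro tendsto_intros)
    qed
  qed measurable
  moreover have "(\<integral>z. P N z * dbar \<psi> z \<partial>disk_measure) = 0" for N using Pw[of N] t by (simp add: weak_deriv_def)
  ultimately show "(\<integral>z. \<phi> z * dbar \<psi> z \<partial>disk_measure) = - (\<integral>z. 0 * \<psi> z \<partial>disk_measure)"
    using LIMSEQ_unique[OF _ tendsto_const[of 0]] by simp
qed

section \<open>Coefficients with bounded continuous dbar-derivatives\<close>

text \<open>Weak \<open>dbar\<close>-derivatives up to order \<open>m\<close>, each with a
  continuous bounded version. Only \<open>dbar\<close> is tracked: Leibniz's rule for it stays
  within the class, and Weyl's lemma supplies the continuous versions.\<close>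

primrec bounded_chain :: "nat \<Rightarrow> (complex \<Rightarrow> complex) set" where
  "bounded_chain 0 = {a. continuous_on unit_disk a \<and> a \<in> L_inf}"
| "bounded_chain (Suc m) = {a. continuous_on unit_disk a \<and> a \<in> L_inf \<and> (\<exists>b\<in>bounded_chain m. weak_deriv dbar a b)}"

declare bounded_chain.simps(2) [simp del]

lemma bounded_chain_SucI:
  "continuous_on unit_disk a \<Longrightarrow> a \<in> L_inf \<Longrightarrow> weak_deriv dbar a b \<Longrightarrow> b \<in> bounded_chain m \<Longrightarrow> a \<in> bounded_chain (Suc m)"
  unfolding bounded_chain.simps(2) by blast

lemma bounded_chain_SucE:
  assumes "a \<in> bounded_chain (Suc m)"
  obtains b where "b \<in> bounded_chain m" "weak_deriv dbar a b"
  using assms unfolding bounded_chain.simps(2) by blast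

lemma bounded_chain_D: "a \<in> bounded_chain m \<Longrightarrow> continuous_on unit_disk a \<and> a \<in> L_inf"
  by (cases m) (auto simp: bounded_chain.simps(2))

lemma bounded_chain_Suc_subset: "a \<in> bounded_chain (Suc m) \<Longrightarrow> a \<in> bounded_chain m"
proof (induction m arbitrary: a)
  case 0
  then show ?case using bounded_chain_D[OF 0] by simp
next
  case (Suc m)
  obtain b where b: "b \<in> bounded_chain (Suc m)" "weak_deriv dbar a b" by (rule bounded_chain_SucE[OF Suc.prems])
  show ?case by (rule bounded_chain_SucI[OF _ _ b(2) Suc.IH[OF b(1)]]) (use bounded_chain_D[OF Suc.prems] in auto)
qed

lemma bounded_chain_antimono: "m \<le> n \<Longrightarrow> a \<in> bounded_chain n \<Longrightarrow> a \<in> bounded_chain m"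
  by (induction rule: dec_induct) (use bounded_chain_Suc_subset in blast)+

lemma bounded_chain_add: "a \<in> bounded_chain m \<Longrightarrow> b \<in> bounded_chain m \<Longrightarrow> (\<lambda>z. a z + b z) \<in> bounded_chain m"
proof (induction m arbitrary: a b)
  case 0
  then show ?case by (auto intro: continuous_on_add L_inf_add)
next
  case (Suc m)
  obtain a' where a': "a' \<in> bounded_chain m" "weak_deriv dbar a a'" by (rule bounded_chain_SucE[OF Suc.prems(1)])
  obtain b' where b': "b' \<in> bounded_chain m" "weak_deriv dbar b b'" by (rule bounded_chain_SucE[OF Suc.prems(2)])
  show ?case
    by (rule bounded_chain_SucI[OF _ _ weak_deriv_add[OF a'(2) b'(2)] Suc.IH[OF a'(1) b'(1)]])
       (use bounded_chain_D[OF Suc.prems(1)] bounded_chain_D[OF Suc.prems(2)] in \<open>auto intro: continuous_on_add L_inf_add\<close>)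
qed

lemma bounded_chain_mult: "a \<in> bounded_chain m \<Longrightarrow> b \<in> bounded_chain m \<Longrightarrow> (\<lambda>z. a z * b z) \<in> bounded_chain m"
proof (induction m arbitrary: a b)
  case 0
  then show ?case by (auto intro: continuous_on_mult L_inf_mult)
next
  case (Suc m)
  obtain a' where a': "a' \<in> bounded_chain m" "weak_deriv dbar a a'" by (rule bounded_chain_SucE[OF Suc.prems(1)])
  obtain b' where b': "b' \<in> bounded_chain m" "weak_deriv dbar b b'" by (rule bounded_chain_SucE[OF Suc.prems(2)])
  note ab = bounded_chain_Suc_subset[OF Suc.prems(1)] bounded_chain_Suc_subset[OF Suc.prems(2)]
  have L: "a \<in> L_inf" "a' \<in> L_inf" using bounded_chain_D[OF ab(1)] bounded_chain_D[OF a'(1)] by auto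
  show ?case
    by (rule bounded_chain_SucI[OF _ _ weak_deriv_mult[OF L a'(2) b'(2)] bounded_chain_add[OF Suc.IH[OF a'(1) ab(2)] Suc.IH[OF ab(1) b'(1)]]])
       (use bounded_chain_D[OF Suc.prems(1)] bounded_chain_D[OF Suc.prems(2)] in \<open>auto intro: continuous_on_mult L_inf_mult\<close>)
qed

lemma bounded_chain_zero: "(\<lambda>_. 0) \<in> bounded_chain m"
proof (induction m)
  case (Suc m)
  have "weak_deriv dbar (\<lambda>_. 0) (\<lambda>_. 0)" by (rule weak_deriv_holomorphic) simp
  from bounded_chain_SucI[OF _ L_inf_const this Suc] show ?case by simp
qed (auto intro: L_inf_const)

text \<open>The essential bound is an actual one, since \<open>max (cmod (a z) - C) 0\<close> is
  continuous and vanishes almost everywhere.\<close>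

lemma bounded_chain_bound:
  assumes "a \<in> bounded_chain m" obtains C where "\<And>z. z \<in> unit_disk \<Longrightarrow> cmod (a z) \<le> C"
proof -
  have c: "continuous_on unit_disk a" and "a \<in> L_inf" using bounded_chain_D[OF assms] by auto
  then obtain C where C: "AE z in disk_measure. cmod (a z) \<le> C" by (auto simp: L_inf_def)
  have "cmod (a z) \<le> C" if z: "z \<in> unit_disk" for z
  proof -
    have "complex_of_real (max (cmod (a z) - C) 0) = 0"
    proof (rule AE_disk_eq_imp_eq[where S=unit_disk and f="\<lambda>z. complex_of_real (max (cmod (a z) - C) 0)" and g="\<lambda>_. 0"])
      show "continuous_on unit_disk (\<lambda>z. complex_of_real (max (cmod (a z) - C) 0))" by (intro continuous_intros c)
      show "AE z in disk_measure. z \<in> unit_disk \<longrightarrow> complex_of_real (max (cmod (a z) - C) 0) = 0"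
        using C by eventually_elim (simp add: max_def)
    qed (use z in auto)
    then have "max (cmod (a z) - C) 0 = 0" by (simp only: of_real_eq_0_iff)
    then show ?thesis by linarith
  qed
  then show thesis by (rule that)
qed

lemma test_function_partial_deriv: "test_function \<phi> \<Longrightarrow> test_function (partial_deriv v \<phi>)"
proof -
  assume t: "test_function \<phi>"
  obtain r where r: "0 < r" "r < 1" "\<And>z. r < cmod z \<Longrightarrow> \<phi> z = 0" by (rule test_function_support[OF t]) blast
  show "test_function (partial_deriv v \<phi>)"
    by (rule test_functionI[OF smooth_partial_deriv r(2)]) (use t r(3) partial_deriv_zero[of r \<phi>] in \<open>auto simp: test_function_iff\<close>)
qed

lemma W_inf_subset_L_inf: "f \<in> W_inf k \<Longrightarrow> f \<in> L_inf"
  by (cases k) auto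

lemma W_inf_lincomb: "f \<in> W_inf k \<Longrightarrow> g \<in> W_inf k \<Longrightarrow> (\<lambda>z. a * f z + b * g z) \<in> W_inf k"
proof (induction k arbitrary: f g)
  case 0
  then show ?case by (auto intro!: L_inf_add L_inf_mult L_inf_const)
next
  case (Suc k)
  have L: "f \<in> L_inf" "g \<in> L_inf" using Suc.prems W_inf_subset_L_inf by blast+
  have lab: "locally_integrable (\<lambda>z. a * f z + b * g z)" if "f \<in> L_inf" "g \<in> L_inf" for f g
    by (intro L_inf_locally_integrable L_inf_add L_inf_mult L_inf_const that)
  have ex: "\<exists>h\<in>W_inf k. weak_deriv (partial_deriv v) (\<lambda>z. a * f z + b * g z) h" if v: "v \<in> {1, \<i>}" for v
  proof -
    have "\<exists>f'\<in>W_inf k. weak_deriv (partial_deriv v) f f'" "\<exists>g'\<in>W_inf k. weak_deriv (partial_deriv v) g g'" using Suc.prems v unfolding W_inf.simps(2) by blast+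
    then obtain f' g' where f': "f' \<in> W_inf k" "weak_deriv (partial_deriv v) f f'" and g': "g' \<in> W_inf k" "weak_deriv (partial_deriv v) g g'" by blast
    have L': "f' \<in> L_inf" "g' \<in> L_inf" using f' g' W_inf_subset_L_inf by auto
    have "weak_deriv (partial_deriv v) (\<lambda>z. a * f z + b * g z) (\<lambda>z. a * f' z + b * g' z)"
      unfolding weak_deriv_def
    proof (intro conjI allI impI lab L L')
      fix \<psi> assume t: "test_function \<psi>"
      note ti = locally_integrable_test[OF L_inf_locally_integrable]
      have "(\<integral>z. (a * f z + b * g z) * partial_deriv v \<psi> z \<partial>disk_measure) = (\<integral>z. a * (f z * partial_deriv v \<psi> z) + b * (g z * partial_deriv v \<psi> z) \<partial>disk_measure)"
        by (rule Bochner_Integration.integral_cong) (auto simp: algebra_simps)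
      also have "\<dots> = a * (\<integral>z. f z * partial_deriv v \<psi> z \<partial>disk_measure) + b * (\<integral>z. g z * partial_deriv v \<psi> z \<partial>disk_measure)"
        by (intro integral_linear_combination ti L test_function_partial_deriv t)
      also have "\<dots> = - (a * (\<integral>z. f' z * \<psi> z \<partial>disk_measure) + b * (\<integral>z. g' z * \<psi> z \<partial>disk_measure))"
        using f'(2) g'(2) t by (simp add: weak_deriv_def)
      also have "a * (\<integral>z. f' z * \<psi> z \<partial>disk_measure) + b * (\<integral>z. g' z * \<psi> z \<partial>disk_measure) = (\<integral>z. a * (f' z * \<psi> z) + b * (g' z * \<psi> z) \<partial>disk_measure)"
        by (rule integral_linear_combination[symmetric]) (intro ti L' t)+
      also have "\<dots> = (\<integral>z. (a * f' z + b * g' z) * \<psi> z \<partial>disk_measure)"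
        by (rule Bochner_Integration.integral_cong) (auto simp: algebra_simps)
      finally show "(\<integral>z. (a * f z + b * g z) * partial_deriv v \<psi> z \<partial>disk_measure) = - (\<integral>z. (a * f' z + b * g' z) * \<psi> z \<partial>disk_measure)" .
    qed
    then show ?thesis using Suc.IH[OF f'(1) g'(1)] by blast
  qed
  have "(\<lambda>z. a * f z + b * g z) \<in> L_inf" by (intro L_inf_add L_inf_mult L_inf_const L)
  then show ?case unfolding W_inf.simps(2) using ex by blast
qed

lemma W_inf_dbar:
  assumes "A \<in> W_inf (Suc k)" obtains B where "B \<in> W_inf k" "weak_deriv dbar A B"
proof -
  have "\<exists>g\<in>W_inf k. weak_deriv (partial_deriv 1) A g" "\<exists>g\<in>W_inf k. weak_deriv (partial_deriv \<i>) A g" using assms unfolding W_inf.simps(2) by blast+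
  then obtain f g where f: "f \<in> W_inf k" "weak_deriv (partial_deriv 1) A f" and g: "g \<in> W_inf k" "weak_deriv (partial_deriv \<i>) A g" by blast
  have L: "A \<in> L_inf" "f \<in> L_inf" "g \<in> L_inf" using f(1) g(1) assms W_inf_subset_L_inf by blast+
  note ti = locally_integrable_test[OF L_inf_locally_integrable]
  have "weak_deriv dbar A (\<lambda>z. (1/2) * f z + (\<i>/2) * g z)"
    unfolding weak_deriv_def
  proof (intro conjI allI impI L_inf_locally_integrable L_inf_add L_inf_mult L_inf_const L)
    fix \<psi> assume t: "test_function \<psi>"
    have "(\<integral>z. A z * dbar \<psi> z \<partial>disk_measure) = (\<integral>z. (1/2) * (A z * partial_deriv 1 \<psi> z) + (\<i>/2) * (A z * partial_deriv \<i> \<psi> z) \<partial>disk_measure)"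
      by (rule Bochner_Integration.integral_cong) (auto simp: dbar_def algebra_simps add_divide_distrib)
    also have "\<dots> = (1/2) * (\<integral>z. A z * partial_deriv 1 \<psi> z \<partial>disk_measure) + (\<i>/2) * (\<integral>z. A z * partial_deriv \<i> \<psi> z \<partial>disk_measure)"
      by (intro integral_linear_combination ti L test_function_partial_deriv t)
    also have "\<dots> = - ((1/2) * (\<integral>z. f z * \<psi> z \<partial>disk_measure) + (\<i>/2) * (\<integral>z. g z * \<psi> z \<partial>disk_measure))"
      using f(2) g(2) t by (simp add: weak_deriv_def)
    also have "(1/2) * (\<integral>z. f z * \<psi> z \<partial>disk_measure) + (\<i>/2) * (\<integral>z. g z * \<psi> z \<partial>disk_measure) = (\<integral>z. (1/2) * (f z * \<psi> z) + (\<i>/2) * (g z * \<psi> z) \<partial>disk_measure)"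
      by (rule integral_linear_combination[symmetric]) (intro ti L t)+
    also have "\<dots> = (\<integral>z. ((1/2) * f z + (\<i>/2) * g z) * \<psi> z \<partial>disk_measure)"
      by (rule Bochner_Integration.integral_cong) (auto simp: algebra_simps)
    finally show "(\<integral>z. A z * dbar \<psi> z \<partial>disk_measure) = - (\<integral>z. ((1/2) * f z + (\<i>/2) * g z) * \<psi> z \<partial>disk_measure)" .
  qed
  then show thesis using that W_inf_lincomb[OF f(1) g(1)] by blast
qed

text \<open>The difference of \<open>A\<close> and the Cauchy transform of its
  \<open>dbar\<close>-derivative is weakly holomorphic, and the transform of a bounded function is
  continuous. The top derivative is spent on this continuity, hence the drop from
  \<open>Suc k\<close> to \<open>k\<close>.\<close>

lemma W_inf_continuous_version:
  "A \<in> W_inf (Suc k) \<Longrightarrow> \<exists>A'\<in>bounded_chain k. AE z in disk_measure. A z = A' z"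
proof (induction k arbitrary: A)
  have version: "\<exists>A'\<in>bounded_chain 0. AE z in disk_measure. A z = A' z"
    if A: "A \<in> L_inf" and B: "B \<in> L_inf" and w: "weak_deriv dbar A B" for A B
  proof -
    have wT: "weak_deriv dbar (cauchy_transform B) B" by (rule weak_deriv_cauchy_transform[OF L_inf_integrable[OF B]])
    have wT': "weak_deriv dbar (\<lambda>z. (- 1) * cauchy_transform B z) (\<lambda>z. 0 * cauchy_transform B z + (- 1) * B z)"
      by (rule weak_deriv_mult[OF L_inf_const L_inf_const weak_deriv_holomorphic wT]) simp
    have "weak_deriv dbar (\<lambda>z. A z + (- 1) * cauchy_transform B z) (\<lambda>_. 0)"
      using weak_deriv_add[OF w wT'] by simp
    then obtain \<phi> where \<phi>: "\<phi> holomorphic_on unit_disk" "AE z in disk_measure. A z + (- 1) * cauchy_transform B z = \<phi> z"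
      by (rule weyl_lemma)
    define A' where "A' z = \<phi> z + cauchy_transform B z" for z
    have ae: "AE z in disk_measure. A z = A' z" using \<phi>(2) by eventually_elim (simp add: A'_def algebra_simps)
    have cB: "continuous_on UNIV (cauchy_transform B)" using B cauchy_transform_continuous[of B] by (auto simp: L_inf_def)
    have cont: "continuous_on unit_disk A'" unfolding A'_def[abs_def]
      by (intro continuous_on_add holomorphic_on_imp_continuous_on[OF \<phi>(1)] continuous_on_subset[OF cB]) auto
    obtain C where C: "AE z in disk_measure. cmod (A z) \<le> C" using A by (auto simp: L_inf_def)
    have "AE z in disk_measure. cmod (A' z) \<le> C" using ae C by eventually_elim simp
    moreover have "A' \<in> borel_measurable disk_measure" by (rule continuous_imp_measurable_on_sets_lebesgue[OF cont]) simp
    ultimately have "A' \<in> bounded_chain 0" using cont by (auto simp: L_inf_def)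
    then show ?thesis using ae by blast
  qed
  {
    case 0
    obtain B where "B \<in> W_inf 0" "weak_deriv dbar A B" by (rule W_inf_dbar[OF 0])
    then show ?case using version[of A B] W_inf_subset_L_inf 0 by blast
  next
    case (Suc k)
    obtain B where B: "B \<in> W_inf (Suc k)" "weak_deriv dbar A B" by (rule W_inf_dbar[OF Suc.prems])
    obtain B' where B': "B' \<in> bounded_chain k" "AE z in disk_measure. B z = B' z" using Suc.IH[OF B(1)] by blast
    obtain A' where A': "A' \<in> bounded_chain 0" "AE z in disk_measure. A z = A' z"
      using version[of A B] W_inf_subset_L_inf B Suc.prems by blast
    have "weak_deriv dbar A' B'"
      by (rule weak_deriv_cong[OF B(2) A'(2) B'(2)]) (use A' B' bounded_chain_D in \<open>auto intro: L_inf_locally_integrable\<close>)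
    then have "A' \<in> bounded_chain (Suc k)" using bounded_chain_D[OF A'(1)] B'(1) by (intro bounded_chain_SucI[of A' B']) auto
    then show ?case using A'(2) by blast
  }
qed

text \<open>Bootstrapping in \<open>dbar E = A * E\<close>: if \<open>E\<close> has order
  \<open>m\<close>, so has its product with the continuous version \<open>A'\<close> of
  \<open>A\<close>, and then \<open>E\<close> has order \<open>m + 1\<close>. As \<open>A'\<close>
  has order \<open>k - 1\<close>, the gain ends at order \<open>k\<close>.\<close>

lemma exp_cauchy_transform_bounded_chain:
  assumes A: "A \<in> W_inf k"
  shows "(\<lambda>z. exp (cauchy_transform A z)) \<in> bounded_chain k"
proof -
  define E where "E z = exp (cauchy_transform A z)" for z
  have AL: "A \<in> L_inf" by (rule W_inf_subset_L_inf[OF A])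
  have E: "E \<in> L_inf" "weak_deriv dbar E (\<lambda>z. A z * E z)"
    using weak_deriv_exp_cauchy_transform[OF AL, of 1] by (simp_all add: E_def[abs_def])
  have cT: "continuous_on UNIV (cauchy_transform A)" using AL cauchy_transform_continuous[of A] by (auto simp: L_inf_def)
  have "continuous_on unit_disk E" unfolding E_def[abs_def] by (intro continuous_intros continuous_on_subset[OF cT]) auto
  then have E0: "E \<in> bounded_chain 0" using E(1) by simp
  have "E \<in> bounded_chain k"
  proof (cases k)
    case (Suc j)
    obtain A' where A': "A' \<in> bounded_chain j" "AE z in disk_measure. A z = A' z" using W_inf_continuous_version A Suc by blast
    have "m \<le> Suc j \<Longrightarrow> E \<in> bounded_chain m" for m
    proof (induction m)
      case (Suc m)
      have m: "A' \<in> bounded_chain m" "E \<in> bounded_chain m" using bounded_chain_antimono[OF _ A'(1), of m] Suc.IH Suc.prems by simp_all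
      then have AE: "(\<lambda>z. A' z * E z) \<in> bounded_chain m" by (rule bounded_chain_mult)
      have "weak_deriv dbar E (\<lambda>z. A' z * E z)"
      proof (rule weak_deriv_cong[OF E(2)])
        show "AE z in disk_measure. A z * E z = A' z * E z" using A'(2) by eventually_elim simp
      qed (use E(1) AE bounded_chain_D in \<open>auto intro: L_inf_locally_integrable\<close>)
      then show ?case using bounded_chain_D[OF E0] AE by (intro bounded_chain_SucI[of E]) auto
    qed (rule E0)
    then show ?thesis using Suc by simp
  qed (use E0 in simp)
  then show ?thesis by (simp add: E_def[abs_def])
qed

section \<open>Polyanalytic functions\<close>

lemma dbar_cnj_power: "dbar (\<lambda>z. c * cnj z ^ j) z = c * (of_nat j * cnj z ^ (j - 1))"
proof -
  have "((\<lambda>z. c * cnj z ^ j) has_derivative (\<lambda>v. c * (of_nat j * cnj v * cnj z ^ (j - 1)))) (at z)"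
    by (rule has_derivative_mult_right, rule has_derivative_power, rule bounded_linear_imp_has_derivative[OF bounded_linear_cnj])
  from dbar_eq[OF this] show ?thesis by (simp add: algebra_simps)
qed

lemma smooth_cnj_power: "smooth (\<lambda>z. c * cnj z ^ j)"
proof -
  have "smooth (\<lambda>z. cnj z ^ j)"
  proof (induction j)
    case 0
    show ?case by (simp add: smooth_const)
  next
    case (Suc j)
    show ?case unfolding power_Suc by (rule smooth_mult[OF smooth_cnj[OF smooth_ident] Suc])
  qed
  from smooth_mult[OF smooth_const this] show ?thesis .
qed

lemma weak_deriv_sum:
  assumes "finite S" "\<And>j. j \<in> S \<Longrightarrow> weak_deriv dbar (u j) (h j)"
  shows "weak_deriv dbar (\<lambda>z. \<Sum>j\<in>S. u j z) (\<lambda>z. \<Sum>j\<in>S. h j z)"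
  using assms
proof (induction S rule: finite_induct)
  case empty
  show ?case using weak_deriv_holomorphic[of "\<lambda>_. 0"] by simp
next
  case (insert x S)
  have "weak_deriv dbar (\<lambda>z. u x z + (\<Sum>j\<in>S. u j z)) (\<lambda>z. h x z + (\<Sum>j\<in>S. h j z))"
    by (rule weak_deriv_add) (use insert in auto)
  then show ?case using insert by simp
qed

text \<open>The weights \<open>1 / fact j\<close> turn \<open>dbar\<close> into the index shift from
  \<open>i\<close> to \<open>Suc i\<close>. At \<open>i = n\<close> the sum is empty, which
  expresses the equation of order \<open>n\<close>.\<close>

definition polyanalytic :: "nat \<Rightarrow> (nat \<Rightarrow> complex \<Rightarrow> complex) \<Rightarrow> nat \<Rightarrow> complex \<Rightarrow> complex" where
  "polyanalytic n \<psi> i z = (\<Sum>j<n-i. (1 / fact j) * cnj z ^ j * \<psi> (i + j) z)"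

lemma weak_deriv_polyanalytic:
  assumes h: "\<And>j. \<psi> j holomorphic_on unit_disk"
  shows "weak_deriv dbar (polyanalytic n \<psi> i) (polyanalytic n \<psi> (Suc i))"
proof -
  define c where "c j = (\<lambda>z. (1 / fact j) * cnj z ^ j)" for j
  define c' where "c' j = (\<lambda>z. (1 / fact j) * (of_nat j * cnj z ^ (j - 1)) :: complex)" for j
  have cs: "smooth (c j)" for j unfolding c_def by (rule smooth_cnj_power)
  have cd: "dbar (c j) = c' j" for j unfolding c_def c'_def by (rule ext) (rule dbar_cnj_power)
  have cL: "c j \<in> L_inf" "c' j \<in> L_inf" for j using smooth_L_inf[OF cs[of j]] smooth_L_inf[OF smooth_dbar[OF cs[of j]]] by (auto simp: cd)
  have cw: "weak_deriv dbar (c j) (c' j)" for j using weak_deriv_smooth[OF cs[of j]] by (simp add: cd)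
  have "weak_deriv dbar (\<lambda>z. \<Sum>j<n-i. c j z * \<psi> (i + j) z) (\<lambda>z. \<Sum>j<n-i. c' j z * \<psi> (i + j) z + c j z * 0)"
    by (rule weak_deriv_sum[OF finite_lessThan]) (rule weak_deriv_mult[OF cL cw weak_deriv_holomorphic[OF h]])
  moreover have "(\<lambda>z. \<Sum>j<n-i. c' j z * \<psi> (i + j) z + c j z * 0) = polyanalytic n \<psi> (Suc i)"
  proof
    fix z
    show "(\<Sum>j<n-i. c' j z * \<psi> (i + j) z + c j z * 0) = polyanalytic n \<psi> (Suc i) z"
    proof (cases "n - i")
      case 0
      then show ?thesis by (simp add: polyanalytic_def)
    next
      case (Suc m)
      \<comment> \<open>\<open>c' 0\<close> vanishes through its factor \<open>of_nat 0\<close>, so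
        the truncated exponent \<open>0 - 1\<close> does no harm; the remaining terms are shifted
        down by one.\<close>
      have "(\<Sum>j<Suc m. c' j z * \<psi> (i + j) z) = c' 0 z * \<psi> (i + 0) z + (\<Sum>j<m. c' (Suc j) z * \<psi> (i + Suc j) z)"
        by (rule sum.lessThan_Suc_shift)
      also have "\<dots> = (\<Sum>j<m. (1 / fact j) * cnj z ^ j * \<psi> (Suc i + j) z)"
      proof -
        have "c' (Suc j) z = (1 / fact j) * cnj z ^ j" for j
          using fact_Suc[of j, where 'a=complex] by (simp add: c'_def field_simps del: of_nat_Suc)
        then show ?thesis by (simp add: c'_def[of 0])
      qed
      moreover have "n - Suc i = m" using Suc by simp
      ultimately show ?thesis using Suc by (simp add: polyanalytic_def)
    qed
  qed
  ultimately show ?thesis by (simp add: polyanalytic_def[abs_def] c_def)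
qed

lemma continuous_polyanalytic:
  assumes h: "\<And>j. \<psi> j holomorphic_on unit_disk"
  shows "continuous_on unit_disk (polyanalytic n \<psi> i)"
  unfolding polyanalytic_def[abs_def]
  by (intro continuous_intros holomorphic_on_imp_continuous_on h)

text \<open>Downward induction from \<open>V n = 0\<close>. Once \<open>V (Suc i)\<close> is known,
  subtracting from \<open>V i\<close> the polyanalytic sum without its component
  \<open>\<psi> i\<close> leaves a function with weak \<open>dbar\<close> zero; by Weyl's lemma it
  is holomorphic and becomes that component.\<close>

lemma polyanalytic_structure:
  assumes V: "\<And>i. i < n \<Longrightarrow> weak_deriv dbar (V i) (V (Suc i))" and Vn: "AE z in disk_measure. V n z = 0"
  obtains \<psi> where "\<And>j. \<psi> j holomorphic_on unit_disk" "\<And>i. i \<le> n \<Longrightarrow> AE z in disk_measure. V i z = polyanalytic n \<psi> i z"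
proof -
  have "d \<le> n \<Longrightarrow> \<exists>\<psi>. (\<forall>j. \<psi> j holomorphic_on unit_disk) \<and> (\<forall>i. n - d \<le> i \<and> i \<le> n \<longrightarrow> (AE z in disk_measure. V i z = polyanalytic n \<psi> i z))" for d
  proof (induction d)
    case 0
    from Vn have "AE z in disk_measure. V n z = polyanalytic n (\<lambda>_ _. 0) n z"
      by eventually_elim (simp add: polyanalytic_def)
    then show ?case by (intro exI[of _ "\<lambda>_ _. 0"]) (auto simp: le_antisym)
  next
    case (Suc d)
    then obtain \<psi> where \<psi>: "\<And>j. \<psi> j holomorphic_on unit_disk"
      "\<And>i. n - d \<le> i \<Longrightarrow> i \<le> n \<Longrightarrow> AE z in disk_measure. V i z = polyanalytic n \<psi> i z" by auto
    define i0 where "i0 = n - Suc d"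
    have i0: "i0 < n" "Suc i0 = n - d" using Suc.prems by (auto simp: i0_def)
    \<comment> \<open>Component \<open>i0\<close> does not enter the sums of larger index, so it may
      be set to 0 now and replaced by \<open>\<phi>\<close> afterwards.\<close>
    define \<psi>0 where "\<psi>0 = \<psi>(i0 := (\<lambda>_. 0))"
    have h0: "\<psi>0 j holomorphic_on unit_disk" for j using \<psi>(1) by (simp add: \<psi>0_def)
    have later: "polyanalytic n (\<psi>(i0 := \<phi>)) i = polyanalytic n \<psi> i" if "i0 < i" for i \<phi>
      unfolding polyanalytic_def[abs_def] using that by (intro ext sum.cong) auto
    have w: "weak_deriv dbar (polyanalytic n \<psi>0 i0) (polyanalytic n \<psi> (Suc i0))"
      using weak_deriv_polyanalytic[where \<psi>=\<psi>0 and n=n and i=i0, OF h0] later[of "Suc i0" "\<lambda>_. 0"] by (simp add: \<psi>0_def)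
    have wm: "weak_deriv dbar (\<lambda>z. (- 1) * polyanalytic n \<psi>0 i0 z) (\<lambda>z. 0 * polyanalytic n \<psi>0 i0 z + (- 1) * polyanalytic n \<psi> (Suc i0) z)"
      by (rule weak_deriv_mult[OF L_inf_const L_inf_const weak_deriv_holomorphic w]) simp
    have w0: "weak_deriv dbar (\<lambda>z. V i0 z + (- 1) * polyanalytic n \<psi>0 i0 z) (\<lambda>_. 0)"
    proof (rule weak_deriv_cong[OF weak_deriv_add[OF V[OF i0(1)] wm]])
      have "AE z in disk_measure. V (Suc i0) z = polyanalytic n \<psi> (Suc i0) z" by (rule \<psi>(2)) (use i0 in auto)
      then show "AE z in disk_measure. V (Suc i0) z + (0 * polyanalytic n \<psi>0 i0 z + (- 1) * polyanalytic n \<psi> (Suc i0) z) = 0"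
        by eventually_elim simp
      show "locally_integrable (\<lambda>z. V i0 z + (- 1) * polyanalytic n \<psi>0 i0 z)"
        using weak_deriv_add[OF V[OF i0(1)] wm] by (simp add: weak_deriv_def)
    qed (auto intro: L_inf_locally_integrable L_inf_const)
    obtain \<phi> where \<phi>: "\<phi> holomorphic_on unit_disk" "AE z in disk_measure. V i0 z + (- 1) * polyanalytic n \<psi>0 i0 z = \<phi> z"
      by (rule weyl_lemma[OF w0])
    define \<psi>' where "\<psi>' = \<psi>(i0 := \<phi>)"
    have split: "polyanalytic n \<psi>' i0 z = \<phi> z + polyanalytic n \<psi>0 i0 z" for z
    proof -
      obtain m where m: "n - i0 = Suc m" using i0(1) by (cases "n - i0") auto
      show ?thesis unfolding polyanalytic_def m sum.lessThan_Suc_shift by (simp add: \<psi>'_def \<psi>0_def)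
    qed
    have "AE z in disk_measure. V i z = polyanalytic n \<psi>' i z" if i: "n - Suc d \<le> i" "i \<le> n" for i
    proof (cases "i = i0")
      case True
      have "AE z in disk_measure. V i0 z = polyanalytic n \<psi>' i0 z" using \<phi>(2) by eventually_elim (simp add: split algebra_simps)
      then show ?thesis using True by simp
    next
      case False
      then have "i0 < i" using i by (simp add: i0_def)
      then show ?thesis using \<psi>(2)[of i] i i0(2) later[of i \<phi>] by (simp add: \<psi>'_def)
    qed
    moreover have "\<psi>' j holomorphic_on unit_disk" for j using \<psi>(1) \<phi>(1) by (simp add: \<psi>'_def)
    ultimately show ?case by blast
  qed
  from this[of n] obtain \<psi> where "\<forall>j. \<psi> j holomorphic_on unit_disk" "\<forall>i. i \<le> n \<longrightarrow> (AE z in disk_measure. V i z = polyanalytic n \<psi> i z)" by auto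
  then show thesis using that by blast
qed

section \<open>From the meta-analytic equation to its holomorphic components\<close>

text \<open>The relational power hides the intermediate functions, but the integrating factor has to
  act on all of them.\<close>

lemma meta_op_chain:
  assumes A: "A \<in> L_inf" and f: "(meta_op A ^^ n) f (\<lambda>_. 0)"
  obtains U where "U 0 = f" "U n = (\<lambda>_. 0)" "\<And>i. i < n \<Longrightarrow> weak_deriv dbar (U i) (\<lambda>z. U (Suc i) z + A z * U i z)"
proof -
  obtain U where U: "U 0 = f" "U n = (\<lambda>_. 0)" "\<And>i. i < n \<Longrightarrow> meta_op A (U i) (U (Suc i))"
    using f unfolding relpowp_fun_conv by blast
  have li: "locally_integrable (U i)" if "i \<le> n" for i
  proof (cases "i = n")
    case True
    then show ?thesis using U(2) by (simp add: L_inf_locally_integrable L_inf_const)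
  next
    case False
    then show ?thesis using U(3)[of i] that by (auto simp: meta_op_def weak_deriv_def)
  qed
  have "weak_deriv dbar (U i) (\<lambda>z. U (Suc i) z + A z * U i z)" if i: "i < n" for i
  proof -
    obtain h where h: "weak_deriv dbar (U i) h" "AE z in disk_measure. U (Suc i) z = h z - A z * U i z"
      using U(3)[OF i] by (auto simp: meta_op_def)
    show ?thesis
    proof (rule weak_deriv_cong[OF h(1)])
      show "AE z in disk_measure. h z = U (Suc i) z + A z * U i z" using h(2) by eventually_elim simp
      show "locally_integrable (\<lambda>z. U (Suc i) z + A z * U i z)"
        by (intro locally_integrable_add locally_integrable_L_inf_mult A li) (use i in auto)
    qed (use i li in auto)
  qed
  with U(1,2) show thesis by (rule that)
qed

lemma weak_power_unique:
  "(weak_deriv dbar ^^ k) f h \<Longrightarrow> (weak_deriv dbar ^^ k) f h' \<Longrightarrow> AE z in disk_measure. h z = h' z"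
proof (induction k arbitrary: h h')
  case (Suc k)
  then obtain g g' where g: "(weak_deriv dbar ^^ k) f g" "weak_deriv dbar g h" and g': "(weak_deriv dbar ^^ k) f g'" "weak_deriv dbar g' h'"
    by auto
  show ?case by (rule weak_deriv_unique[OF g(2) g'(2) Suc.IH[OF g(1) g'(1)]])
qed auto

text \<open>Resolves the choice in \<open>dbar_power\<close>: iterated weak derivatives are unique
  almost everywhere and continuous versions everywhere, so any continuous candidate has the chosen
  values.\<close>

lemma dbar_power_eq:
  assumes "continuous_on unit_disk F" "(weak_deriv dbar ^^ k) f F" "z \<in> unit_disk"
  shows "dbar_power k f z = F z"
proof -
  have ex: "continuous_on unit_disk (dbar_power k f) \<and> (weak_deriv dbar ^^ k) f (dbar_power k f)"
    unfolding dbar_power_def by (rule someI[of "\<lambda>h. continuous_on unit_disk h \<and> (weak_deriv dbar ^^ k) f h" F]) (use assms in auto)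
  have "AE z in disk_measure. dbar_power k f z = F z" by (rule weak_power_unique[of k f]) (use ex assms in auto)
  then have "AE z in disk_measure. z \<in> unit_disk \<longrightarrow> dbar_power k f z = F z" by eventually_elim simp
  then show ?thesis
    by (rule AE_disk_eq_imp_eq[OF open_ball subset_refl _ assms(1) _ assms(3), rotated]) (use ex in auto)
qed

text \<open>The \<open>k\<close>-th derivative of \<open>exp s * E 0\<close> is a combination of \<open>E 0, ..., E k\<close> whose top coefficient
  is \<open>exp s\<close>; it is this triangular shape that transfers the norm bounds from the derivatives to the \<open>E k\<close>.\<close>

lemma weak_powers_triangular:
  fixes E :: "nat \<Rightarrow> complex \<Rightarrow> complex"
  assumes E: "\<And>i. weak_deriv dbar (E i) (E (Suc i))" "\<And>i. continuous_on unit_disk (E i)"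
    and g: "g \<in> bounded_chain m" and f: "\<And>z. z \<in> unit_disk \<Longrightarrow> f z = g z * E 0 z" "continuous_on unit_disk f"
  shows "k \<le> m \<Longrightarrow> \<exists>F P. continuous_on unit_disk F \<and> (weak_deriv dbar ^^ k) f F \<and> (\<forall>j\<le>k. P j \<in> bounded_chain (m - k)) \<and>
     (\<forall>z. P k z = g z) \<and> (\<forall>z\<in>unit_disk. F z = (\<Sum>j\<le>k. P j z * E j z))"
proof (induction k)
  case 0
  show ?case by (intro exI[of _ f] exI[of _ "\<lambda>_. g"]) (use f g in auto)
next
  case (Suc k)
  obtain F P where F: "continuous_on unit_disk F" "(weak_deriv dbar ^^ k) f F" and P: "\<And>j. j \<le> k \<Longrightarrow> P j \<in> bounded_chain (m - k)"
    and Pk: "\<And>z. P k z = g z" and FP: "\<And>z. z \<in> unit_disk \<Longrightarrow> F z = (\<Sum>j\<le>k. P j z * E j z)"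
    using Suc.IH[OF Suc_leD[OF Suc.prems]] by blast
  have mk: "m - k = Suc (m - Suc k)" using Suc.prems by simp
  have "\<forall>j\<in>{..k}. \<exists>b. b \<in> bounded_chain (m - Suc k) \<and> weak_deriv dbar (P j) b"
    using bounded_chain_SucE[OF P[unfolded mk]] by (metis atMost_iff)
  from bchoice[OF this] obtain P' where P': "\<And>j. j \<le> k \<Longrightarrow> P' j \<in> bounded_chain (m - Suc k)" "\<And>j. j \<le> k \<Longrightarrow> weak_deriv dbar (P j) (P' j)" by auto
  have Pm: "P j \<in> bounded_chain (m - Suc k)" if "j \<le> k" for j using bounded_chain_Suc_subset P[OF that] mk by simp
  \<comment> \<open>The coefficient of \<open>E j\<close> collects the derivative of
    \<open>P j\<close> and, because \<open>dbar (E (j - 1)) = E j\<close>, also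
    \<open>P (j - 1)\<close>. At \<open>j = Suc k\<close> only the latter remains, which preserves
    the top coefficient \<open>g\<close>.\<close>
  define R where "R j z = (if j \<le> k then P' j z else 0) + (if j = 0 then 0 else P (j - 1) z)" for j z
  have R: "R j \<in> bounded_chain (m - Suc k)" if "j \<le> Suc k" for j
  proof -
    have "(\<lambda>z. if j \<le> k then P' j z else 0) \<in> bounded_chain (m - Suc k)" using P'(1)[of j] bounded_chain_zero by (cases "j \<le> k") auto
    moreover have "(\<lambda>z. if j = 0 then 0 else P (j - 1) z) \<in> bounded_chain (m - Suc k)"
      using Pm[of "j - 1"] bounded_chain_zero that by (cases "j = 0") auto
    ultimately show ?thesis unfolding R_def[abs_def] by (rule bounded_chain_add)
  qed
  define F' where "F' z = (\<Sum>j\<le>Suc k. R j z * E j z)" for z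
  have F'eq: "(\<Sum>j\<le>k. P' j z * E j z + P j z * E (Suc j) z) = F' z" for z
  proof -
    have "F' z = (\<Sum>j\<le>Suc k. (if j \<le> k then P' j z else 0) * E j z) + (\<Sum>j\<le>Suc k. (if j = 0 then 0 else P (j - 1) z) * E j z)"
      by (simp only: F'_def R_def distrib_right sum.distrib)
    also have "(\<Sum>j\<le>Suc k. (if j \<le> k then P' j z else 0) * E j z) = (\<Sum>j\<le>k. P' j z * E j z)"
      by simp
    also have "(\<Sum>j\<le>Suc k. (if j = 0 then 0 else P (j - 1) z) * E j z) = (\<Sum>j\<le>k. P j z * E (Suc j) z)"
      by (subst sum.atMost_Suc_shift) simp
    finally show ?thesis by (simp add: sum.distrib)
  qed
  have contF': "continuous_on unit_disk F'" unfolding F'_def[abs_def]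
    by (intro continuous_intros E) (use R bounded_chain_D in auto)
  have "weak_deriv dbar (\<lambda>z. \<Sum>j\<le>k. P j z * E j z) (\<lambda>z. \<Sum>j\<le>k. P' j z * E j z + P j z * E (Suc j) z)"
  proof (rule weak_deriv_sum)
    fix j assume "j \<in> {..k}"
    then have j: "j \<le> k" by simp
    show "weak_deriv dbar (\<lambda>z. P j z * E j z) (\<lambda>z. P' j z * E j z + P j z * E (Suc j) z)"
      by (rule weak_deriv_mult[OF _ _ P'(2)[OF j] E(1)]) (use bounded_chain_D[OF Pm[OF j]] bounded_chain_D[OF P'(1)[OF j]] in auto)
  qed simp
  then have "weak_deriv dbar (\<lambda>z. \<Sum>j\<le>k. P j z * E j z) F'" unfolding F'eq .
  then have "weak_deriv dbar F F'"
  proof (rule weak_deriv_cong)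
    show "AE z in disk_measure. (\<Sum>j\<le>k. P j z * E j z) = F z" by (rule AE_I2) (simp add: FP)
  qed (auto intro: continuous_locally_integrable F contF')
  then have "(weak_deriv dbar ^^ Suc k) f F'" using F(2) by auto
  moreover have "\<forall>z. R (Suc k) z = g z" using Pk by (simp add: R_def)
  moreover have "\<forall>j\<le>Suc k. R j \<in> bounded_chain (m - Suc k)" using R by blast
  moreover have "\<forall>z\<in>unit_disk. F' z = (\<Sum>j\<le>Suc k. R j z * E j z)" by (simp only: F'_def) simp
  ultimately show ?case using contF' by (intro exI[of _ F'] exI[of _ R] conjI)
qed

lemma meta_analytic_representation:
  assumes A: "A \<in> L_inf" and f: "continuous_on unit_disk f" "(meta_op A ^^ n) f (\<lambda>_. 0)"
  obtains \<psi> where "\<And>j. \<psi> j holomorphic_on unit_disk"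
    "\<And>z. z \<in> unit_disk \<Longrightarrow> f z = exp (cauchy_transform A z) * polyanalytic n \<psi> 0 z"
proof -
  let ?s = "cauchy_transform A"
  define e where "e z = exp ((- 1) * ?s z)" for z
  define e' where "e' z = (- 1) * A z * exp ((- 1) * ?s z)" for z
  have e: "e \<in> L_inf" "weak_deriv dbar e e'"
    using weak_deriv_exp_cauchy_transform[OF A, of "- 1"] by (simp_all only: e_def[abs_def] e'_def[abs_def])
  have e'L: "e' \<in> L_inf" using L_inf_mult[OF L_inf_mult[OF L_inf_const[of "- 1"] A] e(1)]
    by (simp only: e_def e'_def[abs_def])
  obtain U where U: "U 0 = f" "U n = (\<lambda>_. 0)" "\<And>i. i < n \<Longrightarrow> weak_deriv dbar (U i) (\<lambda>z. U (Suc i) z + A z * U i z)"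
    using meta_op_chain[OF A f(2)] by blast
  \<comment> \<open>The derivative of the integrating factor cancels the term
    \<open>A * U i\<close>, so the functions \<open>V i\<close> form a pure
    \<open>dbar\<close>-chain that ends in 0.\<close>
  define V where "V i z = e z * U i z" for i z
  have V: "weak_deriv dbar (V i) (V (Suc i))" if "i < n" for i
  proof -
    have "(\<lambda>z. e' z * U i z + e z * (U (Suc i) z + A z * U i z)) = V (Suc i)"
      by (rule ext) (simp add: V_def e_def e'_def algebra_simps)
    then show ?thesis using weak_deriv_mult[OF e(1) e'L e(2) U(3)[OF that]] by (simp only: V_def[abs_def])
  qed
  have Vn: "AE z in disk_measure. V n z = 0" by (simp add: V_def U(2))
  obtain \<psi> where \<psi>: "\<And>j. \<psi> j holomorphic_on unit_disk" "\<And>i. i \<le> n \<Longrightarrow> AE z in disk_measure. V i z = polyanalytic n \<psi> i z"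
    by (rule polyanalytic_structure[of n V]) (use V Vn that in blast)+
  have cs: "continuous_on UNIV ?s" using A cauchy_transform_continuous[of A] by (auto simp: L_inf_def)
  have "f z = exp (?s z) * polyanalytic n \<psi> 0 z" if z: "z \<in> unit_disk" for z
  proof (rule AE_disk_eq_imp_eq[OF open_ball subset_refl f(1) _ _ z])
    show "continuous_on unit_disk (\<lambda>z. exp (?s z) * polyanalytic n \<psi> 0 z)"
      by (intro continuous_intros continuous_polyanalytic \<psi>(1) continuous_on_subset[OF cs]) simp
    show "AE z in disk_measure. z \<in> unit_disk \<longrightarrow> f z = exp (?s z) * polyanalytic n \<psi> 0 z"
      using \<psi>(2)[OF le0] by eventually_elim (simp add: V_def U(1) e_def exp_minus field_simps)
  qed
  with \<psi>(1) show thesis by (rule that)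
qed

lemma ennreal_powr_finite_iff: "ennreal_powr x a < \<infinity> \<longleftrightarrow> x < \<infinity>"
  by (auto simp: ennreal_powr_def less_top[symmetric])

lemma meta_hardy_norm_finite:
  assumes "meta_hardy_norm n p f < \<infinity>" "k < n" and F: "continuous_on unit_disk F" "\<And>z. z \<in> unit_disk \<Longrightarrow> dbar_power k f z = F z"
  shows "bounded_means p F"
proof -
  define S where "S = (SUP r\<in>{0<..<1::real}. circle_integral p (\<lambda>\<zeta>. dbar_power k f (of_real r * \<zeta>)))"
  have "ennreal_powr S (1 / p) \<le> meta_hardy_norm n p f"
    unfolding meta_hardy_norm_def S_def using assms(2) by (intro member_le_sum) auto
  then have "S < \<infinity>" using assms(1) ennreal_powr_finite_iff le_less_trans by blast
  then obtain I where I: "S = ennreal I" by (cases S) auto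
  have "circle_integral p (\<lambda>\<zeta>. F (of_real r * \<zeta>)) \<le> ennreal I" if r: "r \<in> {0<..<1}" for r :: real
  proof -
    have "circle_integral p (\<lambda>\<zeta>. dbar_power k f (of_real r * \<zeta>)) = circle_integral p (\<lambda>\<zeta>. F (of_real r * \<zeta>))"
      unfolding circle_integral_def using r by (simp add: F(2) norm_mult)
    moreover have "circle_integral p (\<lambda>\<zeta>. dbar_power k f (of_real r * \<zeta>)) \<le> S"
      unfolding S_def by (rule SUP_upper[OF r])
    ultimately show ?thesis by (simp add: I)
  qed
  then show ?thesis unfolding bounded_means_def using F(1) by blast
qed

lemma bounded_means_diff_sum:
  assumes p: "p > 0" and f: "bounded_means p f" and S: "finite S" "\<And>j. j \<in> S \<Longrightarrow> bounded_means p (u j)"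
    "\<And>j. j \<in> S \<Longrightarrow> continuous_on unit_disk (c j)" "\<And>j. j \<in> S \<Longrightarrow> \<exists>C. \<forall>z\<in>unit_disk. cmod (c j z) \<le> C"
  shows "bounded_means p (\<lambda>z. f z - (\<Sum>j\<in>S. c j z * u j z))"
proof -
  have "bounded_means p (\<lambda>z. (- c j z) * u j z)" if j: "j \<in> S" for j
  proof -
    obtain C where "\<forall>z\<in>unit_disk. cmod (c j z) \<le> C" using S(4)[OF j] by blast
    then have "\<And>z. z \<in> unit_disk \<Longrightarrow> cmod (- c j z) \<le> C" by simp
    then show ?thesis by (rule bounded_means_mult[OF p S(2)[OF j] continuous_on_minus[OF S(3)[OF j]]])
  qed
  then have "bounded_means p (\<lambda>z. f z + (\<Sum>j\<in>S. (- c j z) * u j z))"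
    by (intro bounded_means_add[OF p f] bounded_means_sum[OF p S(1)])
  then show ?thesis by (simp add: sum_negf)
qed

text \<open>Forward substitution: the polyanalytic derivatives of order below \<open>k\<close> have
  bounded means by induction, so removing their share from the \<open>k\<close>-th derivative of
  \<open>f\<close> and multiplying by \<open>exp (- s)\<close>, bounded on the closed disk, isolates
  order \<open>k\<close>.\<close>

lemma bounded_means_polyanalytic:
  assumes p: "p > 0" and A: "A \<in> W_inf m" and h: "\<And>j. \<psi> j holomorphic_on unit_disk"
    and f: "continuous_on unit_disk f" "\<And>z. z \<in> unit_disk \<Longrightarrow> f z = exp (cauchy_transform A z) * polyanalytic (Suc m) \<psi> 0 z"
    and fin: "meta_hardy_norm (Suc m) p f < \<infinity>"
  shows "k \<le> m \<Longrightarrow> bounded_means p (polyanalytic (Suc m) \<psi> k)"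
proof (induction k rule: less_induct)
  case (less k)
  let ?s = "cauchy_transform A"
  let ?E = "polyanalytic (Suc m) \<psi>"
  have AL: "A \<in> L_inf" by (rule W_inf_subset_L_inf[OF A])
  have cs: "continuous_on UNIV ?s" using AL cauchy_transform_continuous[of A] by (auto simp: L_inf_def)
  have "\<exists>F P. continuous_on unit_disk F \<and> (weak_deriv dbar ^^ k) f F \<and> (\<forall>j\<le>k. P j \<in> bounded_chain (m - k)) \<and>
     (\<forall>z. P k z = exp (?s z)) \<and> (\<forall>z\<in>unit_disk. F z = (\<Sum>j\<le>k. P j z * ?E j z))"
    by (rule weak_powers_triangular[OF weak_deriv_polyanalytic[OF h] continuous_polyanalytic[OF h]
          exp_cauchy_transform_bounded_chain[OF A] f(2) f(1) less.prems])
  then obtain F P where F: "continuous_on unit_disk F" "(weak_deriv dbar ^^ k) f F"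
    and P: "\<And>j. j \<le> k \<Longrightarrow> P j \<in> bounded_chain (m - k)" and Pk: "\<And>z. P k z = exp (?s z)"
    and FP: "\<And>z. z \<in> unit_disk \<Longrightarrow> F z = (\<Sum>j\<le>k. P j z * ?E j z)" by blast
  have "bounded_means p F"
    by (rule meta_hardy_norm_finite[OF fin _ F(1) dbar_power_eq[OF F]]) (use less.prems in auto)
  then have d: "bounded_means p (\<lambda>z. F z - (\<Sum>j<k. P j z * ?E j z))"
  proof (rule bounded_means_diff_sum[OF p _ finite_lessThan])
    fix j assume "j \<in> {..<k}"
    then have j: "j < k" by simp
    show "bounded_means p (?E j)" using less j by simp
    show "continuous_on unit_disk (P j)" using bounded_chain_D[OF P[of j]] j by simp
    show "\<exists>C. \<forall>z\<in>unit_disk. cmod (P j z) \<le> C" using bounded_chain_bound[OF P[of j]] j by (metis less_imp_le)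
  qed
  have ce: "continuous_on UNIV (\<lambda>z. exp (- ?s z))" by (intro continuous_intros cs)
  have "bounded ((\<lambda>z. exp (- ?s z)) ` cball 0 1)"
    by (intro compact_imp_bounded compact_continuous_image continuous_on_subset[OF ce subset_UNIV] compact_cball)
  then obtain C where C: "\<forall>z\<in>cball 0 1. cmod (exp (- ?s z)) \<le> C" unfolding bounded_iff ball_simps by blast
  have "bounded_means p (\<lambda>z. exp (- ?s z) * (F z - (\<Sum>j<k. P j z * ?E j z)))"
    by (rule bounded_means_mult[OF p d continuous_on_subset[OF ce subset_UNIV], of C]) (rule bspec[OF C], simp)
  then show ?case
  proof (rule bounded_means_cong[rotated])
    fix z :: complex assume z: "z \<in> unit_disk"
    have "{..k} = insert k {..<k}" by auto
    then have "F z - (\<Sum>j<k. P j z * ?E j z) = exp (?s z) * ?E k z" using FP[OF z] by (simp add: Pk)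
    then show "exp (- ?s z) * (F z - (\<Sum>j<k. P j z * ?E j z)) = ?E k z"
      by (simp add: exp_minus)
  qed
qed

text \<open>Back substitution: \<open>polyanalytic n \<psi> i\<close> is \<open>\<psi> i\<close>
  plus multiples of components with larger index, with coefficients of modulus at most 1 on the
  disk, so the induction descends from \<open>n - 1\<close>.\<close>

lemma bounded_means_components:
  assumes p: "p > 0" and E: "\<And>k. k < n \<Longrightarrow> bounded_means p (polyanalytic n \<psi> k)"
  shows "i < n \<Longrightarrow> bounded_means p (\<psi> i)"
proof (induction "n - i" arbitrary: i rule: less_induct)
  case less
  obtain m where m: "n - i = Suc m" using less.prems by (cases "n - i") auto
  have "bounded_means p (\<lambda>z. polyanalytic n \<psi> i z - (\<Sum>j<m. ((1 / fact (Suc j)) * cnj z ^ Suc j) * \<psi> (i + Suc j) z))"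
  proof (rule bounded_means_diff_sum[OF p E[OF less.prems] finite_lessThan])
    fix j assume j: "j \<in> {..<m}"
    show "bounded_means p (\<psi> (i + Suc j))" by (rule less.hyps) (use j m in auto)
    show "continuous_on unit_disk (\<lambda>z. (1 / fact (Suc j)) * cnj z ^ Suc j)" by (intro continuous_intros)
    have "cmod ((1 / fact (Suc j)) * cnj z ^ Suc j) \<le> 1" if "z \<in> unit_disk" for z
    proof -
      have "cmod z ^ Suc j \<le> 1" using that by (intro power_le_one) auto
      moreover have "1 \<le> x \<Longrightarrow> 1 / x \<le> 1" for x :: real by simp
      then have "1 / fact (Suc j) \<le> (1::real)" using fact_ge_1 by blast
      ultimately have "(1 / fact (Suc j)) * cmod z ^ Suc j \<le> 1 * (1::real)" by (intro mult_mono) auto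
      then show ?thesis by (simp only: norm_mult norm_divide norm_power complex_mod_cnj norm_one norm_fact mult_1)
    qed
    then show "\<exists>C. \<forall>z\<in>unit_disk. cmod ((1 / fact (Suc j)) * cnj z ^ Suc j) \<le> C" by blast
  qed
  moreover have "polyanalytic n \<psi> i z - (\<Sum>j<m. ((1 / fact (Suc j)) * cnj z ^ Suc j) * \<psi> (i + Suc j) z) = \<psi> i z" for z
    unfolding polyanalytic_def m sum.lessThan_Suc_shift by simp
  ultimately show ?case by simp
qed

theorem theorem3p5:
  fixes n :: nat and p :: real and A f :: "complex \<Rightarrow> complex"
  assumes "n \<ge> 1" and "0 < p"
    and "A \<in> W_inf (n - 1)"
    and "f \<in> meta_hardy n p A"
  shows "\<exists>fp \<in> Lp_circle p.
           (AE \<theta> in lebesgue_on {0..2*pi}. nontangential_limit f (cis \<theta>) (fp (cis \<theta>))) \<and>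
           ((\<lambda>r::real. circle_integral p (\<lambda>\<zeta>. fp \<zeta> - f (of_real r * \<zeta>))) \<longlongrightarrow> 0) (at_left 1)"
proof -
  let ?s = "cauchy_transform A"
  obtain m where n: "n = Suc m" using assms(1) by (cases n) auto
  have A: "A \<in> W_inf m" using assms(3) by (simp add: n)
  have f: "continuous_on unit_disk f" "(meta_op A ^^ n) f (\<lambda>_. 0)" "meta_hardy_norm n p f < \<infinity>"
    using assms(4) by (auto simp: meta_hardy_def)
  have AL: "A \<in> L_inf" by (rule W_inf_subset_L_inf[OF A])
  have cs: "continuous_on UNIV ?s" using AL cauchy_transform_continuous[of A] by (auto simp: L_inf_def)
  obtain \<psi> where h: "\<And>j. \<psi> j holomorphic_on unit_disk"
    and fE: "\<And>z. z \<in> unit_disk \<Longrightarrow> f z = exp (?s z) * polyanalytic n \<psi> 0 z"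
    by (rule meta_analytic_representation[OF AL f(1,2)]) (use that in blast)
  have E: "bounded_means p (polyanalytic n \<psi> k)" if "k < n" for k
    using bounded_means_polyanalytic[where \<psi>=\<psi>, OF assms(2) A h f(1) fE[unfolded n] f(3)[unfolded n], of k] that
    by (simp add: n)
  have hb: "hardy_boundary p (\<psi> j) (radial_limit (\<psi> j))" if j: "j < n" for j
  proof -
    obtain I where I: "\<And>r. r \<in> {0<..<1} \<Longrightarrow> circle_integral p (\<lambda>\<zeta>. \<psi> j (of_real r * \<zeta>)) \<le> ennreal I"
      using bounded_means_components[OF assms(2) E j] unfolding bounded_means_def by blast
    show ?thesis by (rule hardy_space_boundary[OF h assms(2), of j I]) (rule I, simp)
  qed
  \<comment> \<open>Each multiplier is continuous across the circle because the Cauchy transform is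
    continuous on the whole plane; \<open>hardy_boundary_mult\<close> asks for this.\<close>
  let ?c = "\<lambda>j z. exp (?s z) * ((1 / fact j) * cnj z ^ j)"
  have c: "continuous_on UNIV (?c j)" for j by (intro continuous_intros cs)
  have cont: "continuous_on unit_disk (\<psi> j)" for j by (rule holomorphic_on_imp_continuous_on[OF h])
  have "hardy_boundary p (\<lambda>z. \<Sum>j\<in>{..<n}. ?c j z * \<psi> j z) (\<lambda>\<zeta>. \<Sum>j\<in>{..<n}. ?c j \<zeta> * radial_limit (\<psi> j) \<zeta>)"
  proof (rule hardy_boundary_sum[OF assms(2) finite_lessThan])
    fix j assume "j \<in> {..<n}"
    then show "hardy_boundary p (\<lambda>z. ?c j z * \<psi> j z) (\<lambda>\<zeta>. ?c j \<zeta> * radial_limit (\<psi> j) \<zeta>)"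
      by (intro hardy_boundary_mult assms(2) hb cont c) simp
    show "continuous_on unit_disk (\<lambda>z. ?c j z * \<psi> j z)"
      by (rule continuous_on_mult[OF continuous_on_subset[OF c subset_UNIV] cont])
  qed
  then have "hardy_boundary p f (\<lambda>\<zeta>. \<Sum>j\<in>{..<n}. ?c j \<zeta> * radial_limit (\<psi> j) \<zeta>)"
  proof (rule hardy_boundary_cong[rotated])
    fix z :: complex assume "z \<in> unit_disk"
    from fE[OF this] show "(\<Sum>j\<in>{..<n}. ?c j z * \<psi> j z) = f z"
      by (simp add: polyanalytic_def sum_distrib_left mult.assoc)
  qed
  then show ?thesis unfolding hardy_boundary_def by (elim conjE) (rule bexI[rotated], assumption, rule conjI)
qed

end
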